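(* Let $X=\{X(h):h\in\mathfrak{H}\}$ be an isonormal Gaussian process over a real separable Hilbert space $\mathfrak{H}$, and let $F_n$, $n\ge1$, be a sequence of centered, square-integrable functionals of $X$ (i.e. $F_n\in L^2(\Omega,\sigma(X),P)$, $E(F_n)=0$) such that $E(F_n^2)=1$ for every $n$. Suppose that: (i) for every $n$, $F_n\in\mathbb{D}^{1,2}$ and the law of $F_n$ is absolutely continuous with respect to Lebesgue measure; (ii) the quantity $\varphi(n)=\sqrt{E[(1-\langle DF_n,-DL^{-1}F_n\rangle_{\mathfrak{H}})^2]}$ is finite for every $n$, converges to $0$ as $n\to\infty$, and there exists $m\ge1$ such that $\varphi(n)>0$ for all $n\ge m$; (iii) as $n\to\infty$, the vector $\Big(F_n,\dfrac{1-\langle DF_n,-DL^{-1}F_n\rangle_{\mathfrak{H}}}{\varphi(n)}\Big)$ converges in distribution to a centered two-dimensional Gaussian vector $(N_1,N_2)$ with $E(N_1^2)=E(N_2^2)=1$ and $E(N_1N_2)=\rho$; (a) for every $n$, $E|F_n|^3<\infty$; (b) there exists $\varepsilon>0$ such that $\sup_{n\ge1}E|F_n|^{2+\varepsilon}<\infty$. Then, as $n\to\infty$, $$\frac{1}{2\varphi(n)}E(F_n^3)\longrightarrow-\rho,$$ and, for every $z\in\mathbb{R}$, $$P(F_n\le z)-\Phi(z)+\frac1{3!}E(F_n^3)\,\Phi^{(3)}(z)=o_z(\varphi(n)),$$ where $\Phi(z)=P(N\le z)$ with $N\sim\mathcal{N}(0,1)$, and $o_z(\varphi(n))$ denotes a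 numerical sequence (depending on $z$) such that $\varphi(n)^{-1}o_z(\varphi(n))\to0$ as $n\to\infty$.
   Context: Isonormal Gaussian process: $X=\{X(h):h\in\mathfrak{H}\}$ is a centered Gaussian family with $E[X(h)X(g)]=\langle h,g\rangle_{\mathfrak{H}}$. Every $F\in L^2(\Omega,\sigma(X),P)$ has a unique chaotic expansion $F=\sum_{q\ge0}I_q(f_q)$, with $I_0(f_0)=E[F]$, $f_q\in\mathfrak{H}^{\odot q}$ (symmetric tensor power), where $I_q$ is the multiple Wiener–Itô integral of order $q$, mapping $\mathfrak{H}^{\odot q}$ onto the $q$th Wiener chaos with $E[I_q(f)^2]=q!\|f\|^2_{\mathfrak{H}^{\otimes q}}$; $J_qF=I_q(f_q)$ denotes the projection on the $q$th chaos. Malliavin derivative: for $F=g(X(\phi_1),\dots,X(\phi_n))$ with $g$ smooth with compact support and $\phi_i\in\mathfrak{H}$, $DF=\sum_i\partial_ig(X(\phi_1),\dots,X(\phi_n))\phi_i\in L^2(\Omega,\mathfrak{H})$; $\mathbb{D}^{1,2}$ is the closure of such variables under $\|F\|_{1,2}^2=E[F^2]+E[\|DF\|_{\mathfrak{H}}^2]$, and $D$ is extended to $\mathbb{D}^{1,2}$ by closure. Pseudo-inverse of the Ornstein–Uhlenbeck generator $L=\sum_{q\ge0}-qJ_q$: $L^{-1}F=-\sum_{q\ge1}\frac1qJ_qF$, so that $LL^{-1}F=F-E(F)$; $L^{-1}F$ is Malliavin differentiable for every $F\in L^2(\Omega,\sigma(X),P)$. $\Phi^{(3)}(z)=(z^2-1)e^{-z^2/2}/\sqrt{2\pi}$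 is the third derivative of $\Phi$. *)

theory Defs
  imports "HOL-Probability.Probability"
begin

section \<open>Gaussian variables and isonormal processes\<close>

text \<open>Degenerate Gaussian laws (point masses) are allowed.\<close>

definition gaussian_rv :: "'w measure \<Rightarrow> ('w \<Rightarrow> real) \<Rightarrow> bool" where
  "gaussian_rv M Y \<longleftrightarrow> Y \<in> borel_measurable M \<and>
     ((\<exists>\<mu> \<sigma>. \<sigma> > 0 \<and> distributed M lborel Y (normal_density \<mu> \<sigma>)) \<or>
      (\<exists>\<mu>. AE \<omega> in M. Y \<omega> = \<mu>))"

definition gaussian_family :: "'w measure \<Rightarrow> ('i \<Rightarrow> 'w \<Rightarrow> real) \<Rightarrow> bool" where
  "gaussian_family M Y \<longleftrightarrow>
     (\<forall>I c. finite I \<longrightarrow> gaussian_rv M (\<lambda>\<omega>. \<Sum>i\<in>I. c i * Y i \<omega>))"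

definition gaussian_pair :: "'w measure \<Rightarrow> ('w \<Rightarrow> real) \<Rightarrow> ('w \<Rightarrow> real) \<Rightarrow> bool" where
  "gaussian_pair M Y Z \<longleftrightarrow> (\<forall>a b. gaussian_rv M (\<lambda>\<omega>. a * Y \<omega> + b * Z \<omega>))"

text \<open>The sort of \<open>'h\<close> expresses that it is a real separable Hilbert space.\<close>

locale isonormal_process = prob_space M
  for M :: "'w measure" +
  fixes X :: "'h :: {real_inner, banach, second_countable_topology} \<Rightarrow> 'w \<Rightarrow> real"
  assumes gaussian: "gaussian_family M X"
    and centered: "expectation (X h) = 0"
    and covariance: "expectation (\<lambda>\<omega>. X h \<omega> * X g \<omega>) = inner h g"

definition sigma_of :: "'w measure \<Rightarrow> ('h \<Rightarrow> 'w \<Rightarrow> real) \<Rightarrow> 'w measure" where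
  "sigma_of M X = sigma (space M) {X h -` B \<inter> space M | h B. B \<in> sets borel}"

text \<open>Square-integrable functionals are represented by functions rather than by classes modulo
  almost sure equality.\<close>

definition L2_functionals :: "'w measure \<Rightarrow> ('h \<Rightarrow> 'w \<Rightarrow> real) \<Rightarrow> ('w \<Rightarrow> real) set" where
  "L2_functionals M X =
     {F. F \<in> borel_measurable (sigma_of M X) \<and> integrable M (\<lambda>\<omega>. (F \<omega>)\<^sup>2)}"

section \<open>Malliavin derivative\<close>

text \<open>A function on \<open>\<real>\<^sup>n\<close> is encoded as a function of sequences depending only on the
  coordinates with index below \<open>n\<close>; for such functions, continuity in the product topology is
  continuity on \<open>\<real>\<^sup>n\<close>.\<close>

definition depends_on_first :: "nat \<Rightarrow> ((nat \<Rightarrow> real) \<Rightarrow> real) \<Rightarrow> bool" where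
  "depends_on_first n g \<longleftrightarrow> (\<forall>x y. (\<forall>i<n. x i = y i) \<longrightarrow> g x = g y)"

definition partial_deriv :: "nat \<Rightarrow> ((nat \<Rightarrow> real) \<Rightarrow> real) \<Rightarrow> (nat \<Rightarrow> real) \<Rightarrow> real" where
  "partial_deriv i g x = deriv (\<lambda>t. g (x(i := t))) (x i)"

fun Ck :: "nat \<Rightarrow> nat \<Rightarrow> ((nat \<Rightarrow> real) \<Rightarrow> real) \<Rightarrow> bool" where
  "Ck n 0 g \<longleftrightarrow> continuous_on UNIV g"
| "Ck n (Suc k) g \<longleftrightarrow> continuous_on UNIV g \<and>
     (\<forall>i<n. (\<forall>x. (\<lambda>t. g (x(i := t))) differentiable (at (x i))) \<and> Ck n k (partial_deriv i g))"

definition smooth_compact_support :: "nat \<Rightarrow> ((nat \<Rightarrow> real) \<Rightarrow> real) \<Rightarrow> bool" where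
  "smooth_compact_support n g \<longleftrightarrow> depends_on_first n g \<and> (\<forall>k. Ck n k g) \<and>
     (\<exists>R. \<forall>x. g x \<noteq> 0 \<longrightarrow> (\<forall>i<n. \<bar>x i\<bar> \<le> R))"

definition smooth_functional ::
  "('h::real_normed_vector \<Rightarrow> 'w \<Rightarrow> real) \<Rightarrow> ('w \<Rightarrow> real) \<Rightarrow> ('w \<Rightarrow> 'h) \<Rightarrow> bool" where
  "smooth_functional X S DS \<longleftrightarrow>
     (\<exists>n\<ge>1. \<exists>g \<phi>. smooth_compact_support n g \<and>
        S = (\<lambda>\<omega>. g (\<lambda>j. X (\<phi> j) \<omega>)) \<and>
        DS = (\<lambda>\<omega>. \<Sum>i<n. partial_deriv i g (\<lambda>j. X (\<phi> j) \<omega>) *\<^sub>R \<phi> i))"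

text \<open>\<open>U\<close> is a version of the derivative of \<open>F\<close>: the pair \<open>(F, U)\<close> lies in the closure of the
  graph of the derivative on smooth functionals.\<close>

definition has_malliavin_deriv ::
  "'w measure \<Rightarrow> ('h::{real_inner, banach, second_countable_topology} \<Rightarrow> 'w \<Rightarrow> real) \<Rightarrow>
     ('w \<Rightarrow> real) \<Rightarrow> ('w \<Rightarrow> 'h) \<Rightarrow> bool" where
  "has_malliavin_deriv M X F U \<longleftrightarrow>
     F \<in> borel_measurable M \<and> integrable M (\<lambda>\<omega>. (F \<omega>)\<^sup>2) \<and>
     U \<in> borel_measurable M \<and> integrable M (\<lambda>\<omega>. (norm (U \<omega>))\<^sup>2) \<and>
     (\<exists>S DS. (\<forall>k. smooth_functional X (S k) (DS k)) \<and>
        (\<lambda>k::nat. integral\<^sup>L M (\<lambda>\<omega>. (F \<omega> - S k \<omega>)\<^sup>2)) \<longlonglongrightarrow> 0 \<and>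
        (\<lambda>k. integral\<^sup>L M (\<lambda>\<omega>. (norm (U \<omega> - DS k \<omega>))\<^sup>2)) \<longlonglongrightarrow> 0)"

definition malliavin_D12 ::
  "'w measure \<Rightarrow> ('h::{real_inner, banach, second_countable_topology} \<Rightarrow> 'w \<Rightarrow> real) \<Rightarrow>
     ('w \<Rightarrow> real) set" where
  "malliavin_D12 M X = {F. \<exists>U. has_malliavin_deriv M X F U}"

definition malliavin_deriv ::
  "'w measure \<Rightarrow> ('h::{real_inner, banach, second_countable_topology} \<Rightarrow> 'w \<Rightarrow> real) \<Rightarrow>
     ('w \<Rightarrow> real) \<Rightarrow> 'w \<Rightarrow> 'h" where
  "malliavin_deriv M X F = (SOME U. has_malliavin_deriv M X F U)"

section \<open>Wiener chaos and the pseudo-inverse of the Ornstein--Uhlenbeck generator\<close>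

fun hermite :: "nat \<Rightarrow> real \<Rightarrow> real" where
  "hermite 0 x = 1"
| "hermite (Suc 0) x = x"
| "hermite (Suc (Suc q)) x = x * hermite (Suc q) x - real (Suc q) * hermite q x"

text \<open>The chaos of order \<open>q \<ge> 1\<close>, that is, the range of the multiple Wiener--Ito integral
  \<open>I\<^sub>q\<close>, is the closed linear span of the \<open>I\<^sub>q (h\<^sup>\<otimes>\<^sup>q) = H\<^sub>q (X h)\<close> with \<open>h\<close> of norm one.\<close>

definition hermite_span ::
  "('h::real_normed_vector \<Rightarrow> 'w \<Rightarrow> real) \<Rightarrow> nat \<Rightarrow> ('w \<Rightarrow> real) set" where
  "hermite_span X q =
     {\<lambda>\<omega>. \<Sum>i<n. c i * hermite q (X (h i) \<omega>) | (n::nat) c h. \<forall>i<n. norm (h i) = 1}"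

definition wiener_chaos ::
  "'w measure \<Rightarrow> ('h::real_normed_vector \<Rightarrow> 'w \<Rightarrow> real) \<Rightarrow> nat \<Rightarrow> ('w \<Rightarrow> real) set" where
  "wiener_chaos M X q =
     (if q = 0 then {F \<in> L2_functionals M X. \<exists>c. AE \<omega> in M. F \<omega> = c}
      else {F \<in> L2_functionals M X. \<exists>S. (\<forall>k::nat. S k \<in> hermite_span X q) \<and>
              (\<lambda>k. integral\<^sup>L M (\<lambda>\<omega>. (F \<omega> - S k \<omega>)\<^sup>2)) \<longlonglongrightarrow> 0})"

definition chaos_proj ::
  "'w measure \<Rightarrow> ('h::real_normed_vector \<Rightarrow> 'w \<Rightarrow> real) \<Rightarrow> nat \<Rightarrow> ('w \<Rightarrow> real) \<Rightarrow> 'w \<Rightarrow> real" where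
  "chaos_proj M X q F = (SOME G. G \<in> wiener_chaos M X q \<and>
     (\<forall>Y\<in>wiener_chaos M X q. integral\<^sup>L M (\<lambda>\<omega>. (F \<omega> - G \<omega>) * Y \<omega>) = 0))"

text \<open>The limit of the series \<open>- (\<Sum>q\<ge>1. J\<^sub>q F / q)\<close> in \<open>L\<^sup>2\<close>.\<close>

definition OU_pseudo_inverse ::
  "'w measure \<Rightarrow> ('h::real_normed_vector \<Rightarrow> 'w \<Rightarrow> real) \<Rightarrow> ('w \<Rightarrow> real) \<Rightarrow> 'w \<Rightarrow> real" where
  "OU_pseudo_inverse M X F = (SOME G. G \<in> L2_functionals M X \<and>
     (\<lambda>N. integral\<^sup>L M (\<lambda>\<omega>. (G \<omega> - (- (\<Sum>q=1..N. chaos_proj M X q F \<omega> / real q)))\<^sup>2))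
       \<longlonglongrightarrow> 0)"

definition malliavin_inner ::
  "'w measure \<Rightarrow> ('h::{real_inner, banach, second_countable_topology} \<Rightarrow> 'w \<Rightarrow> real) \<Rightarrow>
     ('w \<Rightarrow> real) \<Rightarrow> 'w \<Rightarrow> real" where
  "malliavin_inner M X F \<omega> =
     inner (malliavin_deriv M X F \<omega>) (- malliavin_deriv M X (OU_pseudo_inverse M X F) \<omega>)"

section \<open>Convergence in distribution and the standard normal distribution function\<close>

definition converges_in_distribution ::
  "'w measure \<Rightarrow> (nat \<Rightarrow> 'w \<Rightarrow> 'a::topological_space) \<Rightarrow> 'v measure \<Rightarrow> ('v \<Rightarrow> 'a) \<Rightarrow> bool" where
  "converges_in_distribution M Y M' Z \<longleftrightarrow>
     (\<forall>f :: 'a \<Rightarrow> real. continuous_on UNIV f \<and> bounded (range f) \<longrightarrow>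
        (\<lambda>n. integral\<^sup>L M (\<lambda>\<omega>. f (Y n \<omega>))) \<longlonglongrightarrow> integral\<^sup>L M' (\<lambda>\<omega>. f (Z \<omega>)))"

definition Phi :: "real \<Rightarrow> real" where
  "Phi = cdf std_normal_distribution"

lemma DERIV_Phi: "(Phi has_real_derivative std_normal_density z) (at z)"
proof -
  let ?f = "std_normal_density"
  interpret N: real_distribution std_normal_distribution by (rule real_dist_normal_dist)
  have cont: "continuous_on A ?f" for A
    by (auto simp: std_normal_density_def intro!: continuous_intros)
  define a where "a = z - 1"
  have eq: "Phi x = Phi a + integral {a..x} ?f" if "x \<in> {a<..}" for x
  proof -
    have int: "set_integrable lborel {a..x} ?f"
      by (rule borel_integrable_atLeastAtMost') (rule cont)
    have "Phi x - Phi a = measure std_normal_distribution {a<..x}"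
      using N.cdf_diff_eq[of a x] that by (simp add: Phi_def)
    also have "\<dots> = integral\<^sup>L std_normal_distribution (indicator {a<..x})"
      by simp
    also have "\<dots> = (LINT y|lborel. ?f y * indicator {a<..x} y)"
      by (subst integral_density) (auto simp: normal_density_nonneg)
    also have "\<dots> = (LINT y|lborel. indicator {a..x} y *\<^sub>R ?f y)"
    proof (rule integral_cong_AE)
      have "AE y in lborel. y \<noteq> a" by (rule AE_lborel_singleton)
      then show "AE y in lborel. ?f y * indicator {a<..x} y = indicator {a..x} y *\<^sub>R ?f y"
        by eventually_elim (auto simp: indicator_def)
    qed auto
    also have "\<dots> = integral {a..x} ?f"
      using set_borel_integral_eq_integral(2)[OF int] by (simp add: set_lebesgue_integral_def)
    finally show ?thesis by simp
  qed
  have "((\<lambda>x. integral {a..x} ?f) has_real_derivative ?f z) (at z within {a..z+1})"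
    by (rule integral_has_real_derivative[OF cont]) (simp add: a_def)
  then have "((\<lambda>x. integral {a..x} ?f) has_real_derivative ?f z) (at z)"
    by (subst (asm) at_within_interior) (auto simp: a_def)
  then have "((\<lambda>x. Phi a + integral {a..x} ?f) has_real_derivative ?f z) (at z)"
    by (auto intro!: derivative_eq_intros)
  then show ?thesis
    by (rule has_field_derivative_transform_within_open[of _ _ _ "{a<..}"])
      (auto simp: a_def eq[unfolded a_def])
qed

lemma Phi_third_deriv:
  "(deriv ^^ 3) Phi z = (z\<^sup>2 - 1) * exp (- z\<^sup>2 / 2) / sqrt (2 * pi)"
proof -
  have 1: "deriv Phi = std_normal_density"
    using DERIV_Phi by (auto intro!: DERIV_imp_deriv)
  have d: "(std_normal_density has_real_derivative - x * std_normal_density x) (at x)" for x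
    unfolding std_normal_density_def
    by (auto intro!: derivative_eq_intros simp: field_simps)
  have 2: "deriv std_normal_density = (\<lambda>x. - x * std_normal_density x)"
    using d by (auto intro!: DERIV_imp_deriv)
  have "((\<lambda>x. - x * std_normal_density x) has_real_derivative
      (z\<^sup>2 - 1) * std_normal_density z) (at z)"
    by (rule derivative_eq_intros d refl)+ (simp add: algebra_simps power2_eq_square)
  then have 3: "deriv (\<lambda>x. - x * std_normal_density x) z =
      (z\<^sup>2 - 1) * exp (- z\<^sup>2 / 2) / sqrt (2 * pi)"
    by (subst DERIV_imp_deriv) (assumption, simp add: std_normal_density_def)
  show ?thesis
    unfolding numeral_3_eq_3 by (simp only: funpow.simps o_apply id_apply 1 2 3)
qed

end

theory Submission
  imports Defs
begin

text \<open>
  The engine is the identity \<open>E[F g(F)] = E[g'(F) \<Theta>]\<close> with \<open>\<Theta> = \<langle>DF, -DL\<^sup>-\<^sup>1F\<rangle>\<close>. For the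
  bounded solution \<open>f\<close> of Stein's equation \<open>f'(x) - x f(x) = 1\<^bsub>x \<le> z\<^esub> - \<Phi>(z)\<close> it gives
  \<open>P(F \<le> z) - \<Phi>(z) = E[f'(F) (1 - \<Theta>)]\<close>, and for \<open>g(x) = x\<^sup>2\<close> and centered \<open>F\<close> it gives
  \<open>E[F\<^sup>3] = - 2 E[F (1 - \<Theta>)]\<close>. After division by \<open>\<phi>(n)\<close>, joint convergence and uniform
  integrability lead to the limits \<open>E[f'(N\<^sub>1) N\<^sub>2]\<close> and \<open>- E[N\<^sub>1 N\<^sub>2] = - \<rho>\<close>. Regression of \<open>N\<^sub>2\<close>
  on \<open>N\<^sub>1\<close> turns the former into \<open>\<rho> E[N\<^sub>1 f'(N\<^sub>1)]\<close>, which is \<open>\<rho> \<Phi>'''(z) / 3\<close>.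

  For the identity, the one-dimensional Gaussian integration by parts is applied in the direction
  of a unit vector \<open>u\<close>, where \<open>X u\<close> is independent of the variables \<open>X g\<close> with \<open>g\<close> orthogonal
  to \<open>u\<close>. It makes \<open>-L\<close> the composition of \<open>D\<close> with its adjoint on Hermite polynomials; these are
  total in \<open>L\<^sup>2(\<sigma>(X))\<close>, which carries the identity over to \<open>F\<close>.
\<close>

section \<open>Square-integrable functions\<close>

text \<open>Both Malliavin derivatives enter through a Hilbert choice, and L2 variables are
  functions rather than classes, so every identity has to hold for arbitrary versions. Two versions
  are compared only against a bounded \<sigma>(X)-measurable weight times a fixed vector. This is
  enough because \<open>F\<close> is first replaced by a smooth functional, whose gradient is a
  finite sum of such terms.

  Differentiability of the pseudo-inverse comes from an energy estimate: for a Hermite sum P with A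
  = - L P one has E|DP|^2 = E[P A], so that convergence of P and of A in L2 forces the derivatives
  to be Cauchy.

  The identity is proved for C^1 functions with bounded derivative. The Stein solution, whose
  derivative jumps, and the square, whose derivative is unbounded, are both outside this class; each
  is reached through C^1 approximations and dominated convergence, with a majorant that the
  available moments of \<open>F\<close> make integrable.

  The two limits then cancel: E[F^3] / \<phi> tends to - 2 \<rho>, and 1/3! of it is - \<rho>/3,
  opposite to the coefficient found from Stein's equation.\<close>

definition sq_int :: "'a measure \<Rightarrow> ('a \<Rightarrow> 'b::{real_inner, banach, second_countable_topology}) \<Rightarrow> bool" where
  "sq_int M f \<longleftrightarrow> f \<in> borel_measurable M \<and> integrable M (\<lambda>x. (norm (f x))\<^sup>2)"

definition l2norm :: "'a measure \<Rightarrow> ('a \<Rightarrow> 'b::{real_inner, banach, second_countable_topology}) \<Rightarrow> real" where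
  "l2norm M f = sqrt (\<integral>x. (norm (f x))\<^sup>2 \<partial>M)"

lemma sq_int_measurable: "sq_int M f \<Longrightarrow> f \<in> borel_measurable M"
  by (simp add: sq_int_def)

lemma sq_int_real: "sq_int M (f :: 'a \<Rightarrow> real) \<longleftrightarrow> f \<in> borel_measurable M \<and> integrable M (\<lambda>x. (f x)\<^sup>2)"
  by (simp add: sq_int_def)

lemma l2norm_nonneg [simp]: "0 \<le> l2norm M f"
  by (simp add: l2norm_def)

lemma l2norm_sq: "(l2norm M f)\<^sup>2 = (\<integral>x. (norm (f x))\<^sup>2 \<partial>M)"
  by (simp add: l2norm_def)

lemma sq_int_bound:
  assumes "f \<in> borel_measurable M" "sq_int M g" "\<And>x. norm (f x) \<le> norm (g x)"
  shows "sq_int M f"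
  unfolding sq_int_def
proof
  show "integrable M (\<lambda>x. (norm (f x))\<^sup>2)"
    by (rule Bochner_Integration.integrable_bound[where f="\<lambda>x. (norm (g x))\<^sup>2"])
      (use assms in \<open>auto simp: sq_int_def intro!: power_mono\<close>)
qed fact

lemma inner_abs_le_sq: "\<bar>inner x y\<bar> \<le> (norm x)\<^sup>2 + (norm (y::'a::real_inner))\<^sup>2"
proof -
  have "\<bar>inner x y\<bar> \<le> norm x * norm y" by (rule Cauchy_Schwarz_ineq2)
  also have "\<dots> \<le> (norm x)\<^sup>2 + (norm y)\<^sup>2"
    using sum_squares_bound[of "norm x" "norm y"] mult_nonneg_nonneg[OF norm_ge_zero norm_ge_zero, of x y]
    by linarith
  finally show ?thesis .
qed

lemma sq_int_inner:
  assumes "sq_int M f" "sq_int M g" shows "integrable M (\<lambda>x. inner (f x) (g x))"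
  by (rule Bochner_Integration.integrable_bound[where f="\<lambda>x. (norm (f x))\<^sup>2 + (norm (g x))\<^sup>2"])
    (use assms inner_abs_le_sq in \<open>auto simp: sq_int_def\<close>)

lemma sq_int_norm: "sq_int M f \<Longrightarrow> sq_int M (\<lambda>x. norm (f x))"
  by (auto simp: sq_int_def)

lemma sq_int_norm_mult:
  assumes "sq_int M f" "sq_int M g" shows "integrable M (\<lambda>x. norm (f x) * norm (g x))"
  using sq_int_inner[OF sq_int_norm[OF assms(1)] sq_int_norm[OF assms(2)]] by simp

lemma sq_int_mult:
  assumes "sq_int M f" "sq_int M g" shows "integrable M (\<lambda>x. f x * g x :: real)"
  using sq_int_inner[OF assms] by simp

lemma sq_int_add:
  assumes "sq_int M f" "sq_int M g" shows "sq_int M (\<lambda>x. f x + g x)"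
  unfolding sq_int_def
proof
  show "(\<lambda>x. f x + g x) \<in> borel_measurable M" using assms by (auto simp: sq_int_def)
  have "integrable M (\<lambda>x. (norm (f x))\<^sup>2 + 2 * inner (f x) (g x) + (norm (g x))\<^sup>2)"
    using sq_int_inner[OF assms] assms by (auto simp: sq_int_def)
  then show "integrable M (\<lambda>x. (norm (f x + g x))\<^sup>2)"
    by (simp add: power2_norm_eq_inner inner_add_left inner_add_right inner_commute algebra_simps)
qed

lemma sq_int_scaleR: "sq_int M f \<Longrightarrow> sq_int M (\<lambda>x. c *\<^sub>R f x)"
  by (auto simp: sq_int_def power_mult_distrib)

lemma sq_int_cmult: "sq_int M f \<Longrightarrow> sq_int M (\<lambda>x. c * f x :: real)"
  using sq_int_scaleR[of M f c] by simp

lemma sq_int_minus: "sq_int M f \<Longrightarrow> sq_int M (\<lambda>x. - f x)"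
  by (auto simp: sq_int_def)

lemma sq_int_diff:
  assumes "sq_int M f" "sq_int M g" shows "sq_int M (\<lambda>x. f x - g x)"
  using sq_int_add[OF assms(1) sq_int_minus[OF assms(2)]] by simp

lemma sq_int_zero [simp]: "sq_int M (\<lambda>x. 0)"
  by (simp add: sq_int_def)

lemma sq_int_sum:
  assumes "\<And>i. i \<in> I \<Longrightarrow> sq_int M (f i)" shows "sq_int M (\<lambda>x. \<Sum>i\<in>I. f i x)"
  using assms by (induction I rule: infinite_finite_induct) (auto intro: sq_int_add)

lemma sq_int_AE_cong:
  assumes "sq_int M f" "g \<in> borel_measurable M" "AE x in M. f x = g x" shows "sq_int M g"
  using assms unfolding sq_int_def
  by (auto elim!: integrable_cong_AE_imp)

lemma sq_int_bounded_mult: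
  assumes "sq_int M f" "w \<in> borel_measurable M" "\<And>x. \<bar>w x\<bar> \<le> C"
  shows "sq_int M (\<lambda>x. w x *\<^sub>R f x)"
proof (rule sq_int_bound[OF _ sq_int_scaleR[OF assms(1), of C]])
  show "(\<lambda>x. w x *\<^sub>R f x) \<in> borel_measurable M" using assms sq_int_measurable[OF assms(1)] by simp
  show "norm (w x *\<^sub>R f x) \<le> norm (C *\<^sub>R f x)" for x
    using assms(3)[of x] by (auto intro!: mult_right_mono)
qed

lemma (in finite_measure) sq_int_const: "sq_int M (\<lambda>x. c)"
  by (simp add: sq_int_def)

lemma (in finite_measure) sq_int_bounded:
  assumes "w \<in> borel_measurable M" "\<And>x. norm (w x) \<le> C"
  shows "sq_int M (w :: 'a \<Rightarrow> 'b::{real_inner, banach, second_countable_topology})"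
  unfolding sq_int_def
proof
  show "integrable M (\<lambda>x. (norm (w x))\<^sup>2)"
    by (rule integrable_const_bound[where B="C\<^sup>2"]) (use assms in \<open>auto intro!: power_mono\<close>)
qed fact

lemma (in finite_measure) sq_int_integrable: "sq_int M f \<Longrightarrow> integrable M f"
proof -
  assume f: "sq_int M f"
  have "integrable M (\<lambda>x. norm (f x) * norm (1::real))"
    by (rule sq_int_norm_mult[OF f sq_int_const])
  then show ?thesis using f by (simp add: sq_int_def integrable_norm_iff)
qed

lemma l2_cauchy_schwarz:
  assumes f: "sq_int M f" and g: "sq_int M g"
  shows "(\<integral>x. norm (f x) * norm (g x) \<partial>M) \<le> l2norm M f * l2norm M g"
proof -
  let ?a = "\<integral>x. (norm (f x))\<^sup>2 \<partial>M" and ?b = "\<integral>x. norm (f x) * norm (g x) \<partial>M"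
    and ?c = "\<integral>x. (norm (g x))\<^sup>2 \<partial>M"
  have i: "integrable M (\<lambda>x. (norm (f x))\<^sup>2)" "integrable M (\<lambda>x. (norm (g x))\<^sup>2)"
    using f g by (auto simp: sq_int_def)
  \<comment> \<open>A quadratic in \<open>t\<close> that is never negative has non-positive
    discriminant; this is the inequality sought.\<close>
  have q: "0 \<le> ?a + 2 * t * ?b + t\<^sup>2 * ?c" for t
  proof -
    have "0 \<le> (\<integral>x. (norm (f x) + t * norm (g x))\<^sup>2 \<partial>M)" by simp
    also have "\<dots> = (\<integral>x. (norm (f x))\<^sup>2 + (2 * t) * (norm (f x) * norm (g x)) + t\<^sup>2 * (norm (g x))\<^sup>2 \<partial>M)"
      by (simp add: power2_sum power_mult_distrib algebra_simps)
    also have "\<dots> = ?a + 2 * t * ?b + t\<^sup>2 * ?c"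
      using i sq_int_norm_mult[OF f g] by simp
    finally show ?thesis .
  qed
  have b0: "0 \<le> ?b" by (auto intro!: integral_nonneg_AE)
  have a0: "0 \<le> ?a" and c0: "0 \<le> ?c" by auto
  have "?b\<^sup>2 \<le> ?a * ?c"
  proof (cases "?c = 0")
    case True
    \<comment> \<open>With \<open>?c = 0\<close> the quadratic is affine in \<open>t\<close>. If
      \<open>?b\<close> were positive, the chosen \<open>t\<close> would make it equal to
      -1.\<close>
    have "?b = 0"
    proof (rule ccontr)
      assume "?b \<noteq> 0"
      then have "0 < ?b" using b0 by linarith
      have "0 \<le> ?a + 2 * (- (?a + 1) / (2 * ?b)) * ?b"
        using q[of "- (?a + 1) / (2 * ?b)"] True by simp
      also have "\<dots> = -1" using \<open>0 < ?b\<close> by (simp add: field_simps)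
      finally show False by simp
    qed
    then show ?thesis using a0 c0 by simp
  next
    case False
    then have c: "0 < ?c" using c0 by linarith
    have "0 \<le> ?a + 2 * (- ?b / ?c) * ?b + (- ?b / ?c)\<^sup>2 * ?c" by (rule q)
    then show ?thesis using c by (simp add: field_simps power2_eq_square)
  qed
  then have "?b \<le> sqrt (?a * ?c)" using real_le_rsqrt by blast
  then show ?thesis by (simp add: l2norm_def real_sqrt_mult)
qed

lemma l2_cauchy_schwarz_inner:
  assumes f: "sq_int M f" and g: "sq_int M g"
  shows "\<bar>\<integral>x. inner (f x) (g x) \<partial>M\<bar> \<le> l2norm M f * l2norm M g"
proof -
  have "\<bar>\<integral>x. inner (f x) (g x) \<partial>M\<bar> \<le> (\<integral>x. norm (f x) * norm (g x) \<partial>M)"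
    by (rule integral_abs_bound[THEN order_trans],
        rule integral_mono[OF integrable_abs[OF sq_int_inner[OF f g]] sq_int_norm_mult[OF f g]])
      (rule Cauchy_Schwarz_ineq2)
  also note l2_cauchy_schwarz[OF f g]
  finally show ?thesis .
qed

lemma l2_triangle:
  assumes f: "sq_int M f" and g: "sq_int M g"
  shows "l2norm M (\<lambda>x. f x + g x) \<le> l2norm M f + l2norm M g"
proof -
  have i: "integrable M (\<lambda>x. (norm (f x))\<^sup>2)" "integrable M (\<lambda>x. (norm (g x))\<^sup>2)"
    using f g by (auto simp: sq_int_def)
  have "(\<integral>x. (norm (f x + g x))\<^sup>2 \<partial>M) = (\<integral>x. (norm (f x))\<^sup>2 + 2 * inner (f x) (g x) + (norm (g x))\<^sup>2 \<partial>M)"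
    by (simp add: power2_norm_eq_inner inner_add_left inner_add_right inner_commute algebra_simps)
  also have "\<dots> = (l2norm M f)\<^sup>2 + 2 * (\<integral>x. inner (f x) (g x) \<partial>M) + (l2norm M g)\<^sup>2"
    using i sq_int_inner[OF f g] by (simp add: l2norm_sq)
  also have "\<dots> \<le> (l2norm M f + l2norm M g)\<^sup>2"
    using l2_cauchy_schwarz_inner[OF f g] by (simp add: power2_sum)
  finally show ?thesis unfolding l2norm_def[of M "\<lambda>x. f x + g x"]
    by (intro real_le_lsqrt) auto
qed



section \<open>The L2 norm and convergence in L2\<close>

lemma l2norm_diff_commute: "l2norm M (\<lambda>x. f x - g x) = l2norm M (\<lambda>x. g x - f x)"
  by (simp add: l2norm_def norm_minus_commute)

lemma l2norm_scaleR: "l2norm M (\<lambda>x. c *\<^sub>R f x) = \<bar>c\<bar> * l2norm M f"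
  by (simp add: l2norm_def power_mult_distrib real_sqrt_mult)

lemma l2_triangle_diff:
  assumes "sq_int M f" and "sq_int M g" "sq_int M h"
  shows "l2norm M (\<lambda>x. f x - h x) \<le> l2norm M (\<lambda>x. f x - g x) + l2norm M (\<lambda>x. g x - h x)"
  using l2_triangle[OF sq_int_diff[OF assms(1,2)] sq_int_diff[OF assms(2,3)]] by simp

lemma l2norm_mono:
  assumes "f \<in> borel_measurable M" "sq_int M g" "\<And>x. norm (f x) \<le> norm (g x)"
  shows "l2norm M f \<le> l2norm M g"
  unfolding l2norm_def
  by (intro real_sqrt_le_mono integral_mono)
    (use assms sq_int_bound[OF assms] in \<open>auto simp: sq_int_def intro!: power_mono\<close>)

text \<open>Square-integrability of all terms is built in, because a Bochner integral takes the
  value 0 on non-integrable functions and \<open>l2norm\<close> would then vanish for the wrong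
  reason.\<close>

definition l2_tendsto :: "'a measure \<Rightarrow> (nat \<Rightarrow> 'a \<Rightarrow> 'b::{real_inner, banach, second_countable_topology}) \<Rightarrow> ('a \<Rightarrow> 'b) \<Rightarrow> bool" where
  "l2_tendsto M s f \<longleftrightarrow> (\<forall>k. sq_int M (s k)) \<and> sq_int M f \<and> (\<lambda>k. l2norm M (\<lambda>x. f x - s k x)) \<longlonglongrightarrow> 0"

lemma l2norm_tendsto_iff:
  "(\<lambda>k. l2norm M (g k)) \<longlonglongrightarrow> 0 \<longleftrightarrow> (\<lambda>k. \<integral>x. (norm (g k x))\<^sup>2 \<partial>M) \<longlonglongrightarrow> 0"
proof
  assume "(\<lambda>k. l2norm M (g k)) \<longlonglongrightarrow> 0"
  then have "(\<lambda>k. (l2norm M (g k))\<^sup>2) \<longlonglongrightarrow> 0\<^sup>2" by (intro tendsto_intros)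
  then show "(\<lambda>k. \<integral>x. (norm (g k x))\<^sup>2 \<partial>M) \<longlonglongrightarrow> 0" by (simp add: l2norm_sq)
next
  assume "(\<lambda>k. \<integral>x. (norm (g k x))\<^sup>2 \<partial>M) \<longlonglongrightarrow> 0"
  then have "(\<lambda>k. sqrt (\<integral>x. (norm (g k x))\<^sup>2 \<partial>M)) \<longlonglongrightarrow> sqrt 0" by (intro tendsto_intros)
  then show "(\<lambda>k. l2norm M (g k)) \<longlonglongrightarrow> 0" by (simp add: l2norm_def)
qed

lemma l2_tendsto_iff:
  "l2_tendsto M s f \<longleftrightarrow> (\<forall>k. sq_int M (s k)) \<and> sq_int M f \<and> (\<lambda>k. \<integral>x. (norm (f x - s k x))\<^sup>2 \<partial>M) \<longlonglongrightarrow> 0"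
  by (simp add: l2_tendsto_def l2norm_tendsto_iff)

lemma l2_tendstoD:
  assumes "l2_tendsto M s f"
  shows "sq_int M (s k)" "sq_int M f" "(\<lambda>k. l2norm M (\<lambda>x. f x - s k x)) \<longlonglongrightarrow> 0"
  using assms by (auto simp: l2_tendsto_def)

lemma l2_tendsto_const: "sq_int M f \<Longrightarrow> l2_tendsto M (\<lambda>k. f) f"
  by (simp add: l2_tendsto_def l2norm_def)

lemma l2_tendsto_bound:
  assumes "\<And>k. sq_int M (s k)" "sq_int M f" "\<And>k. l2norm M (\<lambda>x. f x - s k x) \<le> e k" "e \<longlonglongrightarrow> 0"
  shows "l2_tendsto M s f"
  unfolding l2_tendsto_def using assms
  by (auto intro: tendsto_sandwich[of "\<lambda>_. 0" _ _ e])

lemma l2_tendsto_add: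
  assumes "l2_tendsto M s f" "l2_tendsto M t g"
  shows "l2_tendsto M (\<lambda>k x. s k x + t k x) (\<lambda>x. f x + g x)"
proof (rule l2_tendsto_bound)
  note a = l2_tendstoD[OF assms(1)] and b = l2_tendstoD[OF assms(2)]
  show "sq_int M (\<lambda>x. s k x + t k x)" "sq_int M (\<lambda>x. f x + g x)" for k
    using a b by (auto intro: sq_int_add)
  show "(\<lambda>k. l2norm M (\<lambda>x. f x - s k x) + l2norm M (\<lambda>x. g x - t k x)) \<longlonglongrightarrow> 0"
    using tendsto_add[OF a(3) b(3)] by simp
  show "l2norm M (\<lambda>x. f x + g x - (s k x + t k x)) \<le> l2norm M (\<lambda>x. f x - s k x) + l2norm M (\<lambda>x. g x - t k x)" for k
    using l2_triangle[OF sq_int_diff[OF a(2) a(1)[of k]] sq_int_diff[OF b(2) b(1)[of k]]]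
    by (simp add: algebra_simps)
qed

lemma l2_tendsto_scaleR:
  assumes "l2_tendsto M s f" shows "l2_tendsto M (\<lambda>k x. c *\<^sub>R s k x) (\<lambda>x. c *\<^sub>R f x)"
  using assms tendsto_mult_right_zero[of "\<lambda>k. l2norm M (\<lambda>x. f x - s k x)" sequentially "\<bar>c\<bar>"]
  by (auto simp: l2_tendsto_def l2norm_scaleR sq_int_scaleR simp flip: scaleR_diff_right)

lemma l2_tendsto_diff:
  assumes "l2_tendsto M s f" "l2_tendsto M t g"
  shows "l2_tendsto M (\<lambda>k x. s k x - t k x) (\<lambda>x. f x - g x)"
  using l2_tendsto_add[OF assms(1) l2_tendsto_scaleR[OF assms(2), of "-1"]] by simp

lemma l2_tendsto_sum:
  assumes "\<And>i. i \<in> I \<Longrightarrow> l2_tendsto M (s i) (f i)"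
  shows "l2_tendsto M (\<lambda>k x. \<Sum>i\<in>I. s i k x) (\<lambda>x. \<Sum>i\<in>I. f i x)"
  using assms by (induction I rule: infinite_finite_induct) (auto intro: l2_tendsto_add l2_tendsto_const)

lemma l2_tendsto_subseq:
  assumes "l2_tendsto M s f" "strict_mono r" shows "l2_tendsto M (\<lambda>k. s (r k)) f"
  using assms(1) LIMSEQ_subseq_LIMSEQ[OF l2_tendstoD(3)[OF assms(1)] assms(2)]
  by (auto simp: l2_tendsto_def o_def)

lemma l2_tendsto_norm:
  assumes "l2_tendsto M s f" shows "(\<lambda>k. l2norm M (s k)) \<longlonglongrightarrow> l2norm M f"
proof -
  note a = l2_tendstoD[OF assms]
  have "\<bar>l2norm M (s k) - l2norm M f\<bar> \<le> l2norm M (\<lambda>x. f x - s k x)" for k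
    using l2_triangle[OF sq_int_diff[OF a(2) a(1)[of k]] a(1)[of k]]
      l2_triangle[OF sq_int_diff[OF a(1)[of k] a(2)] a(2)] l2norm_diff_commute[of M "s k" f] by auto
  then have "(\<lambda>k. l2norm M (s k) - l2norm M f) \<longlonglongrightarrow> 0"
    by (intro tendsto_rabs_zero_cancel[OF tendsto_sandwich[OF _ _ tendsto_const a(3)]]) auto
  then show ?thesis by (simp add: LIM_zero_iff)
qed

lemma null_tendsto_bound:
  fixes f :: "nat \<Rightarrow> 'a::real_normed_vector"
  assumes "\<And>k. norm (f k - l) \<le> e k" "e \<longlonglongrightarrow> 0" shows "f \<longlonglongrightarrow> l"
  by (rule LIM_zero_cancel, rule Lim_null_comparison[OF _ assms(2)])
    (simp add: assms(1))

lemma l2_tendsto_inner: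
  assumes "l2_tendsto M s f" "l2_tendsto M t g"
  shows "(\<lambda>k. \<integral>x. inner (s k x) (t k x) \<partial>M) \<longlonglongrightarrow> (\<integral>x. inner (f x) (g x) \<partial>M)"
proof -
  note a = l2_tendstoD[OF assms(1)] and b = l2_tendstoD[OF assms(2)]
  let ?e = "\<lambda>k. l2norm M (\<lambda>x. f x - s k x) * l2norm M (t k) + l2norm M f * l2norm M (\<lambda>x. g x - t k x)"
  have "norm ((\<integral>x. inner (s k x) (t k x) \<partial>M) - (\<integral>x. inner (f x) (g x) \<partial>M)) \<le> ?e k" for k
  proof -
    have "(\<integral>x. inner (f x) (g x) \<partial>M) - (\<integral>x. inner (s k x) (t k x) \<partial>M) =
      (\<integral>x. inner (f x - s k x) (t k x) \<partial>M) + (\<integral>x. inner (f x) (g x - t k x) \<partial>M)"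
      using sq_int_inner[OF a(1)[of k] b(1)[of k]] sq_int_inner[OF a(2) b(2)]
        sq_int_inner[OF a(2) b(1)[of k]]
      by (simp add: inner_diff_left inner_diff_right)
    then show ?thesis
      using l2_cauchy_schwarz_inner[OF sq_int_diff[OF a(2) a(1)[of k]] b(1)[of k]]
        l2_cauchy_schwarz_inner[OF a(2) sq_int_diff[OF b(2) b(1)[of k]]]
      unfolding real_norm_def by linarith
  qed
  moreover have "?e \<longlonglongrightarrow> 0"
    using tendsto_add[OF tendsto_mult[OF a(3) l2_tendsto_norm[OF assms(2)]]
        tendsto_mult[OF tendsto_const[of "l2norm M f"] b(3)]] by simp
  ultimately show ?thesis
    by (rule null_tendsto_bound)
qed

lemma l2_tendsto_mult:
  assumes "l2_tendsto M s f" "l2_tendsto M t g"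
  shows "(\<lambda>k. \<integral>x. s k x * (t k x :: real) \<partial>M) \<longlonglongrightarrow> (\<integral>x. f x * g x \<partial>M)"
  using l2_tendsto_inner[OF assms] by simp

lemma (in finite_measure) l1_le_l2:
  assumes "sq_int M f"
  shows "(\<integral>x. norm (f x) \<partial>M) \<le> l2norm M f * sqrt (measure M (space M))"
  using l2_cauchy_schwarz[OF assms sq_int_const[of "1::real"]] by (simp add: l2norm_def)

text \<open>On a probability space the L1 norm is at most the L2 norm, and L1 convergence has an
  almost surely convergent subsequence. This is what a merely continuous function of the variables
  requires.\<close>

lemma (in prob_space) l2_tendsto_AE_subseq:
  assumes "l2_tendsto M s f"
  obtains r where "strict_mono r" "AE x in M. (\<lambda>k. s (r k) x) \<longlonglongrightarrow> f x"
proof -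
  note a = l2_tendstoD[OF assms]
  have "(\<lambda>k. \<integral>x. norm (f x - s k x) \<partial>M) \<longlonglongrightarrow> 0"
    by (rule tendsto_sandwich[OF _ _ tendsto_const a(3)])
      (use l1_le_l2[OF sq_int_diff[OF a(2) a(1)]] in \<open>auto simp: prob_space\<close>)
  then obtain r where r: "strict_mono r" "AE x in M. (\<lambda>k. f x - s (r k) x) \<longlonglongrightarrow> 0"
    using tendsto_L1_AE_subseq[of M "\<lambda>k x. f x - s k x"] sq_int_integrable[OF sq_int_diff[OF a(2) a(1)]] by auto
  have "AE x in M. (\<lambda>k. s (r k) x) \<longlonglongrightarrow> f x"
    using r(2)
  proof eventually_elim
    case (elim x)
    from tendsto_diff[OF tendsto_const[of "f x"] elim] show ?case by simp
  qed
  then show ?thesis using r(1) that by blast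
qed

section \<open>Completeness of L2 and orthogonal projection\<close>

definition l2_Cauchy :: "'a measure \<Rightarrow> (nat \<Rightarrow> 'a \<Rightarrow> 'b::{real_inner, banach, second_countable_topology}) \<Rightarrow> bool" where
  "l2_Cauchy M s \<longleftrightarrow> (\<forall>k. sq_int M (s k)) \<and> (\<forall>e>0. \<exists>N. \<forall>i\<ge>N. \<forall>j\<ge>N. l2norm M (\<lambda>x. s i x - s j x) < e)"

lemma l2_tendsto_imp_Cauchy:
  assumes "l2_tendsto M s f" shows "l2_Cauchy M s"
  unfolding l2_Cauchy_def
proof (intro conjI allI impI)
  note a = l2_tendstoD[OF assms]
  show "sq_int M (s k)" for k by (rule a)
  fix e :: real assume "0 < e"
  then obtain N where N: "\<And>k. k \<ge> N \<Longrightarrow> l2norm M (\<lambda>x. f x - s k x) < e / 2"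
    using order_tendstoD(2)[OF a(3), of "e / 2"] by (auto simp: eventually_sequentially)
  have "l2norm M (\<lambda>x. s i x - s j x) < e" if "i \<ge> N" "j \<ge> N" for i j
    using l2_triangle_diff[OF a(1)[of i] a(2) a(1)[of j]] N[OF that(1)] N[OF that(2)]
      l2norm_diff_commute[of M "s i" f] by linarith
  then show "\<exists>N. \<forall>i\<ge>N. \<forall>j\<ge>N. l2norm M (\<lambda>x. s i x - s j x) < e" by blast
qed

text \<open>The limit is the pointwise \<open>lim\<close> of an almost surely Cauchy subsequence. It
  is therefore measurable for the subalgebra \<open>N\<close> itself and not merely equal to such a
  function almost surely, which membership in \<open>L2_functionals\<close> demands.\<close>

lemma (in prob_space) l2_complete:
  assumes C: "l2_Cauchy M s" and sub: "subalgebra M N" and meas: "\<And>k. s k \<in> borel_measurable N"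
  obtains f where "f \<in> borel_measurable N" "l2_tendsto M s f"
proof -
  have s: "sq_int M (s k)" for k using C by (simp add: l2_Cauchy_def)
  have [measurable]: "s k \<in> borel_measurable M" for k using s by (rule sq_int_measurable)
  have l1: "\<exists>N. \<forall>i\<ge>N. \<forall>j\<ge>N. (\<integral>x. norm (s i x - s j x) \<partial>M) < e" if "e > 0" for e
  proof -
    obtain N where N: "\<forall>i\<ge>N. \<forall>j\<ge>N. l2norm M (\<lambda>x. s i x - s j x) < e"
      using C \<open>e > 0\<close> unfolding l2_Cauchy_def by blast
    have "(\<integral>x. norm (s i x - s j x) \<partial>M) < e" if "i \<ge> N" "j \<ge> N" for i j
      using l1_le_l2[OF sq_int_diff[OF s[of i] s[of j]]] N that by (fastforce simp: prob_space)
    then show ?thesis by blast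
  qed
  obtain r where r: "strict_mono r" "AE x in M. Cauchy (\<lambda>i. s (r i) x)"
    using cauchy_L1_AE_cauchy_subseq[of M s, OF sq_int_integrable[OF s] l1] by blast
  define f where "f = (\<lambda>x. lim (\<lambda>i. s (r i) x))"
  have fN: "f \<in> borel_measurable N"
    unfolding f_def by (rule borel_measurable_lim_metric) (rule meas)
  have fM [measurable]: "f \<in> borel_measurable M" by (rule measurable_from_subalg[OF sub fN])
  have lim: "AE x in M. (\<lambda>i. s (r i) x) \<longlonglongrightarrow> f x"
    using r(2) by eventually_elim (auto simp: f_def Cauchy_convergent_iff convergent_LIMSEQ_iff)
  \<comment> \<open>Fatou's lemma along the subsequence, with \<open>k\<close> fixed. The integral
    is the non-negative one because square-integrability of \<open>f\<close> is not known yet; it is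
    read off from this estimate.\<close>
  have fatou: "(\<integral>\<^sup>+x. ennreal ((norm (f x - s k x))\<^sup>2) \<partial>M) \<le> ennreal (e\<^sup>2)"
    if N: "\<forall>i\<ge>N. \<forall>j\<ge>N. l2norm M (\<lambda>x. s i x - s j x) < e" and k: "k \<ge> N" for e N k
  proof -
    have "(\<integral>\<^sup>+x. ennreal ((norm (f x - s k x))\<^sup>2) \<partial>M) = (\<integral>\<^sup>+x. liminf (\<lambda>i. ennreal ((norm (s (r i) x - s k x))\<^sup>2)) \<partial>M)"
    proof (rule nn_integral_cong_AE)
      show "AE x in M. ennreal ((norm (f x - s k x))\<^sup>2) = liminf (\<lambda>i. ennreal ((norm (s (r i) x - s k x))\<^sup>2))"
        using lim
      proof eventually_elim
        case (elim x)
        have "(\<lambda>i. ennreal ((norm (s (r i) x - s k x))\<^sup>2)) \<longlonglongrightarrow> ennreal ((norm (f x - s k x))\<^sup>2)"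
          by (intro tendsto_ennrealI tendsto_intros elim)
        then show ?case by (intro lim_imp_Liminf[symmetric]) auto
      qed
    qed
    also have "\<dots> \<le> liminf (\<lambda>i. \<integral>\<^sup>+x. ennreal ((norm (s (r i) x - s k x))\<^sup>2) \<partial>M)"
      by (rule nn_integral_liminf) auto
    also have "\<dots> \<le> liminf (\<lambda>i. ennreal (e\<^sup>2))"
    proof (rule Liminf_mono)
      have "eventually (\<lambda>i. i \<ge> N) sequentially" by (rule eventually_ge_at_top)
      then show "\<forall>\<^sub>F i in sequentially. (\<integral>\<^sup>+x. ennreal ((norm (s (r i) x - s k x))\<^sup>2) \<partial>M) \<le> ennreal (e\<^sup>2)"
      proof eventually_elim
        case (elim i)
        then have "r i \<ge> N" using seq_suble[OF r(1), of i] by simp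
        then have "l2norm M (\<lambda>x. s (r i) x - s k x) \<le> e" using N k by (auto intro: less_imp_le)
        then have "(\<integral>x. (norm (s (r i) x - s k x))\<^sup>2 \<partial>M) \<le> e\<^sup>2"
          by (metis l2norm_sq l2norm_nonneg power_mono)
        then show ?case using sq_int_diff[OF s[of "r i"] s[of k]]
          by (subst nn_integral_eq_integral) (auto simp: sq_int_def ennreal_leI)
      qed
    qed
    finally show ?thesis by (simp add: Liminf_const)
  qed
  have f2: "sq_int M f"
  proof -
    obtain N where N: "\<forall>i\<ge>N. \<forall>j\<ge>N. l2norm M (\<lambda>x. s i x - s j x) < 1" using C unfolding l2_Cauchy_def using zero_less_one by blast
    have "sq_int M (\<lambda>x. f x - s N x)"
      unfolding sq_int_def using fatou[OF N order_refl]
      by (auto intro!: integrableI_bounded le_less_trans[OF fatou[OF N order_refl]])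
    from sq_int_add[OF this s[of N]] show ?thesis by simp
  qed
  have "(\<lambda>k. l2norm M (\<lambda>x. f x - s k x)) \<longlonglongrightarrow> 0"
  proof (rule LIMSEQ_I)
    fix e :: real assume "0 < e"
    then have "e / 2 > 0" by simp
    then obtain N where N: "\<forall>i\<ge>N. \<forall>j\<ge>N. l2norm M (\<lambda>x. s i x - s j x) < e / 2"
      using C unfolding l2_Cauchy_def by blast
    have "l2norm M (\<lambda>x. f x - s k x) < e" if "k \<ge> N" for k
    proof -
      have "ennreal (\<integral>x. (norm (f x - s k x))\<^sup>2 \<partial>M) \<le> ennreal ((e/2)\<^sup>2)"
        using fatou[OF N that] sq_int_diff[OF f2 s[of k]]
        by (subst (asm) nn_integral_eq_integral) (auto simp: sq_int_def)
      then have "(l2norm M (\<lambda>x. f x - s k x))\<^sup>2 \<le> (e/2)\<^sup>2" by (simp add: l2norm_sq)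
      then have "l2norm M (\<lambda>x. f x - s k x) \<le> e/2" by (rule power2_le_imp_le) (use \<open>0 < e\<close> in simp)
      then show ?thesis using \<open>0 < e\<close> by simp
    qed
    then show "\<exists>no. \<forall>n\<ge>no. norm (l2norm M (\<lambda>x. f x - s n x) - 0) < e" by auto
  qed
  then have "l2_tendsto M s f" using s f2 by (simp add: l2_tendsto_def)
  then show ?thesis using fN that by blast
qed

text \<open>Parallelogram law on a minimising sequence.\<close>

lemma (in prob_space) l2_projection:
  fixes F :: "'a \<Rightarrow> real"
  assumes F: "sq_int M F" and sub: "subalgebra M N"
    and H: "\<And>s. s \<in> H \<Longrightarrow> sq_int M s \<and> s \<in> borel_measurable N"
    and zero: "(\<lambda>x. 0) \<in> H"
    and lin: "\<And>s t c. s \<in> H \<Longrightarrow> t \<in> H \<Longrightarrow> (\<lambda>x. s x + c * t x) \<in> H"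
  obtains G s where "G \<in> borel_measurable N" "\<And>k::nat. s k \<in> H" "l2_tendsto M s G"
    "\<And>Y. Y \<in> H \<Longrightarrow> (\<integral>x. (F x - G x) * Y x \<partial>M) = 0"
proof -
  define d where "d = (INF s\<in>H. l2norm M (\<lambda>x. F x - s x))"
  have bdd: "bdd_below ((\<lambda>s. l2norm M (\<lambda>x. F x - s x)) ` H)"
    by (rule bdd_belowI[of _ 0]) auto
  have d_le: "d \<le> l2norm M (\<lambda>x. F x - s x)" if "s \<in> H" for s
    unfolding d_def by (rule cINF_lower[OF bdd that])
  have d0: "0 \<le> d" unfolding d_def using zero by (intro cINF_greatest) auto
  have "\<exists>s\<in>H. l2norm M (\<lambda>x. F x - s x) < d + 1 / real (Suc k)" for k
  proof -
    have "d < d + 1 / real (Suc k)" by simp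
    then show ?thesis unfolding d_def using cINF_less_iff[OF _ bdd] zero by blast
  qed
  then obtain s where s: "\<And>k. s k \<in> H" "\<And>k. l2norm M (\<lambda>x. F x - s k x) < d + 1 / real (Suc k)" by metis
  have sq: "sq_int M (s k)" for k using H s by blast
  have par: "(l2norm M (\<lambda>x. s i x - s j x))\<^sup>2 \<le> 2 * (d + 1 / real (Suc i))\<^sup>2 + 2 * (d + 1 / real (Suc j))\<^sup>2 - 4 * d\<^sup>2" for i j
  proof -
    have I: "integrable M (\<lambda>x. (F x - s i x)\<^sup>2)" "integrable M (\<lambda>x. (F x - s j x)\<^sup>2)"
      "integrable M (\<lambda>x. (s i x - s j x)\<^sup>2)" 
      "integrable M (\<lambda>x. (F x - (1/2 * s i x + 1/2 * s j x))\<^sup>2)"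
      using sq_int_diff[OF F sq[of i]] sq_int_diff[OF F sq[of j]] sq_int_diff[OF sq[of i] sq[of j]] 
      sq_int_diff[OF F sq_int_add[OF sq_int_cmult[OF sq[of i], of "1/2"] sq_int_cmult[OF sq[of j], of "1/2"]]]
      by (auto simp only: sq_int_real)
    have "(l2norm M (\<lambda>x. s i x - s j x))\<^sup>2 = (\<integral>x. (s i x - s j x)\<^sup>2 \<partial>M)" by (simp add: l2norm_sq)
    also have "\<dots> = (\<integral>x. 2 * (F x - s i x)\<^sup>2 + 2 * (F x - s j x)\<^sup>2 - 4 * (F x - (1/2 * s i x + 1/2 * s j x))\<^sup>2 \<partial>M)"
      by (rule Bochner_Integration.integral_cong) (auto simp: power2_eq_square field_simps)
    also have "\<dots> = 2 * (l2norm M (\<lambda>x. F x - s i x))\<^sup>2 + 2 * (l2norm M (\<lambda>x. F x - s j x))\<^sup>2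
        - 4 * (l2norm M (\<lambda>x. F x - (1/2 * s i x + 1/2 * s j x)))\<^sup>2"
      using I by (simp add: l2norm_sq)
    also have "\<dots> \<le> 2 * (d + 1 / real (Suc i))\<^sup>2 + 2 * (d + 1 / real (Suc j))\<^sup>2 - 4 * d\<^sup>2"
    proof -
      have "(\<lambda>x. 1/2 * s i x + 1/2 * s j x) \<in> H"
        using lin[OF lin[OF zero s(1)[of i], of "1/2"] s(1)[of j], of "1/2"] by simp
      then have "d\<^sup>2 \<le> (l2norm M (\<lambda>x. F x - (1/2 * s i x + 1/2 * s j x)))\<^sup>2"
        using d_le d0 by (intro power_mono) auto

      moreover have "(l2norm M (\<lambda>x. F x - s i x))\<^sup>2 \<le> (d + 1 / real (Suc i))\<^sup>2"
        using s(2)[of i] by (intro power_mono) auto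
      moreover have "(l2norm M (\<lambda>x. F x - s j x))\<^sup>2 \<le> (d + 1 / real (Suc j))\<^sup>2"
        using s(2)[of j] by (intro power_mono) auto
      ultimately show ?thesis by linarith
    qed
    finally show ?thesis .
  qed
  have "l2_Cauchy M s"
    unfolding l2_Cauchy_def
  proof (intro conjI allI impI sq)
    fix e :: real assume "0 < e"
    have "(\<lambda>k. 2 * (d + 1 / real (Suc k))\<^sup>2 - 2 * d\<^sup>2) \<longlonglongrightarrow> 2 * (d + 0)\<^sup>2 - 2 * d\<^sup>2"
      by (intro tendsto_intros LIMSEQ_Suc lim_1_over_n)
    then have "\<forall>\<^sub>F k in sequentially. 2 * (d + 1 / real (Suc k))\<^sup>2 - 2 * d\<^sup>2 < e\<^sup>2 / 2"
      using \<open>0 < e\<close> by (intro order_tendstoD(2)) auto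
    then obtain K where K: "\<And>k. k \<ge> K \<Longrightarrow> 2 * (d + 1 / real (Suc k))\<^sup>2 - 2 * d\<^sup>2 < e\<^sup>2 / 2"
      by (auto simp: eventually_sequentially)
    have "l2norm M (\<lambda>x. s i x - s j x) < e" if "i \<ge> K" "j \<ge> K" for i j
    proof -
      have "(l2norm M (\<lambda>x. s i x - s j x))\<^sup>2 < e\<^sup>2" using par[of i j] K[OF that(1)] K[OF that(2)] by linarith
      then show ?thesis using \<open>0 < e\<close> by (simp add: power_less_imp_less_base)
    qed
    then show "\<exists>N. \<forall>i\<ge>N. \<forall>j\<ge>N. l2norm M (\<lambda>x. s i x - s j x) < e" by blast
  qed
  then obtain G where G: "G \<in> borel_measurable N" "l2_tendsto M s G"
    using l2_complete[OF _ sub] H s by blast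
  have FG: "sq_int M (\<lambda>x. F x - G x)" using sq_int_diff[OF F l2_tendstoD(2)[OF G(2)]] .
  have dG: "l2norm M (\<lambda>x. F x - G x) = d"
  proof -
    have a: "(\<lambda>k. l2norm M (\<lambda>x. F x - s k x)) \<longlonglongrightarrow> l2norm M (\<lambda>x. F x - G x)"
      by (rule l2_tendsto_norm[OF l2_tendsto_diff[OF l2_tendsto_const[OF F] G(2)]])
    have b: "(\<lambda>k. l2norm M (\<lambda>x. F x - s k x)) \<longlonglongrightarrow> d"
    proof (rule tendsto_sandwich[OF _ _ tendsto_const])
      show "(\<lambda>k. d + 1 / real (Suc k)) \<longlonglongrightarrow> d"
        using tendsto_add[OF tendsto_const LIMSEQ_Suc[OF lim_1_over_n], of d] by simp
    qed (use s d_le in \<open>auto intro: less_imp_le always_eventually\<close>)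
    show ?thesis by (rule LIMSEQ_unique[OF a b])
  qed
  have "(\<integral>x. (F x - G x) * Y x \<partial>M) = 0" if Y: "Y \<in> H" for Y
  proof -
    have Y2: "sq_int M Y" using H Y by blast
    let ?b = "\<integral>x. (F x - G x) * Y x \<partial>M" and ?c = "\<integral>x. (Y x)\<^sup>2 \<partial>M"
    \<comment> \<open>First variation: moving \<open>G\<close> by \<open>t * Y\<close> stays in the
      closure of \<open>H\<close>, so the distance cannot fall below \<open>d\<close>. A non-zero
      linear coefficient would contradict this for small \<open>t\<close>.\<close>
    have q: "0 \<le> - 2 * t * ?b + t\<^sup>2 * ?c" for t
    proof -
      have "d \<le> l2norm M (\<lambda>x. F x - (s k x + t * Y x))" for k
        by (rule d_le[OF lin[OF s(1) Y]])
      moreover have "(\<lambda>k. l2norm M (\<lambda>x. F x - (s k x + t * Y x))) \<longlonglongrightarrow> l2norm M (\<lambda>x. F x - (G x + t * Y x))"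
        by (rule l2_tendsto_norm[OF l2_tendsto_diff[OF l2_tendsto_const[OF F] l2_tendsto_add[OF G(2) l2_tendsto_const[OF sq_int_cmult[OF Y2]]]]])
      ultimately have "d \<le> l2norm M (\<lambda>x. F x - (G x + t * Y x))"
        by (intro LIMSEQ_le_const) auto
      then have "d\<^sup>2 \<le> (\<integral>x. (F x - (G x + t * Y x))\<^sup>2 \<partial>M)"
        using power_mono[OF _ d0, of "l2norm M (\<lambda>x. F x - (G x + t * Y x))" 2] l2norm_sq[of M "\<lambda>x. F x - (G x + t * Y x)"]
        by simp
      also have "\<dots> = (\<integral>x. (F x - G x)\<^sup>2 - (2 * t) * ((F x - G x) * Y x) + t\<^sup>2 * (Y x)\<^sup>2 \<partial>M)"
        by (rule Bochner_Integration.integral_cong) (auto simp: power2_eq_square algebra_simps)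
      also have "\<dots> = (\<integral>x. (F x - G x)\<^sup>2 \<partial>M) - (2 * t) * ?b + t\<^sup>2 * ?c"
        using FG Y2 sq_int_mult[OF FG Y2] by (simp add: sq_int_real)
      also have "(\<integral>x. (F x - G x)\<^sup>2 \<partial>M) = d\<^sup>2" using dG l2norm_sq[of M "\<lambda>x. F x - G x"] by simp
      finally show ?thesis by simp
    qed
    have c0: "0 \<le> ?c" by simp
    show "?b = 0"
    proof (rule ccontr)
      assume b: "?b \<noteq> 0"
      \<comment> \<open>The minimising step would be \<open>?b / ?c\<close>; the 1 in the
        denominator keeps it meaningful when \<open>Y\<close> is null.\<close>
      have "0 \<le> - 2 * (?b / (?c + 1)) * ?b + (?b / (?c + 1))\<^sup>2 * ?c" by (rule q)
      also have "\<dots> = - (?b\<^sup>2 * (?c + 2)) / (?c + 1)\<^sup>2" using c0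
        by (simp add: field_simps power2_eq_square add_nonneg_eq_0_iff)
      also have "\<dots> < 0"
      proof (rule divide_neg_pos)
        have "0 < ?c + 2" "0 < ?c + 1" using c0 by linarith+
        then show "- (?b\<^sup>2 * (?c + 2)) < 0" "0 < (?c + 1)\<^sup>2"
          using b by (auto simp: mult_pos_pos)
      qed
      finally show False by simp
    qed
  qed
  then show ?thesis using that G s by blast
qed

section \<open>Uniqueness of characteristic functions\<close>

text \<open>Tilting the probability by \<open>W / c\<close> turns integrals weighted by
  \<open>W\<close> into the law of \<open>Y\<close> under a new probability, to which uniqueness
  theorems for laws apply.\<close>

lemma (in prob_space) char_distr_density:
  fixes W Y :: "'a \<Rightarrow> real"
  assumes [measurable]: "W \<in> borel_measurable M" "Y \<in> borel_measurable M" and W: "integrable M W" "\<And>x. 0 \<le> W x"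
    and c: "(\<integral>x. W x \<partial>M) = c" "c > 0"
  shows "real_distribution (distr (density M (\<lambda>x. W x / c)) borel Y)"
    "char (distr (density M (\<lambda>x. W x / c)) borel Y) t =
      complex_of_real ((\<integral>x. W x * cos (t * Y x) \<partial>M) / c) + \<i> * complex_of_real ((\<integral>x. W x * sin (t * Y x) \<partial>M) / c)"
    "B \<in> sets borel \<Longrightarrow> measure (distr (density M (\<lambda>x. W x / c)) borel Y) B = (\<integral>x. W x * indicator B (Y x) \<partial>M) / c"
proof -
  let ?D = "density M (\<lambda>x. W x / c)"
  have i: "integrable M (\<lambda>x. W x * cos (t * Y x))" "integrable M (\<lambda>x. W x * sin (t * Y x))" for t
    by (rule Bochner_Integration.integrable_bound[OF W(1)], simp,
      simp add: abs_mult mult_left_le)+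
  have "emeasure ?D (space ?D) = (\<integral>\<^sup>+x. ennreal (W x / c) \<partial>M)"
    by (auto simp: emeasure_density intro!: nn_integral_cong)
  also have "\<dots> = ennreal (\<integral>x. W x / c \<partial>M)"
    using W c by (intro nn_integral_eq_integral) auto
  also have "\<dots> = 1" using c by simp
  finally have D: "prob_space ?D" by (rule prob_spaceI)
  then interpret D: prob_space ?D .
  show "real_distribution (distr ?D borel Y)"
    by (rule D.real_distribution_distr) simp
  have "char (distr ?D borel Y) t = (CLINT x|M. (W x / c) *\<^sub>R iexp (t * Y x))"
    unfolding char_def using W c by (subst integral_distr, simp, simp, subst integral_density) auto
  also have "\<dots> = (CLINT x|M. complex_of_real (W x * cos (t * Y x) / c) + \<i> * complex_of_real (W x * sin (t * Y x) / c))"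
    by (rule Bochner_Integration.integral_cong)
      (auto simp: Re_exp Im_exp complex_eq_iff)
  also have "\<dots> = complex_of_real ((\<integral>x. W x * cos (t * Y x) \<partial>M) / c) + \<i> * complex_of_real ((\<integral>x. W x * sin (t * Y x) \<partial>M) / c)"
    using i by (subst Bochner_Integration.integral_add) (auto simp del: of_real_divide of_real_mult)
  finally show "char (distr ?D borel Y) t = \<dots>" .
  assume [measurable]: "B \<in> sets borel"
  have "measure (distr ?D borel Y) B = (\<integral>x. indicator B x \<partial>distr ?D borel Y)" by simp
  also have "\<dots> = (\<integral>x. (W x / c) * indicator B (Y x) \<partial>M)"
    using W c by (subst integral_distr, simp, simp, subst integral_density) auto
  finally show "measure (distr ?D borel Y) B = (\<integral>x. W x * indicator B (Y x) \<partial>M) / c" by simp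
qed

text \<open>The weight is signed, so it is split into positive and negative parts. Frequency 0 shows
  that both have the same mass \<open>c\<close>; the two tilted laws of \<open>Y\<close> then share
  their characteristic function and coincide by Levy's theorem.\<close>

lemma (in prob_space) char_zero_indicator:
  fixes W Y :: "'a \<Rightarrow> real"
  assumes W: "integrable M W" and Y [measurable]: "Y \<in> borel_measurable M"
    and zero: "\<And>t. (\<integral>x. W x * cos (t * Y x) \<partial>M) = 0" "\<And>t. (\<integral>x. W x * sin (t * Y x) \<partial>M) = 0"
    and B [measurable]: "B \<in> sets borel"
  shows "(\<integral>x. W x * indicator B (Y x) \<partial>M) = 0"
proof -
  have [measurable]: "W \<in> borel_measurable M" using W by auto
  define P where "P = (\<lambda>x. max (W x) 0)"
  define N where "N = (\<lambda>x. max (- W x) 0)"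
  have PN: "W x = P x - N x" "0 \<le> P x" "0 \<le> N x" for x by (auto simp: P_def N_def)
  have [measurable]: "P \<in> borel_measurable M" "N \<in> borel_measurable M" by (auto simp: P_def N_def)
  have iPN: "integrable M P" "integrable M N" using W unfolding P_def N_def by auto
  have bm: "integrable M (\<lambda>x. P x * b x)" "integrable M (\<lambda>x. N x * b x)"
    if "\<And>x. \<bar>b x\<bar> \<le> 1" "b \<in> borel_measurable M" for b :: "'a \<Rightarrow> real"
    by (rule Bochner_Integration.integrable_bound[OF iPN(1)], use that in \<open>auto simp: abs_mult mult_left_le\<close>)
      (rule Bochner_Integration.integrable_bound[OF iPN(2)], use that in \<open>auto simp: abs_mult mult_left_le\<close>)
  have split: "(\<integral>x. W x * b x \<partial>M) = (\<integral>x. P x * b x \<partial>M) - (\<integral>x. N x * b x \<partial>M)"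
    if "\<And>x. \<bar>b x\<bar> \<le> 1" "b \<in> borel_measurable M" for b
    using bm[OF that] by (simp add: PN(1) left_diff_distrib)
  define c where "c = (\<integral>x. P x \<partial>M)"
  have cN: "(\<integral>x. N x \<partial>M) = c"
    using zero(1)[of 0] split[of "\<lambda>_. 1"] by (simp add: c_def)
  have "0 \<le> c" unfolding c_def using PN by (intro integral_nonneg_AE) auto
  have "(\<integral>x. P x * indicator B (Y x) \<partial>M) = (\<integral>x. N x * indicator B (Y x) \<partial>M)"
  proof (cases "c = 0")
    \<comment> \<open>Without mass there is nothing to normalise, but then both parts of the weight
      vanish almost surely.\<close>
    case True
    have "AE x in M. P x = 0" "AE x in M. N x = 0"
      using integral_nonneg_eq_0_iff_AE[OF iPN(1)] integral_nonneg_eq_0_iff_AE[OF iPN(2)] PN True cN c_def by auto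
    then have "AE x in M. P x * indicator B (Y x) = 0" "AE x in M. N x * indicator B (Y x) = (0::real)"
      by auto
    then show ?thesis using integral_eq_zero_AE[of "\<lambda>x. P x * indicator B (Y x)" M]
      integral_eq_zero_AE[of "\<lambda>x. N x * indicator B (Y x)" M] by linarith
  next
    case False
    then have c: "c > 0" using \<open>0 \<le> c\<close> by simp
    note cp = char_distr_density[OF \<open>P \<in> _\<close> Y iPN(1) PN(2) c_def[symmetric] c]
    note cn = char_distr_density[OF \<open>N \<in> _\<close> Y iPN(2) PN(3) cN c]
    have "char (distr (density M (\<lambda>x. P x / c)) borel Y) = char (distr (density M (\<lambda>x. N x / c)) borel Y)"
      using zero split[of "\<lambda>x. cos (_ * Y x)"] split[of "\<lambda>x. sin (_ * Y x)"]
      by (intro ext) (simp add: cp(2) cn(2))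
    then have "distr (density M (\<lambda>x. P x / c)) borel Y = distr (density M (\<lambda>x. N x / c)) borel Y"
      by (rule Levy_uniqueness[OF cp(1) cn(1)])
    then show ?thesis using cp(3)[OF B] cn(3)[OF B] c by simp
  qed
  then show ?thesis using split[of "\<lambda>x. indicator B (Y x)"] by (simp add: indicator_def)
qed

lemma space_sigma_of [simp]: "space (sigma_of M Y) = space M"
  unfolding sigma_of_def by (rule space_measure_of) auto

lemma sets_sigma_of: "sets (sigma_of M Y) = sigma_sets (space M) {Y h -` B \<inter> space M | h B. B \<in> sets borel}"
  unfolding sigma_of_def by (rule sets_measure_of) auto

lemma subalgebra_sigma_of:
  assumes "\<And>h. Y h \<in> borel_measurable M" shows "subalgebra M (sigma_of M Y)"
  unfolding subalgebra_def
  by (auto simp: sets_sigma_of intro!: sets.sigma_sets_subset measurable_sets[OF assms] set_mp[OF sets.sigma_sets_subset])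

lemma measurable_sigma_of: "Y h \<in> borel_measurable (sigma_of M Y)"
  by (rule measurableI) (auto simp: sets_sigma_of)

text \<open>Uniqueness of the characteristic function for arbitrary families of random variables: the
  coordinates are handled one at a time, the indicators of the coordinates already treated being
  absorbed into the weight.\<close>

lemma (in prob_space) char_zero_sigma_of:
  fixes W :: "'a \<Rightarrow> real" and Y :: "'h \<Rightarrow> 'a \<Rightarrow> real" and L :: "('a \<Rightarrow> real) set"
  assumes W: "integrable M W" and Y: "\<And>h. Y h \<in> borel_measurable M"
    and L: "\<And>l. l \<in> L \<Longrightarrow> l \<in> borel_measurable M" "(\<lambda>x. 0) \<in> L"
      "\<And>l h c. l \<in> L \<Longrightarrow> (\<lambda>x. l x + c * Y h x) \<in> L"
    and zero: "\<And>l. l \<in> L \<Longrightarrow> (\<integral>x. W x * cos (l x) \<partial>M) = 0" "\<And>l. l \<in> L \<Longrightarrow> (\<integral>x. W x * sin (l x) \<partial>M) = 0"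
    and A: "A \<in> sets (sigma_of M Y)"
  shows "(\<integral>x. W x * indicator A x \<partial>M) = 0"
proof -
  note [measurable] = Y
  have Wm [measurable]: "W \<in> borel_measurable M" using W by auto
  define ind where "ind = (\<lambda>xs x. if \<forall>(h, B)\<in>set xs. Y h x \<in> B then 1 else (0::real))"
  have ind_Nil: "ind [] x = 1" for x by (simp add: ind_def)
  have ind_Cons: "ind ((h, B) # xs) x = ind xs x * indicator B (Y h x)" for h B xs x
    by (auto simp: ind_def)
  have ind_m [measurable]: "ind xs \<in> borel_measurable M" if "\<forall>(h, B)\<in>set xs. B \<in> sets borel" for xs
    using that
  proof (induction xs)
    case Nil then show ?case by (simp add: ind_def)
  next
    case (Cons a xs)
    obtain h B where a: "a = (h, B)" by force
    have [measurable]: "B \<in> sets borel" "ind xs \<in> borel_measurable M" using Cons a by auto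
    have "(\<lambda>x. ind xs x * indicator B (Y h x)) \<in> borel_measurable M" by simp
    then show ?case unfolding a using ind_Cons by presburger
  qed
  have key: "\<forall>l\<in>L. (\<integral>x. W x * ind xs x * cos (l x) \<partial>M) = 0 \<and> (\<integral>x. W x * ind xs x * sin (l x) \<partial>M) = 0"
    if "\<forall>(h, B)\<in>set xs. B \<in> sets borel" for xs
    using that
  proof (induction xs)
    case Nil then show ?case using zero by (simp add: ind_def)
  next
    case (Cons a xs)
    obtain h B where a: "a = (h, B)" by force
    have B [measurable]: "B \<in> sets borel" and xs: "\<forall>(h, B)\<in>set xs. B \<in> sets borel" using Cons a by auto
    note IH = Cons.IH[OF xs]
    have im [measurable]: "ind xs \<in> borel_measurable M" by (rule ind_m[OF xs])
    show ?case
    proof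
      fix l assume l: "l \<in> L"
      have [measurable]: "l \<in> borel_measurable M" using L l by auto
      have i: "integrable M (\<lambda>x. W x * ind xs x * b x)" if "b \<in> borel_measurable M" "\<And>x. \<bar>b x\<bar> \<le> 1" for b
        proof (rule Bochner_Integration.integrable_bound[OF W])
        show "(\<lambda>x. W x * ind xs x * b x) \<in> borel_measurable M" using that by measurable
        have "\<bar>W x\<bar> * (\<bar>ind xs x\<bar> * \<bar>b x\<bar>) \<le> \<bar>W x\<bar> * 1" for x
          using that(2)[of x] by (intro mult_left_mono) (auto simp: ind_def)
        then show "AE x in M. norm (W x * ind xs x * b x) \<le> norm (W x)"
          by (simp add: abs_mult mult.assoc)
      qed
      have pm: "(\<lambda>x. l x + t * Y h x) \<in> L" "(\<lambda>x. l x - t * Y h x) \<in> L" for t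
        using L(3)[OF l, of t h] L(3)[OF l, of "-t" h] by auto
      \<comment> \<open>Here and in the next three facts, product-to-sum formulas absorb the
        frequency \<open>t\<close> into \<open>l \<plusminus> t * Y h\<close>. These functions stay
        in \<open>L\<close>, so the induction hypothesis covers them.\<close>
      have cc: "(\<integral>x. (W x * ind xs x * cos (l x)) * cos (t * Y h x) \<partial>M) = 0" for t
      proof -
        have "(\<integral>x. (W x * ind xs x * cos (l x)) * cos (t * Y h x) \<partial>M)
          = (\<integral>x. 1/2 * (W x * ind xs x * cos (l x + t * Y h x)) + 1/2 * (W x * ind xs x * cos (l x - t * Y h x)) \<partial>M)"
          by (rule Bochner_Integration.integral_cong) (auto simp: cos_add cos_diff algebra_simps)
        also have "\<dots> = 0" using IH pm i by (subst Bochner_Integration.integral_add) auto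
        finally show ?thesis .
      qed
      have cs: "(\<integral>x. (W x * ind xs x * cos (l x)) * sin (t * Y h x) \<partial>M) = 0" for t
      proof -
        have "(\<integral>x. (W x * ind xs x * cos (l x)) * sin (t * Y h x) \<partial>M)
          = (\<integral>x. 1/2 * (W x * ind xs x * sin (l x + t * Y h x)) - 1/2 * (W x * ind xs x * sin (l x - t * Y h x)) \<partial>M)"
          by (rule Bochner_Integration.integral_cong) (auto simp: sin_add sin_diff algebra_simps)
        also have "\<dots> = 0" using IH pm i by (subst Bochner_Integration.integral_diff) auto
        finally show ?thesis .
      qed
      have sc: "(\<integral>x. (W x * ind xs x * sin (l x)) * cos (t * Y h x) \<partial>M) = 0" for t
      proof -
        have "(\<integral>x. (W x * ind xs x * sin (l x)) * cos (t * Y h x) \<partial>M)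
          = (\<integral>x. 1/2 * (W x * ind xs x * sin (l x + t * Y h x)) + 1/2 * (W x * ind xs x * sin (l x - t * Y h x)) \<partial>M)"
          by (rule Bochner_Integration.integral_cong) (auto simp: sin_add sin_diff algebra_simps)
        also have "\<dots> = 0" using IH pm i by (subst Bochner_Integration.integral_add) auto
        finally show ?thesis .
      qed
      have ss: "(\<integral>x. (W x * ind xs x * sin (l x)) * sin (t * Y h x) \<partial>M) = 0" for t
      proof -
        have "(\<integral>x. (W x * ind xs x * sin (l x)) * sin (t * Y h x) \<partial>M)
          = (\<integral>x. 1/2 * (W x * ind xs x * cos (l x - t * Y h x)) - 1/2 * (W x * ind xs x * cos (l x + t * Y h x)) \<partial>M)"
          by (rule Bochner_Integration.integral_cong) (auto simp: cos_add cos_diff algebra_simps)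
        also have "\<dots> = 0" using IH pm i by (subst Bochner_Integration.integral_diff) auto
        finally show ?thesis .
      qed
      have "(\<integral>x. (W x * ind xs x * cos (l x)) * indicator B (Y h x) \<partial>M) = 0"
        by (rule char_zero_indicator[OF i Y cc cs B]) auto
      moreover have "(\<integral>x. (W x * ind xs x * sin (l x)) * indicator B (Y h x) \<partial>M) = 0"
        by (rule char_zero_indicator[OF i Y sc ss B]) auto
      ultimately show "(\<integral>x. W x * ind (a # xs) x * cos (l x) \<partial>M) = 0 \<and> (\<integral>x. W x * ind (a # xs) x * sin (l x) \<partial>M) = 0"
        by (simp add: a ind_Cons mult_ac)
    qed
  qed
  \<comment> \<open>Finite intersections of coordinate events: concatenating lists shows stability
    under intersection, lists of length one generate, and a Dynkin argument reaches the whole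
    \<sigma>-algebra.\<close>
  define G where "G = {{x\<in>space M. \<forall>(h, B)\<in>set xs. Y h x \<in> B} | xs. \<forall>(h, B)\<in>set xs. B \<in> sets borel}"
  have GE: "\<exists>xs. A = {x\<in>space M. \<forall>(h, B)\<in>set xs. Y h x \<in> B} \<and> (\<forall>(h, B)\<in>set xs. B \<in> sets borel)" if "A \<in> G" for A
    using that unfolding G_def by blast
  have stable: "Int_stable G"
  proof (rule Int_stableI)
    fix a b assume "a \<in> G" "b \<in> G"
    obtain xs where xs: "a = {x\<in>space M. \<forall>(h, B)\<in>set xs. Y h x \<in> B}" "\<forall>(h, B)\<in>set xs. B \<in> sets borel"
      using GE[OF \<open>a \<in> G\<close>] by blast
    obtain ys where ys: "b = {x\<in>space M. \<forall>(h, B)\<in>set ys. Y h x \<in> B}" "\<forall>(h, B)\<in>set ys. B \<in> sets borel"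
      using GE[OF \<open>b \<in> G\<close>] by blast
    have "a \<inter> b = {x\<in>space M. \<forall>(h, B)\<in>set (xs @ ys). Y h x \<in> B}" "\<forall>(h, B)\<in>set (xs @ ys). B \<in> sets borel"
      using xs ys by auto
    then show "a \<inter> b \<in> G" unfolding G_def by blast
  qed
  have sub: "G \<subseteq> Pow (space M)" unfolding G_def by auto
  have gen: "{Y h -` B \<inter> space M | h B. B \<in> sets borel} \<subseteq> G"
  proof
    fix a assume "a \<in> {Y h -` B \<inter> space M | h B. B \<in> sets borel}"
    then obtain h B where "a = Y h -` B \<inter> space M" "B \<in> sets borel" by blast
    then have "a = {x\<in>space M. \<forall>(h, B)\<in>set [(h, B)]. Y h x \<in> B} \<and> (\<forall>(h, B)\<in>set [(h, B)]. B \<in> sets borel)" by auto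
    then show "a \<in> G" unfolding G_def by blast
  qed
  have GM: "G \<subseteq> sets M"
  proof
    fix a assume "a \<in> G"
    then obtain xs where xs: "a = {x\<in>space M. \<forall>(h, B)\<in>set xs. Y h x \<in> B}" "\<forall>(h, B)\<in>set xs. B \<in> sets borel"
      using GE by blast
    have "{x\<in>space M. ind xs x \<in> {1}} \<in> sets M" using ind_m[OF xs(2)] by measurable
    also have "{x\<in>space M. ind xs x \<in> {1}} = a" by (auto simp: ind_def xs)
    finally show "a \<in> sets M" .
  qed
  have iA: "integrable M (\<lambda>x. W x * indicator A x)" if "A \<in> sets M" for A
    using integrable_mult_indicator[OF that W] by (simp add: mult.commute)
  have A': "A \<in> sigma_sets (space M) G"
    using A sigma_sets_mono'[OF gen] by (auto simp: sets_sigma_of)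
  have sM: "sigma_sets (space M) G \<subseteq> sets M" using GM by (rule sets.sigma_sets_subset)
  show ?thesis
    using stable sub A'
  proof (induction rule: sigma_sets_induct_disjoint)
    case (basic A)
    then obtain xs where xs: "A = {x\<in>space M. \<forall>(h, B)\<in>set xs. Y h x \<in> B}" "\<forall>(h, B)\<in>set xs. B \<in> sets borel"
      using GE by blast
    have "(\<integral>x. W x * indicator A x \<partial>M) = (\<integral>x. W x * ind xs x * cos 0 \<partial>M)"
      by (rule Bochner_Integration.integral_cong) (auto simp: xs ind_def indicator_def)
    also have "\<dots> = 0" using key[OF xs(2)] L(2) by (metis (no_types, lifting) Bochner_Integration.integral_cong)
    finally show ?case .
  next
    case empty
    then show ?case by simp
  next
    case (compl A)
    have A: "A \<in> sets M" using compl sM by blast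
    have "(\<integral>x. W x * indicator (space M - A) x \<partial>M) = (\<integral>x. W x - W x * indicator A x \<partial>M)"
      by (rule Bochner_Integration.integral_cong) (auto simp: indicator_def)
    also have "\<dots> = (\<integral>x. W x \<partial>M)" using W iA[OF A] compl by simp
    also have "\<dots> = 0" using zero(1)[OF L(2)] by simp
    finally show ?case .
  next
    case (union A)
    have A: "A i \<in> sets M" for i using union sM by blast
    have "(\<integral>x\<in>(\<Union>i. A i). W x \<partial>M) = (\<Sum>i. (\<integral>x\<in>A i. W x \<partial>M))"
    proof (rule lebesgue_integral_countable_add)
      show "set_integrable M (\<Union> (range A)) W"
        unfolding set_integrable_def using A by (intro integrable_mult_indicator W) auto
    qed (use A union(1) in \<open>auto simp: disjoint_family_on_def\<close>)
    also have "\<dots> = 0" using union by (simp add: set_lebesgue_integral_def mult.commute)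
    finally show ?case by (simp add: set_lebesgue_integral_def mult.commute)
  qed
qed

section \<open>Independence and Gaussian integration by parts\<close>

text \<open>No decay at infinity is assumed; integrability of \<open>u\<close> replaces it. The
  integral of \<open>u'\<close> over [-b, b] is \<open>u b - u (- b)\<close>, which has a limit, and
  an integrable function with a limit at infinity must have limit 0.\<close>

lemma integral_deriv_eq_zero:
  fixes u u' :: "real \<Rightarrow> real"
  assumes d: "\<And>x. (u has_real_derivative u' x) (at x)" and c: "continuous_on UNIV u'"
    and iu: "integrable lborel u" and iu': "integrable lborel u'"
  shows "(\<integral>x. u' x \<partial>lborel) = 0"
proof (rule ccontr)
  let ?L = "\<integral>x. u' x \<partial>lborel"
  assume L: "?L \<noteq> 0"
  define D where "D = (\<lambda>x. u x - u (- x))"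
  have "((\<lambda>b. \<integral>x. u' x * indicator {-b..b} x \<partial>lborel) \<longlongrightarrow> ?L) at_top"
  proof (rule integral_dominated_convergence_at_top[where w="\<lambda>x. \<bar>u' x\<bar>"])
    show "AE x in lborel. ((\<lambda>b. u' x * indicator {-b..b} x) \<longlongrightarrow> u' x) at_top"
    proof (rule AE_I2)
      fix x
      have "\<forall>\<^sub>F b in at_top. u' x * indicator {-b..b} x = u' x"
        using eventually_ge_at_top[of "\<bar>x\<bar>"] by eventually_elim (auto simp: indicator_def)
      then show "((\<lambda>b. u' x * indicator {-b..b} x) \<longlongrightarrow> u' x) at_top"
        by (rule tendsto_eventually)
    qed
    show "\<forall>\<^sub>F i in at_top. AE x in lborel. norm (u' x * indicat_real {- i..i} x) \<le> \<bar>u' x\<bar>"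
      by (auto simp: indicator_def)
  qed (use iu' in auto)
  moreover have "\<forall>\<^sub>F b in at_top. (\<integral>x. u' x * indicator {-b..b} x \<partial>lborel) = D b"
    using eventually_ge_at_top[of 0]
  proof eventually_elim
    case (elim b)
    show ?case unfolding D_def
      by (rule integral_FTC_Icc_real) (use d c elim in \<open>auto simp: continuous_on_eq_continuous_at\<close>)
  qed
  ultimately have "(D \<longlongrightarrow> ?L) at_top" by (rule Lim_transform_eventually)
  then have "((\<lambda>b. \<bar>D b\<bar>) \<longlongrightarrow> \<bar>?L\<bar>) at_top" by (rule tendsto_rabs)
  then have "\<forall>\<^sub>F b in at_top. \<bar>?L\<bar> / 2 < \<bar>D b\<bar>" using L by (intro order_tendstoD) auto
  then obtain N where N: "\<And>b. b \<ge> N \<Longrightarrow> \<bar>?L\<bar> / 2 < \<bar>D b\<bar>" by (auto simp: eventually_at_top_linorder)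
  have iD: "integrable lborel D"
    unfolding D_def using iu lborel_integrable_real_affine_iff[of "-1" u 0] by simp
  \<comment> \<open>From \<open>N\<close> on, \<open>D\<close> exceeds half of the supposed limit in
    absolute value, so windows of growing length \<open>k\<close> would give it an infinite
    integral.\<close>
  have "\<bar>?L\<bar> / 2 * real k \<le> (\<integral>x. \<bar>D x\<bar> \<partial>lborel)" for k
  proof -
    have "\<bar>?L\<bar> / 2 * real k = (\<integral>x. \<bar>?L\<bar> / 2 * indicator {N..N + real k} x \<partial>lborel)"
      by simp
    also have "\<dots> \<le> (\<integral>x. \<bar>D x\<bar> \<partial>lborel)"
      proof (rule integral_mono)
      show "integrable lborel (\<lambda>x. \<bar>?L\<bar> / 2 * indicator {N..N + real k} x)"
        by (intro integrable_mult_right integrable_real_indicator) auto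
      show "\<bar>?L\<bar> / 2 * indicator {N..N + real k} x \<le> \<bar>D x\<bar>" for x
        using less_imp_le[OF N[of x]] by (simp add: indicator_def)
    qed (use iD in simp)
    finally show ?thesis .
  qed
  moreover obtain k where "(\<integral>x. \<bar>D x\<bar> \<partial>lborel) / (\<bar>?L\<bar> / 2) < real k" using reals_Archimedean2 by blast
  ultimately show False using L by (auto simp: field_simps not_less[symmetric])
qed

text \<open>The derivative of density times \<open>f\<close> is the density times
  \<open>f' x - x * f x\<close>. The hypotheses ask for integrability only, with no growth
  condition, since Fubini's theorem provides nothing more for the slices to which this is
  applied.\<close>

lemma stein_identity_normal:
  fixes f f' :: "real \<Rightarrow> real"
  assumes d: "\<And>x. (f has_real_derivative f' x) (at x)" and c: "continuous_on UNIV f'"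
    and i: "integrable std_normal_distribution f" "integrable std_normal_distribution (\<lambda>x. f x * x)"
      "integrable std_normal_distribution f'"
  shows "(\<integral>x. f' x \<partial>std_normal_distribution) = (\<integral>x. f x * x \<partial>std_normal_distribution)"
proof -
  have cf: "continuous_on UNIV f" using d by (auto intro!: continuous_at_imp_continuous_on DERIV_isCont)
  have [measurable]: "f \<in> borel_measurable borel" "f' \<in> borel_measurable borel"
    using cf c by (auto intro: borel_measurable_continuous_onI)
  have i': "integrable lborel (\<lambda>x. std_normal_density x * f x)"
    "integrable lborel (\<lambda>x. std_normal_density x * (f x * x))"
    "integrable lborel (\<lambda>x. std_normal_density x * f' x)"
    using i by (auto simp: integrable_density)
  have dn: "(std_normal_density has_real_derivative - x * std_normal_density x) (at x)" for x
    unfolding std_normal_density_def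
    by (auto intro!: derivative_eq_intros simp: field_simps)
  have "(\<integral>x. std_normal_density x * f' x - std_normal_density x * (f x * x) \<partial>lborel) = 0"
  proof (rule integral_deriv_eq_zero)
    show "((\<lambda>x. std_normal_density x * f x) has_real_derivative
       std_normal_density x * f' x - std_normal_density x * (f x * x)) (at x)" for x
      by (auto intro!: derivative_eq_intros dn d simp: algebra_simps)
    show "continuous_on UNIV (\<lambda>x. std_normal_density x * f' x - std_normal_density x * (f x * x))"
      unfolding std_normal_density_def by (intro continuous_intros cf c) auto
  qed (use i' in auto)
  then show ?thesis using i' by (simp add: integral_density)
qed

text \<open>The sequence space is not normed, so the chain rule is assembled one coordinate at a
  time. In \<open>P s t\<close> the coordinates below \<open>m\<close> move with \<open>s\<close>
  and coordinate \<open>m\<close> with \<open>t\<close>; continuity of the partial derivatives gives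
  a total derivative in the two real parameters, and restriction to the diagonal
  \<open>s = t\<close> is the induction step.\<close>

lemma has_derivative_along_coordinates:
  fixes f :: "(nat \<Rightarrow> real) \<Rightarrow> real" and f' :: "nat \<Rightarrow> (nat \<Rightarrow> real) \<Rightarrow> real"
  assumes c: "\<And>i. i < n \<Longrightarrow> continuous_on UNIV (f' i)"
    and d: "\<And>i x. i < n \<Longrightarrow> ((\<lambda>t. f (x(i := t))) has_real_derivative f' i x) (at (x i))"
    and m: "m \<le> n"
  shows "((\<lambda>t. f (\<lambda>j. y j + (if j < m then t * a j else 0))) has_real_derivative
    (\<Sum>i<m. f' i (\<lambda>j. y j + (if j < m then t * a j else 0)) * a i)) (at t)"
  using m
proof (induction m arbitrary: y t)
  case 0
  then show ?case by simp
next
  case (Suc m)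
  define P where "P = (\<lambda>s t j. y j + (if j < m then s * a j else 0) + (if j = m then t * a m else 0))"
  have cP: "continuous_on UNIV (\<lambda>(s, t). P s t)"
    unfolding P_def case_prod_beta
    proof (rule continuous_on_coordinatewise_then_product)
    fix i
    show "continuous_on UNIV (\<lambda>x. y i + (if i < m then fst x * a i else 0) + (if i = m then snd x * a m else 0))"
      by (cases "i < m"; cases "i = m") (auto intro!: continuous_intros)
  qed
  have m: "m < n" using Suc by simp
  have bl: "blinfun_apply (blinfun_scaleR_left c) = (*) c" for c :: real
    by (auto simp: fun_eq_iff blinfun_scaleR_left.rep_eq)
  have fx: "((\<lambda>s. f (P s t)) has_derivative (*) (\<Sum>i<m. f' i (P t t) * a i)) (at t)"
  proof -
    have "P s t = (\<lambda>j. (y(m := y m + t * a m)) j + (if j < m then s * a j else 0))" for s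
      by (auto simp: P_def)
    then show ?thesis
      using Suc.IH[of "y(m := y m + t * a m)" t] m unfolding has_field_derivative_def by simp
  qed
  have fy: "((\<lambda>t. f (P s t)) has_derivative blinfun_apply (blinfun_scaleR_left (f' m (P s t) * a m))) (at t)" for s t
  proof -
    have eq: "P s t' = (P s t)(m := y m + t' * a m)" for t' by (auto simp: P_def)
    have "((\<lambda>r. f ((P s t)(m := r))) has_real_derivative f' m (P s t)) (at (y m + t * a m))"
      using d[OF m, of "P s t"] by (simp add: P_def)
    then have "((\<lambda>t'. f ((P s t)(m := y m + t' * a m))) has_real_derivative f' m (P s t) * a m) (at t)"
      by (rule DERIV_chain'[rotated]) (auto intro!: derivative_eq_intros)
    moreover have "(\<lambda>t'. f (P s t')) = (\<lambda>t'. f ((P s t)(m := y m + t' * a m)))"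
      by (intro ext arg_cong[where f=f] eq)
    ultimately show ?thesis by (simp only: bl has_field_derivative_def)
  qed
  have cont: "continuous (at (t, t) within UNIV \<times> UNIV) (\<lambda>(x, y). blinfun_scaleR_left (f' m (P x y) * a m) :: real \<Rightarrow>\<^sub>L real)"
  proof -
    have "continuous_on UNIV (\<lambda>(s, t). f' m (P s t))"
      using continuous_on_compose2[OF c[OF m] cP] by (simp add: case_prod_beta')
    then have "continuous_on UNIV (\<lambda>(s, t). blinfun_scaleR_left (f' m (P s t) * a m) :: real \<Rightarrow>\<^sub>L real)"
      unfolding case_prod_beta
      by (intro bounded_linear.continuous_on[OF bounded_linear_blinfun_scaleR_left] continuous_on_mult_right)
    then show ?thesis
      by (simp add: continuous_on_eq_continuous_at)
  qed
  have "((\<lambda>(s, t). f (P s t)) has_derivative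
     (\<lambda>(tx, ty). (\<Sum>i<m. f' i (P t t) * a i) * tx + blinfun_apply (blinfun_scaleR_left (f' m (P t t) * a m)) ty))
     (at (t, t) within UNIV \<times> UNIV)"
    by (rule has_derivative_partialsI[where fy="\<lambda>s t. blinfun_scaleR_left (f' m (P s t) * a m)"])
      (use fx fy cont in \<open>simp_all add: continuous_within\<close>)
  then have D: "((\<lambda>(s, t). f (P s t)) has_derivative
     (\<lambda>(tx, ty). (\<Sum>i<m. f' i (P t t) * a i) * tx + f' m (P t t) * a m * ty)) (at (t, t))"
    by (simp only: bl UNIV_Times_UNIV)
  have "((\<lambda>r. (\<lambda>(s, t). f (P s t)) (r, r)) has_derivative
      (\<lambda>r. (\<lambda>(tx, ty). (\<Sum>i<m. f' i (P t t) * a i) * tx + f' m (P t t) * a m * ty) (r, r))) (at t)"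
    by (rule has_derivative_compose[of "\<lambda>r. (r, r)", OF _ D]) (auto intro!: derivative_eq_intros)
  moreover have "(\<lambda>r. (\<lambda>(tx, ty). (\<Sum>i<m. f' i (P t t) * a i) * tx + f' m (P t t) * a m * ty) (r, r))
      = (*) (\<Sum>i<Suc m. f' i (P t t) * a i)"
    by (simp add: fun_eq_iff algebra_simps)
  ultimately have "((\<lambda>r. f (P r r)) has_real_derivative (\<Sum>i<Suc m. f' i (P t t) * a i)) (at t)"
    unfolding has_field_derivative_def by simp
  moreover have "P r r = (\<lambda>j. y j + (if j < Suc m then r * a j else 0))" for r
    by (auto simp: P_def less_Suc_eq)
  ultimately show ?case by simp
qed

lemma has_derivative_along_line:
  fixes f :: "(nat \<Rightarrow> real) \<Rightarrow> real"
  assumes c: "\<And>i. i < n \<Longrightarrow> continuous_on UNIV (f' i)"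
    and d: "\<And>i x. i < n \<Longrightarrow> ((\<lambda>t. f (x(i := t))) has_real_derivative f' i x) (at (x i))"
    and dep: "depends_on_first n f" "\<And>i. i < n \<Longrightarrow> depends_on_first n (f' i)"
  shows "((\<lambda>t. f (\<lambda>j. y j + t * a j)) has_real_derivative
    (\<Sum>i<n. f' i (\<lambda>j. y j + t * a j) * a i)) (at t)"
proof -
  have "f (\<lambda>j. y j + (if j < n then t * a j else 0)) = f (\<lambda>j. y j + t * a j)" for t
    using dep(1) unfolding depends_on_first_def by auto
  moreover have "f' i (\<lambda>j. y j + (if j < n then t * a j else 0)) = f' i (\<lambda>j. y j + t * a j)" if "i < n" for i
    using dep(2)[OF that] unfolding depends_on_first_def by auto
  ultimately show ?thesis
    using has_derivative_along_coordinates[of n f' f n y a t, OF c d] by simp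
qed

context prob_space
begin

lemma char_distr:
  assumes [measurable]: "Y \<in> borel_measurable M"
  shows "char (distr M borel Y) t = complex_of_real (\<integral>x. cos (t * Y x) \<partial>M) + \<i> * complex_of_real (\<integral>x. sin (t * Y x) \<partial>M)"
  using char_distr_density(2)[of "\<lambda>_. 1" Y 1 t] by (simp add: density_1 prob_space)

end

section \<open>Linearity, Gaussian laws and independence of orthogonal directions\<close>

context isonormal_process
begin

lemma gaussian_X: "gaussian_rv M (X h)"
  using gaussian[unfolded gaussian_family_def, rule_format, of "{h}" "\<lambda>_. 1"] by simp

lemma X_measurable [measurable]: "X h \<in> borel_measurable M"
  using gaussian_X[of h] by (simp add: gaussian_rv_def)

lemma X_distr_cases:
  obtains (normal) \<mu> \<sigma> where "\<sigma> > 0" "distributed M lborel (X h) (normal_density \<mu> \<sigma>)"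
  | (const) \<mu> where "AE \<omega> in M. X h \<omega> = \<mu>"
  using gaussian_X[of h] by (auto simp: gaussian_rv_def)

lemma X_sq_int: "sq_int M (X h)"
proof (cases rule: X_distr_cases[of h])
  case (normal \<mu> \<sigma>)
  have "integrable lborel (\<lambda>x. normal_density \<mu> \<sigma> x * (x - \<mu>)\<^sup>2)"
    by (rule integrable_normal_moment[OF normal(1)])
  then have "integrable M (\<lambda>\<omega>. (X h \<omega> - \<mu>)\<^sup>2)"
    using distributed_integrable[OF normal(2), of "\<lambda>x. (x - \<mu>)\<^sup>2"] by simp
  then have "sq_int M (\<lambda>\<omega>. X h \<omega> - \<mu>)" by (simp add: sq_int_real)
  from sq_int_add[OF this sq_int_const[of \<mu>]] show ?thesis by simp
next
  case (const \<mu>)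
  have "AE \<omega> in M. \<mu> = X h \<omega>" using const by auto
  from sq_int_AE_cong[OF sq_int_const _ this] show ?thesis by simp
qed

text \<open>Linearity is not part of the locale but follows from the covariance: the second moment
  of the difference expands to the squared norm of a zero vector. It holds only almost surely, with
  a null set that depends on the vectors.\<close>

lemma X_add_scale: "AE \<omega> in M. X (h + c *\<^sub>R g) \<omega> = X h \<omega> + c * X g \<omega>"
proof -
  let ?k = "h + c *\<^sub>R g"
  have i: "integrable M (\<lambda>\<omega>. X a \<omega> * X b \<omega>)" for a b by (rule sq_int_mult[OF X_sq_int X_sq_int])
  have "(\<integral>\<omega>. (X ?k \<omega> - X h \<omega> - c * X g \<omega>)\<^sup>2 \<partial>M) =
    (\<integral>\<omega>. X ?k \<omega> * X ?k \<omega> + X h \<omega> * X h \<omega> + c\<^sup>2 * (X g \<omega> * X g \<omega>)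
      - 2 * (X ?k \<omega> * X h \<omega>) - (2 * c) * (X ?k \<omega> * X g \<omega>) + (2 * c) * (X h \<omega> * X g \<omega>) \<partial>M)"
    by (rule Bochner_Integration.integral_cong) (auto simp: power2_eq_square algebra_simps)
  also have "\<dots> = inner ?k ?k + inner h h + c\<^sup>2 * inner g g - 2 * inner ?k h - (2 * c) * inner ?k g + (2 * c) * inner h g"
    using i by (simp add: covariance)
  also have "\<dots> = 0"
    by (simp add: inner_add_left inner_add_right inner_commute power2_eq_square algebra_simps)
  finally have "(\<integral>\<omega>. (X ?k \<omega> - X h \<omega> - c * X g \<omega>)\<^sup>2 \<partial>M) = 0" .
  moreover have "integrable M (\<lambda>\<omega>. (X ?k \<omega> - X h \<omega> - c * X g \<omega>)\<^sup>2)"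
    using sq_int_diff[OF sq_int_diff[OF X_sq_int X_sq_int] sq_int_cmult[OF X_sq_int]] by (simp only: sq_int_real)
  ultimately have "AE \<omega> in M. (X ?k \<omega> - X h \<omega> - c * X g \<omega>)\<^sup>2 = 0"
    by (subst (asm) integral_nonneg_eq_0_iff_AE) auto
  then show ?thesis by eventually_elim auto
qed

lemma X_zero: "AE \<omega> in M. X 0 \<omega> = 0"
  using X_add_scale[of 0 1 0] by eventually_elim simp

lemma X_scale: "AE \<omega> in M. X (c *\<^sub>R g) \<omega> = c * X g \<omega>"
  using X_add_scale[of 0 c g] X_zero by eventually_elim simp

lemma distr_X_unit:
  assumes u: "norm u = 1" shows "distr M borel (X u) = std_normal_distribution"
proof (cases rule: X_distr_cases[of u])
  case (normal \<mu> \<sigma>)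
  have "\<mu> = 0" using normal_distributed_expectation[OF normal] by (simp add: centered)
  moreover have "\<sigma>\<^sup>2 = 1" using normal_distributed_variance[OF normal] u
    by (simp add: centered power2_eq_square covariance norm_eq_1)
  then have "\<sigma> = 1" using normal(1) by (simp add: power2_eq_1_iff)
  ultimately have "distributed M lborel (X u) std_normal_density" using normal by simp
  then have "distr M lborel (X u) = std_normal_distribution" by (simp add: distributed_def)
  moreover have "distr M borel (X u) = distr M lborel (X u)" by (rule distr_cong) auto
  ultimately show ?thesis by simp
next
  \<comment> \<open>Excluded: a constant of mean 0 has variance 0, while the variance is the squared
    norm of \<open>u\<close>, which is 1.\<close>
  case (const \<mu>)
  have "(\<integral>\<omega>. X u \<omega> \<partial>M) = \<mu>" using const by (subst integral_cong_AE[where g="\<lambda>_. \<mu>"]) (auto simp: prob_space)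
  then have "AE \<omega> in M. X u \<omega> * X u \<omega> = 0" using const by (auto simp: centered)
  then have "inner u u = 0" unfolding covariance[symmetric] by (rule integral_eq_zero_AE)
  then show ?thesis using u by simp
qed

lemma expectation_cos_sin_unit:
  assumes u: "norm u = 1"
  shows "expectation (\<lambda>\<omega>. cos (t * X u \<omega>)) = exp (- t\<^sup>2 / 2)" "expectation (\<lambda>\<omega>. sin (t * X u \<omega>)) = 0"
  using char_distr[OF X_measurable, of u t] unfolding distr_X_unit[OF u] char_std_normal_distribution
  by (auto simp: complex_eq_iff)

lemma expectation_cos_sin:
  "expectation (\<lambda>\<omega>. cos (X h \<omega>)) = exp (- (norm h)\<^sup>2 / 2)" "expectation (\<lambda>\<omega>. sin (X h \<omega>)) = 0"
proof -
  have "expectation (\<lambda>\<omega>. cos (X h \<omega>)) = exp (- (norm h)\<^sup>2 / 2) \<and> expectation (\<lambda>\<omega>. sin (X h \<omega>)) = 0"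
  proof (cases "h = 0")
    case True
    have "expectation (\<lambda>\<omega>. cos (X h \<omega>)) = expectation (\<lambda>\<omega>. 1)" "expectation (\<lambda>\<omega>. sin (X h \<omega>)) = expectation (\<lambda>\<omega>. 0)"
      by (rule integral_cong_AE; use X_zero True in \<open>auto elim!: eventually_mono\<close>)+
    then show ?thesis using True by (simp add: prob_space)
  next
    case False
    define u where "u = h /\<^sub>R norm h"
    have u: "norm u = 1" using False by (simp add: u_def)
    have h: "h = norm h *\<^sub>R u" using False by (simp add: u_def)
    have "AE \<omega> in M. X h \<omega> = norm h * X u \<omega>" using X_scale[of "norm h" u] h by simp
    then have "expectation (\<lambda>\<omega>. cos (X h \<omega>)) = expectation (\<lambda>\<omega>. cos (norm h * X u \<omega>))"
      "expectation (\<lambda>\<omega>. sin (X h \<omega>)) = expectation (\<lambda>\<omega>. sin (norm h * X u \<omega>))"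
      by (auto intro!: integral_cong_AE)
    then show ?thesis using expectation_cos_sin_unit[OF u, of "norm h"] by simp
  qed
  then show "expectation (\<lambda>\<omega>. cos (X h \<omega>)) = exp (- (norm h)\<^sup>2 / 2)" "expectation (\<lambda>\<omega>. sin (X h \<omega>)) = 0"
    by auto
qed

lemma integrable_bounded: 
  fixes W :: "'w \<Rightarrow> real"
  assumes "W \<in> borel_measurable M" "\<And>x. \<bar>W x\<bar> \<le> C" shows "integrable M W"
  using assms by (intro integrable_const_bound[where B=C]) auto

text \<open>By Pythagoras the squared norm of \<open>\<psi> + t *\<^sub>R u\<close> is a sum, so the
  characteristic function of the pair factorises in \<open>t\<close>. The centered weights
  \<open>cos (X \<psi> \<omega>)\<close> and \<open>sin (X \<psi> \<omega>)\<close>, minus their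
  means, thus have vanishing transform against \<open>X u\<close>, and
  \<open>char_zero_indicator\<close> applies.\<close>

lemma indicator_X_independent_trig:
  assumes u: "norm u = 1" and \<psi>: "inner \<psi> u = 0" and B [measurable]: "B \<in> sets borel"
  shows "expectation (\<lambda>\<omega>. indicator B (X u \<omega>) * cos (X \<psi> \<omega>)) = prob (X u -` B \<inter> space M) * expectation (\<lambda>\<omega>. cos (X \<psi> \<omega>))"
    "expectation (\<lambda>\<omega>. indicator B (X u \<omega>) * sin (X \<psi> \<omega>)) = prob (X u -` B \<inter> space M) * expectation (\<lambda>\<omega>. sin (X \<psi> \<omega>))"
proof -
  have iu: "inner u u = 1" using u by (simp add: norm_eq_1)
  have n: "(norm (\<psi> + t *\<^sub>R u))\<^sup>2 = (norm \<psi>)\<^sup>2 + t\<^sup>2" for t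
    proof -
    have "inner u \<psi> = 0" using \<psi> by (simp add: inner_commute)
    then have "inner (\<psi> + t *\<^sub>R u) (\<psi> + t *\<^sub>R u) = inner \<psi> \<psi> + t * t"
      using \<psi> iu by (simp add: inner_add_left inner_add_right)
    then show ?thesis unfolding power2_norm_eq_inner power2_eq_square[of t] .
  qed
  have shift: "AE \<omega> in M. X (\<psi> + t *\<^sub>R u) \<omega> = X \<psi> \<omega> + t * X u \<omega>" for t by (rule X_add_scale)
  have C: "expectation (\<lambda>\<omega>. cos (X \<psi> \<omega> + t * X u \<omega>)) = exp (- ((norm \<psi>)\<^sup>2 + t\<^sup>2) / 2)"
    and S: "expectation (\<lambda>\<omega>. sin (X \<psi> \<omega> + t * X u \<omega>)) = 0" for t
  proof -
    have "expectation (\<lambda>\<omega>. cos (X \<psi> \<omega> + t * X u \<omega>)) = expectation (\<lambda>\<omega>. cos (X (\<psi> + t *\<^sub>R u) \<omega>))"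
      "expectation (\<lambda>\<omega>. sin (X \<psi> \<omega> + t * X u \<omega>)) = expectation (\<lambda>\<omega>. sin (X (\<psi> + t *\<^sub>R u) \<omega>))"
      by (rule integral_cong_AE; use shift[of t] in \<open>auto elim!: eventually_mono\<close>)+
    then show "expectation (\<lambda>\<omega>. cos (X \<psi> \<omega> + t * X u \<omega>)) = exp (- ((norm \<psi>)\<^sup>2 + t\<^sup>2) / 2)"
      "expectation (\<lambda>\<omega>. sin (X \<psi> \<omega> + t * X u \<omega>)) = 0"
      using expectation_cos_sin[of "\<psi> + t *\<^sub>R u"] by (simp_all only: n)
  qed
  have i: "integrable M (\<lambda>\<omega>. cos (X \<psi> \<omega> + t * X u \<omega>))" "integrable M (\<lambda>\<omega>. sin (X \<psi> \<omega> + t * X u \<omega>))"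
    "integrable M (\<lambda>\<omega>. cos (t * X u \<omega>))" "integrable M (\<lambda>\<omega>. sin (t * X u \<omega>))" for t
    by (rule integrable_bounded[where C=1]; simp)+
  have i2: "integrable M (\<lambda>\<omega>. cos (X \<psi> \<omega>) * cos (t * X u \<omega>))" "integrable M (\<lambda>\<omega>. cos (X \<psi> \<omega>) * sin (t * X u \<omega>))"
    "integrable M (\<lambda>\<omega>. sin (X \<psi> \<omega>) * cos (t * X u \<omega>))" "integrable M (\<lambda>\<omega>. sin (X \<psi> \<omega>) * sin (t * X u \<omega>))" for t
    by (rule integrable_bounded[where C="1 * 1"], simp, simp only: abs_mult, intro mult_mono, auto)+
  have cc: "expectation (\<lambda>\<omega>. cos (X \<psi> \<omega>) * cos (t * X u \<omega>)) = exp (- (norm \<psi>)\<^sup>2 / 2) * exp (- t\<^sup>2 / 2)" for t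
  proof -
    have "expectation (\<lambda>\<omega>. cos (X \<psi> \<omega>) * cos (t * X u \<omega>)) =
      expectation (\<lambda>\<omega>. 1/2 * cos (X \<psi> \<omega> + t * X u \<omega>) + 1/2 * cos (X \<psi> \<omega> + (-t) * X u \<omega>))"
      by (rule Bochner_Integration.integral_cong) (auto simp: cos_add cos_diff field_simps)
    also have "\<dots> = exp (- ((norm \<psi>)\<^sup>2 + t\<^sup>2) / 2)"
      by (subst Bochner_Integration.integral_add) (use i[of t] i[of "-t"] C[of t] C[of "-t"] in auto)
    also have "\<dots> = exp (- (norm \<psi>)\<^sup>2 / 2) * exp (- t\<^sup>2 / 2)"
      by (simp add: exp_add[symmetric] field_simps)
    finally show ?thesis .
  qed
  have cs: "expectation (\<lambda>\<omega>. cos (X \<psi> \<omega>) * sin (t * X u \<omega>)) = 0" for t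
  proof -
    have "expectation (\<lambda>\<omega>. cos (X \<psi> \<omega>) * sin (t * X u \<omega>)) =
      expectation (\<lambda>\<omega>. 1/2 * sin (X \<psi> \<omega> + t * X u \<omega>) - 1/2 * sin (X \<psi> \<omega> + (-t) * X u \<omega>))"
      by (rule Bochner_Integration.integral_cong) (auto simp: sin_add sin_diff field_simps)
    also have "\<dots> = 0"
      by (subst Bochner_Integration.integral_diff) (use i[of t] i[of "-t"] S[of t] S[of "-t"] in auto)
    finally show ?thesis .
  qed
  have sc: "expectation (\<lambda>\<omega>. sin (X \<psi> \<omega>) * cos (t * X u \<omega>)) = 0" for t
  proof -
    have "expectation (\<lambda>\<omega>. sin (X \<psi> \<omega>) * cos (t * X u \<omega>)) =
      expectation (\<lambda>\<omega>. 1/2 * sin (X \<psi> \<omega> + t * X u \<omega>) + 1/2 * sin (X \<psi> \<omega> + (-t) * X u \<omega>))"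
      by (rule Bochner_Integration.integral_cong) (auto simp: sin_add sin_diff field_simps)
    also have "\<dots> = 0"
      by (subst Bochner_Integration.integral_add) (use i[of t] i[of "-t"] S[of t] S[of "-t"] in auto)
    finally show ?thesis .
  qed
  have ss: "expectation (\<lambda>\<omega>. sin (X \<psi> \<omega>) * sin (t * X u \<omega>)) = 0" for t
  proof -
    have "expectation (\<lambda>\<omega>. sin (X \<psi> \<omega>) * sin (t * X u \<omega>)) =
      expectation (\<lambda>\<omega>. 1/2 * cos (X \<psi> \<omega> + (-t) * X u \<omega>) - 1/2 * cos (X \<psi> \<omega> + t * X u \<omega>))"
      by (rule Bochner_Integration.integral_cong) (auto simp: cos_add cos_diff field_simps)
    also have "\<dots> = 0"
      by (subst Bochner_Integration.integral_diff) (use i[of t] i[of "-t"] C[of t] C[of "-t"] in auto)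
    finally show ?thesis .
  qed
  have e: "expectation (\<lambda>\<omega>. indicator B (X u \<omega>)) = prob (X u -` B \<inter> space M)"
  proof -
    have "expectation (\<lambda>\<omega>. indicator B (X u \<omega>)) = (expectation (indicator (X u -` B \<inter> space M)) :: real)"
      by (rule Bochner_Integration.integral_cong) (auto simp: indicator_def)
    then show ?thesis by simp
  qed
  have iB: "integrable M (\<lambda>\<omega>. w \<omega> * indicator B (X u \<omega>))" if "w \<in> borel_measurable M" "\<And>x. \<bar>w x\<bar> \<le> 1" for w :: "'w \<Rightarrow> real"
    by (rule integrable_bounded[where C=1]) (use that in \<open>auto simp: indicator_def\<close>)
  have iB1: "integrable M (\<lambda>\<omega>. indicator B (X u \<omega>) :: real)"
    by (rule integrable_bounded[where C=1]) (auto simp: indicator_def)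
  have z: "expectation (\<lambda>\<omega>. (w \<omega> - c) * indicator B (X u \<omega>)) = 0 \<Longrightarrow> w \<in> borel_measurable M \<Longrightarrow> (\<And>x. \<bar>w x\<bar> \<le> 1) \<Longrightarrow>
     expectation (\<lambda>\<omega>. indicator B (X u \<omega>) * w \<omega>) = prob (X u -` B \<inter> space M) * c" for w :: "'w \<Rightarrow> real" and c
    using iB[of w] iB1 e by (simp add: left_diff_distrib mult.commute)
  note Z = expectation_cos_sin[of \<psi>] expectation_cos_sin_unit[OF u]
  show "expectation (\<lambda>\<omega>. indicator B (X u \<omega>) * cos (X \<psi> \<omega>)) = prob (X u -` B \<inter> space M) * expectation (\<lambda>\<omega>. cos (X \<psi> \<omega>))"
  proof (rule z)
    show "expectation (\<lambda>\<omega>. (cos (X \<psi> \<omega>) - expectation (\<lambda>\<omega>. cos (X \<psi> \<omega>))) * indicator B (X u \<omega>)) = 0"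
      by (rule char_zero_indicator) (use i i2 i[of 0] Z cc cs in \<open>auto simp: left_diff_distrib prob_space\<close>)
  qed auto
  show "expectation (\<lambda>\<omega>. indicator B (X u \<omega>) * sin (X \<psi> \<omega>)) = prob (X u -` B \<inter> space M) * expectation (\<lambda>\<omega>. sin (X \<psi> \<omega>))"
  proof (rule z)
    show "expectation (\<lambda>\<omega>. (sin (X \<psi> \<omega>) - expectation (\<lambda>\<omega>. sin (X \<psi> \<omega>))) * indicator B (X u \<omega>)) = 0"
      by (rule char_zero_indicator) (use i i2 i[of 0] Z sc ss in \<open>auto simp: left_diff_distrib prob_space\<close>)
  qed auto
qed

text \<open>The whole process projected onto the orthogonal complement of \<open>u\<close>, kept as
  one random element of a product space. Almost surely each \<open>X g\<close> is a function of it
  and of the single Gaussian \<open>X u\<close>.\<close>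

definition orth :: "'h \<Rightarrow> 'w \<Rightarrow> 'h \<Rightarrow> real" where
  "orth u \<omega> g = X (g - inner g u *\<^sub>R u) \<omega>"

lemma orth_measurable [measurable]: "orth u \<in> measurable M (PiM UNIV (\<lambda>_. borel))"
  unfolding orth_def by (rule measurable_PiM_single') auto

lemma X_decompose: "AE \<omega> in M. X g \<omega> = inner g u * X u \<omega> + orth u \<omega> g"
  using X_add_scale[of "g - inner g u *\<^sub>R u" "inner g u" u] by (simp add: orth_def add.commute)

lemma orth_measurable_sigma:
  "orth u \<in> measurable (sigma_of M (\<lambda>g. X (g - inner g u *\<^sub>R u))) (PiM UNIV (\<lambda>_. borel))"
  unfolding orth_def
proof (rule measurable_PiM_single')
  fix i :: 'h
  show "X (i - inner i u *\<^sub>R u) \<in> borel_measurable (sigma_of M (\<lambda>g. X (g - inner g u *\<^sub>R u)))"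
    by (rule measurable_sigma_of[of "\<lambda>g. X (g - inner g u *\<^sub>R u)"])
qed auto

text \<open>Independence of \<open>orth u\<close> and \<open>X u\<close>, stated as an equality of
  laws because Fubini's theorem uses it in this form. For fixed \<open>B\<close> the centered
  indicator of the event that \<open>X u\<close> lies in \<open>B\<close> is orthogonal to all
  trigonometric functions of \<open>X \<psi>\<close> with \<open>\<psi>\<close> orthogonal to
  \<open>u\<close>; \<open>char_zero_sigma_of\<close> extends this to every event of
  \<open>orth u\<close>.\<close>

lemma distr_orth_X:
  assumes u: "norm u = 1"
  shows "distr M (PiM UNIV (\<lambda>_. borel) \<Otimes>\<^sub>M borel) (\<lambda>\<omega>. (orth u \<omega>, X u \<omega>)) =
    distr M (PiM UNIV (\<lambda>_. borel)) (orth u) \<Otimes>\<^sub>M std_normal_distribution"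
proof (rule sym, rule pair_measure_eqI)
  interpret N: real_distribution std_normal_distribution by (rule real_dist_normal_dist)
  show "sigma_finite_measure std_normal_distribution" by unfold_locales
  interpret Y: prob_space "distr M (PiM UNIV (\<lambda>_. borel)) (orth u)" by (rule prob_space_distr) simp
  show "sigma_finite_measure (distr M (PiM UNIV (\<lambda>_. borel)) (orth u))" by unfold_locales
  show "sets (distr M (PiM UNIV (\<lambda>_. borel)) (orth u) \<Otimes>\<^sub>M std_normal_distribution) =
    sets (distr M (PiM UNIV (\<lambda>_. borel) \<Otimes>\<^sub>M borel) (\<lambda>\<omega>. (orth u \<omega>, X u \<omega>)))"
    by (auto intro!: sets_pair_measure_cong)
  fix A B assume "A \<in> sets (distr M (PiM UNIV (\<lambda>_. borel)) (orth u))" "B \<in> sets std_normal_distribution"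
  then have A [measurable]: "A \<in> sets (PiM UNIV (\<lambda>_. borel))" and B [measurable]: "B \<in> sets borel" by auto
  let ?P = "\<lambda>g. g - inner g u *\<^sub>R u"
  have iu: "inner u u = 1" using u by (simp add: norm_eq_1)
  let ?A = "orth u -` A \<inter> space M" and ?B = "X u -` B \<inter> space M"
  have AS: "?A \<in> sets (sigma_of M (\<lambda>g. X (?P g)))"
    using measurable_sets[OF orth_measurable_sigma A] by simp
  define W :: "'w \<Rightarrow> real" where "W = (\<lambda>\<omega>. indicator B (X u \<omega>) - prob ?B)"
  \<comment> \<open>Sums of variables of the process agree with a variable of the process only
    almost surely, so the class of phases has to be closed under almost sure equality.\<close>
  define L where "L = {l \<in> borel_measurable M. \<exists>\<psi>. inner \<psi> u = 0 \<and> (AE \<omega> in M. l \<omega> = X \<psi> \<omega>)}"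
  have iB: "integrable M (\<lambda>\<omega>. indicator B (X u \<omega>) * w \<omega>)" if "w \<in> borel_measurable M" "\<And>x. \<bar>w x\<bar> \<le> 1" for w :: "'w \<Rightarrow> real"
    by (rule integrable_bounded[where C=1]) (use that in \<open>auto simp: indicator_def\<close>)
  have iw: "integrable M w" if "w \<in> borel_measurable M" "\<And>x. \<bar>w x\<bar> \<le> 1" for w :: "'w \<Rightarrow> real"
    by (rule integrable_bounded[where C=1]) (use that in auto)
  have W: "expectation (\<lambda>\<omega>. W \<omega> * w \<omega>) = expectation (\<lambda>\<omega>. indicator B (X u \<omega>) * w \<omega>) - prob ?B * expectation w"
    if "w \<in> borel_measurable M" "\<And>x. \<bar>w x\<bar> \<le> 1" for w :: "'w \<Rightarrow> real"
    unfolding W_def using iB[OF that] iw[OF that] by (simp add: left_diff_distrib)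
  have "expectation (\<lambda>\<omega>. W \<omega> * indicator ?A \<omega>) = 0"
  proof (rule char_zero_sigma_of[of W "\<lambda>g. X (?P g)" L, OF _ _ _ _ _ _ _ AS])
    show "integrable M W" unfolding W_def
      by (rule integrable_bounded[where C=2])
        (use prob_le_1[of ?B] measure_nonneg[of M ?B] in \<open>auto simp: indicator_def abs_if simp del: prob_le_1 measure_nonneg\<close>)
    show "(\<lambda>x. 0) \<in> L" unfolding L_def using X_zero by (auto intro!: exI[of _ 0])
    show "(\<lambda>x. l x + c * X (?P h) x) \<in> L" if lL: "l \<in> L" for l h c
    proof -
      obtain \<psi> where \<psi>: "inner \<psi> u = 0" "AE \<omega> in M. l \<omega> = X \<psi> \<omega>" using lL unfolding L_def by blast
      have "AE \<omega> in M. l \<omega> + c * X (?P h) \<omega> = X (\<psi> + c *\<^sub>R ?P h) \<omega>"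
        using \<psi>(2) X_add_scale[of \<psi> c "?P h"] by eventually_elim simp
      moreover have "inner (\<psi> + c *\<^sub>R ?P h) u = 0"
        using \<psi> iu by (simp add: inner_add_left inner_diff_left)
      ultimately show ?thesis using lL unfolding L_def by (auto intro!: exI[of _ "\<psi> + c *\<^sub>R ?P h"])
    qed
    fix l assume "l \<in> L"
    then obtain \<psi> where l [measurable]: "l \<in> borel_measurable M" and \<psi>: "inner \<psi> u = 0" "AE \<omega> in M. l \<omega> = X \<psi> \<omega>"
      unfolding L_def by blast
    show "l \<in> borel_measurable M" by fact
    have [measurable]: "W \<in> borel_measurable M" unfolding W_def by simp
    have "expectation (\<lambda>\<omega>. W \<omega> * cos (l \<omega>)) = expectation (\<lambda>\<omega>. W \<omega> * cos (X \<psi> \<omega>))"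
      "expectation (\<lambda>\<omega>. W \<omega> * sin (l \<omega>)) = expectation (\<lambda>\<omega>. W \<omega> * sin (X \<psi> \<omega>))"
      using \<psi>(2) by (auto intro!: integral_cong_AE)
    then show "expectation (\<lambda>\<omega>. W \<omega> * cos (l \<omega>)) = 0" "expectation (\<lambda>\<omega>. W \<omega> * sin (l \<omega>)) = 0"
      using W indicator_X_independent_trig[OF u \<psi>(1) B] by auto
  qed (auto simp: L_def)
  then have "expectation (\<lambda>\<omega>. indicator B (X u \<omega>) * indicator ?A \<omega>) = prob ?B * prob ?A"
    using W[of "indicator ?A"] by (auto simp: indicator_def)
  also have "expectation (\<lambda>\<omega>. indicator B (X u \<omega>) * indicator ?A \<omega>) = (expectation (indicator (?A \<inter> ?B)) :: real)"
    by (rule Bochner_Integration.integral_cong) (auto simp: indicator_def)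
  finally have "prob (?A \<inter> ?B) = prob ?A * prob ?B" by simp
  moreover have "emeasure std_normal_distribution B = emeasure M ?B"
    unfolding distr_X_unit[OF u, symmetric] by (rule emeasure_distr) auto
  ultimately show "emeasure (distr M (PiM UNIV (\<lambda>_. borel)) (orth u)) A * emeasure std_normal_distribution B
      = emeasure (distr M (PiM UNIV (\<lambda>_. borel) \<Otimes>\<^sub>M borel) (\<lambda>\<omega>. (orth u \<omega>, X u \<omega>))) (A \<times> B)"
    by (simp add: emeasure_distr emeasure_eq_measure ennreal_mult[symmetric] vimage_Times Int_ac)
      (simp add: o_def Int_ac)
qed

end

section \<open>Differentiation along one Gaussian direction\<close>

context isonormal_process
begin

text \<open>Differentiability in the direction of a unit vector \<open>u\<close>: the variable is a function of
  \<open>X u\<close> and of the coordinates \<open>orth u\<close>, which are independent of \<open>X u\<close>, and it is continuously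
  differentiable in the former.\<close>

definition dir_deriv :: "'h \<Rightarrow> ('w \<Rightarrow> real) \<Rightarrow> ('w \<Rightarrow> real) \<Rightarrow> bool" where
  "dir_deriv u A A' \<longleftrightarrow> (\<exists>a a'.
     case_prod a \<in> borel_measurable (PiM UNIV (\<lambda>_. borel) \<Otimes>\<^sub>M borel) \<and>
     case_prod a' \<in> borel_measurable (PiM UNIV (\<lambda>_. borel) \<Otimes>\<^sub>M borel) \<and>
     (\<forall>y t. (a y has_real_derivative a' y t) (at t)) \<and> (\<forall>y. continuous_on UNIV (a' y)) \<and>
     (AE \<omega> in M. A \<omega> = a (orth u \<omega>) (X u \<omega>) \<and> A' \<omega> = a' (orth u \<omega>) (X u \<omega>)))"

lemma dir_derivI:
  assumes "case_prod a \<in> borel_measurable (PiM UNIV (\<lambda>_. borel) \<Otimes>\<^sub>M borel)"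
    "case_prod a' \<in> borel_measurable (PiM UNIV (\<lambda>_. borel) \<Otimes>\<^sub>M borel)"
    "\<And>y t. (a y has_real_derivative a' y t) (at t)" "\<And>y. continuous_on UNIV (a' y)"
    "AE \<omega> in M. A \<omega> = a (orth u \<omega>) (X u \<omega>) \<and> A' \<omega> = a' (orth u \<omega>) (X u \<omega>)"
  shows "dir_deriv u A A'"
  unfolding dir_deriv_def using assms by blast

lemma dir_derivE:
  assumes "dir_deriv u A A'"
  obtains a a' where "case_prod a \<in> borel_measurable (PiM UNIV (\<lambda>_. borel) \<Otimes>\<^sub>M borel)"
    "case_prod a' \<in> borel_measurable (PiM UNIV (\<lambda>_. borel) \<Otimes>\<^sub>M borel)"
    "\<And>y t. (a y has_real_derivative a' y t) (at t)" "\<And>y. continuous_on UNIV (a' y)"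
    "AE \<omega> in M. A \<omega> = a (orth u \<omega>) (X u \<omega>) \<and> A' \<omega> = a' (orth u \<omega>) (X u \<omega>)"
  using assms unfolding dir_deriv_def by blast

lemma dir_deriv_const: "dir_deriv u (\<lambda>_. c) (\<lambda>_. 0)"
  by (rule dir_derivI[where a="\<lambda>_ _. c" and a'="\<lambda>_ _. 0"]) auto

lemma dir_deriv_X: "dir_deriv u (X g) (\<lambda>_. inner g u)"
proof (rule dir_derivI[where a="\<lambda>y t. inner g u * t + y g" and a'="\<lambda>_ _. inner g u"])
  show "AE \<omega> in M. X g \<omega> = inner g u * X u \<omega> + orth u \<omega> g \<and> inner g u = inner g u"
    using X_decompose[of g u] by simp
  show "((\<lambda>t. inner g u * t + y g) has_real_derivative inner g u) (at t)" for y t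
    by (auto intro!: derivative_eq_intros)
qed auto

lemma dir_deriv_add:
  assumes "dir_deriv u A A'" "dir_deriv u B B'"
  shows "dir_deriv u (\<lambda>\<omega>. A \<omega> + B \<omega>) (\<lambda>\<omega>. A' \<omega> + B' \<omega>)"
proof -
  from assms(1) obtain a a' where [measurable]: "case_prod a \<in> borel_measurable (PiM UNIV (\<lambda>_. borel) \<Otimes>\<^sub>M borel)"
    "case_prod a' \<in> borel_measurable (PiM UNIV (\<lambda>_. borel) \<Otimes>\<^sub>M borel)"
    and a: "\<And>y t. (a y has_real_derivative a' y t) (at t)" "\<And>y. continuous_on UNIV (a' y)"
    "AE \<omega> in M. A \<omega> = a (orth u \<omega>) (X u \<omega>) \<and> A' \<omega> = a' (orth u \<omega>) (X u \<omega>)"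
    by (rule dir_derivE) blast
  from assms(2) obtain b b' where [measurable]: "case_prod b \<in> borel_measurable (PiM UNIV (\<lambda>_. borel) \<Otimes>\<^sub>M borel)"
    "case_prod b' \<in> borel_measurable (PiM UNIV (\<lambda>_. borel) \<Otimes>\<^sub>M borel)"
    and b: "\<And>y t. (b y has_real_derivative b' y t) (at t)" "\<And>y. continuous_on UNIV (b' y)"
    "AE \<omega> in M. B \<omega> = b (orth u \<omega>) (X u \<omega>) \<and> B' \<omega> = b' (orth u \<omega>) (X u \<omega>)"
    by (rule dir_derivE) blast
  show ?thesis
  proof (rule dir_derivI[where a="\<lambda>y t. a y t + b y t" and a'="\<lambda>y t. a' y t + b' y t"])
    show "((\<lambda>t. a y t + b y t) has_real_derivative a' y t + b' y t) (at t)" for y t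
      by (intro DERIV_add a b)
    show "continuous_on UNIV (\<lambda>t. a' y t + b' y t)" for y by (intro continuous_intros a b)
    show "AE \<omega> in M. A \<omega> + B \<omega> = a (orth u \<omega>) (X u \<omega>) + b (orth u \<omega>) (X u \<omega>) \<and>
       A' \<omega> + B' \<omega> = a' (orth u \<omega>) (X u \<omega>) + b' (orth u \<omega>) (X u \<omega>)"
      using a(3) b(3) by eventually_elim simp
  qed measurable
qed

lemma dir_deriv_mult:
  assumes "dir_deriv u A A'" "dir_deriv u B B'"
  shows "dir_deriv u (\<lambda>\<omega>. A \<omega> * B \<omega>) (\<lambda>\<omega>. A' \<omega> * B \<omega> + B' \<omega> * A \<omega>)"
proof -
  from assms(1) obtain a a' where [measurable]: "case_prod a \<in> borel_measurable (PiM UNIV (\<lambda>_. borel) \<Otimes>\<^sub>M borel)"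
    "case_prod a' \<in> borel_measurable (PiM UNIV (\<lambda>_. borel) \<Otimes>\<^sub>M borel)"
    and a: "\<And>y t. (a y has_real_derivative a' y t) (at t)" "\<And>y. continuous_on UNIV (a' y)"
    "AE \<omega> in M. A \<omega> = a (orth u \<omega>) (X u \<omega>) \<and> A' \<omega> = a' (orth u \<omega>) (X u \<omega>)"
    by (rule dir_derivE) blast
  from assms(2) obtain b b' where [measurable]: "case_prod b \<in> borel_measurable (PiM UNIV (\<lambda>_. borel) \<Otimes>\<^sub>M borel)"
    "case_prod b' \<in> borel_measurable (PiM UNIV (\<lambda>_. borel) \<Otimes>\<^sub>M borel)"
    and b: "\<And>y t. (b y has_real_derivative b' y t) (at t)" "\<And>y. continuous_on UNIV (b' y)"
    "AE \<omega> in M. B \<omega> = b (orth u \<omega>) (X u \<omega>) \<and> B' \<omega> = b' (orth u \<omega>) (X u \<omega>)"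
    by (rule dir_derivE) blast
  have cont: "continuous_on UNIV (a y)" "continuous_on UNIV (b y)" for y
    using a(1) b(1) by (auto intro!: continuous_at_imp_continuous_on DERIV_isCont)
  show ?thesis
  proof (rule dir_derivI[where a="\<lambda>y t. a y t * b y t" and a'="\<lambda>y t. a' y t * b y t + b' y t * a y t"])
    show "((\<lambda>t. a y t * b y t) has_real_derivative a' y t * b y t + b' y t * a y t) (at t)" for y t
      by (intro DERIV_mult a b)
    show "continuous_on UNIV (\<lambda>t. a' y t * b y t + b' y t * a y t)" for y
      by (intro continuous_intros a b cont)
    show "AE \<omega> in M. A \<omega> * B \<omega> = a (orth u \<omega>) (X u \<omega>) * b (orth u \<omega>) (X u \<omega>) \<and>
       A' \<omega> * B \<omega> + B' \<omega> * A \<omega> = a' (orth u \<omega>) (X u \<omega>) * b (orth u \<omega>) (X u \<omega>) + b' (orth u \<omega>) (X u \<omega>) * a (orth u \<omega>) (X u \<omega>)"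
      using a(3) b(3) by eventually_elim simp
  qed measurable
qed

lemma dir_deriv_compose:
  assumes A: "dir_deriv u A A'" and g: "\<And>x. (g has_real_derivative g' x) (at x)" "continuous_on UNIV g'"
  shows "dir_deriv u (\<lambda>\<omega>. g (A \<omega>)) (\<lambda>\<omega>. g' (A \<omega>) * A' \<omega>)"
proof -
  from A obtain a a' where [measurable]: "case_prod a \<in> borel_measurable (PiM UNIV (\<lambda>_. borel) \<Otimes>\<^sub>M borel)"
    "case_prod a' \<in> borel_measurable (PiM UNIV (\<lambda>_. borel) \<Otimes>\<^sub>M borel)"
    and a: "\<And>y t. (a y has_real_derivative a' y t) (at t)" "\<And>y. continuous_on UNIV (a' y)"
    "AE \<omega> in M. A \<omega> = a (orth u \<omega>) (X u \<omega>) \<and> A' \<omega> = a' (orth u \<omega>) (X u \<omega>)"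
    by (rule dir_derivE) blast
  have cont: "continuous_on UNIV (a y)" for y
    using a(1) by (auto intro!: continuous_at_imp_continuous_on DERIV_isCont)
  have [measurable]: "g \<in> borel_measurable borel" "g' \<in> borel_measurable borel"
    using g by (auto intro!: borel_measurable_continuous_onI continuous_at_imp_continuous_on DERIV_isCont)
  show ?thesis
  proof (rule dir_derivI[where a="\<lambda>y t. g (a y t)" and a'="\<lambda>y t. g' (a y t) * a' y t"])
    show "((\<lambda>t. g (a y t)) has_real_derivative g' (a y t) * a' y t) (at t)" for y t
      by (rule DERIV_chain2[OF g(1) a(1)])
    show "continuous_on UNIV (\<lambda>t. g' (a y t) * a' y t)" for y
      by (intro continuous_intros a continuous_on_compose2[OF g(2) cont]) auto
    show "AE \<omega> in M. g (A \<omega>) = g (a (orth u \<omega>) (X u \<omega>)) \<and>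
       g' (A \<omega>) * A' \<omega> = g' (a (orth u \<omega>) (X u \<omega>)) * a' (orth u \<omega>) (X u \<omega>)"
      using a(3) by eventually_elim simp
  qed measurable
qed

text \<open>\<open>X g\<close> does not involve \<open>X u\<close> at all, so \<open>f\<close> need
  not even be continuous. The Stein derivative, which jumps, enters the regression argument in this
  way.\<close>

lemma dir_deriv_orthogonal:
  assumes f [measurable]: "f \<in> borel_measurable borel" and g: "inner g u = 0"
  shows "dir_deriv u (\<lambda>\<omega>. f (X g \<omega>)) (\<lambda>_. 0)"
proof (rule dir_derivI[where a="\<lambda>y t. f (y g)" and a'="\<lambda>_ _. 0"])
  show "AE \<omega> in M. f (X g \<omega>) = f (orth u \<omega> g) \<and> 0 = 0"
    using g by (simp add: orth_def)
qed auto

lemma dir_deriv_cylinder: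
  fixes f :: "(nat \<Rightarrow> real) \<Rightarrow> real"
  assumes c: "continuous_on UNIV f" "\<And>i. i < n \<Longrightarrow> continuous_on UNIV (f' i)"
    and d: "\<And>i x. i < n \<Longrightarrow> ((\<lambda>t. f (x(i := t))) has_real_derivative f' i x) (at (x i))"
    and dep: "depends_on_first n f" "\<And>i. i < n \<Longrightarrow> depends_on_first n (f' i)"
  shows "dir_deriv u (\<lambda>\<omega>. f (\<lambda>j. X (\<phi> j) \<omega>)) (\<lambda>\<omega>. \<Sum>i<n. f' i (\<lambda>j. X (\<phi> j) \<omega>) * inner (\<phi> i) u)"
proof (rule dir_derivI[where a="\<lambda>y t. f (\<lambda>j. y (\<phi> j) + t * inner (\<phi> j) u)"
      and a'="\<lambda>y t. \<Sum>i<n. f' i (\<lambda>j. y (\<phi> j) + t * inner (\<phi> j) u) * inner (\<phi> i) u"])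
  show "((\<lambda>t. f (\<lambda>j. y (\<phi> j) + t * inner (\<phi> j) u)) has_real_derivative
     (\<Sum>i<n. f' i (\<lambda>j. y (\<phi> j) + t * inner (\<phi> j) u) * inner (\<phi> i) u)) (at t)" for y t
    by (rule has_derivative_along_line[OF c(2) d dep])
  have line: "continuous_on UNIV (\<lambda>t j. y (\<phi> j) + t * inner (\<phi> j) u)" for y
    by (rule continuous_on_coordinatewise_then_product) (intro continuous_intros)
  show "continuous_on UNIV (\<lambda>t. \<Sum>i<n. f' i (\<lambda>j. y (\<phi> j) + t * inner (\<phi> j) u) * inner (\<phi> i) u)" for y
    by (intro continuous_intros continuous_on_compose2[OF c(2) line]) auto
  have m: "(\<lambda>(y, t) j. y (\<phi> j) + t * inner (\<phi> j) u) \<in> measurable (PiM UNIV (\<lambda>_. borel) \<Otimes>\<^sub>M borel) borel"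
    unfolding case_prod_beta
    by (rule measurable_coordinatewise_then_product) measurable
  have comp: "(\<lambda>(y, t). k (\<lambda>j. y (\<phi> j) + t * inner (\<phi> j) u)) \<in> borel_measurable (PiM UNIV (\<lambda>_. borel) \<Otimes>\<^sub>M borel)"
    if "continuous_on UNIV k" for k :: "(nat \<Rightarrow> real) \<Rightarrow> real"
    using measurable_compose[OF m borel_measurable_continuous_onI[OF that]] by (simp add: case_prod_beta)
  show "(\<lambda>(y, t). f (\<lambda>j. y (\<phi> j) + t * inner (\<phi> j) u)) \<in> borel_measurable (PiM UNIV (\<lambda>_. borel) \<Otimes>\<^sub>M borel)"
    by (rule comp[OF c(1)])
  show "(\<lambda>(y, t). \<Sum>i<n. f' i (\<lambda>j. y (\<phi> j) + t * inner (\<phi> j) u) * inner (\<phi> i) u) \<in> borel_measurable (PiM UNIV (\<lambda>_. borel) \<Otimes>\<^sub>M borel)"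
    using comp[OF c(2)] unfolding case_prod_beta by (intro borel_measurable_sum borel_measurable_times) auto
  \<comment> \<open>Only countably many vectors \<open>\<phi> j\<close> occur, so one null set
    serves all decompositions at once.\<close>
  have "AE \<omega> in M. \<forall>j. X (\<phi> j) \<omega> = inner (\<phi> j) u * X u \<omega> + orth u \<omega> (\<phi> j)"
    unfolding AE_all_countable by (intro allI X_decompose)
  then show "AE \<omega> in M. f (\<lambda>j. X (\<phi> j) \<omega>) = f (\<lambda>j. orth u \<omega> (\<phi> j) + X u \<omega> * inner (\<phi> j) u) \<and>
    (\<Sum>i<n. f' i (\<lambda>j. X (\<phi> j) \<omega>) * inner (\<phi> i) u) =
    (\<Sum>i<n. f' i (\<lambda>j. orth u \<omega> (\<phi> j) + X u \<omega> * inner (\<phi> j) u) * inner (\<phi> i) u)"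
    by eventually_elim (simp add: add.commute mult.commute)
qed

text \<open>With the other coordinates frozen, this is the one-dimensional identity in the variable
  \<open>X u\<close>. The product form of the law allows freezing them: Fubini's theorem makes
  almost every slice integrable, and the slices are then integrated.\<close>

lemma gaussian_integration_by_parts:
  assumes u: "norm u = 1" and D: "dir_deriv u A A'"
    and i: "integrable M A" "integrable M (\<lambda>\<omega>. A \<omega> * X u \<omega>)" "integrable M A'"
  shows "expectation A' = expectation (\<lambda>\<omega>. A \<omega> * X u \<omega>)"
proof -
  let ?P = "PiM UNIV (\<lambda>_. borel) :: ('h \<Rightarrow> real) measure" and ?N = std_normal_distribution
  let ?J = "distr M ?P (orth u)"
  from D obtain a a' where [measurable]: "case_prod a \<in> borel_measurable (?P \<Otimes>\<^sub>M borel)"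
    "case_prod a' \<in> borel_measurable (?P \<Otimes>\<^sub>M borel)"
    and a: "\<And>y t. (a y has_real_derivative a' y t) (at t)" "\<And>y. continuous_on UNIV (a' y)"
    "AE \<omega> in M. A \<omega> = a (orth u \<omega>) (X u \<omega>) \<and> A' \<omega> = a' (orth u \<omega>) (X u \<omega>)"
    by (rule dir_derivE) blast
  interpret N: real_distribution ?N by (rule real_dist_normal_dist)
  interpret J: prob_space ?J by (rule prob_space_distr) simp
  interpret P: pair_sigma_finite ?J ?N by unfold_locales
  have law: "distr M (?P \<Otimes>\<^sub>M borel) (\<lambda>\<omega>. (orth u \<omega>, X u \<omega>)) = ?J \<Otimes>\<^sub>M ?N" by (rule distr_orth_X[OF u])
  have [measurable]: "A \<in> borel_measurable M" "A' \<in> borel_measurable M" using i by auto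
  have tr: "integrable (?J \<Otimes>\<^sub>M ?N) k \<and> (\<integral>p. k p \<partial>(?J \<Otimes>\<^sub>M ?N)) = expectation K"
    if "k \<in> borel_measurable (?P \<Otimes>\<^sub>M borel)" "integrable M K" "AE \<omega> in M. K \<omega> = k (orth u \<omega>, X u \<omega>)"
    for k :: "('h \<Rightarrow> real) \<times> real \<Rightarrow> real" and K
  proof
    have mk: "(\<lambda>\<omega>. k (orth u \<omega>, X u \<omega>)) \<in> borel_measurable M"
      by (rule measurable_compose[OF _ that(1)]) simp
    have "integrable M (\<lambda>\<omega>. k (orth u \<omega>, X u \<omega>))"
      using integrable_cong_AE_imp[OF that(2) mk] that(3) by (auto elim: eventually_mono)
    then show "integrable (?J \<Otimes>\<^sub>M ?N) k"
      unfolding law[symmetric] using that(1) by (subst integrable_distr_eq) auto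
    have "(\<integral>p. k p \<partial>(?J \<Otimes>\<^sub>M ?N)) = expectation (\<lambda>\<omega>. k (orth u \<omega>, X u \<omega>))"
      unfolding law[symmetric] using that(1) by (subst integral_distr) auto
    also have "\<dots> = expectation K" using that mk by (intro integral_cong_AE) (auto elim: eventually_mono)
    finally show "(\<integral>p. k p \<partial>(?J \<Otimes>\<^sub>M ?N)) = expectation K" .
  qed
  have ae: "AE \<omega> in M. A \<omega> = a (orth u \<omega>) (X u \<omega>)"
    "AE \<omega> in M. A \<omega> * X u \<omega> = a (orth u \<omega>) (X u \<omega>) * X u \<omega>"
    "AE \<omega> in M. A' \<omega> = a' (orth u \<omega>) (X u \<omega>)"
    using a(3) by (eventually_elim, simp)+
  have t1: "integrable (?J \<Otimes>\<^sub>M ?N) (\<lambda>p. a (fst p) (snd p))"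
    using tr[of "\<lambda>p. a (fst p) (snd p)" A] i ae by (simp_all add: case_prod_beta')
  have t2: "integrable (?J \<Otimes>\<^sub>M ?N) (\<lambda>p. a (fst p) (snd p) * snd p)"
    "(\<integral>p. a (fst p) (snd p) * snd p \<partial>(?J \<Otimes>\<^sub>M ?N)) = expectation (\<lambda>\<omega>. A \<omega> * X u \<omega>)"
    using tr[of "\<lambda>p. a (fst p) (snd p) * snd p" "\<lambda>\<omega>. A \<omega> * X u \<omega>"] i ae by (simp_all add: case_prod_beta')
  have t3: "integrable (?J \<Otimes>\<^sub>M ?N) (\<lambda>p. a' (fst p) (snd p))"
    "(\<integral>p. a' (fst p) (snd p) \<partial>(?J \<Otimes>\<^sub>M ?N)) = expectation A'"
    using tr[of "\<lambda>p. a' (fst p) (snd p)" A'] i ae by (simp_all add: case_prod_beta')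
  have "AE y in ?J. (\<integral>t. a' y t \<partial>?N) = (\<integral>t. a y t * t \<partial>?N)"
    using P.AE_integrable_fst'[OF t1] P.AE_integrable_fst'[OF t2(1)] P.AE_integrable_fst'[OF t3(1)]
  proof eventually_elim
    case (elim y)
    then show ?case by (intro stein_identity_normal a) simp_all
  qed
  then have "(\<integral>y. \<integral>t. a' y t \<partial>?N \<partial>?J) = (\<integral>y. \<integral>t. a y t * t \<partial>?N \<partial>?J)"
    using P.integrable_fst'[OF t2(1)] P.integrable_fst'[OF t3(1)] by (intro integral_cong_AE) auto
  then show ?thesis
    using P.integral_fst'[OF t2(1)] P.integral_fst'[OF t3(1)] t2(2) t3(2) by simp
qed

end

section \<open>Hermite polynomials\<close>

fun hermite_deriv :: "nat \<Rightarrow> real \<Rightarrow> real" where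
  "hermite_deriv 0 x = 0"
| "hermite_deriv (Suc q) x = real (Suc q) * hermite q x"

text \<open>The shape in which Gaussian integration by parts produces the next polynomial:
  multiplication by the variable minus differentiation.\<close>

lemma hermite_rec: "hermite (Suc q) x = x * hermite q x - hermite_deriv q x"
  by (cases q) auto

lemma DERIV_hermite: "(hermite q has_real_derivative hermite_deriv q x) (at x)"
proof (induction q arbitrary: x rule: less_induct)
  case (less q)
  show ?case
  proof (cases q)
    case 0
    then show ?thesis by (simp add: fun_eq_iff[of "hermite 0" "\<lambda>_. 1", THEN iffD2])
  next
    case (Suc p)
    show ?thesis
    proof (cases p)
      case 0
      have "hermite (Suc 0) = (\<lambda>x. x)" by auto
      then show ?thesis using Suc 0 by simp
    next
      case (Suc r)
      \<comment> \<open>Eliminating the derivative of lower order through the recursion leaves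
        \<open>hermite (Suc r) x\<close> with total coefficient \<open>Suc r + 1\<close>, the index
        of the polynomial being differentiated.\<close>
      have hd: "hermite_deriv r x = x * hermite r x - hermite (Suc r) x"
        using hermite_rec[of r x] by simp
      have "((\<lambda>x. x * hermite (Suc r) x - real (Suc r) * hermite r x) has_real_derivative
        x * hermite_deriv (Suc r) x + hermite (Suc r) x - real (Suc r) * hermite_deriv r x) (at x)"
        using \<open>q = Suc p\<close> Suc by (auto intro!: derivative_eq_intros less)
      moreover have "x * hermite_deriv (Suc r) x + hermite (Suc r) x - real (Suc r) * hermite_deriv r x =
        hermite_deriv q x"
        unfolding hd using \<open>q = Suc p\<close> Suc by (simp add: algebra_simps)
      moreover have "hermite q = (\<lambda>x. x * hermite (Suc r) x - real (Suc r) * hermite r x)"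
        using \<open>q = Suc p\<close> Suc by (auto simp: fun_eq_iff)
      ultimately show ?thesis by simp
    qed
  qed
qed

lemma continuous_hermite: "continuous_on A (hermite q)"
  using DERIV_hermite by (blast intro: continuous_at_imp_continuous_on DERIV_isCont)

lemma hermite_measurable [measurable]: "hermite q \<in> borel_measurable borel"
  by (rule borel_measurable_continuous_onI[OF continuous_hermite])

lemma continuous_hermite_deriv: "continuous_on A (hermite_deriv q)"
proof (cases q)
  case (Suc p)
  have "hermite_deriv q = (\<lambda>x. real (Suc p) * hermite p x)" using Suc by auto
  then show ?thesis by (simp only:) (intro continuous_intros continuous_hermite)
qed (simp cong: continuous_on_cong)

lemma hermite_deriv_measurable [measurable]: "hermite_deriv q \<in> borel_measurable borel"
  by (rule borel_measurable_continuous_onI[OF continuous_hermite_deriv])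

lemma hermite_poly: "\<exists>p. \<forall>x. hermite q x = poly p x"
proof (induction q rule: less_induct)
  case (less q)
  show ?case
  proof (cases q)
    case 0
    then show ?thesis by (intro exI[of _ 1]) simp
  next
    case (Suc p)
    show ?thesis
    proof (cases p)
      case 0
      then show ?thesis using Suc by (intro exI[of _ "[:0, 1:]"]) simp
    next
      case (Suc r)
      then obtain a b where "\<forall>x. hermite (Suc r) x = poly a x" "\<forall>x. hermite r x = poly b x"
        using less[of "Suc r"] less[of r] \<open>q = Suc p\<close> by auto
      then show ?thesis using \<open>q = Suc p\<close> Suc
        by (intro exI[of _ "[:0, 1:] * a - smult (real (Suc r)) b"]) simp
    qed
  qed
qed

lemma monom_in_hermite_span:
  "\<exists>c. \<forall>x. x ^ q = (\<Sum>j\<le>q. c j * hermite j x)"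
proof (induction q)
  case 0
  then show ?case by (intro exI[of _ "\<lambda>_. 1"]) simp
next
  case (Suc q)
  then obtain c where c: "\<And>x. x ^ q = (\<Sum>j\<le>q. c j * hermite j x)" by blast
  \<comment> \<open>For \<open>j = 0\<close> the truncated index \<open>j - 1\<close> is 0 as well,
    which is harmless because its coefficient is 0.\<close>
  have x: "x * hermite j x = hermite (Suc j) x + real j * hermite (j - 1) x" for j x
    by (cases j) auto
  have "\<exists>d. \<forall>x. x * (\<Sum>j\<le>m. c j * hermite j x) = (\<Sum>j\<le>Suc m. d j * hermite j x)" for m
  proof (induction m)
    case 0
    show ?case by (intro exI[of _ "\<lambda>j. if j = 1 then c 0 else 0"]) simp
  next
    case (Suc m)
    then obtain d where d: "\<And>x. x * (\<Sum>j\<le>m. c j * hermite j x) = (\<Sum>j\<le>Suc m. d j * hermite j x)" by blast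
    \<comment> \<open>The new top term contributes its coefficient at degree
      \<open>Suc (Suc m)\<close>, and \<open>Suc m\<close> times it at degree \<open>m\<close>; the
      latter is added to what \<open>d\<close> already has there.\<close>
    define e where "e = (\<lambda>j. (if j \<le> Suc m then d j else 0) + (if j = Suc (Suc m) then c (Suc m) else 0) + (if j = m then c (Suc m) * real (Suc m) else 0))"
    have "x * (\<Sum>j\<le>Suc m. c j * hermite j x) = (\<Sum>j\<le>Suc (Suc m). e j * hermite j x)" for x
    proof -
      have "(\<Sum>j\<le>Suc (Suc m). e j * hermite j x) = (\<Sum>j\<le>Suc (Suc m). (if j \<le> Suc m then d j else 0) * hermite j x)
        + (\<Sum>j\<le>Suc (Suc m). (if j = Suc (Suc m) then c (Suc m) else 0) * hermite j x)
        + (\<Sum>j\<le>Suc (Suc m). (if j = m then c (Suc m) * real (Suc m) else 0) * hermite j x)"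
        unfolding e_def by (simp add: sum.distrib[symmetric] algebra_simps del: hermite.simps sum.atMost_Suc)
      also have "\<dots> = (\<Sum>j\<le>Suc m. d j * hermite j x) + c (Suc m) * hermite (Suc (Suc m)) x + c (Suc m) * real (Suc m) * hermite m x"
        by (simp add: if_distrib[of "\<lambda>z. z * _"] sum.delta del: hermite.simps cong: if_cong)
      also have "\<dots> = x * (\<Sum>j\<le>m. c j * hermite j x) + c (Suc m) * (x * hermite (Suc m) x)"
        unfolding d x[of x "Suc m"] by (simp only: distrib_left diff_Suc_1 mult.assoc)
      also have "\<dots> = x * (\<Sum>j\<le>Suc m. c j * hermite j x)" by (simp add: algebra_simps del: hermite.simps)
      finally show ?thesis by simp
    qed
    then show ?case by blast
  qed
  then obtain d where "\<And>x. x * (\<Sum>j\<le>q. c j * hermite j x) = (\<Sum>j\<le>Suc q. d j * hermite j x)" by blast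
  then show ?case using c by (intro exI[of _ d]) simp
qed

section \<open>Hermite polynomials of Gaussian variables\<close>

context isonormal_process
begin

lemma X_moment: "integrable M (\<lambda>\<omega>. \<bar>X h \<omega>\<bar> ^ k)"
proof (cases rule: X_distr_cases[of h])
  case (normal \<mu> \<sigma>)
  have \<mu>: "\<mu> = 0" using normal_distributed_expectation[OF normal] by (simp add: centered)
  have "integrable lborel (\<lambda>x. normal_density \<mu> \<sigma> x * \<bar>x\<bar> ^ k)"
    using integrable_normal_moment_abs[OF normal(1), of \<mu> k] \<mu> by simp
  then show ?thesis
    using distributed_integrable[OF normal(2), of "\<lambda>x. \<bar>x\<bar> ^ k"] by simp
next
  case (const \<mu>)
  have "AE \<omega> in M. \<bar>X h \<omega>\<bar> ^ k = \<bar>\<mu>\<bar> ^ k" using const by auto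
  then show ?thesis
    by (subst integrable_cong_AE[where g="\<lambda>_. \<bar>\<mu>\<bar> ^ k"]) auto
qed

lemma sq_int_X_power: "sq_int M (\<lambda>\<omega>. X h \<omega> ^ k)"
proof -
  have "integrable M (\<lambda>\<omega>. \<bar>X h \<omega>\<bar> ^ (2 * k))" by (rule X_moment)
  then show ?thesis by (simp add: sq_int_real power_mult[symmetric] mult.commute power_even_abs)
qed

lemma sq_int_poly_X: "sq_int M (\<lambda>\<omega>. poly p (X h \<omega>))"
  unfolding poly_altdef by (intro sq_int_sum sq_int_cmult sq_int_X_power)

lemma sq_int_hermite: "sq_int M (\<lambda>\<omega>. hermite q (X h \<omega>))"
  using hermite_poly[of q] sq_int_poly_X by auto

lemma sq_int_hermite_deriv: "sq_int M (\<lambda>\<omega>. hermite_deriv q (X h \<omega>))"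
  by (cases q) (auto intro: sq_int_cmult sq_int_hermite)

lemma sq_int_X_hermite: "sq_int M (\<lambda>\<omega>. hermite q (X h \<omega>) * X h \<omega>)"
proof -
  obtain p where p: "\<And>x. hermite q x = poly p x" using hermite_poly by blast
  show ?thesis using sq_int_poly_X[of "p * [:0, 1:]" h] by (simp add: p mult.commute)
qed

lemma dir_deriv_hermite: "dir_deriv u (\<lambda>\<omega>. hermite q (X g \<omega>)) (\<lambda>\<omega>. hermite_deriv q (X g \<omega>) * inner g u)"
  using dir_deriv_compose[OF dir_deriv_X DERIV_hermite continuous_hermite_deriv] .

text \<open>The adjoint of the derivative, applied to \<open>H\<^sub>q (X u) u\<close>, is \<open>H\<^sub>q\<^sub>+\<^sub>1 (X u)\<close>.\<close>

lemma hermite_integration_by_parts: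
  assumes u: "norm u = 1" and A: "dir_deriv u A A'" "sq_int M A" "sq_int M A'"
  shows "expectation (\<lambda>\<omega>. A' \<omega> * hermite q (X u \<omega>)) = expectation (\<lambda>\<omega>. A \<omega> * hermite (Suc q) (X u \<omega>))"
proof -
  have iu: "inner u u = 1" using u by (simp add: norm_eq_1)
  have D: "dir_deriv u (\<lambda>\<omega>. A \<omega> * hermite q (X u \<omega>))
     (\<lambda>\<omega>. A' \<omega> * hermite q (X u \<omega>) + hermite_deriv q (X u \<omega>) * inner u u * A \<omega>)"
    by (rule dir_deriv_mult[OF A(1) dir_deriv_hermite])
  have i: "integrable M (\<lambda>\<omega>. A' \<omega> * hermite q (X u \<omega>))" "integrable M (\<lambda>\<omega>. A \<omega> * hermite q (X u \<omega>))"
    "integrable M (\<lambda>\<omega>. A \<omega> * (hermite q (X u \<omega>) * X u \<omega>))" "integrable M (\<lambda>\<omega>. A \<omega> * hermite_deriv q (X u \<omega>))"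
    by (intro sq_int_mult A sq_int_hermite sq_int_X_hermite sq_int_hermite_deriv)+
  have "expectation (\<lambda>\<omega>. A' \<omega> * hermite q (X u \<omega>) + hermite_deriv q (X u \<omega>) * inner u u * A \<omega>) =
    expectation (\<lambda>\<omega>. A \<omega> * hermite q (X u \<omega>) * X u \<omega>)"
    by (rule gaussian_integration_by_parts[OF u D]) (use i in \<open>simp_all add: iu mult_ac\<close>)
  then show ?thesis
    using i by (simp add: iu hermite_rec algebra_simps del: hermite.simps)
qed

text \<open>Each integration by parts lowers both degrees by one, at the price of a factor
  \<open>p\<close> from the derivative and a factor \<open>inner h g\<close> from the direction. If
  the degrees differ, the smaller one reaches a constant first, whose derivative is 0. Symmetry
  reduces to the case of \<open>p\<close> at most \<open>q\<close>.\<close>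

lemma hermite_covariance:
  assumes "norm h = 1" "norm g = 1"
  shows "expectation (\<lambda>\<omega>. hermite p (X h \<omega>) * hermite q (X g \<omega>)) = (if p = q then fact p * inner h g ^ p else 0)"
proof -
  have *: "expectation (\<lambda>\<omega>. hermite p (X h \<omega>) * hermite q (X g \<omega>)) = (if p = q then fact p * inner h g ^ p else 0)"
    if "norm h = 1" "norm g = 1" "p \<le> q" for p q h g
    using that(1) that(2) that(3)
  proof (induction p arbitrary: q h g)
    case 0
    show ?case
    proof (cases q)
      case 0 then show ?thesis by (simp add: prob_space)
    next
      case (Suc r)
      have "expectation (\<lambda>\<omega>. 0 * hermite r (X g \<omega>)) = expectation (\<lambda>\<omega>. 1 * hermite (Suc r) (X g \<omega>))"
        by (rule hermite_integration_by_parts[OF 0(2) dir_deriv_const]) (auto intro: sq_int_const)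
      then show ?thesis using Suc by (simp del: hermite.simps(2-) )
    qed
  next
    case (Suc p)
    then obtain r where r: "q = Suc r" by (cases q) auto
    have "expectation (\<lambda>\<omega>. (hermite_deriv (Suc p) (X h \<omega>) * inner h g) * hermite r (X g \<omega>)) =
      expectation (\<lambda>\<omega>. hermite (Suc p) (X h \<omega>) * hermite (Suc r) (X g \<omega>))"
      using Suc sq_int_cmult[OF sq_int_hermite_deriv[of "Suc p" h], of "inner h g"]
      by (intro hermite_integration_by_parts dir_deriv_hermite sq_int_hermite) (auto simp: mult.commute)
    moreover have "expectation (\<lambda>\<omega>. (hermite_deriv (Suc p) (X h \<omega>) * inner h g) * hermite r (X g \<omega>)) =
      real (Suc p) * inner h g * expectation (\<lambda>\<omega>. hermite p (X h \<omega>) * hermite r (X g \<omega>))"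
      by (subst integral_mult_right_zero[symmetric]) (auto intro!: Bochner_Integration.integral_cong simp: mult_ac)
    moreover have "p \<le> r" using Suc r by simp
    ultimately show ?case using Suc.IH[of h g r] Suc.prems r by (auto simp del: hermite.simps)
  qed
  show ?thesis
  proof (cases "p \<le> q")
    case True then show ?thesis using * assms by blast
  next
    case False
    then show ?thesis using *[of g h q p] assms by (simp add: mult.commute)
  qed
qed

end

section \<open>Smooth functionals and the closure of the derivative\<close>

lemma Ck_continuous: "Ck n k f \<Longrightarrow> continuous_on UNIV f"
  by (cases k) auto

lemma Ck_SucI:
  assumes "continuous_on UNIV f"
    and "\<And>i x. i < n \<Longrightarrow> ((\<lambda>t. f (x(i := t))) has_real_derivative f' i x) (at (x i))"
    and "\<And>i. i < n \<Longrightarrow> Ck n k (f' i)"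
  shows "Ck n (Suc k) f"
proof -
  have "partial_deriv i f = f' i" if "i < n" for i
    unfolding partial_deriv_def using assms(2)[OF that] by (auto intro!: DERIV_imp_deriv)
  then show ?thesis using assms by (auto simp: real_differentiable_def)
qed

lemma Ck_SucD:
  assumes "Ck n (Suc k) f" "i < n"
  shows "((\<lambda>t. f (x(i := t))) has_real_derivative partial_deriv i f x) (at (x i))"
    "Ck n k (partial_deriv i f)"
proof -
  show "((\<lambda>t. f (x(i := t))) has_real_derivative partial_deriv i f x) (at (x i))"
    unfolding partial_deriv_def
    using assms by (subst DERIV_deriv_iff_real_differentiable) auto
  show "Ck n k (partial_deriv i f)" using assms by auto
qed

lemma Ck_Suc_imp: "Ck n (Suc k) f \<Longrightarrow> Ck n k f"
proof (induction k arbitrary: f)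
  case (Suc k)
  show ?case
    by (rule Ck_SucI) (use Suc Ck_continuous Ck_SucD in blast)+
qed auto

lemma Ck_const: "Ck n k (\<lambda>_. c)"
proof (induction k arbitrary: c)
  case (Suc k)
  show ?case by (rule Ck_SucI[where f'="\<lambda>_ _. 0"]) (use Suc in auto)
qed auto

lemma Ck_add: "Ck n k f \<Longrightarrow> Ck n k g \<Longrightarrow> Ck n k (\<lambda>x. f x + g x)"
proof (induction k arbitrary: f g)
  case 0
  then show ?case by (auto intro: continuous_intros)
next
  case (Suc k)
  show ?case
  proof (rule Ck_SucI)
    show "continuous_on UNIV (\<lambda>x. f x + g x)"
      by (intro continuous_intros Ck_continuous[OF Suc.prems(1)] Ck_continuous[OF Suc.prems(2)])
    fix i x assume i: "i < n"
    show "((\<lambda>t. f (x(i := t)) + g (x(i := t))) has_real_derivative (\<lambda>i x. partial_deriv i f x + partial_deriv i g x) i x) (at (x i))"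
      by (intro DERIV_add Ck_SucD(1)[OF Suc.prems(1) i] Ck_SucD(1)[OF Suc.prems(2) i])
    show "Ck n k (\<lambda>x. partial_deriv i f x + partial_deriv i g x)"
      by (intro Suc.IH Ck_SucD(2)[OF Suc.prems(1) i] Ck_SucD(2)[OF Suc.prems(2) i])
  qed
qed

lemma Ck_mult: "Ck n k f \<Longrightarrow> Ck n k g \<Longrightarrow> Ck n k (\<lambda>x. f x * g x)"
proof (induction k arbitrary: f g)
  case 0
  then show ?case by (auto intro: continuous_intros)
next
  case (Suc k)
  show ?case
  proof (rule Ck_SucI)
    show "continuous_on UNIV (\<lambda>x. f x * g x)"
      by (intro continuous_intros Ck_continuous[OF Suc.prems(1)] Ck_continuous[OF Suc.prems(2)])
    fix i x assume i: "i < n"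
    show "((\<lambda>t. f (x(i := t)) * g (x(i := t))) has_real_derivative (\<lambda>i x. partial_deriv i f x * g x + partial_deriv i g x * f x) i x) (at (x i))"
      using DERIV_mult[OF Ck_SucD(1)[OF Suc.prems(1) i, of x] Ck_SucD(1)[OF Suc.prems(2) i, of x]]
      by (simp only: fun_upd_triv)
    show "Ck n k (\<lambda>x. partial_deriv i f x * g x + partial_deriv i g x * f x)"
      by (rule Ck_add[OF Suc.IH[OF Ck_SucD(2)[OF Suc.prems(1) i] Ck_Suc_imp[OF Suc.prems(2)]]
            Suc.IH[OF Ck_SucD(2)[OF Suc.prems(2) i] Ck_Suc_imp[OF Suc.prems(1)]]])
  qed
qed

lemma Ck_sum: "(\<And>i. i \<in> I \<Longrightarrow> Ck n k (f i)) \<Longrightarrow> Ck n k (\<lambda>x. \<Sum>i\<in>I. f i x)"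
  by (induction I rule: infinite_finite_induct) (auto intro: Ck_const Ck_add)

lemma Ck_prod: "(\<And>i. i \<in> I \<Longrightarrow> Ck n k (f i)) \<Longrightarrow> Ck n k (\<lambda>x. \<Prod>i\<in>I. f i x)"
  by (induction I rule: infinite_finite_induct) (auto intro: Ck_const Ck_mult)

text \<open>Smoothness of all orders by a single induction: a class \<open>S\<close> of functions of
  one variable that is closed under differentiation consists of smooth functions. Used for
  polynomials and for the flat exponentials.\<close>

lemma Ck_coordinate:
  assumes S: "\<And>f. f \<in> S \<Longrightarrow> \<exists>f'\<in>S. \<forall>x. (f has_real_derivative f' x) (at (x::real))"
  shows "f \<in> S \<Longrightarrow> Ck n k (\<lambda>x. f (x j))"
proof (induction k arbitrary: f)
  case 0
  obtain f' where "\<And>x. (f has_real_derivative f' x) (at x)" using S[OF 0] by blast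
  then have "continuous_on UNIV f" by (auto intro!: continuous_at_imp_continuous_on DERIV_isCont)
  then show ?case using continuous_on_compose2[OF _ continuous_on_product_coordinates] by fastforce
next
  case (Suc k)
  obtain f' where f': "f' \<in> S" "\<And>x. (f has_real_derivative f' x) (at x)" using S[OF Suc.prems] by blast
  show ?case
  proof (rule Ck_SucI)
    show "continuous_on UNIV (\<lambda>x. f (x j))"
      by (rule Ck_continuous[OF Suc.IH[OF Suc.prems]])
    show "((\<lambda>t. f ((x(i := t)) j)) has_real_derivative (\<lambda>i x. (if i = j then 1 else 0) * f' (x j)) i x) (at (x i))" for i x
      using f'(2)[of "x j"] by (cases "i = j") auto
    show "Ck n k (\<lambda>x. (if i = j then 1 else 0) * f' (x j))" for i
      by (intro Ck_mult Ck_const Suc.IH f')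
  qed
qed

lemma Ck_rescale: "Ck n k f \<Longrightarrow> Ck n k (\<lambda>x. f (\<lambda>j. r * x j))"
proof (induction k arbitrary: f)
  case 0
  have "continuous_on UNIV (\<lambda>x j. r * x j :: real)"
    by (rule continuous_on_coordinatewise_then_product) (intro continuous_intros continuous_on_product_coordinates)
  then show ?case using 0 continuous_on_compose2[of UNIV f UNIV "\<lambda>x j. r * x j"] by auto
next
  case (Suc k)
  show ?case
  proof (rule Ck_SucI)
    show "continuous_on UNIV (\<lambda>x. f (\<lambda>j. r * x j))"
      by (rule Ck_continuous[OF Suc.IH[OF Ck_Suc_imp[OF Suc.prems]]])
    fix i and x :: "nat \<Rightarrow> real" assume i: "i < n"
    have "((\<lambda>s. f ((\<lambda>j. r * x j)(i := s))) has_real_derivative partial_deriv i f (\<lambda>j. r * x j)) (at (r * x i))"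
      by (rule Ck_SucD(1)[OF Suc.prems i, of "\<lambda>j. r * x j"])
    then have "((\<lambda>t. f ((\<lambda>j. r * x j)(i := r * t))) has_real_derivative partial_deriv i f (\<lambda>j. r * x j) * r) (at (x i))"
      by (rule DERIV_chain2) (auto intro!: derivative_eq_intros)
    moreover have "(\<lambda>j. r * x j)(i := r * t) = (\<lambda>j. r * (x(i := t)) j)" for t by auto
    ultimately show "((\<lambda>t. f (\<lambda>j. r * (x(i := t)) j)) has_real_derivative (\<lambda>i x. partial_deriv i f (\<lambda>j. r * x j) * r) i x) (at (x i))"
      by simp
    show "Ck n k (\<lambda>x. partial_deriv i f (\<lambda>j. r * x j) * r)"
      by (intro Ck_mult Ck_const Suc.IH Ck_SucD(2)[OF Suc.prems i])
  qed
qed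

text \<open>Only the first \<open>n\<close> coordinates are confined, so the support is not compact
  in the sequence space. Setting the remaining coordinates to 0 does not change \<open>f\<close>,
  and the box with these coordinates frozen is compact by Tychonoff's theorem.\<close>

lemma compact_support_bounded:
  fixes f :: "(nat \<Rightarrow> real) \<Rightarrow> real"
  assumes f: "continuous_on UNIV f" "depends_on_first n f"
    and R: "\<And>x i. i < n \<Longrightarrow> R < \<bar>x i\<bar> \<Longrightarrow> f x = 0"
  obtains C where "\<And>x. \<bar>f x\<bar> \<le> C"
proof -
  define K where "K = (\<Pi>\<^sub>E i\<in>UNIV. if i < n then {-R..R} else {0::real})"
  have "compactin (product_topology (\<lambda>_::nat. euclidean) UNIV) K"
    unfolding K_def compactin_PiE by (auto simp: compactin_euclidean_iff)
  then have "compact K" unfolding euclidean_product_topology by simp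
  then have "compact (f ` K)" by (rule compact_continuous_image[OF continuous_on_subset[OF f(1)], rotated]) simp
  then have "\<exists>C. \<forall>x\<in>K. \<bar>f x\<bar> \<le> C"
    by (auto dest!: compact_imp_bounded simp: bounded_iff)
  then obtain C where C: "\<And>x. x \<in> K \<Longrightarrow> \<bar>f x\<bar> \<le> C" by blast
  have "\<bar>f x\<bar> \<le> max C 0" for x
  proof (cases "\<exists>i<n. R < \<bar>x i\<bar>")
    case True then show ?thesis using R by auto
  next
    case False
    define y where "y = (\<lambda>i. if i < n then x i else 0)"
    have "f x = f y" using f(2) by (auto simp: depends_on_first_def y_def)
    moreover have "\<bar>x i\<bar> \<le> R" if "i < n" for i using False that by (meson not_le)
    then have "y \<in> K" by (auto simp: K_def y_def abs_le_iff minus_le_iff)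
    ultimately show ?thesis using C by fastforce
  qed
  then show ?thesis using that by blast
qed

lemma depends_on_first_partial_deriv:
  assumes "depends_on_first n f" "i < n" shows "depends_on_first n (partial_deriv i f)"
  unfolding depends_on_first_def
proof (intro allI impI)
  fix x y :: "nat \<Rightarrow> real" assume "\<forall>i<n. x i = y i"
  then have "(\<lambda>t. f (x(i := t))) = (\<lambda>t. f (y(i := t)))" "x i = y i"
    using assms by (auto simp: depends_on_first_def fun_eq_iff)
  then show "partial_deriv i f x = partial_deriv i f y" unfolding partial_deriv_def by simp
qed

lemma smooth_compact_supportD:
  assumes "smooth_compact_support n g"
  shows "continuous_on UNIV g" "depends_on_first n g"
    and "\<And>i. i < n \<Longrightarrow> continuous_on UNIV (partial_deriv i g)"
    and "\<And>i. i < n \<Longrightarrow> depends_on_first n (partial_deriv i g)"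
    and "\<And>i x. i < n \<Longrightarrow> ((\<lambda>t. g (x(i := t))) has_real_derivative partial_deriv i g x) (at (x i))"
proof -
  have C: "Ck n k g" for k using assms by (simp add: smooth_compact_support_def)
  show "continuous_on UNIV g" by (rule Ck_continuous[OF C])
  show dep: "depends_on_first n g" using assms by (simp add: smooth_compact_support_def)
  fix i assume i: "i < n"
  show "continuous_on UNIV (partial_deriv i g)" using Ck_SucD(2)[OF C i] by (rule Ck_continuous)
  show "depends_on_first n (partial_deriv i g)" by (rule depends_on_first_partial_deriv[OF dep i])
  show "((\<lambda>t. g (x(i := t))) has_real_derivative partial_deriv i g x) (at (x i))" for x by (rule Ck_SucD(1)[OF C i])
qed

lemma smooth_compact_support_bounded:
  assumes g: "smooth_compact_support n g"
  obtains C where "\<And>x. \<bar>g x\<bar> \<le> C" "\<And>i x. i < n \<Longrightarrow> \<bar>partial_deriv i g x\<bar> \<le> C"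
proof -
  note D = smooth_compact_supportD[OF g]
  obtain R where R: "\<And>x i. i < n \<Longrightarrow> R < \<bar>x i\<bar> \<Longrightarrow> g x = 0"
    using g unfolding smooth_compact_support_def by (meson not_le)
  obtain C0 where C0: "\<And>x. \<bar>g x\<bar> \<le> C0"
    by (rule compact_support_bounded[where R=R, OF D(1,2)]) (rule R, assumption+, rule that)
  \<comment> \<open>Outside the closed box \<open>g\<close> vanishes in a whole neighbourhood, so
    its partial derivatives vanish there too and the same compactness bound covers them.\<close>
  have P0: "partial_deriv i g x = 0" if "i < n" "j < n" "R < \<bar>x j\<bar>" for i j x
  proof -
    have "eventually (\<lambda>t. R < \<bar>(x(i := t)) j\<bar>) (nhds (x i))"
    proof (cases "i = j")
      case True
      have "open {t. R < \<bar>t\<bar>}" by (intro open_Collect_less continuous_intros)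
      then show ?thesis using that True by (auto dest: eventually_nhds_in_open)
    qed (use that in auto)
    then have "eventually (\<lambda>t. g (x(i := t)) = 0) (nhds (x i))"
      by eventually_elim (use R that in blast)
    then have "((\<lambda>t. g (x(i := t))) has_real_derivative 0) (at (x i))"
      using DERIV_cong_ev[OF refl _ refl, of "\<lambda>t. g (x(i := t))" "\<lambda>_. 0" "x i" 0] by simp
    then show ?thesis using D(5)[OF that(1)] DERIV_unique by blast
  qed
  have "\<exists>C. \<forall>x. \<bar>partial_deriv i g x\<bar> \<le> C" if i: "i < n" for i
  proof -
    obtain C where "\<And>x. \<bar>partial_deriv i g x\<bar> \<le> C"
      by (rule compact_support_bounded[where R=R, OF D(3,4)[OF i]]) (rule P0[OF i], assumption+, rule that)
    then show ?thesis by blast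
  qed
  then have "\<forall>i. \<exists>C. i < n \<longrightarrow> (\<forall>x. \<bar>partial_deriv i g x\<bar> \<le> C)" by blast
  from choice[OF this] obtain C where C: "\<And>i x. i < n \<Longrightarrow> \<bar>partial_deriv i g x\<bar> \<le> C i" by blast
  show ?thesis
  proof (rule that[of "\<bar>C0\<bar> + (\<Sum>i<n. \<bar>C i\<bar>)"])
    show "\<bar>g x\<bar> \<le> \<bar>C0\<bar> + (\<Sum>i<n. \<bar>C i\<bar>)" for x
      proof -
      have "0 \<le> (\<Sum>i<n. \<bar>C i\<bar>)" by (intro sum_nonneg) auto
      then show ?thesis using C0[of x] by linarith
    qed
    show "\<bar>partial_deriv i g x\<bar> \<le> \<bar>C0\<bar> + (\<Sum>i<n. \<bar>C i\<bar>)" if "i < n" for i x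
      using C[OF that, of x] member_le_sum[of i "{..<n}" "\<lambda>i. \<bar>C i\<bar>"] that by auto
  qed
qed

text \<open>With a polynomial factor in \<open>1 / y\<close>, the family is closed under differentiation.\<close>

definition flat_exp :: "real poly \<Rightarrow> real \<Rightarrow> real" where
  "flat_exp p y = (if y > 0 then poly p (inverse y) * exp (- inverse y) else 0)"

lemma poly_times_exp_tendsto_0: "((\<lambda>x. poly p x * exp (- x)) \<longlongrightarrow> (0::real)) at_top"
proof -
  have "((\<lambda>x. \<Sum>i\<le>degree p. coeff p i * (x ^ i / exp x)) \<longlongrightarrow> (\<Sum>i\<le>degree p. coeff p i * 0)) at_top"
    by (intro tendsto_sum tendsto_mult tendsto_const tendsto_power_div_exp_0)
  then show ?thesis
    by (simp add: poly_altdef sum_distrib_right exp_minus divide_inverse mult.assoc)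
qed

text \<open>The polynomial \<open>[:0, 0, 1:] * (p - pderiv p)\<close> arises from the derivative
  \<open>- 1 / y\<^sup>2\<close> of the inverse, acting on the polynomial and on the exponential. At
  0 the right difference quotient is a polynomial in \<open>1 / y\<close> times a decaying
  exponential of \<open>1 / y\<close>.\<close>

lemma DERIV_flat_exp:
  "(flat_exp p has_real_derivative flat_exp ([:0, 0, 1:] * (p - pderiv p)) y) (at y)"
proof -
  consider "y > 0" | "y < 0" | "y = 0" by linarith
  then show ?thesis
  proof cases
    case 1
    have "((\<lambda>y. poly p (inverse y) * exp (- inverse y)) has_real_derivative
      flat_exp ([:0, 0, 1:] * (p - pderiv p)) y) (at y)"
      using 1 by (auto intro!: derivative_eq_intros DERIV_chain2[OF poly_DERIV]
          simp: flat_exp_def power2_eq_square field_simps)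
    moreover have "eventually (\<lambda>y. flat_exp p y = poly p (inverse y) * exp (- inverse y)) (nhds y)"
      using eventually_nhds_in_open[of "{0<..}" y] 1 by (auto simp: flat_exp_def elim: eventually_mono)
    ultimately show ?thesis by (subst DERIV_cong_ev[OF refl _ refl])
  next
    case 2
    have "eventually (\<lambda>y. flat_exp p y = 0) (nhds y)"
      using eventually_nhds_in_open[of "{..<0}" y] 2 by (auto simp: flat_exp_def elim: eventually_mono)
    then show ?thesis using 2 by (subst DERIV_cong_ev[OF refl _ refl]) (auto simp: flat_exp_def)
  next
    case 3
    have r: "((\<lambda>y. poly ([:0, 1:] * p) (inverse y) * exp (- inverse y)) \<longlongrightarrow> 0) (at_right 0)"
      by (rule filterlim_compose[OF poly_times_exp_tendsto_0 filterlim_inverse_at_top_right])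
    have "((\<lambda>y. (flat_exp p y - flat_exp p 0) / (y - 0)) \<longlongrightarrow> 0) (at_right 0)"
      by (rule Lim_transform_eventually[OF r])
        (use eventually_at_right_less[of 0] in eventually_elim, auto simp: flat_exp_def field_simps)
    moreover have "((\<lambda>y. (flat_exp p y - flat_exp p 0) / (y - 0)) \<longlongrightarrow> 0) (at_left 0)"
      by (rule tendsto_eventually) (auto simp: flat_exp_def eventually_at_filter)
    ultimately have "((\<lambda>y. (flat_exp p y - flat_exp p 0) / (y - 0)) \<longlongrightarrow> 0) (at 0)"
      by (simp add: filterlim_at_split)
    then show ?thesis using 3 by (simp add: has_field_derivative_iff flat_exp_def)
  qed
qed

text \<open>The factor \<open>exp 2\<close> normalises the value at 0 to 1, since each of the two
  flat exponentials equals \<open>exp (- 1)\<close> there.\<close>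

definition bump :: "real \<Rightarrow> real" where
  "bump x = exp 2 * (flat_exp 1 (1 + x) * flat_exp 1 (1 - x))"

lemma Ck_flat_exp: "Ck n k (\<lambda>x. flat_exp p (a * x j + b))"
proof -
  let ?S = "{\<lambda>x. flat_exp p (a * x + b) | p a b. True}"
  have "\<exists>f'\<in>?S. \<forall>x. (f has_real_derivative f' x) (at x)" if fS: "f \<in> ?S" for f
  proof -
    obtain p a b where f: "f = (\<lambda>x. flat_exp p (a * x + b))" using fS by auto
    have "(f has_real_derivative flat_exp (smult a ([:0, 0, 1:] * (p - pderiv p))) (a * x + b)) (at x)" for x
    proof -
      have "(f has_real_derivative flat_exp ([:0, 0, 1:] * (p - pderiv p)) (a * x + b) * a) (at x)"
        unfolding f by (rule DERIV_chain2[OF DERIV_flat_exp]) (auto intro!: derivative_eq_intros)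
      moreover have "flat_exp p' y * a = flat_exp (smult a p') y" for p' y by (simp add: flat_exp_def)
      ultimately show ?thesis by metis
    qed
    then show ?thesis
      by (intro bexI[of _ "\<lambda>x. flat_exp (smult a ([:0, 0, 1:] * (p - pderiv p))) (a * x + b)"]) auto
  qed
  then show ?thesis
    by (rule Ck_coordinate[where S="?S" and f="\<lambda>x. flat_exp p (a * x + b)"]) auto
qed

lemma Ck_bump: "Ck n k (\<lambda>x. bump (x j))"
  unfolding bump_def using Ck_flat_exp[of n k 1 1 j 1] Ck_flat_exp[of n k 1 "-1" j 1]
  by (intro Ck_mult Ck_const) (auto simp: algebra_simps)

lemma bump_0: "bump 0 = 1" and bump_support: "1 < \<bar>x\<bar> \<Longrightarrow> bump x = 0"
  by (auto simp: bump_def flat_exp_def mult_exp_exp abs_if split: if_splits)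

definition cutoff :: "nat \<Rightarrow> (nat \<Rightarrow> real) \<Rightarrow> real" where
  "cutoff n x = (\<Prod>i<n. bump (x i))"

lemma cutoff_0: "cutoff n (\<lambda>_. 0) = 1"
  by (simp add: cutoff_def bump_0)

lemma smooth_compact_support_cutoff: "smooth_compact_support n (cutoff n)"
  unfolding smooth_compact_support_def
proof (intro conjI allI exI impI)
  show "depends_on_first n (cutoff n)" by (auto simp: depends_on_first_def cutoff_def)
  show "Ck n k (cutoff n)" for k unfolding cutoff_def[abs_def] by (intro Ck_prod Ck_bump)
  show "\<bar>x i\<bar> \<le> 1" if "cutoff n x \<noteq> 0" "i < n" for x i
    using that bump_support[of "x i"] by (auto simp: cutoff_def not_less[symmetric])
qed

lemma Ck_hermite: "Ck n k (\<lambda>x. hermite q (x j))"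
proof -
  obtain p where p: "\<And>x. hermite q x = poly p x" using hermite_poly by blast
  have "Ck n k (\<lambda>x. poly p (x j))"
    by (rule Ck_coordinate[of "range poly"]) (use poly_DERIV in blast)+
  then show ?thesis by (simp add: p)
qed

lemma l2_tendsto_dominated:
  assumes P: "sq_int M P" and w: "\<And>k. w k \<in> borel_measurable M" "\<And>k x. \<bar>w k x\<bar> \<le> C"
    "AE x in M. (\<lambda>k. w k x) \<longlonglongrightarrow> l x" "l \<in> borel_measurable M" "\<And>x. \<bar>l x\<bar> \<le> C"
  shows "l2_tendsto M (\<lambda>k x. w k x *\<^sub>R P x) (\<lambda>x. l x *\<^sub>R P x)"
  unfolding l2_tendsto_iff
proof (intro conjI allI)
  note [measurable] = sq_int_measurable[OF P] w(1,4)
  show "sq_int M (\<lambda>x. w k x *\<^sub>R P x)" for k by (rule sq_int_bounded_mult[OF P w(1,2)])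
  show "sq_int M (\<lambda>x. l x *\<^sub>R P x)" by (rule sq_int_bounded_mult[OF P w(4,5)])
  have "(\<lambda>k. \<integral>x. (norm (l x *\<^sub>R P x - w k x *\<^sub>R P x))\<^sup>2 \<partial>M) \<longlonglongrightarrow> (\<integral>x. 0 \<partial>M)"
  proof (rule integral_dominated_convergence[where w="\<lambda>x. (2 * C)\<^sup>2 * (norm (P x))\<^sup>2"])
    show "integrable M (\<lambda>x. (2 * C)\<^sup>2 * (norm (P x))\<^sup>2)" using P by (simp add: sq_int_def)
    show "AE x in M. (\<lambda>k. (norm (l x *\<^sub>R P x - w k x *\<^sub>R P x))\<^sup>2) \<longlonglongrightarrow> 0"
      using w(3)
    proof eventually_elim
      case (elim x)
      have "(\<lambda>k. (norm (l x *\<^sub>R P x - w k x *\<^sub>R P x))\<^sup>2) \<longlonglongrightarrow> (norm (l x *\<^sub>R P x - l x *\<^sub>R P x))\<^sup>2"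
        by (intro tendsto_intros elim)
      then show ?case by simp
    qed
    show "AE x in M. norm ((norm (l x *\<^sub>R P x - w k x *\<^sub>R P x))\<^sup>2) \<le> (2 * C)\<^sup>2 * (norm (P x))\<^sup>2" for k
    proof (rule AE_I2)
      fix x
      have "\<bar>l x - w k x\<bar> \<le> 2 * C" using w(2)[of k x] w(5)[of x] by linarith
      then have "norm (l x *\<^sub>R P x - w k x *\<^sub>R P x) \<le> (2 * C) * norm (P x)"
        unfolding scaleR_diff_left[symmetric] norm_scaleR by (intro mult_right_mono) auto
      then have "(norm (l x *\<^sub>R P x - w k x *\<^sub>R P x))\<^sup>2 \<le> ((2 * C) * norm (P x))\<^sup>2" by (intro power_mono) auto
      then show "norm ((norm (l x *\<^sub>R P x - w k x *\<^sub>R P x))\<^sup>2) \<le> (2 * C)\<^sup>2 * (norm (P x))\<^sup>2"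
        by (simp only: power_mult_distrib) simp
    qed
  qed auto
  then show "(\<lambda>k. \<integral>x. (norm (l x *\<^sub>R P x - w k x *\<^sub>R P x))\<^sup>2 \<partial>M) \<longlonglongrightarrow> 0" by simp
qed

lemma l2norm_scaleR_const: "l2norm M (\<lambda>x. f x *\<^sub>R v) = norm v * l2norm M (f :: _ \<Rightarrow> real)"
  by (simp add: l2norm_def power_mult_distrib real_sqrt_mult mult.commute)

lemma sq_int_scaleR_const: "sq_int M f \<Longrightarrow> sq_int M (\<lambda>x. f x *\<^sub>R v)"
  by (auto simp: sq_int_def power_mult_distrib)

lemma l2_tendsto_scaleR_const:
  assumes "l2_tendsto M s f" shows "l2_tendsto M (\<lambda>k x. s k x *\<^sub>R v) (\<lambda>x. f x *\<^sub>R v)"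
  using assms tendsto_mult_right_zero[of "\<lambda>k. l2norm M (\<lambda>x. f x - s k x)" sequentially "norm v"]
  by (auto simp: l2_tendsto_def l2norm_scaleR_const sq_int_scaleR_const simp flip: scaleR_diff_left)

section \<open>The Malliavin derivative beyond compactly supported functions\<close>

context isonormal_process
begin

lemma cylinder_measurable:
  fixes g :: "(nat \<Rightarrow> real) \<Rightarrow> real"
  assumes "continuous_on UNIV g"
  shows "(\<lambda>\<omega>. g (\<lambda>j. X (\<phi> j) \<omega>)) \<in> borel_measurable (sigma_of M X)"
    "(\<lambda>\<omega>. g (\<lambda>j. X (\<phi> j) \<omega>)) \<in> borel_measurable M"
proof -
  show "(\<lambda>\<omega>. g (\<lambda>j. X (\<phi> j) \<omega>)) \<in> borel_measurable (sigma_of M X)"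
    by (rule measurable_compose[OF _ borel_measurable_continuous_onI[OF assms]])
      (intro measurable_coordinatewise_then_product measurable_sigma_of)
  show "(\<lambda>\<omega>. g (\<lambda>j. X (\<phi> j) \<omega>)) \<in> borel_measurable M"
    by (rule measurable_compose[OF _ borel_measurable_continuous_onI[OF assms]])
      (intro measurable_coordinatewise_then_product X_measurable)
qed

lemma sq_int_smooth:
  assumes g: "smooth_compact_support n g"
  shows "sq_int M (\<lambda>\<omega>. g (\<lambda>j. X (\<phi> j) \<omega>))"
    "i < n \<Longrightarrow> sq_int M (\<lambda>\<omega>. partial_deriv i g (\<lambda>j. X (\<phi> j) \<omega>))"
proof -
  note D = smooth_compact_supportD[OF g]
  obtain C where C: "\<And>x. \<bar>g x\<bar> \<le> C" "\<And>i x. i < n \<Longrightarrow> \<bar>partial_deriv i g x\<bar> \<le> C"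
    using smooth_compact_support_bounded[OF g] by blast
  show "sq_int M (\<lambda>\<omega>. g (\<lambda>j. X (\<phi> j) \<omega>))"
    by (rule sq_int_bounded[OF cylinder_measurable(2)[OF D(1)]]) (use C in simp)
  show "sq_int M (\<lambda>\<omega>. partial_deriv i g (\<lambda>j. X (\<phi> j) \<omega>))" if "i < n"
    by (rule sq_int_bounded[OF cylinder_measurable(2)[OF D(3)[OF that]]]) (use C(2)[OF that] in simp)
qed

lemma sq_int_smooth_functional:
  assumes "smooth_functional X S DS" shows "sq_int M S" "sq_int M DS"
  proof -
  obtain n g \<phi> where g: "smooth_compact_support n g" and S: "S = (\<lambda>\<omega>. g (\<lambda>j. X (\<phi> j) \<omega>))"
    and DS: "DS = (\<lambda>\<omega>. \<Sum>i<n. partial_deriv i g (\<lambda>j. X (\<phi> j) \<omega>) *\<^sub>R \<phi> i)"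
    using assms unfolding smooth_functional_def by blast
  show "sq_int M S" unfolding S by (rule sq_int_smooth(1)[OF g])
  show "sq_int M DS" unfolding DS
    by (intro sq_int_sum sq_int_scaleR_const sq_int_smooth(2)[OF g]) simp
qed

lemma has_malliavin_deriv_iff:
  "has_malliavin_deriv M X F U \<longleftrightarrow>
     (\<exists>S DS. (\<forall>k. smooth_functional X (S k) (DS k)) \<and> l2_tendsto M S F \<and> l2_tendsto M DS U)"
proof
  assume "has_malliavin_deriv M X F U"
  then have F: "sq_int M F" "sq_int M U" and ex: "\<exists>S DS. (\<forall>k. smooth_functional X (S k) (DS k)) \<and>
      (\<lambda>k. \<integral>\<omega>. (F \<omega> - S k \<omega>)\<^sup>2 \<partial>M) \<longlonglongrightarrow> 0 \<and> (\<lambda>k. \<integral>\<omega>. (norm (U \<omega> - DS k \<omega>))\<^sup>2 \<partial>M) \<longlonglongrightarrow> 0"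
    by (simp_all add: has_malliavin_deriv_def sq_int_def)
  from ex obtain S DS where S: "\<And>k. smooth_functional X (S k) (DS k)"
    "(\<lambda>k. \<integral>\<omega>. (F \<omega> - S k \<omega>)\<^sup>2 \<partial>M) \<longlonglongrightarrow> 0" "(\<lambda>k. \<integral>\<omega>. (norm (U \<omega> - DS k \<omega>))\<^sup>2 \<partial>M) \<longlonglongrightarrow> 0"
    by blast
  have "l2_tendsto M S F" "l2_tendsto M DS U"
    using F S(2,3) sq_int_smooth_functional[OF S(1)] by (simp_all add: l2_tendsto_iff)
  then show "\<exists>S DS. (\<forall>k. smooth_functional X (S k) (DS k)) \<and> l2_tendsto M S F \<and> l2_tendsto M DS U"
    using S(1) by blast
next
  assume "\<exists>S DS. (\<forall>k. smooth_functional X (S k) (DS k)) \<and> l2_tendsto M S F \<and> l2_tendsto M DS U"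
  then show "has_malliavin_deriv M X F U"
    by (simp add: has_malliavin_deriv_def l2_tendsto_iff sq_int_def) blast
qed

text \<open>The closure of a graph is closed: for each \<open>k\<close> one smooth functional within
  \<open>1 / real (Suc k)\<close> of both components of the \<open>k\<close>-th pair is selected,
  and the diagonal sequence converges.\<close>

lemma has_malliavin_deriv_closed:
  assumes d: "\<And>k. has_malliavin_deriv M X (F k) (U k)" and F: "l2_tendsto M F G" and U: "l2_tendsto M U V"
  shows "has_malliavin_deriv M X G V"
proof -
  have "\<exists>S DS. smooth_functional X S DS \<and> l2norm M (\<lambda>x. F k x - S x) < 1 / real (Suc k) \<and>
      l2norm M (\<lambda>x. U k x - DS x) < 1 / real (Suc k)" for k
  proof -
    obtain S DS where S: "\<And>j. smooth_functional X (S j) (DS j)" "l2_tendsto M S (F k)" "l2_tendsto M DS (U k)"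
      using d[of k] unfolding has_malliavin_deriv_iff by blast
    have "\<forall>\<^sub>F j in sequentially. l2norm M (\<lambda>x. F k x - S j x) < 1 / real (Suc k)"
      "\<forall>\<^sub>F j in sequentially. l2norm M (\<lambda>x. U k x - DS j x) < 1 / real (Suc k)"
      using order_tendstoD(2)[OF l2_tendstoD(3)[OF S(2)]] order_tendstoD(2)[OF l2_tendstoD(3)[OF S(3)]] by auto
    then have "\<forall>\<^sub>F j in sequentially. l2norm M (\<lambda>x. F k x - S j x) < 1 / real (Suc k) \<and> l2norm M (\<lambda>x. U k x - DS j x) < 1 / real (Suc k)"
      by (rule eventually_conj)
    then obtain j where "l2norm M (\<lambda>x. F k x - S j x) < 1 / real (Suc k) \<and> l2norm M (\<lambda>x. U k x - DS j x) < 1 / real (Suc k)"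
      using eventually_happens'[OF sequentially_bot] by blast
    then show ?thesis using S(1) by blast
  qed
  then obtain S DS where S: "\<And>k. smooth_functional X (S k) (DS k)" "\<And>k. l2norm M (\<lambda>x. F k x - S k x) < 1 / real (Suc k)"
    "\<And>k. l2norm M (\<lambda>x. U k x - DS k x) < 1 / real (Suc k)" by metis
  note f = l2_tendstoD[OF F] and u = l2_tendstoD[OF U]
  note sq = sq_int_smooth_functional[OF S(1)]
  have o: "(\<lambda>k. 1 / real (Suc k)) \<longlonglongrightarrow> 0" by (rule LIMSEQ_Suc[OF lim_1_over_n])
  have "l2_tendsto M S G"
  proof (rule l2_tendsto_bound)
    show "l2norm M (\<lambda>x. G x - S k x) \<le> l2norm M (\<lambda>x. G x - F k x) + 1 / real (Suc k)" for k
      using l2_triangle_diff[OF f(2) f(1)[of k] sq(1)[of k]] S(2)[of k] by simp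
    show "(\<lambda>k. l2norm M (\<lambda>x. G x - F k x) + 1 / real (Suc k)) \<longlonglongrightarrow> 0" using tendsto_add[OF f(3) o] by simp
  qed (use f sq in auto)
  moreover have "l2_tendsto M DS V"
  proof (rule l2_tendsto_bound)
    show "l2norm M (\<lambda>x. V x - DS k x) \<le> l2norm M (\<lambda>x. V x - U k x) + 1 / real (Suc k)" for k
      using l2_triangle_diff[OF u(2) u(1)[of k] sq(2)[of k]] S(3)[of k] by simp
    show "(\<lambda>k. l2norm M (\<lambda>x. V x - U k x) + 1 / real (Suc k)) \<longlonglongrightarrow> 0" using tendsto_add[OF u(3) o] by simp
  qed (use u sq in auto)
  ultimately show ?thesis unfolding has_malliavin_deriv_iff using S(1) by blast
qed

text \<open>Hermite polynomials do not have compact support. Multiplying \<open>p\<close> by the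
  cutoff at scale \<open>1 / r k\<close> makes it admissible; by the product rule the gradient gains
  a term with an extra factor \<open>r k\<close>, which tends to 0, and dominated convergence
  handles both terms.\<close>

lemma has_malliavin_deriv_cylinder:
  assumes n: "n \<ge> 1" and p: "\<And>k. Ck n k p" "depends_on_first n p"
    and P: "sq_int M (\<lambda>\<omega>. p (\<lambda>j. X (\<phi> j) \<omega>))"
    and P': "\<And>i. i < n \<Longrightarrow> sq_int M (\<lambda>\<omega>. partial_deriv i p (\<lambda>j. X (\<phi> j) \<omega>))"
  shows "has_malliavin_deriv M X (\<lambda>\<omega>. p (\<lambda>j. X (\<phi> j) \<omega>))
    (\<lambda>\<omega>. \<Sum>i<n. partial_deriv i p (\<lambda>j. X (\<phi> j) \<omega>) *\<^sub>R \<phi> i)"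
proof -
  define r where "r = (\<lambda>k::nat. 1 / real (Suc k))"
  have r0: "r \<longlonglongrightarrow> 0" unfolding r_def by (rule LIMSEQ_Suc[OF lim_1_over_n])
  have rpos: "0 < r k" for k by (simp add: r_def)
  define K where "K = cutoff n"
  have Ks: "smooth_compact_support n K" unfolding K_def by (rule smooth_compact_support_cutoff)
  note KD = smooth_compact_supportD[OF Ks]
  have KC: "Ck n k K" for k using Ks by (simp add: smooth_compact_support_def)
  obtain C where C: "\<And>x. \<bar>K x\<bar> \<le> C" "\<And>i x. i < n \<Longrightarrow> \<bar>partial_deriv i K x\<bar> \<le> C"
    using smooth_compact_support_bounded[OF Ks] by blast
  have C1: "1 \<le> C" using C(1)[of "\<lambda>_. 0"] by (simp add: K_def cutoff_0)
  define g where "g = (\<lambda>k x. p x * K (\<lambda>j. r k * x j))"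
  have gC: "Ck n m (g k)" for m k unfolding g_def by (intro Ck_mult p Ck_rescale KC)
  have g': "partial_deriv i (g k) x = partial_deriv i p x * K (\<lambda>j. r k * x j) + p x * (r k * partial_deriv i K (\<lambda>j. r k * x j))"
    if i: "i < n" for i k x
  proof -
    have "((\<lambda>s. K ((\<lambda>j. r k * x j)(i := s))) has_real_derivative partial_deriv i K (\<lambda>j. r k * x j)) (at (r k * x i))"
      by (rule KD(5)[OF i, of "\<lambda>j. r k * x j"])
    then have "((\<lambda>t. K ((\<lambda>j. r k * x j)(i := r k * t))) has_real_derivative partial_deriv i K (\<lambda>j. r k * x j) * r k) (at (x i))"
      by (rule DERIV_chain2) (auto intro!: derivative_eq_intros)
    moreover have "(\<lambda>j. r k * x j)(i := r k * t) = (\<lambda>j. r k * (x(i := t)) j)" for t by auto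
    ultimately have K': "((\<lambda>t. K (\<lambda>j. r k * (x(i := t)) j)) has_real_derivative partial_deriv i K (\<lambda>j. r k * x j) * r k) (at (x i))"
      by simp
    have "((\<lambda>t. g k (x(i := t))) has_real_derivative partial_deriv i p x * K (\<lambda>j. r k * x j) + p x * (r k * partial_deriv i K (\<lambda>j. r k * x j))) (at (x i))"
      using DERIV_mult[OF Ck_SucD(1)[OF p(1) i, of x] K']
      unfolding g_def by (simp only: fun_upd_triv mult_ac)
    then show ?thesis using Ck_SucD(1)[OF gC i] DERIV_unique by blast
  qed
  have gs: "smooth_compact_support n (g k)" for k
    unfolding smooth_compact_support_def
  proof (intro conjI allI gC)
    show "depends_on_first n (g k)"
      using p(2) KD(2) unfolding depends_on_first_def g_def by (metis (mono_tags, lifting))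
    obtain R where R: "\<And>x i. K x \<noteq> 0 \<Longrightarrow> i < n \<Longrightarrow> \<bar>x i\<bar> \<le> R"
      using Ks by (auto simp: smooth_compact_support_def)
    have "\<bar>x i\<bar> \<le> R / r k" if "g k x \<noteq> 0" "i < n" for x i
      using R[of "\<lambda>j. r k * x j" i] that rpos[of k] by (auto simp: g_def abs_mult field_simps)
    then show "\<exists>R. \<forall>x. g k x \<noteq> 0 \<longrightarrow> (\<forall>i<n. \<bar>x i\<bar> \<le> R)" by blast
  qed
  have Km: "(\<lambda>\<omega>. K (\<lambda>j. r k * X (\<phi> j) \<omega>)) \<in> borel_measurable M" for k
    by (rule cylinder_measurable(2)[OF Ck_continuous[OF Ck_rescale[OF KC]]])
  have K'm: "(\<lambda>\<omega>. partial_deriv i K (\<lambda>j. r k * X (\<phi> j) \<omega>)) \<in> borel_measurable M" if "i < n" for k i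
    by (rule cylinder_measurable(2)[OF Ck_continuous[OF Ck_rescale[OF Ck_SucD(2)[OF KC that]]]])
  have Klim: "(\<lambda>k. K (\<lambda>j. r k * x j)) \<longlonglongrightarrow> 1" for x
  proof -
    have c: "continuous_on UNIV (\<lambda>s j. s * x j)"
      by (rule continuous_on_coordinatewise_then_product) (intro continuous_intros)
    have "isCont (\<lambda>s. K (\<lambda>j. s * x j)) 0"
      using continuous_on_compose2[OF KD(1) c] by (simp add: continuous_on_eq_continuous_at)
    from isCont_tendsto_compose[OF this r0] show ?thesis by (simp add: K_def cutoff_0)
  qed
  have lim1: "l2_tendsto M (\<lambda>k \<omega>. K (\<lambda>j. r k * X (\<phi> j) \<omega>) *\<^sub>R Q \<omega>) Q" if "sq_int M Q" for Q :: "'w \<Rightarrow> real"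
    using l2_tendsto_dominated[OF that, of "\<lambda>k \<omega>. K (\<lambda>j. r k * X (\<phi> j) \<omega>)" C "\<lambda>_. 1"] Km C(1) Klim C1 by simp
  have lim2: "l2_tendsto M (\<lambda>k \<omega>. (r k * partial_deriv i K (\<lambda>j. r k * X (\<phi> j) \<omega>)) *\<^sub>R p (\<lambda>j. X (\<phi> j) \<omega>)) (\<lambda>_. 0)" if i: "i < n" for i
  proof -
    have "\<bar>r k * partial_deriv i K x\<bar> \<le> C" for k x
    proof -
      have "\<bar>r k\<bar> * \<bar>partial_deriv i K x\<bar> \<le> 1 * C"
        by (intro mult_mono) (use C(2)[OF i] in \<open>auto simp: r_def\<close>)
      then show ?thesis by (simp add: abs_mult)
    qed
    moreover have "(\<lambda>k. r k * partial_deriv i K (\<lambda>j. r k * x j)) \<longlonglongrightarrow> 0" for x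
    proof (rule tendsto_rabs_zero_cancel, rule tendsto_sandwich[OF _ _ tendsto_const])
      show "(\<lambda>k. r k * C) \<longlonglongrightarrow> 0" using tendsto_mult_left_zero[OF r0] .
      show "\<forall>\<^sub>F k in sequentially. \<bar>r k * partial_deriv i K (\<lambda>j. r k * x j)\<bar> \<le> r k * C"
        using C(2)[OF i] rpos by (auto intro!: always_eventually mult_left_mono less_imp_le simp: abs_mult less_imp_le)
    qed auto
    ultimately show ?thesis
      using l2_tendsto_dominated[OF P, of "\<lambda>k \<omega>. r k * partial_deriv i K (\<lambda>j. r k * X (\<phi> j) \<omega>)" C "\<lambda>_. 0"] K'm[OF i] C1
      by simp
  qed
  show ?thesis unfolding has_malliavin_deriv_iff
  proof (intro exI conjI allI)
    show "smooth_functional X (\<lambda>\<omega>. g k (\<lambda>j. X (\<phi> j) \<omega>)) (\<lambda>\<omega>. \<Sum>i<n. partial_deriv i (g k) (\<lambda>j. X (\<phi> j) \<omega>) *\<^sub>R \<phi> i)" for k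
      unfolding smooth_functional_def using gs n by blast
    show "l2_tendsto M (\<lambda>k \<omega>. g k (\<lambda>j. X (\<phi> j) \<omega>)) (\<lambda>\<omega>. p (\<lambda>j. X (\<phi> j) \<omega>))"
      using lim1[OF P] by (simp add: g_def mult.commute)
    show "l2_tendsto M (\<lambda>k \<omega>. \<Sum>i<n. partial_deriv i (g k) (\<lambda>j. X (\<phi> j) \<omega>) *\<^sub>R \<phi> i)
      (\<lambda>\<omega>. \<Sum>i<n. partial_deriv i p (\<lambda>j. X (\<phi> j) \<omega>) *\<^sub>R \<phi> i)"
    proof (intro l2_tendsto_sum l2_tendsto_scaleR_const)
      fix i assume "i \<in> {..<n}"
      then have i: "i < n" by simp
      show "l2_tendsto M (\<lambda>k \<omega>. partial_deriv i (g k) (\<lambda>j. X (\<phi> j) \<omega>)) (\<lambda>\<omega>. partial_deriv i p (\<lambda>j. X (\<phi> j) \<omega>))"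
        using l2_tendsto_add[OF lim1[OF P'[OF i]] lim2[OF i]] by (simp add: g'[OF i] mult_ac)
    qed
  qed
qed

lemma has_malliavin_deriv_hermite_sum:
  fixes n :: nat
  shows "has_malliavin_deriv M X (\<lambda>\<omega>. \<Sum>i<n. c i * hermite (q i) (X (h i) \<omega>))
     (\<lambda>\<omega>. \<Sum>i<n. (c i * hermite_deriv (q i) (X (h i) \<omega>)) *\<^sub>R h i)"
proof -
  define p where "p = (\<lambda>x. \<Sum>i<n. c i * hermite (q i) (x i))"
  \<comment> \<open>One coordinate more than the sum has terms: smooth functionals require at least
    one coordinate, also when the sum is empty. The partial derivative in the additional coordinate
    is 0.\<close>
  have C: "Ck (Suc n) k p" for k unfolding p_def by (intro Ck_sum Ck_mult Ck_const Ck_hermite)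
  have p': "partial_deriv j p x = (if j < n then c j * hermite_deriv (q j) (x j) else 0)" if "j < Suc n" for j x
  proof -
    have "((\<lambda>t. p (x(j := t))) has_real_derivative (\<Sum>i<n. if i = j then c j * hermite_deriv (q j) (x j) else 0)) (at (x j))"
      unfolding p_def
    proof (rule DERIV_sum)
      fix i
      show "((\<lambda>t. c i * hermite (q i) ((x(j := t)) i)) has_real_derivative (if i = j then c j * hermite_deriv (q j) (x j) else 0)) (at (x j))"
        by (cases "i = j") (auto intro!: derivative_eq_intros DERIV_hermite)
    qed
    then have "((\<lambda>t. p (x(j := t))) has_real_derivative (if j < n then c j * hermite_deriv (q j) (x j) else 0)) (at (x j))"
      by (simp add: sum.delta)
    then show ?thesis using Ck_SucD(1)[OF C that] DERIV_unique by blast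
  qed
  have "has_malliavin_deriv M X (\<lambda>\<omega>. p (\<lambda>j. X (h j) \<omega>))
    (\<lambda>\<omega>. \<Sum>i<Suc n. partial_deriv i p (\<lambda>j. X (h j) \<omega>) *\<^sub>R h i)"
  proof (rule has_malliavin_deriv_cylinder[OF _ C])
    show "depends_on_first (Suc n) p" by (auto simp: depends_on_first_def p_def intro!: sum.cong)
    show "sq_int M (\<lambda>\<omega>. p (\<lambda>j. X (h j) \<omega>))"
      unfolding p_def by (intro sq_int_sum sq_int_cmult sq_int_hermite)
    show "sq_int M (\<lambda>\<omega>. partial_deriv i p (\<lambda>j. X (h j) \<omega>))" if "i < Suc n" for i
      unfolding p'[OF that] by (cases "i < n") (simp_all add: sq_int_cmult sq_int_hermite_deriv)
  qed simp
  moreover have "(\<Sum>i<Suc n. partial_deriv i p x *\<^sub>R h i) = (\<Sum>i<n. (c i * hermite_deriv (q i) (x i)) *\<^sub>R h i)" for x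
    by (simp add: p')
  ultimately show ?thesis by (simp only:) (simp add: p_def)
qed

text \<open>The divergence of \<open>w\<close> times \<open>u\<close> is
  \<open>w * X u - w'\<close>, so pairing the derivative with this field can be expressed through
  \<open>F\<close> alone. For smooth functionals this is Gaussian integration by parts of a product,
  and both sides are continuous in L2. All versions of the derivative must agree on such
  pairings.\<close>

lemma malliavin_deriv_weak:
  assumes u: "norm u = 1" and F: "has_malliavin_deriv M X F U"
    and w: "dir_deriv u w w'" "w \<in> borel_measurable M" "w' \<in> borel_measurable M" "\<And>\<omega>. \<bar>w \<omega>\<bar> \<le> C" "\<And>\<omega>. \<bar>w' \<omega>\<bar> \<le> C"
  shows "expectation (\<lambda>\<omega>. inner (U \<omega>) u * w \<omega>) = expectation (\<lambda>\<omega>. F \<omega> * (w \<omega> * X u \<omega> - w' \<omega>))"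
proof -
  obtain S DS where S: "\<And>k. smooth_functional X (S k) (DS k)" "l2_tendsto M S F" "l2_tendsto M DS U"
    using F unfolding has_malliavin_deriv_iff by blast
  have sw: "sq_int M w" "sq_int M w'" by (rule sq_int_bounded[where C=C]; use w in simp)+
  have swX: "sq_int M (\<lambda>\<omega>. w \<omega> * X u \<omega>)" using sq_int_bounded_mult[OF X_sq_int w(2,4)] by simp
  have T: "sq_int M (\<lambda>\<omega>. w \<omega> * X u \<omega> - w' \<omega>)" by (intro sq_int_diff swX sw)
  have id: "expectation (\<lambda>\<omega>. inner (DS k \<omega>) (w \<omega> *\<^sub>R u)) = expectation (\<lambda>\<omega>. S k \<omega> * (w \<omega> * X u \<omega> - w' \<omega>))" for k
  proof -
    note sq = sq_int_smooth_functional[OF S(1)[of k]]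
    obtain n g \<phi> where g: "smooth_compact_support n g" and Sk: "S k = (\<lambda>\<omega>. g (\<lambda>j. X (\<phi> j) \<omega>))"
      and DSk: "DS k = (\<lambda>\<omega>. \<Sum>i<n. partial_deriv i g (\<lambda>j. X (\<phi> j) \<omega>) *\<^sub>R \<phi> i)"
      using S(1)[of k] unfolding smooth_functional_def by blast
    note D = smooth_compact_supportD[OF g]
    have "dir_deriv u (S k) (\<lambda>\<omega>. \<Sum>i<n. partial_deriv i g (\<lambda>j. X (\<phi> j) \<omega>) * inner (\<phi> i) u)"
      unfolding Sk by (rule dir_deriv_cylinder[OF D(1,3,5,2,4)])
    then have "dir_deriv u (S k) (\<lambda>\<omega>. inner (DS k \<omega>) u)"
      by (simp add: DSk inner_sum_left)
    from dir_deriv_mult[OF this w(1)]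
    have dd: "dir_deriv u (\<lambda>\<omega>. S k \<omega> * w \<omega>) (\<lambda>\<omega>. inner (DS k \<omega>) u * w \<omega> + w' \<omega> * S k \<omega>)" .
    have swu: "sq_int M (\<lambda>\<omega>. w \<omega> *\<^sub>R u)" by (rule sq_int_scaleR_const[OF sw(1)])
    have i: "integrable M (\<lambda>\<omega>. inner (DS k \<omega>) u * w \<omega>)" "integrable M (\<lambda>\<omega>. S k \<omega> * w' \<omega>)"
      "integrable M (\<lambda>\<omega>. S k \<omega> * w \<omega>)" "integrable M (\<lambda>\<omega>. S k \<omega> * (w \<omega> * X u \<omega>))"
      using sq_int_inner[OF sq(2) swu] sq_int_mult[OF sq(1) sw(1)] sq_int_mult[OF sq(1) sw(2)] sq_int_mult[OF sq(1) swX]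
      by (auto simp: mult.commute)
    have "expectation (\<lambda>\<omega>. inner (DS k \<omega>) u * w \<omega> + w' \<omega> * S k \<omega>) = expectation (\<lambda>\<omega>. S k \<omega> * w \<omega> * X u \<omega>)"
      by (rule gaussian_integration_by_parts[OF u dd]) (use i in \<open>simp_all add: mult_ac\<close>)
    then show ?thesis using i by (simp add: algebra_simps)
  qed
  have "(\<lambda>k. expectation (\<lambda>\<omega>. inner (DS k \<omega>) (w \<omega> *\<^sub>R u))) \<longlonglongrightarrow> expectation (\<lambda>\<omega>. inner (U \<omega>) (w \<omega> *\<^sub>R u))"
    by (rule l2_tendsto_inner[OF S(3) l2_tendsto_const[OF sq_int_scaleR_const[OF sw(1)]]])
  moreover have "(\<lambda>k. expectation (\<lambda>\<omega>. S k \<omega> * (w \<omega> * X u \<omega> - w' \<omega>))) \<longlonglongrightarrow> expectation (\<lambda>\<omega>. F \<omega> * (w \<omega> * X u \<omega> - w' \<omega>))"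
    by (rule l2_tendsto_mult[OF S(2) l2_tendsto_const[OF T]])
  ultimately show ?thesis unfolding id by (simp add: LIMSEQ_unique mult.commute)
qed

end

section \<open>Chaos expansion\<close>

lemma sum_concat:
  fixes f g :: "nat \<Rightarrow> 'a::comm_monoid_add"
  shows "(\<Sum>i<n + m. if i < n then f i else g (i - n)) = (\<Sum>i<n. f i) + (\<Sum>i<m. g i)"
  by (induction m) (auto simp: add.assoc)

lemma integral_double_sum:
  fixes f :: "'b \<Rightarrow> 'c \<Rightarrow> 'a \<Rightarrow> real"
  assumes "\<And>p q. p \<in> I \<Longrightarrow> q \<in> K \<Longrightarrow> integrable M (f p q)"
  shows "(\<integral>x. (\<Sum>p\<in>I. \<Sum>q\<in>K. f p q x) \<partial>M) = (\<Sum>p\<in>I. \<Sum>q\<in>K. \<integral>x. f p q x \<partial>M)"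
proof -
  have "(\<integral>x. (\<Sum>p\<in>I. \<Sum>q\<in>K. f p q x) \<partial>M) = (\<Sum>p\<in>I. \<integral>x. (\<Sum>q\<in>K. f p q x) \<partial>M)"
    by (intro Bochner_Integration.integral_sum Bochner_Integration.integrable_sum assms)
  also have "\<dots> = (\<Sum>p\<in>I. \<Sum>q\<in>K. \<integral>x. f p q x \<partial>M)"
    by (intro sum.cong refl Bochner_Integration.integral_sum assms)
  finally show ?thesis .
qed

text \<open>By orthogonality the squared norm of a block is at most the matching block of a
  convergent series. The bounded multipliers \<open>b\<close> treat the chaos expansion and the
  series of the pseudo-inverse together.\<close>

lemma (in prob_space) l2_Cauchy_orthogonal_series:
  fixes J :: "nat \<Rightarrow> 'a \<Rightarrow> real"
  assumes J: "\<And>q. q \<ge> 1 \<Longrightarrow> sq_int M (J q)"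
    and orth: "\<And>p q. p \<ge> 1 \<Longrightarrow> q \<ge> 1 \<Longrightarrow> p \<noteq> q \<Longrightarrow> (\<integral>x. J p x * J q x \<partial>M) = 0"
    and sum: "summable (\<lambda>q. if q \<ge> 1 then \<integral>x. (J q x)\<^sup>2 \<partial>M else 0)"
    and b: "\<And>q. \<bar>b q\<bar> \<le> 1"
  shows "l2_Cauchy M (\<lambda>N x. \<Sum>q=1..N. b q * J q x)"
proof -
  define a where "a = (\<lambda>q. if q \<ge> 1 then \<integral>x. (J q x)\<^sup>2 \<partial>M else 0)"
  have a0: "0 \<le> a q" for q by (simp add: a_def)
  have J': "sq_int M (\<lambda>x. b q * J q x)" if "q \<ge> 1" for q by (intro sq_int_cmult J that)
  have sq: "sq_int M (\<lambda>x. \<Sum>q=1..N. b q * J q x)" for N by (intro sq_int_sum J') auto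
  have block: "(\<integral>x. (\<Sum>q\<in>{Suc m..n}. b q * J q x)\<^sup>2 \<partial>M) \<le> sum a {Suc m..n}" for m n
  proof -
    have "(\<integral>x. (\<Sum>q\<in>{Suc m..n}. b q * J q x)\<^sup>2 \<partial>M) =
      (\<integral>x. (\<Sum>p\<in>{Suc m..n}. \<Sum>q\<in>{Suc m..n}. b p * b q * (J p x * J q x)) \<partial>M)"
      by (simp add: power2_eq_square sum_product mult_ac)
    also have "\<dots> = (\<Sum>p\<in>{Suc m..n}. \<Sum>q\<in>{Suc m..n}. b p * b q * (\<integral>x. J p x * J q x \<partial>M))"
    proof -
      have "integrable M (\<lambda>x. b p * b q * (J p x * J q x))" if "p \<in> {Suc m..n}" "q \<in> {Suc m..n}" for p q
        using that by (intro integrable_mult_right sq_int_mult J) auto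
      then have "(\<integral>x. (\<Sum>p\<in>{Suc m..n}. \<Sum>q\<in>{Suc m..n}. b p * b q * (J p x * J q x)) \<partial>M) =
          (\<Sum>p\<in>{Suc m..n}. \<Sum>q\<in>{Suc m..n}. \<integral>x. b p * b q * (J p x * J q x) \<partial>M)"
        by (rule integral_double_sum)
      then show ?thesis by simp
    qed
    also have "\<dots> = (\<Sum>p\<in>{Suc m..n}. \<Sum>q\<in>{Suc m..n}. if q = p then (b p)\<^sup>2 * a p else 0)"
      by (intro sum.cong refl) (auto simp: orth a_def power2_eq_square)
    also have "\<dots> = (\<Sum>p\<in>{Suc m..n}. (b p)\<^sup>2 * a p)" by (intro sum.cong refl) (simp add: sum.delta)
    also have "\<dots> \<le> sum a {Suc m..n}"
    proof (rule sum_mono)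
      fix p
      have "(b p)\<^sup>2 \<le> 1" using b[of p] by (simp add: abs_square_le_1)
      then show "(b p)\<^sup>2 * a p \<le> a p" using mult_right_mono[OF _ a0[of p], of "(b p)\<^sup>2" 1] by simp
    qed
    finally show ?thesis .
  qed
  show ?thesis unfolding l2_Cauchy_def
  proof (intro conjI allI impI sq)
    fix e :: real assume e: "0 < e"
    then have e2: "0 < e\<^sup>2" by simp
    obtain K where K: "\<And>m n. m \<ge> K \<Longrightarrow> norm (sum a {m..<n}) < e\<^sup>2"
      using sum e2 unfolding a_def[symmetric] summable_Cauchy by blast
    have le: "l2norm M (\<lambda>x. (\<Sum>q=1..j. b q * J q x) - (\<Sum>q=1..i. b q * J q x)) < e" if "K \<le> i" "i \<le> j" for i j
    proof -
      have "(\<Sum>q=1..j. b q * J q x) - (\<Sum>q=1..i. b q * J q x) = (\<Sum>q\<in>{Suc i..j}. b q * J q x)" for x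
      proof -
        have "{1..j} = {1..i} \<union> {Suc i..j}" using that by auto
        then show ?thesis by (simp add: sum.union_disjoint)
      qed
      then have "(l2norm M (\<lambda>x. (\<Sum>q=1..j. b q * J q x) - (\<Sum>q=1..i. b q * J q x)))\<^sup>2 \<le> sum a {Suc i..j}"
        using block[of i j] by (simp add: l2norm_sq)
      also have "\<dots> < e\<^sup>2" using K[of "Suc i" "Suc j"] that by (simp add: atLeastLessThanSuc_atLeastAtMost)
      finally show ?thesis using e by (simp add: power_less_imp_less_base)
    qed
    have "l2norm M (\<lambda>x. (\<Sum>q=1..i. b q * J q x) - (\<Sum>q=1..j. b q * J q x)) < e" if "i \<ge> K" "j \<ge> K" for i j
    proof (cases "i \<le> j")
      case True
      then show ?thesis using le[of i j] that l2norm_diff_commute[of M "\<lambda>x. \<Sum>q=1..i. b q * J q x"] by simp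
    next
      case False
      then show ?thesis using le[of j i] that by simp
    qed
    then show "\<exists>K. \<forall>i\<ge>K. \<forall>j\<ge>K. l2norm M (\<lambda>x. (\<Sum>q=1..i. b q * J q x) - (\<Sum>q=1..j. b q * J q x)) < e" by blast
  qed
qed

section \<open>Totality and orthogonality of the chaoses\<close>

context isonormal_process
begin

lemma subalgebra_X: "subalgebra M (sigma_of M X)"
  by (rule subalgebra_sigma_of) simp

lemma sigma_X_measurable: "f \<in> borel_measurable (sigma_of M X) \<Longrightarrow> f \<in> borel_measurable M"
  by (rule measurable_from_subalg[OF subalgebra_X])

lemma L2_functionals_iff: "F \<in> L2_functionals M X \<longleftrightarrow> F \<in> borel_measurable (sigma_of M X) \<and> sq_int M F"
  using sigma_X_measurable by (auto simp: L2_functionals_def sq_int_real)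

text \<open>The hypothesis says that \<open>D\<close> has conditional expectation 0 given
  \<sigma>(X). A measurable factor can be moved inside, hence \<open>w\<close> may be unbounded as
  long as the product is integrable.\<close>

lemma zero_expectation_extend:
  fixes D w :: "'w \<Rightarrow> real"
  assumes D: "integrable M D" and z: "\<And>A. A \<in> sets (sigma_of M X) \<Longrightarrow> expectation (\<lambda>\<omega>. D \<omega> * indicator A \<omega>) = 0"
    and w: "w \<in> borel_measurable (sigma_of M X)" "integrable M (\<lambda>\<omega>. w \<omega> * D \<omega>)"
  shows "expectation (\<lambda>\<omega>. w \<omega> * D \<omega>) = 0"
proof -
  interpret finite_measure_subalgebra M "sigma_of M X"
    by unfold_locales (rule subalgebra_X)
  have "AE \<omega> in M. real_cond_exp M (sigma_of M X) D \<omega> = 0"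
    by (rule real_cond_exp_charact) (use D z in \<open>auto simp: set_lebesgue_integral_def mult.commute\<close>)
  then have "expectation (\<lambda>\<omega>. w \<omega> * real_cond_exp M (sigma_of M X) D \<omega>) = 0"
    by (intro integral_eq_zero_AE) auto
  then show ?thesis using real_cond_exp_intg(2)[OF w(2,1)] D by auto
qed

text \<open>Serves two purposes: totality of the Hermite polynomials, and the comparison of two
  versions of a derivative.\<close>

lemma zero_expectation_trig:
  fixes D w :: "'w \<Rightarrow> real"
  assumes D: "integrable M D"
    and z: "\<And>k. expectation (\<lambda>\<omega>. D \<omega> * cos (X k \<omega>)) = 0" "\<And>k. expectation (\<lambda>\<omega>. D \<omega> * sin (X k \<omega>)) = 0"
    and w: "w \<in> borel_measurable (sigma_of M X)" "integrable M (\<lambda>\<omega>. w \<omega> * D \<omega>)"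
  shows "expectation (\<lambda>\<omega>. w \<omega> * D \<omega>) = 0"
proof (rule zero_expectation_extend[OF D _ w])
  fix A assume A: "A \<in> sets (sigma_of M X)"
  define L where "L = {l \<in> borel_measurable M. \<exists>\<psi>. AE \<omega> in M. l \<omega> = X \<psi> \<omega>}"
  have [measurable]: "D \<in> borel_measurable M" using D by auto
  show "expectation (\<lambda>\<omega>. D \<omega> * indicator A \<omega>) = 0"
  proof (rule char_zero_sigma_of[of D X L, OF D _ _ _ _ _ _ A])
    show "(\<lambda>x. 0) \<in> L" unfolding L_def using X_zero by (auto intro!: exI[of _ 0])
    show "(\<lambda>x. l x + c * X h x) \<in> L" if lL: "l \<in> L" for l h c
    proof -
      obtain \<psi> where \<psi>: "AE \<omega> in M. l \<omega> = X \<psi> \<omega>" using lL unfolding L_def by blast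
      have "AE \<omega> in M. l \<omega> + c * X h \<omega> = X (\<psi> + c *\<^sub>R h) \<omega>"
        using \<psi> X_add_scale[of \<psi> c h] by eventually_elim simp
      then show ?thesis using lL unfolding L_def by (auto intro!: exI[of _ "\<psi> + c *\<^sub>R h"])
    qed
    fix l assume "l \<in> L"
    then obtain \<psi> where l [measurable]: "l \<in> borel_measurable M" and \<psi>: "AE \<omega> in M. l \<omega> = X \<psi> \<omega>"
      unfolding L_def by blast
    have "expectation (\<lambda>\<omega>. D \<omega> * cos (l \<omega>)) = expectation (\<lambda>\<omega>. D \<omega> * cos (X \<psi> \<omega>))"
      "expectation (\<lambda>\<omega>. D \<omega> * sin (l \<omega>)) = expectation (\<lambda>\<omega>. D \<omega> * sin (X \<psi> \<omega>))"
      using \<psi> by (auto intro!: integral_cong_AE)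
    then show "expectation (\<lambda>\<omega>. D \<omega> * cos (l \<omega>)) = 0" "expectation (\<lambda>\<omega>. D \<omega> * sin (l \<omega>)) = 0"
      using z by auto
  qed (auto simp: L_def)
qed

lemma sq_int_exp_X:
  assumes u: "norm u = 1" shows "sq_int M (\<lambda>\<omega>. exp \<bar>t * X u \<omega>\<bar>)"
proof -
  have i: "integrable M (\<lambda>\<omega>. exp (c * X u \<omega>))" for c
  proof -
    \<comment> \<open>Completing the square: an exponential tilt of the standard Gaussian density is
      a multiple of the Gaussian density with mean \<open>c\<close>.\<close>
    have e: "std_normal_density x * exp (c * x) = exp (c\<^sup>2 / 2) * normal_density c 1 x" for x
      by (simp add: normal_density_def exp_add[symmetric] power2_eq_square field_simps)
    have "integrable lborel (\<lambda>x. exp (c\<^sup>2 / 2) * normal_density c 1 x)" by simp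
    then have "integrable std_normal_distribution (\<lambda>x. exp (c * x))"
      by (subst integrable_density) (auto simp: e normal_density_nonneg)
    then show ?thesis unfolding distr_X_unit[OF u, symmetric] by (subst (asm) integrable_distr_eq) auto
  qed
  have "integrable M (\<lambda>\<omega>. (exp \<bar>t * X u \<omega>\<bar>)\<^sup>2)"
  proof (rule Bochner_Integration.integrable_bound[where f="\<lambda>\<omega>. exp ((2 * t) * X u \<omega>) + exp ((- 2 * t) * X u \<omega>)"])
    show "integrable M (\<lambda>\<omega>. exp ((2 * t) * X u \<omega>) + exp ((- 2 * t) * X u \<omega>))" by (intro Bochner_Integration.integrable_add i)
    have "(exp \<bar>y\<bar>)\<^sup>2 \<le> exp (2 * y) + exp (- 2 * y)" for y :: real
      by (cases "y \<ge> 0") (auto simp: exp_double[symmetric] add_increasing add_increasing2)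
    from this[of "t * X u _"] show "AE \<omega> in M. norm ((exp \<bar>t * X u \<omega>\<bar>)\<^sup>2) \<le> norm (exp ((2 * t) * X u \<omega>) + exp ((- 2 * t) * X u \<omega>))"
      by (simp add: mult.assoc abs_of_nonneg add_nonneg_nonneg)
  qed simp
  then show ?thesis by (simp add: sq_int_real)
qed

text \<open>The coefficient bound \<open>1 / fact k\<close> dominates all partial sums by
  \<open>exp \<bar>y\<bar>\<close>, and the Gaussian variable has a square-integrable exponential,
  so the series may be integrated term by term against \<open>R\<close>.\<close>

lemma zero_expectation_power_series:
  assumes u: "norm u = 1" and R: "sq_int M R"
    and z: "\<And>q. expectation (\<lambda>\<omega>. R \<omega> * X u \<omega> ^ q) = 0"
    and c: "\<And>k. \<bar>c k\<bar> \<le> 1 / fact k" "\<And>y. (\<lambda>k. c k * y ^ k) sums f y" and f: "f \<in> borel_measurable borel"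
  shows "expectation (\<lambda>\<omega>. R \<omega> * f (t * X u \<omega>)) = (0::real)"
proof -
  note [measurable] = sq_int_measurable[OF R] f
  have "(\<lambda>n. expectation (\<lambda>\<omega>. R \<omega> * (\<Sum>k<n. c k * (t * X u \<omega>) ^ k))) \<longlonglongrightarrow> expectation (\<lambda>\<omega>. R \<omega> * f (t * X u \<omega>))"
  proof (rule integral_dominated_convergence[where w="\<lambda>\<omega>. \<bar>R \<omega>\<bar> * exp \<bar>t * X u \<omega>\<bar>"])
    show "integrable M (\<lambda>\<omega>. \<bar>R \<omega>\<bar> * exp \<bar>t * X u \<omega>\<bar>)"
      using sq_int_norm_mult[OF R sq_int_exp_X[OF u, of t]] by simp
    show "AE \<omega> in M. (\<lambda>n. R \<omega> * (\<Sum>k<n. c k * (t * X u \<omega>) ^ k)) \<longlonglongrightarrow> R \<omega> * f (t * X u \<omega>)"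
      using c(2) by (auto intro!: tendsto_intros simp: sums_def)
    have b: "\<bar>\<Sum>k<n. c k * y ^ k\<bar> \<le> exp \<bar>y\<bar>" for y n
    proof -
      have "\<bar>\<Sum>k<n. c k * y ^ k\<bar> \<le> (\<Sum>k<n. \<bar>y\<bar> ^ k / fact k)"
      proof (rule order_trans[OF sum_abs], rule sum_mono)
        fix k
        have "\<bar>c k\<bar> * \<bar>y\<bar> ^ k \<le> 1 / fact k * \<bar>y\<bar> ^ k" by (intro mult_right_mono c) auto
        then show "\<bar>c k * y ^ k\<bar> \<le> \<bar>y\<bar> ^ k / fact k" by (simp add: abs_mult power_abs)
      qed
      also have "\<dots> \<le> exp \<bar>y\<bar>"
        using sum_le_suminf[OF summable_exp[of "\<bar>y\<bar>"], of "{..<n}"]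
        by (simp add: exp_def divide_inverse mult.commute scaleR_conv_of_real)
      finally show ?thesis .
    qed
    show "AE \<omega> in M. norm (R \<omega> * (\<Sum>k<n. c k * (t * X u \<omega>) ^ k)) \<le> \<bar>R \<omega>\<bar> * exp \<bar>t * X u \<omega>\<bar>" for n
      proof (rule AE_I2)
      fix \<omega>
      show "norm (R \<omega> * (\<Sum>k<n. c k * (t * X u \<omega>) ^ k)) \<le> \<bar>R \<omega>\<bar> * exp \<bar>t * X u \<omega>\<bar>"
        unfolding real_norm_def abs_mult[of "R \<omega>"] by (intro mult_left_mono b) simp
    qed
  qed auto
  moreover have "expectation (\<lambda>\<omega>. R \<omega> * (\<Sum>k<n. c k * (t * X u \<omega>) ^ k)) = 0" for n
  proof -
    have "expectation (\<lambda>\<omega>. R \<omega> * (\<Sum>k<n. c k * (t * X u \<omega>) ^ k)) = expectation (\<lambda>\<omega>. \<Sum>k<n. (c k * t ^ k) * (R \<omega> * X u \<omega> ^ k))"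
      by (simp add: sum_distrib_left power_mult_distrib mult_ac)
    also have "\<dots> = (\<Sum>k<n. (c k * t ^ k) * expectation (\<lambda>\<omega>. R \<omega> * X u \<omega> ^ k))"
      using sq_int_mult[OF R sq_int_X_power[of u]] by (simp add: Bochner_Integration.integral_sum)
    finally show ?thesis using z by simp
  qed
  ultimately show ?thesis by (simp add: LIMSEQ_const_iff)
qed

text \<open>The mean is a separate assumption because a trivial Hilbert space has no unit vectors.\<close>

lemma hermite_total:
  assumes R: "sq_int M R" "R \<in> borel_measurable (sigma_of M X)"
    and m: "expectation R = 0"
    and z: "\<And>q u. norm u = 1 \<Longrightarrow> expectation (\<lambda>\<omega>. R \<omega> * hermite q (X u \<omega>)) = 0"
  shows "expectation (\<lambda>\<omega>. (R \<omega>)\<^sup>2) = 0"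
proof -
  note [measurable] = sq_int_measurable[OF R(1)]
  have mom: "expectation (\<lambda>\<omega>. R \<omega> * X u \<omega> ^ q) = 0" if u: "norm u = 1" for u q
  proof -
    obtain c where c: "\<And>x. x ^ q = (\<Sum>j\<le>q. c j * hermite j x)" using monom_in_hermite_span by blast
    have "expectation (\<lambda>\<omega>. R \<omega> * X u \<omega> ^ q) = expectation (\<lambda>\<omega>. \<Sum>j\<le>q. c j * (R \<omega> * hermite j (X u \<omega>)))"
      by (simp add: c sum_distrib_left mult_ac)
    also have "\<dots> = (\<Sum>j\<le>q. c j * expectation (\<lambda>\<omega>. R \<omega> * hermite j (X u \<omega>)))"
      using sq_int_mult[OF R(1) sq_int_hermite] by (simp add: Bochner_Integration.integral_sum)
    finally show ?thesis using z[OF u] by simp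
  qed
  have cb: "\<bar>cos_coeff k\<bar> \<le> 1 / fact k" "\<bar>sin_coeff k\<bar> \<le> 1 / fact k" for k
    by (auto simp: cos_coeff_def sin_coeff_def power_abs abs_divide)
  have series: "(\<lambda>k. cos_coeff k * y ^ k) sums cos y" "(\<lambda>k. sin_coeff k * y ^ k) sums sin y" for y :: real
    using cos_converges[of y] sin_converges[of y] by simp_all
  have unit: "expectation (\<lambda>\<omega>. R \<omega> * cos (t * X u \<omega>)) = 0" "expectation (\<lambda>\<omega>. R \<omega> * sin (t * X u \<omega>)) = 0"
    if u: "norm u = 1" for u t
    using zero_expectation_power_series[OF u R(1) mom[OF u], of cos_coeff cos t]
      zero_expectation_power_series[OF u R(1) mom[OF u], of sin_coeff sin t] cb
      series by auto
  have trig: "expectation (\<lambda>\<omega>. R \<omega> * cos (X k \<omega>)) = 0 \<and> expectation (\<lambda>\<omega>. R \<omega> * sin (X k \<omega>)) = 0" for k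
  proof (cases "k = 0")
    case True
    have "expectation (\<lambda>\<omega>. R \<omega> * cos (X k \<omega>)) = expectation R" "expectation (\<lambda>\<omega>. R \<omega> * sin (X k \<omega>)) = expectation (\<lambda>_. 0)"
      by (rule integral_cong_AE; use X_zero True in \<open>auto elim!: eventually_mono\<close>)+
    then show ?thesis using m by simp
  next
    case False
    define u where "u = k /\<^sub>R norm k"
    have u: "norm u = 1" and k: "k = norm k *\<^sub>R u" using False by (auto simp: u_def)
    have ae: "AE \<omega> in M. X k \<omega> = norm k * X u \<omega>" using X_scale[of "norm k" u] k by simp
    have "expectation (\<lambda>\<omega>. R \<omega> * cos (X k \<omega>)) = expectation (\<lambda>\<omega>. R \<omega> * cos (norm k * X u \<omega>))"
      "expectation (\<lambda>\<omega>. R \<omega> * sin (X k \<omega>)) = expectation (\<lambda>\<omega>. R \<omega> * sin (norm k * X u \<omega>))"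
      by (rule integral_cong_AE; use ae in \<open>auto elim!: eventually_mono\<close>)+
    then show ?thesis using unit[OF u] by simp
  qed
  \<comment> \<open>\<open>R\<close> is itself an admissible test variable, being
    \<sigma>(X)-measurable with integrable square.\<close>
  have "expectation (\<lambda>\<omega>. R \<omega> * R \<omega>) = 0"
    by (rule zero_expectation_trig[OF sq_int_integrable[OF R(1)] _ _ R(2) sq_int_mult[OF R(1) R(1)]]) (use trig in auto)
  then show ?thesis by (simp add: power2_eq_square)
qed

lemma hermite_measurable_sigma: "(\<lambda>\<omega>. hermite q (X h \<omega>)) \<in> borel_measurable (sigma_of M X)"
  by (rule measurable_compose[OF measurable_sigma_of[of X h M]]) simp

lemma hermite_spanE:
  assumes "s \<in> hermite_span X q"
  obtains n c h where "\<forall>i<(n::nat). norm (h i) = 1" "s = (\<lambda>\<omega>. \<Sum>i<n. c i * hermite q (X (h i) \<omega>))"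
  using assms unfolding hermite_span_def by blast

lemma hermite_span_sq_int:
  assumes "s \<in> hermite_span X q" shows "sq_int M s" "s \<in> borel_measurable (sigma_of M X)"
proof -
  obtain n :: nat and c h where s: "s = (\<lambda>\<omega>. \<Sum>i<n. c i * hermite q (X (h i) \<omega>))" using assms by (rule hermite_spanE) blast
  show "sq_int M s" unfolding s by (intro sq_int_sum sq_int_cmult sq_int_hermite)
  show "s \<in> borel_measurable (sigma_of M X)" unfolding s
    by (intro borel_measurable_sum borel_measurable_times borel_measurable_const hermite_measurable_sigma)
qed

lemma hermite_in_span: "norm u = 1 \<Longrightarrow> (\<lambda>\<omega>. hermite q (X u \<omega>)) \<in> hermite_span X q"
  unfolding hermite_span_def by (rule CollectI, rule exI[of _ 1], rule exI[of _ "\<lambda>_. 1"], rule exI[of _ "\<lambda>_. u"]) auto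

lemma hermite_span_zero: "(\<lambda>\<omega>. 0) \<in> hermite_span X q"
  unfolding hermite_span_def by (rule CollectI, rule exI[of _ 0]) auto

lemma hermite_span_linear:
  assumes "s \<in> hermite_span X q" "t \<in> hermite_span X q"
  shows "(\<lambda>\<omega>. s \<omega> + a * t \<omega>) \<in> hermite_span X q"
proof -
  obtain n :: nat and c h where s: "\<forall>i<n. norm (h i) = 1" "s = (\<lambda>\<omega>. \<Sum>i<n. c i * hermite q (X (h i) \<omega>))"
    using assms(1) by (rule hermite_spanE) blast
  obtain m :: nat and d g where t: "\<forall>i<m. norm (g i) = 1" "t = (\<lambda>\<omega>. \<Sum>i<m. d i * hermite q (X (g i) \<omega>))"
    using assms(2) by (rule hermite_spanE) blast
  have "s \<omega> + a * t \<omega> = (\<Sum>i<n + m. (if i < n then c i else a * d (i - n)) * hermite q (X (if i < n then h i else g (i - n)) \<omega>))" for \<omega>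
  proof -
    have "s \<omega> + a * t \<omega> = (\<Sum>i<n + m. if i < n then c i * hermite q (X (h i) \<omega>) else a * d (i - n) * hermite q (X (g (i - n)) \<omega>))"
      by (simp add: sum_concat[where f="\<lambda>i. c i * hermite q (X (h i) \<omega>)" and g="\<lambda>i. a * d i * hermite q (X (g i) \<omega>)"] s(2) t(2) sum_distrib_left mult.assoc)
    then show ?thesis by (simp add: if_distrib cong: sum.cong) (auto intro!: sum.cong)
  qed
  moreover have "\<forall>i<n + m. norm (if i < n then h i else g (i - n)) = 1" using s(1) t(1) by auto
  ultimately show ?thesis unfolding hermite_span_def
    by (intro CollectI exI[of _ "n + m"] exI[of _ "\<lambda>i. if i < n then c i else a * d (i - n)"]
        exI[of _ "\<lambda>i. if i < n then h i else g (i - n)"] conjI ext)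
qed

lemma hermite_span_orthogonal:
  assumes "s \<in> hermite_span X p" "t \<in> hermite_span X q" "p \<noteq> q"
  shows "expectation (\<lambda>\<omega>. s \<omega> * t \<omega>) = 0"
proof -
  obtain n :: nat and c h where s: "\<forall>i<n. norm (h i) = 1" "s = (\<lambda>\<omega>. \<Sum>i<n. c i * hermite p (X (h i) \<omega>))"
    using assms(1) by (rule hermite_spanE) blast
  obtain m :: nat and d g where t: "\<forall>i<m. norm (g i) = 1" "t = (\<lambda>\<omega>. \<Sum>i<m. d i * hermite q (X (g i) \<omega>))"
    using assms(2) by (rule hermite_spanE) blast
  have "expectation (\<lambda>\<omega>. s \<omega> * t \<omega>) = expectation (\<lambda>\<omega>. \<Sum>i<n. \<Sum>j<m. (c i * d j) * (hermite p (X (h i) \<omega>) * hermite q (X (g j) \<omega>)))"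
    by (simp add: s(2) t(2) sum_product mult_ac)
  also have "\<dots> = (\<Sum>i<n. \<Sum>j<m. (c i * d j) * expectation (\<lambda>\<omega>. hermite p (X (h i) \<omega>) * hermite q (X (g j) \<omega>)))"
    using sq_int_mult[OF sq_int_hermite sq_int_hermite] by (simp add: Bochner_Integration.integral_sum)
  also have "\<dots> = 0" using s(1) t(1) assms(3) by (simp add: hermite_covariance)
  finally show ?thesis .
qed

lemma hermite_span_mean_zero:
  assumes "s \<in> hermite_span X q" "q \<ge> 1" shows "expectation s = 0"
proof -
  obtain n :: nat and c h where s: "\<forall>i<n. norm (h i) = 1" "s = (\<lambda>\<omega>. \<Sum>i<n. c i * hermite q (X (h i) \<omega>))"
    using assms(1) by (rule hermite_spanE) blast
  have "expectation s = (\<Sum>i<n. c i * expectation (\<lambda>\<omega>. hermite q (X (h i) \<omega>)))"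
    unfolding s(2) using sq_int_integrable[OF sq_int_hermite] by (simp add: Bochner_Integration.integral_sum)
  also have "\<dots> = 0"
    using s(1) assms(2) hermite_covariance[of "h _" "h _" q 0] by (intro sum.neutral) auto
  finally show ?thesis .
qed

lemma wiener_chaos_iff:
  assumes "q \<ge> 1"
  shows "G \<in> wiener_chaos M X q \<longleftrightarrow> G \<in> L2_functionals M X \<and> (\<exists>S. (\<forall>k. S k \<in> hermite_span X q) \<and> l2_tendsto M S G)"
proof -
  have "(\<lambda>k. \<integral>\<omega>. (G \<omega> - S k \<omega>)\<^sup>2 \<partial>M) \<longlonglongrightarrow> 0 \<longleftrightarrow> l2_tendsto M S G"
    if "G \<in> L2_functionals M X" "\<forall>k. S k \<in> hermite_span X q" for S
    proof -
    have "\<forall>k. sq_int M (S k)" using that hermite_span_sq_int by blast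
    then show ?thesis using that(1) by (simp add: l2_tendsto_iff L2_functionals_iff)
  qed
  note * = this
  have "wiener_chaos M X q = {F \<in> L2_functionals M X. \<exists>S. (\<forall>k. S k \<in> hermite_span X q) \<and>
      (\<lambda>k. \<integral>\<omega>. (F \<omega> - S k \<omega>)\<^sup>2 \<partial>M) \<longlonglongrightarrow> 0}"
    using assms by (simp add: wiener_chaos_def)
  then show ?thesis using * by (simp only: mem_Collect_eq) (metis (no_types, lifting))
qed

text \<open>\<open>chaos_proj\<close> is a choice, so a projection has to be exhibited.
  \<open>l2_projection\<close> yields one onto the closed span; orthogonality to the span passes to
  its limits because the inner product is continuous.\<close>

lemma chaos_proj:
  assumes q: "q \<ge> 1" and F: "sq_int M F"
  shows "chaos_proj M X q F \<in> wiener_chaos M X q"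
    "Y \<in> wiener_chaos M X q \<Longrightarrow> expectation (\<lambda>\<omega>. (F \<omega> - chaos_proj M X q F \<omega>) * Y \<omega>) = 0"
proof -
  have "\<exists>G. G \<in> wiener_chaos M X q \<and> (\<forall>Y\<in>wiener_chaos M X q. expectation (\<lambda>\<omega>. (F \<omega> - G \<omega>) * Y \<omega>) = 0)"
  proof -
    obtain G s where G: "G \<in> borel_measurable (sigma_of M X)" "\<And>k::nat. s k \<in> hermite_span X q" "l2_tendsto M s G"
      "\<And>Y. Y \<in> hermite_span X q \<Longrightarrow> expectation (\<lambda>\<omega>. (F \<omega> - G \<omega>) * Y \<omega>) = 0"
      by (rule l2_projection[OF F subalgebra_X, of "hermite_span X q"])
        (use hermite_span_sq_int hermite_span_zero hermite_span_linear in auto)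
    have G2: "sq_int M G" by (rule l2_tendstoD(2)[OF G(3)])
    have "G \<in> wiener_chaos M X q" unfolding wiener_chaos_iff[OF q] L2_functionals_iff using G G2 by blast
    moreover have "expectation (\<lambda>\<omega>. (F \<omega> - G \<omega>) * Y \<omega>) = 0" if Y: "Y \<in> wiener_chaos M X q" for Y
    proof -
      obtain S where S: "\<And>k. S k \<in> hermite_span X q" "l2_tendsto M S Y" using Y unfolding wiener_chaos_iff[OF q] by blast
      have "(\<lambda>k. expectation (\<lambda>\<omega>. (F \<omega> - G \<omega>) * S k \<omega>)) \<longlonglongrightarrow> expectation (\<lambda>\<omega>. (F \<omega> - G \<omega>) * Y \<omega>)"
        by (rule l2_tendsto_mult[OF l2_tendsto_const[OF sq_int_diff[OF F G2]] S(2)])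
      then show ?thesis using G(4)[OF S(1)] by (simp add: LIMSEQ_const_iff)
    qed
    ultimately show ?thesis by blast
  qed
  from someI_ex[OF this] show "chaos_proj M X q F \<in> wiener_chaos M X q"
    "Y \<in> wiener_chaos M X q \<Longrightarrow> expectation (\<lambda>\<omega>. (F \<omega> - chaos_proj M X q F \<omega>) * Y \<omega>) = 0"
    unfolding chaos_proj_def by auto
qed

lemma hermite_span_subset_chaos:
  assumes "q \<ge> 1" "s \<in> hermite_span X q" shows "s \<in> wiener_chaos M X q"
  unfolding wiener_chaos_iff[OF assms(1)] L2_functionals_iff
  by (intro conjI exI[of _ "\<lambda>_. s"] allI hermite_span_sq_int[OF assms(2)] assms(2) l2_tendsto_const)

lemma wiener_chaos_orthogonal:
  assumes "p \<ge> 1" "q \<ge> 1" "p \<noteq> q" "F \<in> wiener_chaos M X p" "G \<in> wiener_chaos M X q"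
  shows "expectation (\<lambda>\<omega>. F \<omega> * G \<omega>) = 0"
proof -
  obtain S where S: "\<And>k. S k \<in> hermite_span X p" "l2_tendsto M S F" using assms(1,4) unfolding wiener_chaos_iff[OF assms(1)] by blast
  obtain T where T: "\<And>k. T k \<in> hermite_span X q" "l2_tendsto M T G" using assms(2,5) unfolding wiener_chaos_iff[OF assms(2)] by blast
  show ?thesis
    using l2_tendsto_mult[OF S(2) T(2)] hermite_span_orthogonal[OF S(1) T(1) assms(3)]
    by (simp add: LIMSEQ_const_iff)
qed

lemma wiener_chaos_sq_int: "q \<ge> 1 \<Longrightarrow> G \<in> wiener_chaos M X q \<Longrightarrow> sq_int M G"
  by (simp add: wiener_chaos_iff L2_functionals_iff)

lemma wiener_chaos_measurable: "q \<ge> 1 \<Longrightarrow> G \<in> wiener_chaos M X q \<Longrightarrow> G \<in> borel_measurable (sigma_of M X)"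
  by (simp add: wiener_chaos_iff L2_functionals_iff)

lemma wiener_chaos_mean_zero:
  assumes "q \<ge> 1" "G \<in> wiener_chaos M X q" shows "expectation G = 0"
proof -
  obtain S where S: "\<And>k. S k \<in> hermite_span X q" "l2_tendsto M S G" using assms unfolding wiener_chaos_iff[OF assms(1)] by blast
  show ?thesis
    using l2_tendsto_mult[OF S(2) l2_tendsto_const[OF sq_int_const[of 1]]] hermite_span_mean_zero[OF S(1) assms(1)]
    by (simp add: LIMSEQ_const_iff)
qed

text \<open>Bessel's inequality: the squared distance from \<open>F\<close> to a partial sum is
  non-negative, which bounds the sum of the squared norms by the second moment of
  \<open>F\<close>.\<close>

lemma chaos_proj_summable:
  assumes F: "sq_int M F"
  shows "summable (\<lambda>q. if q \<ge> 1 then expectation (\<lambda>\<omega>. (chaos_proj M X q F \<omega>)\<^sup>2) else 0)"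
proof -
  let ?J = "\<lambda>q. chaos_proj M X q F"
  let ?a = "\<lambda>q. if q \<ge> 1 then expectation (\<lambda>\<omega>. (?J q \<omega>)\<^sup>2) else 0"
  note J = chaos_proj[OF _ F]
  have Jsq: "sq_int M (?J q)" if "q \<ge> 1" for q by (rule wiener_chaos_sq_int[OF that J(1)[OF that]])
  have FJ: "expectation (\<lambda>\<omega>. F \<omega> * ?J q \<omega>) = ?a q" if "q \<ge> 1" for q
    using J(2)[OF that J(1)[OF that]] sq_int_mult[OF F Jsq[OF that]] sq_int_mult[OF Jsq[OF that] Jsq[OF that]] that
    by (simp add: left_diff_distrib power2_eq_square)
  show ?thesis
  proof (rule summableI_nonneg_bounded[where x="expectation (\<lambda>\<omega>. (F \<omega>)\<^sup>2)"])
    fix n :: nat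
    let ?I = "{1..<n}"
    have iF: "integrable M (\<lambda>\<omega>. (F \<omega>)\<^sup>2)" using F by (simp add: sq_int_real)
    have iFJ: "integrable M (\<lambda>\<omega>. F \<omega> * ?J q \<omega>)" if "q \<in> ?I" for q using that by (intro sq_int_mult F Jsq) auto
    have iJJ: "integrable M (\<lambda>\<omega>. ?J p \<omega> * ?J q \<omega>)" if "p \<in> ?I" "q \<in> ?I" for p q using that by (intro sq_int_mult Jsq) auto
    have "0 \<le> expectation (\<lambda>\<omega>. (F \<omega> - (\<Sum>q\<in>?I. ?J q \<omega>))\<^sup>2)" by simp
    also have "\<dots> = expectation (\<lambda>\<omega>. (F \<omega>)\<^sup>2 - 2 * (\<Sum>q\<in>?I. F \<omega> * ?J q \<omega>) + (\<Sum>p\<in>?I. \<Sum>q\<in>?I. ?J p \<omega> * ?J q \<omega>))"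
      unfolding sum_product[symmetric] sum_distrib_left[symmetric] sum_distrib_right[symmetric]
      by (simp add: power2_eq_square algebra_simps)
    also have "\<dots> = expectation (\<lambda>\<omega>. (F \<omega>)\<^sup>2) - 2 * (\<Sum>q\<in>?I. expectation (\<lambda>\<omega>. F \<omega> * ?J q \<omega>))
        + (\<Sum>p\<in>?I. \<Sum>q\<in>?I. expectation (\<lambda>\<omega>. ?J p \<omega> * ?J q \<omega>))"
      proof -
      have "integrable M (\<lambda>\<omega>. \<Sum>q\<in>?I. F \<omega> * ?J q \<omega>)" "integrable M (\<lambda>\<omega>. \<Sum>p\<in>?I. \<Sum>q\<in>?I. ?J p \<omega> * ?J q \<omega>)"
        by (intro Bochner_Integration.integrable_sum iFJ iJJ; assumption)+
      then have "expectation (\<lambda>\<omega>. (F \<omega>)\<^sup>2 - 2 * (\<Sum>q\<in>?I. F \<omega> * ?J q \<omega>) + (\<Sum>p\<in>?I. \<Sum>q\<in>?I. ?J p \<omega> * ?J q \<omega>)) =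
          expectation (\<lambda>\<omega>. (F \<omega>)\<^sup>2) - 2 * expectation (\<lambda>\<omega>. \<Sum>q\<in>?I. F \<omega> * ?J q \<omega>)
          + expectation (\<lambda>\<omega>. \<Sum>p\<in>?I. \<Sum>q\<in>?I. ?J p \<omega> * ?J q \<omega>)"
        using iF by simp
      then show ?thesis
        using Bochner_Integration.integral_sum[of ?I M, OF iFJ] integral_double_sum[of ?I ?I M, OF iJJ] by simp
    qed
    also have "(\<Sum>p\<in>?I. \<Sum>q\<in>?I. expectation (\<lambda>\<omega>. ?J p \<omega> * ?J q \<omega>)) = (\<Sum>p\<in>?I. \<Sum>q\<in>?I. if q = p then ?a p else 0)"
      by (intro sum.cong refl) (auto simp: wiener_chaos_orthogonal[OF _ _ _ J(1) J(1)] power2_eq_square)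
    also have "\<dots> = (\<Sum>p\<in>?I. ?a p)" by (intro sum.cong refl) (simp add: sum.delta)
    also have "(\<Sum>q\<in>?I. expectation (\<lambda>\<omega>. F \<omega> * ?J q \<omega>)) = (\<Sum>q\<in>?I. ?a q)"
      by (intro sum.cong refl) (use FJ in auto)
    finally have "(\<Sum>q\<in>?I. ?a q) \<le> expectation (\<lambda>\<omega>. (F \<omega>)\<^sup>2)" by simp
    moreover have "(\<Sum>q<n. ?a q) = (\<Sum>q\<in>?I. ?a q)" by (rule sum.mono_neutral_right) auto
    ultimately show "(\<Sum>q<n. ?a q) \<le> expectation (\<lambda>\<omega>. (F \<omega>)\<^sup>2)" by simp
  qed auto
qed

lemma chaos_series_Cauchy:
  assumes F: "sq_int M F" and b: "\<And>q. \<bar>b q\<bar> \<le> 1"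
  shows "l2_Cauchy M (\<lambda>N \<omega>. \<Sum>q=1..N. b q * chaos_proj M X q F \<omega>)"
  by (rule l2_Cauchy_orthogonal_series[OF _ _ chaos_proj_summable[OF F] b])
    (use wiener_chaos_sq_int wiener_chaos_orthogonal chaos_proj[OF _ F] in blast)+

lemma chaos_series_converges:
  assumes F: "sq_int M F" and b: "\<And>q. \<bar>b q\<bar> \<le> 1"
  obtains G where "G \<in> L2_functionals M X" "l2_tendsto M (\<lambda>N \<omega>. \<Sum>q=1..N. b q * chaos_proj M X q F \<omega>) G"
proof -
  have "(\<lambda>\<omega>. \<Sum>q=1..N. b q * chaos_proj M X q F \<omega>) \<in> borel_measurable (sigma_of M X)" for N
    by (intro borel_measurable_sum borel_measurable_times borel_measurable_const
        wiener_chaos_measurable[OF _ chaos_proj(1)[OF _ F]]) auto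
  from l2_complete[OF chaos_series_Cauchy[OF F b] subalgebra_X this]
  obtain G where "G \<in> borel_measurable (sigma_of M X)" "l2_tendsto M (\<lambda>N \<omega>. \<Sum>q=1..N. b q * chaos_proj M X q F \<omega>) G"
    by blast
  then show ?thesis using that l2_tendstoD(2) by (auto simp: L2_functionals_iff)
qed

text \<open>The series converges to some \<open>G\<close>, and the residual \<open>F - G\<close> is
  orthogonal to every Hermite variable, hence zero by \<open>hermite_total\<close>. Order 0 is
  absent from the sum because \<open>F\<close> is centered.\<close>

lemma chaos_expansion:
  assumes F: "F \<in> L2_functionals M X" "expectation F = 0"
  shows "l2_tendsto M (\<lambda>N \<omega>. \<Sum>q=1..N. chaos_proj M X q F \<omega>) F"
proof -
  have F2: "sq_int M F" using F by (simp add: L2_functionals_iff)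
  let ?J = "\<lambda>q. chaos_proj M X q F"
  note J = chaos_proj[OF _ F2]
  have Jsq: "sq_int M (?J q)" if "q \<ge> 1" for q by (rule wiener_chaos_sq_int[OF that J(1)[OF that]])
  obtain G where G: "G \<in> L2_functionals M X" "l2_tendsto M (\<lambda>N \<omega>. \<Sum>q=1..N. ?J q \<omega>) G"
    using chaos_series_converges[OF F2, of "\<lambda>_. 1"] by auto
  define R where "R = (\<lambda>\<omega>. F \<omega> - G \<omega>)"
  have G2: "sq_int M G" using G by (simp add: L2_functionals_iff)
  have R2: "sq_int M R" unfolding R_def by (rule sq_int_diff[OF F2 G2])
  have RY: "(\<lambda>N. expectation (\<lambda>\<omega>. (F \<omega> - (\<Sum>q=1..N. ?J q \<omega>)) * Y \<omega>)) \<longlonglongrightarrow> expectation (\<lambda>\<omega>. R \<omega> * Y \<omega>)" if "sq_int M Y" for Y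
    unfolding R_def by (rule l2_tendsto_mult[OF l2_tendsto_diff[OF l2_tendsto_const[OF F2] G(2)] l2_tendsto_const[OF that]])
  have R0: "expectation R = 0"
  proof -
    have "expectation (\<lambda>\<omega>. (F \<omega> - (\<Sum>q=1..N. ?J q \<omega>)) * 1) = 0" for N
      proof -
      have "expectation (\<lambda>\<omega>. F \<omega> - (\<Sum>q=1..N. ?J q \<omega>)) = expectation F - expectation (\<lambda>\<omega>. \<Sum>q=1..N. ?J q \<omega>)"
        by (intro Bochner_Integration.integral_diff sq_int_integrable[OF F2] Bochner_Integration.integrable_sum
            sq_int_integrable[OF Jsq]) auto
      also have "expectation (\<lambda>\<omega>. \<Sum>q=1..N. ?J q \<omega>) = (\<Sum>q=1..N. expectation (?J q))"
        by (intro Bochner_Integration.integral_sum sq_int_integrable[OF Jsq]) auto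
      also have "\<dots> = 0" by (intro sum.neutral ballI wiener_chaos_mean_zero[OF _ J(1)]) auto
      finally show ?thesis using F(2) by simp
    qed
    then show ?thesis using RY[OF sq_int_const[of 1]] by (simp add: LIMSEQ_const_iff)
  qed
  have RH: "expectation (\<lambda>\<omega>. R \<omega> * hermite p (X u \<omega>)) = 0" if u: "norm u = 1" for p u
  proof (cases "p = 0")
    case True
    then show ?thesis using R0 by simp
  next
    case False
    then have p: "p \<ge> 1" by simp
    let ?Y = "\<lambda>\<omega>. hermite p (X u \<omega>)"
    have Y: "?Y \<in> wiener_chaos M X p" by (rule hermite_span_subset_chaos[OF p hermite_in_span[OF u]])
    \<comment> \<open>Once \<open>N\<close> has reached \<open>p\<close>, only the projection of
      order \<open>p\<close> sees a Hermite variable of that order, and it removes the pairing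
      exactly. The sequence of pairings is thus eventually 0.\<close>
    have "expectation (\<lambda>\<omega>. (F \<omega> - (\<Sum>q=1..N. ?J q \<omega>)) * ?Y \<omega>) = 0" if N: "N \<ge> p" for N
    proof -
      have i: "integrable M (\<lambda>\<omega>. F \<omega> * ?Y \<omega>)" "q \<ge> 1 \<Longrightarrow> integrable M (\<lambda>\<omega>. ?J q \<omega> * ?Y \<omega>)" for q
        by (intro sq_int_mult F2 Jsq sq_int_hermite; simp)+
      have "expectation (\<lambda>\<omega>. (F \<omega> - (\<Sum>q=1..N. ?J q \<omega>)) * ?Y \<omega>) = expectation (\<lambda>\<omega>. F \<omega> * ?Y \<omega> - (\<Sum>q=1..N. ?J q \<omega> * ?Y \<omega>))"
        by (simp add: left_diff_distrib sum_distrib_right)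
      also have "\<dots> = expectation (\<lambda>\<omega>. F \<omega> * ?Y \<omega>) - (\<Sum>q=1..N. expectation (\<lambda>\<omega>. ?J q \<omega> * ?Y \<omega>))"
        proof -
        have "expectation (\<lambda>\<omega>. F \<omega> * ?Y \<omega> - (\<Sum>q=1..N. ?J q \<omega> * ?Y \<omega>)) =
            expectation (\<lambda>\<omega>. F \<omega> * ?Y \<omega>) - expectation (\<lambda>\<omega>. \<Sum>q=1..N. ?J q \<omega> * ?Y \<omega>)"
          by (intro Bochner_Integration.integral_diff Bochner_Integration.integrable_sum i) auto
        also have "expectation (\<lambda>\<omega>. \<Sum>q=1..N. ?J q \<omega> * ?Y \<omega>) = (\<Sum>q=1..N. expectation (\<lambda>\<omega>. ?J q \<omega> * ?Y \<omega>))"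
          by (intro Bochner_Integration.integral_sum i) auto
        finally show ?thesis .
      qed
      also have "(\<Sum>q=1..N. expectation (\<lambda>\<omega>. ?J q \<omega> * ?Y \<omega>)) = (\<Sum>q=1..N. if q = p then expectation (\<lambda>\<omega>. ?J p \<omega> * ?Y \<omega>) else 0)"
        by (intro sum.cong refl) (use wiener_chaos_orthogonal[OF _ p _ J(1) Y] in auto)
      also have "\<dots> = expectation (\<lambda>\<omega>. ?J p \<omega> * ?Y \<omega>)" using N p by (simp add: sum.delta)
      finally show ?thesis using J(2)[OF p Y] i(1) i(2)[OF p] by (simp add: left_diff_distrib)
    qed
    then have "\<forall>\<^sub>F N in sequentially. expectation (\<lambda>\<omega>. (F \<omega> - (\<Sum>q=1..N. ?J q \<omega>)) * ?Y \<omega>) = 0"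
      unfolding eventually_sequentially by blast
    from LIMSEQ_unique[OF RY[OF sq_int_hermite] tendsto_eventually[OF this]] show ?thesis .
  qed
  have "R \<in> borel_measurable (sigma_of M X)"
    using F G unfolding R_def by (auto simp: L2_functionals_iff)
  from hermite_total[OF R2 this R0 RH] have R0': "l2norm M R = 0" by (simp add: l2norm_def)
  show ?thesis
  proof (rule l2_tendsto_bound)
    show "l2norm M (\<lambda>\<omega>. F \<omega> - (\<Sum>q=1..N. ?J q \<omega>)) \<le> l2norm M (\<lambda>\<omega>. G \<omega> - (\<Sum>q=1..N. ?J q \<omega>))" for N
      using l2_triangle_diff[OF F2 G2 l2_tendstoD(1)[OF G(2)], of N] R0' unfolding R_def by simp
  qed (use l2_tendstoD[OF G(2)] F2 in auto)
qed

lemma OU_pseudo_inverse_tendsto: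
  assumes F: "sq_int M F"
  shows "OU_pseudo_inverse M X F \<in> L2_functionals M X"
    "l2_tendsto M (\<lambda>N \<omega>. - (\<Sum>q=1..N. chaos_proj M X q F \<omega> / real q)) (OU_pseudo_inverse M X F)"
proof -
  have T: "sq_int M (\<lambda>\<omega>. - (\<Sum>q=1..N. chaos_proj M X q F \<omega> / real q))" for N
    unfolding divide_inverse mult.commute[of _ "inverse _"]
    by (intro sq_int_minus sq_int_sum sq_int_cmult wiener_chaos_sq_int[OF _ chaos_proj(1)[OF _ F]]) auto
  obtain G where G: "G \<in> L2_functionals M X" "l2_tendsto M (\<lambda>N \<omega>. \<Sum>q=1..N. (- 1 / real q) * chaos_proj M X q F \<omega>) G"
  proof (rule chaos_series_converges[OF F])
    \<comment> \<open>The bound is required for all indices; at \<open>q = 0\<close>, which the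
      series omits, division by zero yields 0.\<close>
    show "\<bar>- 1 / real q\<bar> \<le> 1" for q by (cases q) auto
  qed
  have eq: "(\<Sum>q=1..N. (- 1 / real q) * chaos_proj M X q F \<omega>) = - (\<Sum>q=1..N. chaos_proj M X q F \<omega> / real q)" for N \<omega>
    by (simp add: sum_negf)
  have "l2_tendsto M (\<lambda>N \<omega>. - (\<Sum>q=1..N. chaos_proj M X q F \<omega> / real q)) G" using G(2) unfolding eq .
  then have ex: "\<exists>G. G \<in> L2_functionals M X \<and>
     (\<lambda>N. \<integral>\<omega>. (G \<omega> - (- (\<Sum>q=1..N. chaos_proj M X q F \<omega> / real q)))\<^sup>2 \<partial>M) \<longlonglongrightarrow> 0"
    using G(1) by (auto simp: l2_tendsto_iff)
  from someI_ex[OF ex] show O: "OU_pseudo_inverse M X F \<in> L2_functionals M X"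
    and "l2_tendsto M (\<lambda>N \<omega>. - (\<Sum>q=1..N. chaos_proj M X q F \<omega> / real q)) (OU_pseudo_inverse M X F)"
    unfolding OU_pseudo_inverse_def[symmetric] using T by (auto simp: l2_tendsto_iff L2_functionals_iff)
qed

end

section \<open>The pseudo-inverse and integration by parts\<close>

context isonormal_process
begin

text \<open>\<open>U\<close> is the derivative of \<open>P\<close>, and \<open>A = - L P\<close>.\<close>

definition hermite_triple :: "('w \<Rightarrow> real) \<Rightarrow> ('w \<Rightarrow> 'h) \<Rightarrow> ('w \<Rightarrow> real) \<Rightarrow> bool" where
  "hermite_triple P U A \<longleftrightarrow> (\<exists>(n::nat) c q h. (\<forall>i<n. norm (h i) = 1) \<and>
     P = (\<lambda>\<omega>. \<Sum>i<n. c i * hermite (q i) (X (h i) \<omega>)) \<and>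
     U = (\<lambda>\<omega>. \<Sum>i<n. (c i * hermite_deriv (q i) (X (h i) \<omega>)) *\<^sub>R h i) \<and>
     A = (\<lambda>\<omega>. \<Sum>i<n. c i * real (q i) * hermite (q i) (X (h i) \<omega>)))"

lemma hermite_tripleE:
  assumes "hermite_triple P U A"
  obtains n :: nat and c q h where "\<And>i. i < n \<Longrightarrow> norm (h i) = 1"
     "P = (\<lambda>\<omega>. \<Sum>i<n. c i * hermite (q i) (X (h i) \<omega>))"
     "U = (\<lambda>\<omega>. \<Sum>i<n. (c i * hermite_deriv (q i) (X (h i) \<omega>)) *\<^sub>R h i)"
     "A = (\<lambda>\<omega>. \<Sum>i<n. c i * real (q i) * hermite (q i) (X (h i) \<omega>))"
  using assms unfolding hermite_triple_def by blast

lemma hermite_triple_sq_int: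
  assumes "hermite_triple P U A" shows "sq_int M P" "sq_int M U" "sq_int M A"
proof -
  from assms obtain n :: nat and c q h where "\<And>i. i < n \<Longrightarrow> norm (h i) = 1"
     and P: "P = (\<lambda>\<omega>. \<Sum>i<n. c i * hermite (q i) (X (h i) \<omega>))"
     and U: "U = (\<lambda>\<omega>. \<Sum>i<n. (c i * hermite_deriv (q i) (X (h i) \<omega>)) *\<^sub>R h i)"
     and A: "A = (\<lambda>\<omega>. \<Sum>i<n. c i * real (q i) * hermite (q i) (X (h i) \<omega>))"
    by (rule hermite_tripleE) blast
  show "sq_int M P" unfolding P by (intro sq_int_sum sq_int_cmult sq_int_hermite)
  show "sq_int M U" unfolding U by (intro sq_int_sum sq_int_scaleR_const sq_int_cmult sq_int_hermite_deriv)
  show "sq_int M A" unfolding A by (intro sq_int_sum sq_int_cmult sq_int_hermite)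
qed

lemma hermite_triple_has_malliavin_deriv: "hermite_triple P U A \<Longrightarrow> has_malliavin_deriv M X P U"
  by (erule hermite_tripleE) (simp only: has_malliavin_deriv_hermite_sum)

lemma hermite_triple_zero: "hermite_triple (\<lambda>_. 0) (\<lambda>_. 0) (\<lambda>_. 0)"
  unfolding hermite_triple_def by (intro exI[of _ 0]) auto

lemma hermite_triple_linear:
  assumes "hermite_triple P U A" "hermite_triple Q V B"
  shows "hermite_triple (\<lambda>\<omega>. P \<omega> + a * Q \<omega>) (\<lambda>\<omega>. U \<omega> + a *\<^sub>R V \<omega>) (\<lambda>\<omega>. A \<omega> + a * B \<omega>)"
proof -
  from assms(1) obtain n :: nat and c q h where h: "\<And>i. i < n \<Longrightarrow> norm (h i) = 1"
     and P: "P = (\<lambda>\<omega>. \<Sum>i<n. c i * hermite (q i) (X (h i) \<omega>))"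
     and U: "U = (\<lambda>\<omega>. \<Sum>i<n. (c i * hermite_deriv (q i) (X (h i) \<omega>)) *\<^sub>R h i)"
     and A: "A = (\<lambda>\<omega>. \<Sum>i<n. c i * real (q i) * hermite (q i) (X (h i) \<omega>))"
    by (rule hermite_tripleE) blast
  from assms(2) obtain m :: nat and d r g where g: "\<And>i. i < m \<Longrightarrow> norm (g i) = 1"
     and Q: "Q = (\<lambda>\<omega>. \<Sum>i<m. d i * hermite (r i) (X (g i) \<omega>))"
     and V: "V = (\<lambda>\<omega>. \<Sum>i<m. (d i * hermite_deriv (r i) (X (g i) \<omega>)) *\<^sub>R g i)"
     and B: "B = (\<lambda>\<omega>. \<Sum>i<m. d i * real (r i) * hermite (r i) (X (g i) \<omega>))"
    by (rule hermite_tripleE) blast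
  define c' where "c' = (\<lambda>i. if i < n then c i else a * d (i - n))"
  define q' where "q' = (\<lambda>i. if i < n then q i else r (i - n))"
  define h' where "h' = (\<lambda>i. if i < n then h i else g (i - n))"
  have "\<forall>i<n + m. norm (h' i) = 1" using h g by (auto simp: h'_def)
  moreover have "P \<omega> + a * Q \<omega> = (\<Sum>i<n + m. c' i * hermite (q' i) (X (h' i) \<omega>))" for \<omega>
  proof -
    have "P \<omega> + a * Q \<omega> = (\<Sum>i<n. c i * hermite (q i) (X (h i) \<omega>)) + (\<Sum>i<m. a * d i * hermite (r i) (X (g i) \<omega>))"
      by (simp add: P Q sum_distrib_left mult.assoc)
    also have "\<dots> = (\<Sum>i<n + m. c' i * hermite (q' i) (X (h' i) \<omega>))"
      unfolding sum_concat[symmetric] by (intro sum.cong refl) (auto simp: c'_def q'_def h'_def)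
    finally show ?thesis .
  qed
  moreover have "U \<omega> + a *\<^sub>R V \<omega> = (\<Sum>i<n + m. (c' i * hermite_deriv (q' i) (X (h' i) \<omega>)) *\<^sub>R h' i)" for \<omega>
  proof -
    have "U \<omega> + a *\<^sub>R V \<omega> = (\<Sum>i<n. (c i * hermite_deriv (q i) (X (h i) \<omega>)) *\<^sub>R h i) + (\<Sum>i<m. (a * d i * hermite_deriv (r i) (X (g i) \<omega>)) *\<^sub>R g i)"
      by (simp add: U V scaleR_sum_right mult.assoc)
    also have "\<dots> = (\<Sum>i<n + m. (c' i * hermite_deriv (q' i) (X (h' i) \<omega>)) *\<^sub>R h' i)"
      unfolding sum_concat[symmetric] by (intro sum.cong refl) (auto simp: c'_def q'_def h'_def)
    finally show ?thesis .
  qed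
  moreover have "A \<omega> + a * B \<omega> = (\<Sum>i<n + m. c' i * real (q' i) * hermite (q' i) (X (h' i) \<omega>))" for \<omega>
  proof -
    have "A \<omega> + a * B \<omega> = (\<Sum>i<n. c i * real (q i) * hermite (q i) (X (h i) \<omega>)) + (\<Sum>i<m. a * d i * real (r i) * hermite (r i) (X (g i) \<omega>))"
      by (simp add: A B sum_distrib_left mult.assoc)
    also have "\<dots> = (\<Sum>i<n + m. c' i * real (q' i) * hermite (q' i) (X (h' i) \<omega>))"
      unfolding sum_concat[symmetric] by (intro sum.cong refl) (auto simp: c'_def q'_def h'_def)
    finally show ?thesis .
  qed
  ultimately show ?thesis unfolding hermite_triple_def
    by (intro exI[of _ "n + m"] exI[of _ c'] exI[of _ q'] exI[of _ h'] conjI ext)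
qed

lemma hermite_triple_sum:
  assumes "finite I" "\<And>i. i \<in> I \<Longrightarrow> hermite_triple (P i) (U i) (A i)"
  shows "hermite_triple (\<lambda>\<omega>. \<Sum>i\<in>I. P i \<omega>) (\<lambda>\<omega>. \<Sum>i\<in>I. U i \<omega>) (\<lambda>\<omega>. \<Sum>i\<in>I. A i \<omega>)"
  using assms
proof (induction I rule: finite_induct)
  case empty
  then show ?case using hermite_triple_zero by simp
next
  case (insert i I)
  then show ?case using hermite_triple_linear[of "P i" "U i" "A i" _ _ _ 1] by simp
qed

lemma hermite_triple_span:
  assumes "s \<in> hermite_span X q"
  shows "\<exists>U. hermite_triple (\<lambda>\<omega>. b * s \<omega>) U (\<lambda>\<omega>. b * real q * s \<omega>)"
proof -
  obtain n :: nat and c h where s: "\<forall>i<n. norm (h i) = 1" "s = (\<lambda>\<omega>. \<Sum>i<n. c i * hermite q (X (h i) \<omega>))"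
    using assms by (rule hermite_spanE) blast
  have "hermite_triple (\<lambda>\<omega>. b * s \<omega>) (\<lambda>\<omega>. \<Sum>i<n. (b * c i * hermite_deriv q (X (h i) \<omega>)) *\<^sub>R h i) (\<lambda>\<omega>. b * real q * s \<omega>)"
    unfolding hermite_triple_def using s
    by (intro exI[of _ n] exI[of _ "\<lambda>i. b * c i"] exI[of _ "\<lambda>_. q"] exI[of _ h])
      (auto simp: sum_distrib_left mult_ac)
  then show ?thesis by blast
qed

text \<open>A gradient understood direction by direction, independent of the Malliavin closure.
  Hermite sums and smooth functions of smooth functionals both have one, so a single duality formula
  covers the energy estimate and the integration by parts.\<close>

definition has_gradient :: "('w \<Rightarrow> real) \<Rightarrow> ('w \<Rightarrow> 'h) \<Rightarrow> bool" where
  "has_gradient B W \<longleftrightarrow> sq_int M B \<and> sq_int M W \<and> (\<forall>u. norm u = 1 \<longrightarrow> dir_deriv u B (\<lambda>\<omega>. inner (W \<omega>) u))"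

text \<open>In direction \<open>h i\<close> the derivative of a Hermite polynomial of degree q is q
  times the one of degree q - 1, and integration by parts raises the degree back to q. What remains
  is the factor q, the eigenvalue of - L on that chaos.\<close>

lemma hermite_triple_duality:
  assumes B: "has_gradient B W" and T: "hermite_triple P U A"
  shows "expectation (\<lambda>\<omega>. inner (W \<omega>) (U \<omega>)) = expectation (\<lambda>\<omega>. B \<omega> * A \<omega>)"
proof -
  from T obtain n :: nat and c q h where h: "\<And>i. i < n \<Longrightarrow> norm (h i) = 1"
     and U: "U = (\<lambda>\<omega>. \<Sum>i<n. (c i * hermite_deriv (q i) (X (h i) \<omega>)) *\<^sub>R h i)"
     and A: "A = (\<lambda>\<omega>. \<Sum>i<n. c i * real (q i) * hermite (q i) (X (h i) \<omega>))"
    by (rule hermite_tripleE) blast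
  have B2: "sq_int M B" "sq_int M W" and d: "\<And>u. norm u = 1 \<Longrightarrow> dir_deriv u B (\<lambda>\<omega>. inner (W \<omega>) u)"
    using B by (auto simp: has_gradient_def)
  have Wu: "sq_int M (\<lambda>\<omega>. inner (W \<omega>) u)" if "norm u = 1" for u
  proof (rule sq_int_bound[OF _ sq_int_norm[OF B2(2)]])
    show "(\<lambda>\<omega>. inner (W \<omega>) u) \<in> borel_measurable M" using sq_int_measurable[OF B2(2)] by simp
    show "norm (inner (W x) u) \<le> norm (norm (W x))" for x
      using Cauchy_Schwarz_ineq2[of "W x" u] that by simp
  qed
  have tm: "expectation (\<lambda>\<omega>. inner (W \<omega>) (h i) * hermite_deriv (q i) (X (h i) \<omega>)) = real (q i) * expectation (\<lambda>\<omega>. B \<omega> * hermite (q i) (X (h i) \<omega>))"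
    if i: "i < n" for i
  proof (cases "q i")
    case 0
    then show ?thesis by simp
  next
    case (Suc p)
    have "expectation (\<lambda>\<omega>. inner (W \<omega>) (h i) * hermite p (X (h i) \<omega>)) = expectation (\<lambda>\<omega>. B \<omega> * hermite (Suc p) (X (h i) \<omega>))"
      by (rule hermite_integration_by_parts[OF h[OF i] d[OF h[OF i]] B2(1) Wu[OF h[OF i]]])
    then show ?thesis by (simp add: Suc mult.left_commute[of _ "1 + real p"] del: hermite.simps)
  qed
  have i1: "integrable M (\<lambda>\<omega>. c i * (inner (W \<omega>) (h i) * hermite_deriv (q i) (X (h i) \<omega>)))" if "i < n" for i
    by (intro integrable_mult_right sq_int_mult Wu h that sq_int_hermite_deriv)
  have i2: "integrable M (\<lambda>\<omega>. c i * real (q i) * (B \<omega> * hermite (q i) (X (h i) \<omega>)))" for i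
    by (intro integrable_mult_right sq_int_mult B2 sq_int_hermite)
  have "expectation (\<lambda>\<omega>. inner (W \<omega>) (U \<omega>)) = expectation (\<lambda>\<omega>. \<Sum>i<n. c i * (inner (W \<omega>) (h i) * hermite_deriv (q i) (X (h i) \<omega>)))"
    by (simp add: U inner_sum_right mult_ac)
  also have "\<dots> = (\<Sum>i<n. c i * expectation (\<lambda>\<omega>. inner (W \<omega>) (h i) * hermite_deriv (q i) (X (h i) \<omega>)))"
    using Bochner_Integration.integral_sum[of "{..<n}" M, OF i1] by simp
  also have "\<dots> = (\<Sum>i<n. c i * (real (q i) * expectation (\<lambda>\<omega>. B \<omega> * hermite (q i) (X (h i) \<omega>))))"
    by (intro sum.cong refl) (simp add: tm)
  also have "\<dots> = (\<Sum>i<n. expectation (\<lambda>\<omega>. c i * real (q i) * (B \<omega> * hermite (q i) (X (h i) \<omega>))))"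
    by (simp add: mult.assoc)
  also have "\<dots> = expectation (\<lambda>\<omega>. \<Sum>i<n. c i * real (q i) * (B \<omega> * hermite (q i) (X (h i) \<omega>)))"
    using Bochner_Integration.integral_sum[of "{..<n}" M, OF i2] by simp
  also have "\<dots> = expectation (\<lambda>\<omega>. B \<omega> * A \<omega>)"
    by (simp add: A sum_distrib_left mult_ac)
  finally show ?thesis .
qed

lemma dir_deriv_sum:
  assumes "\<And>i. i \<in> I \<Longrightarrow> dir_deriv u (A i) (A' i)"
  shows "dir_deriv u (\<lambda>\<omega>. \<Sum>i\<in>I. A i \<omega>) (\<lambda>\<omega>. \<Sum>i\<in>I. A' i \<omega>)"
  using assms by (induction I rule: infinite_finite_induct) (auto intro: dir_deriv_const dir_deriv_add)

lemma hermite_triple_has_gradient: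
  assumes T: "hermite_triple P U A" shows "has_gradient P U"
proof -
  from T obtain n :: nat and c q h where P: "P = (\<lambda>\<omega>. \<Sum>i<n. c i * hermite (q i) (X (h i) \<omega>))"
     and U: "U = (\<lambda>\<omega>. \<Sum>i<n. (c i * hermite_deriv (q i) (X (h i) \<omega>)) *\<^sub>R h i)"
    by (rule hermite_tripleE) blast
  have "dir_deriv u P (\<lambda>\<omega>. inner (U \<omega>) u)" for u
  proof -
    have "dir_deriv u P (\<lambda>\<omega>. \<Sum>i<n. 0 * hermite (q i) (X (h i) \<omega>) + hermite_deriv (q i) (X (h i) \<omega>) * inner (h i) u * c i)"
      unfolding P by (intro dir_deriv_sum dir_deriv_mult dir_deriv_const dir_deriv_hermite)
    then show ?thesis by (simp add: U inner_sum_left mult_ac)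
  qed
  then show ?thesis using hermite_triple_sq_int[OF T] by (simp add: has_gradient_def)
qed

text \<open>Duality of \<open>P\<close> with itself: the derivative is controlled by
  \<open>P\<close> and by its image \<open>A\<close> under - L. Applied to differences, it makes
  derivatives Cauchy as soon as both of these are.\<close>

lemma hermite_triple_energy:
  assumes T: "hermite_triple P U A" shows "(l2norm M U)\<^sup>2 \<le> l2norm M P * l2norm M A"
proof -
  note sq = hermite_triple_sq_int[OF T]
  have "(l2norm M U)\<^sup>2 = expectation (\<lambda>\<omega>. inner (U \<omega>) (U \<omega>))" by (simp add: l2norm_sq power2_norm_eq_inner)
  also have "\<dots> = expectation (\<lambda>\<omega>. P \<omega> * A \<omega>)"
    by (rule hermite_triple_duality[OF hermite_triple_has_gradient[OF T] T])
  also have "\<dots> \<le> l2norm M P * l2norm M A"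
    using l2_cauchy_schwarz_inner[OF sq(1,3)] by simp
  finally show ?thesis .
qed

text \<open>Chaos projections are only limits of Hermite sums, so each is replaced by a nearby
  element of the span. Then \<open>P\<close> approximates the pseudo-inverse while \<open>A\<close>
  approximates \<open>- F\<close>; the energy estimate supplies the limit \<open>V\<close> of the
  derivatives.\<close>

lemma OU_pseudo_inverse_approx:
  assumes F: "F \<in> L2_functionals M X" "expectation F = 0"
  obtains P U A V where "\<And>N::nat. hermite_triple (P N) (U N) (A N)"
    "l2_tendsto M P (OU_pseudo_inverse M X F)" "l2_tendsto M A (\<lambda>\<omega>. - F \<omega>)" "l2_tendsto M U V"
proof -
  have F2: "sq_int M F" using F by (simp add: L2_functionals_iff)
  let ?J = "\<lambda>q. chaos_proj M X q F" and ?G = "OU_pseudo_inverse M X F"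
  note J = chaos_proj[OF _ F2]
  have Jsq: "sq_int M (?J q)" if "q \<ge> 1" for q by (rule wiener_chaos_sq_int[OF that J(1)[OF that]])
  \<comment> \<open>The tolerance is quadratic in \<open>1 / Suc N\<close> because up to
    \<open>N\<close> such errors are added and their sum still has to tend to 0.\<close>
  define e where "e = (\<lambda>N::nat. 1 / (real (Suc N))\<^sup>2)"
  have epos: "0 < e N" for N by (simp add: e_def)
  define s where "s = (\<lambda>N q. SOME s. s \<in> hermite_span X q \<and> l2norm M (\<lambda>\<omega>. ?J q \<omega> - s \<omega>) < e N)"
  have s: "s N q \<in> hermite_span X q \<and> l2norm M (\<lambda>\<omega>. ?J q \<omega> - s N q \<omega>) < e N" if q: "q \<ge> 1" for N q
  proof -
    obtain S where S: "\<And>k. S k \<in> hermite_span X q" "l2_tendsto M S (?J q)"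
      using J(1)[OF q] unfolding wiener_chaos_iff[OF q] by blast
    obtain k where "l2norm M (\<lambda>\<omega>. ?J q \<omega> - S k \<omega>) < e N"
      using eventually_happens'[OF sequentially_bot order_tendstoD(2)[OF l2_tendstoD(3)[OF S(2)] epos[of N]]] by blast
    then have "S k \<in> hermite_span X q \<and> l2norm M (\<lambda>\<omega>. ?J q \<omega> - S k \<omega>) < e N" using S(1) by blast
    then show ?thesis unfolding s_def
      by (rule someI[where P="\<lambda>s. s \<in> hermite_span X q \<and> l2norm M (\<lambda>\<omega>. ?J q \<omega> - s \<omega>) < e N"])
  qed
  note s = s[THEN conjunct1] s[THEN conjunct2]
  have ssq: "sq_int M (s N q)" if "q \<ge> 1" for N q by (rule hermite_span_sq_int(1)[OF s(1)[OF that]])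
  define P where "P = (\<lambda>N \<omega>. \<Sum>q=1..N. (- 1 / real q) * s N q \<omega>)"
  \<comment> \<open>The eigenvalue \<open>real q\<close> cancels the weight of the pseudo-inverse.
    The product is left unsimplified so that it matches \<open>hermite_triple_span\<close>.\<close>
  define A where "A = (\<lambda>N \<omega>. \<Sum>q=1..N. (- 1 / real q) * real q * s N q \<omega>)"
  define u where "u = (\<lambda>N q. SOME U. hermite_triple (\<lambda>\<omega>. (- 1 / real q) * s N q \<omega>) U (\<lambda>\<omega>. (- 1 / real q) * real q * s N q \<omega>))"
  have u: "hermite_triple (\<lambda>\<omega>. (- 1 / real q) * s N q \<omega>) (u N q) (\<lambda>\<omega>. (- 1 / real q) * real q * s N q \<omega>)" if "q \<ge> 1" for N q
    unfolding u_def by (rule someI_ex[OF hermite_triple_span[OF s(1)[OF that]]])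
  define U where "U = (\<lambda>N \<omega>. \<Sum>q=1..N. u N q \<omega>)"
  have T: "hermite_triple (P N) (U N) (A N)" for N
    unfolding P_def U_def A_def
    by (rule hermite_triple_sum, simp, rule u) simp
  note sq = hermite_triple_sq_int[OF T]
  have close: "l2norm M (\<lambda>\<omega>. (\<Sum>q=1..N. b q * ?J q \<omega>) - (\<Sum>q=1..N. b q * s N q \<omega>)) \<le> 1 / real (Suc N)"
    if b: "\<And>q. \<bar>b q\<bar> \<le> 1" for b N
  proof -
    have "l2norm M (\<lambda>\<omega>. \<Sum>q=1..m. b q * (?J q \<omega> - s N q \<omega>)) \<le> real m * e N" for m
    proof (induction m)
      case 0
      show ?case by (simp add: l2norm_def)
    next
      case (Suc m)
      have "l2norm M (\<lambda>\<omega>. b (Suc m) * (?J (Suc m) \<omega> - s N (Suc m) \<omega>)) = \<bar>b (Suc m)\<bar> * l2norm M (\<lambda>\<omega>. ?J (Suc m) \<omega> - s N (Suc m) \<omega>)"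
        using l2norm_scaleR[of M "b (Suc m)" "\<lambda>\<omega>. ?J (Suc m) \<omega> - s N (Suc m) \<omega>"] by simp
      also have "\<dots> \<le> 1 * e N" using b[of "Suc m"] s(2)[of "Suc m" N] by (intro mult_mono) auto
      finally have "l2norm M (\<lambda>\<omega>. b (Suc m) * (?J (Suc m) \<omega> - s N (Suc m) \<omega>)) \<le> e N" by simp
      moreover have "l2norm M (\<lambda>\<omega>. (\<Sum>q=1..m. b q * (?J q \<omega> - s N q \<omega>)) + b (Suc m) * (?J (Suc m) \<omega> - s N (Suc m) \<omega>)) \<le>
        l2norm M (\<lambda>\<omega>. \<Sum>q=1..m. b q * (?J q \<omega> - s N q \<omega>)) + l2norm M (\<lambda>\<omega>. b (Suc m) * (?J (Suc m) \<omega> - s N (Suc m) \<omega>))"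
        by (intro l2_triangle sq_int_sum sq_int_cmult sq_int_diff Jsq ssq) auto
      ultimately show ?case using Suc by (simp add: algebra_simps)
    qed
    from this[of N] have "l2norm M (\<lambda>\<omega>. \<Sum>q=1..N. b q * (?J q \<omega> - s N q \<omega>)) \<le> real N * e N" .
    also have "\<dots> \<le> real (Suc N) * e N" by (intro mult_right_mono) (auto simp: e_def)
    also have "\<dots> = 1 / real (Suc N)" by (simp add: e_def power2_eq_square del: of_nat_Suc)
    finally show ?thesis by (simp add: right_diff_distrib sum_subtractf)
  qed
  have o: "(\<lambda>N. 1 / real (Suc N)) \<longlonglongrightarrow> 0" by (rule LIMSEQ_Suc[OF lim_1_over_n])
  have approx: "l2_tendsto M (\<lambda>N \<omega>. \<Sum>q=1..N. b q * s N q \<omega>) H"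
    if H: "l2_tendsto M (\<lambda>N \<omega>. \<Sum>q=1..N. b q * ?J q \<omega>) H" and b: "\<And>q. \<bar>b q\<bar> \<le> 1" for H b
  proof (rule l2_tendsto_bound)
    note h = l2_tendstoD[OF H]
    show ss: "sq_int M (\<lambda>\<omega>. \<Sum>q=1..N. b q * s N q \<omega>)" for N by (intro sq_int_sum sq_int_cmult ssq) auto
    show "sq_int M H" by (rule h)
    show "l2norm M (\<lambda>\<omega>. H \<omega> - (\<Sum>q=1..N. b q * s N q \<omega>)) \<le> l2norm M (\<lambda>\<omega>. H \<omega> - (\<Sum>q=1..N. b q * ?J q \<omega>)) + 1 / real (Suc N)" for N
      proof -
      have "l2norm M (\<lambda>\<omega>. (\<Sum>q=1..N. b q * ?J q \<omega>) - (\<Sum>q=1..N. b q * s N q \<omega>)) \<le> 1 / real (Suc N)"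
        by (rule close[OF b])
      then show ?thesis using l2_triangle_diff[OF h(2) h(1)[of N] ss[of N]] by simp
    qed
    show "(\<lambda>N. l2norm M (\<lambda>\<omega>. H \<omega> - (\<Sum>q=1..N. b q * ?J q \<omega>)) + 1 / real (Suc N)) \<longlonglongrightarrow> 0"
      using tendsto_add[OF h(3) o] by simp
  qed
  have b1: "\<bar>- 1 / real q\<bar> \<le> 1" for q by (cases q) auto
  have eq1: "- (\<Sum>q=1..N. ?J q \<omega> / real q) = (\<Sum>q=1..N. (- 1 / real q) * ?J q \<omega>)" for N \<omega>
    by (simp add: sum_negf)
  have PG: "l2_tendsto M P ?G"
    unfolding P_def using OU_pseudo_inverse_tendsto(2)[OF F2] unfolding eq1 by (intro approx b1)
  have AF: "l2_tendsto M A (\<lambda>\<omega>. - F \<omega>)"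
  proof -
    have "l2_tendsto M (\<lambda>N \<omega>. \<Sum>q=1..N. (- 1) * ?J q \<omega>) (\<lambda>\<omega>. - F \<omega>)"
      using l2_tendsto_scaleR[OF chaos_expansion[OF F], of "-1"] by (simp add: sum_negf)
    from approx[OF this] have "l2_tendsto M (\<lambda>N \<omega>. \<Sum>q=1..N. (- 1) * s N q \<omega>) (\<lambda>\<omega>. - F \<omega>)" by simp
    moreover have "A = (\<lambda>N \<omega>. \<Sum>q=1..N. (- 1) * s N q \<omega>)"
      unfolding A_def by (intro ext sum.cong refl) auto
    ultimately show ?thesis by simp
  qed
  have "l2_Cauchy M U"
    unfolding l2_Cauchy_def
  proof (intro conjI allI impI sq)
    fix \<epsilon> :: real assume \<epsilon>: "0 < \<epsilon>"
    have "l2_Cauchy M P" "l2_Cauchy M A" using PG AF l2_tendsto_imp_Cauchy by blast+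
    then obtain N1 N2 where N1: "\<And>i j. i \<ge> N1 \<Longrightarrow> j \<ge> N1 \<Longrightarrow> l2norm M (\<lambda>x. P i x - P j x) < \<epsilon>"
      and N2: "\<And>i j. i \<ge> N2 \<Longrightarrow> j \<ge> N2 \<Longrightarrow> l2norm M (\<lambda>x. A i x - A j x) < \<epsilon>"
      using \<epsilon> unfolding l2_Cauchy_def by meson
    have "l2norm M (\<lambda>x. U i x - U j x) < \<epsilon>" if "i \<ge> max N1 N2" "j \<ge> max N1 N2" for i j
    proof -
      \<comment> \<open>Triples form a linear space, so the energy estimate is available for
        differences.\<close>
      have "hermite_triple (\<lambda>x. P i x - P j x) (\<lambda>x. U i x - U j x) (\<lambda>x. A i x - A j x)"
        using hermite_triple_linear[OF T[of i] T[of j], of "-1"] by simp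
      from hermite_triple_energy[OF this]
      have "(l2norm M (\<lambda>x. U i x - U j x))\<^sup>2 \<le> l2norm M (\<lambda>x. P i x - P j x) * l2norm M (\<lambda>x. A i x - A j x)" .
      also have "\<dots> < \<epsilon> * \<epsilon>" using N1[of i j] N2[of i j] that by (intro mult_strict_mono') auto
      finally show ?thesis using \<epsilon> by (simp add: power2_eq_square[symmetric] power_less_imp_less_base)
    qed
    then show "\<exists>N. \<forall>i\<ge>N. \<forall>j\<ge>N. l2norm M (\<lambda>x. U i x - U j x) < \<epsilon>" by blast
  qed
  then obtain V where "l2_tendsto M U V"
    using l2_complete[of U M] sq_int_measurable[OF sq(2)] unfolding subalgebra_def by blast
  then show ?thesis using that T PG AF by blast
qed

text \<open>This weak form of closability is all that is needed of the version of the derivative that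
  \<^const>\<open>malliavin_deriv\<close> happens to choose.\<close>

lemma malliavin_deriv_unique_weak:
  assumes G: "has_malliavin_deriv M X G V" "has_malliavin_deriv M X G V'"
    and w: "w \<in> borel_measurable (sigma_of M X)" "\<And>\<omega>. \<bar>w \<omega>\<bar> \<le> C"
  shows "expectation (\<lambda>\<omega>. w \<omega> * inner (V \<omega>) h) = expectation (\<lambda>\<omega>. w \<omega> * inner (V' \<omega>) h)"
proof (cases "h = 0")
  case True
  then show ?thesis by simp
next
  case False
  define u where "u = h /\<^sub>R norm h"
  have u: "norm u = 1" and h: "h = norm h *\<^sub>R u" using False by (auto simp: u_def)
  have V: "sq_int M V" "sq_int M V'" using G by (auto simp: has_malliavin_deriv_def sq_int_def)
  have i: "integrable M (\<lambda>\<omega>. inner (V \<omega>) (b \<omega> *\<^sub>R u))" "integrable M (\<lambda>\<omega>. inner (V' \<omega>) (b \<omega> *\<^sub>R u))"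
    if "b \<in> borel_measurable M" "\<And>\<omega>. \<bar>b \<omega>\<bar> \<le> c" for b c
    using that by (intro sq_int_inner V sq_int_scaleR_const sq_int_bounded[where C=c]; simp)+
  let ?D = "\<lambda>\<omega>. inner (V \<omega>) u - inner (V' \<omega>) u"
  have wM: "w \<in> borel_measurable M" by (rule sigma_X_measurable[OF w(1)])
  \<comment> \<open>Trigonometric weights suffice: they are smooth along \<open>u\<close>, so
    \<open>malliavin_deriv_weak\<close> rewrites both pairings as the same expression in
    \<open>G\<close>.\<close>
  have "expectation (\<lambda>\<omega>. w \<omega> * ?D \<omega>) = 0"
  proof (rule zero_expectation_trig[OF _ _ _ w(1)])
    show "integrable M ?D" using i[of "\<lambda>_. 1" 1] by simp
    show "integrable M (\<lambda>\<omega>. w \<omega> * ?D \<omega>)" using i[OF wM w(2)] by (simp add: right_diff_distrib)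
    fix k
    have b: "\<bar>inner k u\<bar> \<le> norm k" using Cauchy_Schwarz_ineq2[of k u] u by simp
    have dc: "dir_deriv u (\<lambda>\<omega>. cos (X k \<omega>)) (\<lambda>\<omega>. - sin (X k \<omega>) * inner k u)"
      by (rule dir_deriv_compose[OF dir_deriv_X]) (auto intro!: derivative_eq_intros continuous_intros)
    have ds: "dir_deriv u (\<lambda>\<omega>. sin (X k \<omega>)) (\<lambda>\<omega>. cos (X k \<omega>) * inner k u)"
      by (rule dir_deriv_compose[OF dir_deriv_X]) (auto intro!: derivative_eq_intros continuous_intros)
    have bd: "\<bar>x * inner k u\<bar> \<le> 1 + norm k" if "\<bar>x\<bar> \<le> 1" for x
      using mult_mono[OF that b] by (simp add: abs_mult)
    have b1: "\<bar>x\<bar> \<le> 1 + norm k" if "\<bar>x\<bar> \<le> 1" for x using that by (simp add: add_increasing2)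
    have "expectation (\<lambda>\<omega>. inner (V \<omega>) u * cos (X k \<omega>)) = expectation (\<lambda>\<omega>. inner (V' \<omega>) u * cos (X k \<omega>))"
      using malliavin_deriv_weak[OF u G(1) dc, of "1 + norm k"] malliavin_deriv_weak[OF u G(2) dc, of "1 + norm k"]
        bd[of "- sin _"] b1[of "cos _"] by simp
    then show "expectation (\<lambda>\<omega>. ?D \<omega> * cos (X k \<omega>)) = 0"
      using i[of "\<lambda>\<omega>. cos (X k \<omega>)" 1] by (simp add: right_diff_distrib mult.commute)
    have "expectation (\<lambda>\<omega>. inner (V \<omega>) u * sin (X k \<omega>)) = expectation (\<lambda>\<omega>. inner (V' \<omega>) u * sin (X k \<omega>))"
      using malliavin_deriv_weak[OF u G(1) ds, of "1 + norm k"] malliavin_deriv_weak[OF u G(2) ds, of "1 + norm k"]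
        bd[of "cos _"] b1[of "sin _"] by simp
    then show "expectation (\<lambda>\<omega>. ?D \<omega> * sin (X k \<omega>)) = 0"
      using i[of "\<lambda>\<omega>. sin (X k \<omega>)" 1] by (simp add: right_diff_distrib mult.commute)
  qed
  then have e: "expectation (\<lambda>\<omega>. w \<omega> * inner (V \<omega>) u) = expectation (\<lambda>\<omega>. w \<omega> * inner (V' \<omega>) u)"
    using i[OF wM w(2)] by (simp add: right_diff_distrib)
  have "inner v h = norm h * inner v u" for v
    by (subst h) simp
  then show ?thesis using e by (simp add: mult.left_commute[of "w _"])
qed

text \<open>\<open>g (S \<omega>)\<close> has the gradient
  \<open>g' (S \<omega>) *\<^sub>R DS \<omega>\<close>, so duality with the approximating Hermite
  triples applies and passes to the limit. This yields the identity for one particular derivative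
  \<open>V0\<close> of the pseudo-inverse, and the given version \<open>V\<close> must then replace
  it.\<close>

lemma malliavin_integration_by_parts_smooth:
  assumes F: "F \<in> L2_functionals M X" "expectation F = 0"
    and V: "has_malliavin_deriv M X (OU_pseudo_inverse M X F) V"
    and S: "smooth_functional X S DS"
    and g: "\<And>x. (g has_real_derivative g' x) (at x)" "continuous_on UNIV g'"
  shows "expectation (\<lambda>\<omega>. g (S \<omega>) * F \<omega>) = expectation (\<lambda>\<omega>. inner (g' (S \<omega>) *\<^sub>R DS \<omega>) (- V \<omega>))"
proof -
  obtain P U A V0 where T: "\<And>N::nat. hermite_triple (P N) (U N) (A N)"
    and P: "l2_tendsto M P (OU_pseudo_inverse M X F)" and A: "l2_tendsto M A (\<lambda>\<omega>. - F \<omega>)" and U: "l2_tendsto M U V0"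
    by (rule OU_pseudo_inverse_approx[OF F], rule that)
  have V0: "has_malliavin_deriv M X (OU_pseudo_inverse M X F) V0"
    by (rule has_malliavin_deriv_closed[OF hermite_triple_has_malliavin_deriv[OF T] P U])
  obtain n s \<phi> where s: "smooth_compact_support n s" and Sd: "S = (\<lambda>\<omega>. s (\<lambda>j. X (\<phi> j) \<omega>))"
    and DSd: "DS = (\<lambda>\<omega>. \<Sum>i<n. partial_deriv i s (\<lambda>j. X (\<phi> j) \<omega>) *\<^sub>R \<phi> i)"
    using S unfolding smooth_functional_def by blast
  note D = smooth_compact_supportD[OF s]
  obtain C where C: "\<And>x. \<bar>s x\<bar> \<le> C" "\<And>i x. i < n \<Longrightarrow> \<bar>partial_deriv i s x\<bar> \<le> C"
    using smooth_compact_support_bounded[OF s] by blast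
  have cg: "continuous_on UNIV g" using g(1) by (auto intro!: continuous_at_imp_continuous_on DERIV_isCont)
  have bd: "\<exists>K. \<forall>y. \<bar>y\<bar> \<le> C \<longrightarrow> \<bar>k y\<bar> \<le> K" if "continuous_on UNIV k" for k :: "real \<Rightarrow> real"
  proof -
    have "compact (k ` {-C..C})"
      by (intro compact_continuous_image continuous_on_subset[OF that]) auto
    then obtain K where "\<forall>y\<in>{-C..C}. \<bar>k y\<bar> \<le> K" by (auto dest!: compact_imp_bounded simp: bounded_iff)
    then show ?thesis by (intro exI[of _ K]) (auto simp: abs_le_iff minus_le_iff)
  qed
  obtain K K' where K: "\<And>y. \<bar>y\<bar> \<le> C \<Longrightarrow> \<bar>g y\<bar> \<le> K" and K': "\<And>y. \<bar>y\<bar> \<le> C \<Longrightarrow> \<bar>g' y\<bar> \<le> K'"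
    using bd[OF cg] bd[OF g(2)] by blast
  have Sb: "\<bar>S \<omega>\<bar> \<le> C" for \<omega> unfolding Sd by (rule C)
  have SN: "S \<in> borel_measurable (sigma_of M X)" unfolding Sd by (rule cylinder_measurable(1)[OF D(1)])
  note SM [measurable] = sigma_X_measurable[OF SN]
  have [measurable]: "g \<in> borel_measurable borel" "g' \<in> borel_measurable borel"
    using cg g(2) by (auto intro: borel_measurable_continuous_onI)
  define W where "W = (\<lambda>\<omega>. g' (S \<omega>) *\<^sub>R DS \<omega>)"
  define w where "w = (\<lambda>i \<omega>. g' (S \<omega>) * partial_deriv i s (\<lambda>j. X (\<phi> j) \<omega>))"
  have W: "W \<omega> = (\<Sum>i<n. w i \<omega> *\<^sub>R \<phi> i)" for \<omega> by (simp add: W_def w_def DSd scaleR_sum_right)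
  have wN: "w i \<in> borel_measurable (sigma_of M X)" if "i < n" for i
    unfolding w_def
    by (intro borel_measurable_times measurable_compose[OF SN] cylinder_measurable(1)[OF D(3)[OF that]]) simp
  have wb: "\<bar>w i \<omega>\<bar> \<le> K' * C" if "i < n" for i \<omega>
    unfolding w_def abs_mult using C(2)[OF that] K'[OF Sb] abs_ge_zero[of "g' (S \<omega>)"]
    by (intro mult_mono) (auto intro: order_trans[OF abs_ge_zero])
  have wsq: "sq_int M (w i)" if "i < n" for i
    by (rule sq_int_bounded[OF sigma_X_measurable[OF wN[OF that]]]) (use wb[OF that] in simp)
  have Wsq: "sq_int M W" unfolding W[abs_def] by (intro sq_int_sum sq_int_scaleR_const wsq) simp
  have Bsq: "sq_int M (\<lambda>\<omega>. g (S \<omega>))" by (rule sq_int_bounded[where C=K]) (use K[OF Sb] in auto)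
  have Vsq: "sq_int M V" "sq_int M V0" using V V0 by (auto simp: has_malliavin_deriv_def sq_int_def)
  have grad: "has_gradient (\<lambda>\<omega>. g (S \<omega>)) W"
    unfolding has_gradient_def
  proof (intro conjI allI impI Bsq Wsq)
    fix u :: 'h assume "norm u = 1"
    have "dir_deriv u S (\<lambda>\<omega>. \<Sum>i<n. partial_deriv i s (\<lambda>j. X (\<phi> j) \<omega>) * inner (\<phi> i) u)"
      unfolding Sd by (rule dir_deriv_cylinder[OF D(1,3,5,2,4)])
    from dir_deriv_compose[OF this g]
    show "dir_deriv u (\<lambda>\<omega>. g (S \<omega>)) (\<lambda>\<omega>. inner (W \<omega>) u)"
      by (simp add: W_def DSd inner_sum_left)
  qed
  have sumV: "expectation (\<lambda>\<omega>. inner (W \<omega>) (v \<omega>)) = (\<Sum>i<n. expectation (\<lambda>\<omega>. w i \<omega> * inner (v \<omega>) (\<phi> i)))" if v: "sq_int M v" for v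
  proof -
    have i: "integrable M (\<lambda>\<omega>. w i \<omega> * inner (v \<omega>) (\<phi> i))" if "i < n" for i
      using sq_int_inner[OF sq_int_scaleR_const[OF wsq[OF that], of "\<phi> i"] v] by (simp add: inner_commute)
    have "expectation (\<lambda>\<omega>. inner (W \<omega>) (v \<omega>)) = expectation (\<lambda>\<omega>. \<Sum>i<n. w i \<omega> * inner (v \<omega>) (\<phi> i))"
      by (simp add: W inner_sum_left inner_commute[of "\<phi> _"])
    then show ?thesis using Bochner_Integration.integral_sum[of "{..<n}" M, OF i] by simp
  qed
  \<comment> \<open>\<open>W\<close> is a finite sum of bounded \<sigma>(X)-measurable weights times
    the fixed vectors \<open>\<phi> i\<close>, exactly the pairings on which versions agree.\<close>
  have VV0: "expectation (\<lambda>\<omega>. inner (W \<omega>) (V \<omega>)) = expectation (\<lambda>\<omega>. inner (W \<omega>) (V0 \<omega>))"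
    unfolding sumV[OF Vsq(1)] sumV[OF Vsq(2)]
    by (intro sum.cong refl malliavin_deriv_unique_weak[OF V V0 wN wb]) auto
  have "(\<lambda>N. expectation (\<lambda>\<omega>. inner (W \<omega>) (U N \<omega>))) \<longlonglongrightarrow> expectation (\<lambda>\<omega>. inner (W \<omega>) (V0 \<omega>))"
    by (rule l2_tendsto_inner[OF l2_tendsto_const[OF Wsq] U])
  moreover have "(\<lambda>N. expectation (\<lambda>\<omega>. g (S \<omega>) * A N \<omega>)) \<longlonglongrightarrow> expectation (\<lambda>\<omega>. g (S \<omega>) * - F \<omega>)"
    by (rule l2_tendsto_mult[OF l2_tendsto_const[OF Bsq] A])
  ultimately have "expectation (\<lambda>\<omega>. inner (W \<omega>) (V0 \<omega>)) = expectation (\<lambda>\<omega>. g (S \<omega>) * - F \<omega>)"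
    unfolding hermite_triple_duality[OF grad T] by (rule LIMSEQ_unique)
  then show ?thesis using VV0 by (simp add: W_def)
qed

text \<open>Smooth functionals that approximate \<open>F\<close> together with its derivative are
  inserted. The bound on \<open>g'\<close> makes \<open>g\<close> Lipschitz, so the left side
  converges in L2; on the right, the approximating derivatives converge in L2, and bounded multiples
  of the fixed derivative of the pseudo-inverse converge by domination.\<close>

lemma malliavin_integration_by_parts:
  assumes F: "F \<in> L2_functionals M X" "expectation F = 0" "F \<in> malliavin_D12 M X"
    and g: "\<And>x. (g has_real_derivative g' x) (at x)" "continuous_on UNIV g'" "\<And>x. \<bar>g' x\<bar> \<le> C"
  shows "expectation (\<lambda>\<omega>. g (F \<omega>) * F \<omega>) = expectation (\<lambda>\<omega>. g' (F \<omega>) * malliavin_inner M X F \<omega>)"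
    "integrable M (malliavin_inner M X F)"
proof -
  define U where "U = malliavin_deriv M X F"
  define V where "V = malliavin_deriv M X (OU_pseudo_inverse M X F)"
  have F2: "sq_int M F" using F(1) by (simp add: L2_functionals_iff)
  have dU: "has_malliavin_deriv M X F U"
    using someI_ex[of "has_malliavin_deriv M X F"] F(3)
    unfolding U_def malliavin_deriv_def malliavin_D12_def by blast
  \<comment> \<open>Existence of some derivative is what makes the choice inside
    \<open>malliavin_deriv\<close> return a genuine one.\<close>
  have dV: "has_malliavin_deriv M X (OU_pseudo_inverse M X F) V"
  proof -
    obtain P W A V0 where T: "\<And>N::nat. hermite_triple (P N) (W N) (A N)"
      and P: "l2_tendsto M P (OU_pseudo_inverse M X F)" and "l2_tendsto M A (\<lambda>\<omega>. - F \<omega>)" and W: "l2_tendsto M W V0"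
      by (rule OU_pseudo_inverse_approx[OF F(1,2)], rule that)
    have "has_malliavin_deriv M X (OU_pseudo_inverse M X F) V0"
      by (rule has_malliavin_deriv_closed[OF hermite_triple_has_malliavin_deriv[OF T] P W])
    then show ?thesis unfolding V_def malliavin_deriv_def using someI[of "has_malliavin_deriv M X (OU_pseudo_inverse M X F)" V0] by blast
  qed
  have Usq: "sq_int M U" and Vsq: "sq_int M V" using dU dV by (auto simp: has_malliavin_deriv_def sq_int_def)
  have inner: "malliavin_inner M X F \<omega> = inner (U \<omega>) (- V \<omega>)" for \<omega>
    by (simp add: malliavin_inner_def U_def V_def)
  have iUV: "integrable M (\<lambda>\<omega>. inner (U \<omega>) (- V \<omega>))" by (intro sq_int_inner Usq sq_int_minus Vsq)
  then show "integrable M (malliavin_inner M X F)" by (simp add: inner[abs_def])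
  have cg: "continuous_on UNIV g" using g(1) by (auto intro!: continuous_at_imp_continuous_on DERIV_isCont)
  note [measurable] = sq_int_measurable[OF F2] borel_measurable_continuous_onI[OF g(2)] borel_measurable_continuous_onI[OF cg]
  have C0: "0 \<le> C" using g(3)[of 0] by linarith
  have lip: "\<bar>g x - g y\<bar> \<le> C * \<bar>x - y\<bar>" for x y
    using field_differentiable_bound[of UNIV g g' C x y] g(1,3) by simp
  obtain S DS where S: "\<And>k. smooth_functional X (S k) (DS k)" "l2_tendsto M S F" "l2_tendsto M DS U"
    using dU unfolding has_malliavin_deriv_iff by blast
  \<comment> \<open>\<open>g'\<close> is continuous but not Lipschitz, so its convergence along the
    approximation requires almost sure convergence.\<close>
  obtain r where r: "strict_mono r" "AE \<omega> in M. (\<lambda>k. S (r k) \<omega>) \<longlonglongrightarrow> F \<omega>"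
    using l2_tendsto_AE_subseq[OF S(2)] by blast
  define S' where "S' = (\<lambda>k. S (r k))"
  define D' where "D' = (\<lambda>k. DS (r k))"
  have S': "l2_tendsto M S' F" "l2_tendsto M D' U" "AE \<omega> in M. (\<lambda>k. S' k \<omega>) \<longlonglongrightarrow> F \<omega>"
    unfolding S'_def D'_def using l2_tendsto_subseq[OF S(2) r(1)] l2_tendsto_subseq[OF S(3) r(1)] r(2) by auto
  note [measurable] = sq_int_measurable[OF l2_tendstoD(1)[OF S'(1)]]
  have id: "expectation (\<lambda>\<omega>. g (S' k \<omega>) * F \<omega>) = expectation (\<lambda>\<omega>. inner (g' (S' k \<omega>) *\<^sub>R D' k \<omega>) (- V \<omega>))" for k
    unfolding S'_def D'_def by (rule malliavin_integration_by_parts_smooth[OF F(1,2) dV S(1) g(1,2)])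
  have gb: "\<bar>g x\<bar> \<le> \<bar>g 0\<bar> + C * \<bar>x\<bar>" for x using lip[of x 0] by simp
  have gsq: "sq_int M (\<lambda>\<omega>. g (Y \<omega>))" if "sq_int M Y" for Y
  proof (rule sq_int_bound[OF _ sq_int_add[OF sq_int_const[of "\<bar>g 0\<bar>"] sq_int_cmult[OF sq_int_norm[OF that], of C]]])
    show "(\<lambda>\<omega>. g (Y \<omega>)) \<in> borel_measurable M" using sq_int_measurable[OF that] by simp
    show "norm (g (Y x)) \<le> norm (\<bar>g 0\<bar> + C * norm (Y x))" for x using gb[of "Y x"] by simp
  qed
  have "l2_tendsto M (\<lambda>k \<omega>. g (S' k \<omega>)) (\<lambda>\<omega>. g (F \<omega>))"
  proof (rule l2_tendsto_bound)
    show "l2norm M (\<lambda>\<omega>. g (F \<omega>) - g (S' k \<omega>)) \<le> C * l2norm M (\<lambda>\<omega>. F \<omega> - S' k \<omega>)" for k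
    proof -
      have "l2norm M (\<lambda>\<omega>. g (F \<omega>) - g (S' k \<omega>)) \<le> l2norm M (\<lambda>\<omega>. C *\<^sub>R (F \<omega> - S' k \<omega>))"
        by (rule l2norm_mono[OF _ sq_int_scaleR[OF sq_int_diff[OF F2 l2_tendstoD(1)[OF S'(1)]]]])
          (use lip C0 in \<open>auto simp: abs_mult\<close>)
      then show ?thesis using l2norm_scaleR[of M C "\<lambda>\<omega>. F \<omega> - S' k \<omega>"] C0 by simp
    qed
    show "(\<lambda>k. C * l2norm M (\<lambda>\<omega>. F \<omega> - S' k \<omega>)) \<longlonglongrightarrow> 0"
      using tendsto_mult_right_zero[OF l2_tendstoD(3)[OF S'(1)]] .
  qed (use gsq F2 l2_tendstoD(1)[OF S'(1)] in auto)
  from l2_tendsto_mult[OF this l2_tendsto_const[OF F2]]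
  have lhs: "(\<lambda>k. expectation (\<lambda>\<omega>. g (S' k \<omega>) * F \<omega>)) \<longlonglongrightarrow> expectation (\<lambda>\<omega>. g (F \<omega>) * F \<omega>)" .
  have m: "(\<lambda>\<omega>. g' (S' k \<omega>)) \<in> borel_measurable M" for k by simp
  have gV: "l2_tendsto M (\<lambda>k \<omega>. g' (S' k \<omega>) *\<^sub>R (- V \<omega>)) (\<lambda>\<omega>. g' (F \<omega>) *\<^sub>R (- V \<omega>))"
  proof (rule l2_tendsto_dominated[OF sq_int_minus[OF Vsq] m])
    show "AE \<omega> in M. (\<lambda>k. g' (S' k \<omega>)) \<longlonglongrightarrow> g' (F \<omega>)"
      using S'(3)
    proof eventually_elim
      case (elim \<omega>)
      show ?case using g(2) elim by (intro isCont_tendsto_compose[of _ g']) (auto simp: continuous_on_eq_continuous_at)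
    qed
  qed (use g(3) in auto)
  from l2_tendsto_inner[OF S'(2) gV]
  have "(\<lambda>k. expectation (\<lambda>\<omega>. inner (g' (S' k \<omega>) *\<^sub>R D' k \<omega>) (- V \<omega>))) \<longlonglongrightarrow> expectation (\<lambda>\<omega>. g' (F \<omega>) * malliavin_inner M X F \<omega>)"
    by (simp add: inner)
  from LIMSEQ_unique[OF lhs[unfolded id] this]
  show "expectation (\<lambda>\<omega>. g (F \<omega>) * F \<omega>) = expectation (\<lambda>\<omega>. g' (F \<omega>) * malliavin_inner M X F \<omega>)" .
qed

end

section \<open>Stein's equation\<close>

abbreviation "gdens \<equiv> std_normal_density"

lemma DERIV_gdens: "(gdens has_real_derivative - x * gdens x) (at x)"
  unfolding std_normal_density_def
  by (auto intro!: derivative_eq_intros simp: field_simps)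

lemma gdens_pos: "0 < gdens x"
  by (simp add: normal_density_pos)

lemma gdens_minus: "gdens (- x) = gdens x"
  by (simp add: normal_density_def)

lemma continuous_gdens: "continuous_on A gdens"
  unfolding std_normal_density_def by (auto intro!: continuous_intros)

lemma Phi_bounds: "0 \<le> Phi x" "Phi x \<le> 1"
proof -
  interpret N: real_distribution std_normal_distribution by (rule real_dist_normal_dist)
  show "0 \<le> Phi x" "Phi x \<le> 1" unfolding Phi_def by (auto simp: N.cdf_nonneg N.cdf_bounded_prob)
qed

lemma Phi_mono: "x \<le> y \<Longrightarrow> Phi x \<le> Phi y"
proof -
  interpret N: real_distribution std_normal_distribution by (rule real_dist_normal_dist)
  show "x \<le> y \<Longrightarrow> Phi x \<le> Phi y" unfolding Phi_def by (rule N.cdf_nondecreasing)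
qed

lemma Phi_at_top: "(Phi \<longlongrightarrow> 1) at_top" and Phi_at_bot: "(Phi \<longlongrightarrow> 0) at_bot"
proof -
  interpret N: real_distribution std_normal_distribution by (rule real_dist_normal_dist)
  show "(Phi \<longlongrightarrow> 1) at_top" "(Phi \<longlongrightarrow> 0) at_bot"
    unfolding Phi_def by (rule N.cdf_lim_at_top_prob N.cdf_lim_at_bot)+
qed

lemma continuous_Phi: "continuous_on A Phi"
  using DERIV_Phi by (blast intro: continuous_at_imp_continuous_on DERIV_isCont)

text \<open>The density is even, so \<open>Phi x + Phi (- x)\<close> is constant; its limit at
  infinity is 1.\<close>

lemma Phi_minus: "Phi (- x) = 1 - Phi x"
proof -
  let ?s = "\<lambda>x. Phi x + Phi (- x)"
  have "(?s has_real_derivative 0) (at x)" for x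
  proof -
    have "((\<lambda>x. Phi (- x)) has_real_derivative gdens (- x) * - 1) (at x)"
      by (rule DERIV_chain2[OF DERIV_Phi]) (auto intro!: derivative_eq_intros)
    from DERIV_add[OF DERIV_Phi this] show ?thesis by (simp add: gdens_minus)
  qed
  then have c: "?s x = ?s y" for x y by (rule DERIV_isconst_all[rule_format])
  have "(?s \<longlongrightarrow> 1 + 0) at_top"
    by (intro tendsto_add Phi_at_top filterlim_compose[OF Phi_at_bot filterlim_uminus_at_bot_at_top])
  moreover have "?s = (\<lambda>_. ?s x)" using c by blast
  ultimately have "((\<lambda>_::real. ?s x) \<longlongrightarrow> 1) at_top" by simp
  from tendsto_unique[OF _ this tendsto_const] show ?thesis by simp
qed

lemma square_gdens_at_top: "((\<lambda>x. x\<^sup>2 * gdens x) \<longlongrightarrow> 0) at_top" and gdens_at_top: "(gdens \<longlongrightarrow> 0) at_top"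
proof -
  have f: "filterlim (\<lambda>x::real. x\<^sup>2 / 2) at_top at_top"
    by (rule filterlim_at_top_mono[OF filterlim_ident])
      (auto simp: power2_eq_square field_simps eventually_at_top_linorder intro!: exI[of _ 2])
  have "((\<lambda>x::real. (2 / sqrt (2 * pi)) * ((x\<^sup>2 / 2) ^ 1 / exp (x\<^sup>2 / 2))) \<longlongrightarrow> (2 / sqrt (2 * pi)) * 0) at_top"
    by (intro tendsto_mult tendsto_const filterlim_compose[OF tendsto_power_div_exp_0 f])
  then show "((\<lambda>x. x\<^sup>2 * gdens x) \<longlongrightarrow> 0) at_top"
    by (simp add: std_normal_density_def exp_minus field_simps)
  have "((\<lambda>x::real. (1 / sqrt (2 * pi)) * ((x\<^sup>2 / 2) ^ 0 / exp (x\<^sup>2 / 2))) \<longlongrightarrow> (1 / sqrt (2 * pi)) * 0) at_top"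
    by (intro tendsto_mult tendsto_const filterlim_compose[OF tendsto_power_div_exp_0 f])
  then have "((\<lambda>x. gdens x) \<longlongrightarrow> 0) at_top"
    by (simp add: std_normal_density_def exp_minus field_simps)
  then show "(gdens \<longlongrightarrow> 0) at_top" by simp
qed

text \<open>Mills' inequality: the difference of the two sides divided by \<open>x\<close> has
  derivative \<open>- gdens y / y\<^sup>2\<close> and tends to 0 at infinity, so it decreases to 0
  and is positive.\<close>

lemma mills_ratio:
  assumes "x > 0" shows "x * (1 - Phi x) \<le> gdens x"
proof -
  have "0 < gdens x / x - (1 - Phi x)"
  proof (rule DERIV_neg_imp_decreasing_at_top[where f="\<lambda>x. gdens x / x - (1 - Phi x)" and b=x and flim=0])
    fix y assume "x \<le> y"
    then have y: "y > 0" using assms by simp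
    have "((\<lambda>x. gdens x / x - (1 - Phi x)) has_real_derivative - (gdens y / y\<^sup>2)) (at y)"
      using y by (auto intro!: derivative_eq_intros DERIV_gdens DERIV_Phi simp: field_simps power2_eq_square)
    moreover have "- (gdens y / y\<^sup>2) < 0" using y gdens_pos[of y] by simp
    ultimately show "\<exists>d. ((\<lambda>x. gdens x / x - (1 - Phi x)) has_real_derivative d) (at y) \<and> d < 0" by blast
  next
    have "((\<lambda>x. gdens x * inverse x - (1 - Phi x)) \<longlongrightarrow> 0 * 0 - (1 - 1)) at_top"
      by (intro tendsto_intros gdens_at_top Phi_at_top tendsto_inverse_0_at_top filterlim_ident)
    then show "((\<lambda>x. gdens x / x - (1 - Phi x)) \<longlongrightarrow> 0) at_top" by (simp add: divide_inverse)
  qed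
  then show ?thesis using assms by (simp add: field_simps)
qed

text \<open>The bounded solution, usually written as the integral of the centered indicator against
  the density up to \<open>x\<close>, divided by the density at \<open>x\<close>. The minimum
  evaluates this integral on both sides of \<open>z\<close> at once.\<close>

definition stein_sol :: "real \<Rightarrow> real \<Rightarrow> real" where
  "stein_sol z x = (Phi (min x z) - Phi z * Phi x) / gdens x"

text \<open>Read off from Stein's equation, which therefore holds at every point. At
  \<open>z\<close>, where the solution has no derivative, this fixes the value on the left.\<close>

definition stein_deriv :: "real \<Rightarrow> real \<Rightarrow> real" where
  "stein_deriv z x = x * stein_sol z x + (if x \<le> z then 1 else 0) - Phi z"

lemma stein_sol_le: "x \<le> z \<Longrightarrow> stein_sol z x = (1 - Phi z) * Phi x / gdens x"
  and stein_sol_ge: "z \<le> x \<Longrightarrow> stein_sol z x = Phi z * (1 - Phi x) / gdens x"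
  by (simp_all add: stein_sol_def min_def algebra_simps)

lemma continuous_stein_sol: "continuous_on UNIV (stein_sol z)"
proof -
  have "continuous_on UNIV (\<lambda>x. Phi (min x z))"
    by (rule continuous_on_compose2[OF continuous_Phi[of UNIV]]) (auto intro!: continuous_intros)
  then show ?thesis unfolding stein_sol_def[abs_def]
    by (intro continuous_intros continuous_Phi continuous_gdens) (use gdens_pos in \<open>auto simp: less_imp_neq[symmetric]\<close>)
qed

lemma DERIV_stein_sol:
  assumes "x \<noteq> z" shows "(stein_sol z has_real_derivative stein_deriv z x) (at x)"
proof (cases "x < z")
  case True
  have "((\<lambda>x. (1 - Phi z) * Phi x / gdens x) has_real_derivative stein_deriv z x) (at x)"
    using gdens_pos[of x] True
    by (auto intro!: derivative_eq_intros DERIV_gdens DERIV_Phi simp: stein_deriv_def stein_sol_le field_simps)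
  then show ?thesis
    by (rule has_field_derivative_transform_within_open[of _ _ _ "{..<z}"]) (use True in \<open>auto simp: stein_sol_le\<close>)
next
  case False
  then have "z < x" using assms by simp
  have "((\<lambda>x. Phi z * (1 - Phi x) / gdens x) has_real_derivative stein_deriv z x) (at x)"
    using gdens_pos[of x] \<open>z < x\<close>
    by (auto intro!: derivative_eq_intros DERIV_gdens DERIV_Phi simp: stein_deriv_def stein_sol_ge field_simps)
  then show ?thesis
    by (rule has_field_derivative_transform_within_open[of _ _ _ "{z<..}"]) (use \<open>z < x\<close> in \<open>auto simp: stein_sol_ge\<close>)
qed

text \<open>The numerator \<open>?Q\<close> is at most both tails \<open>Phi x\<close> and
  \<open>1 - Phi x\<close>. Mills' inequality bounds the relevant tail on the positive half-line,
  and by reflection on the negative one.\<close>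

lemma stein_sol_bound: "\<bar>x * stein_sol z x\<bar> \<le> 1"
proof -
  let ?Q = "Phi (min x z) - Phi z * Phi x"
  note p = Phi_bounds[of x] Phi_bounds[of z]
  have Q: "0 \<le> ?Q \<and> ?Q \<le> Phi x \<and> ?Q \<le> 1 - Phi x"
  proof (cases "x \<le> z")
    case True
    then have m: "Phi x \<le> Phi z" by (rule Phi_mono)
    have e: "?Q = (1 - Phi z) * Phi x" using True by (simp add: min_def algebra_simps)
    have "(1 - Phi z) * Phi x \<le> 1 * Phi x" "(1 - Phi z) * Phi x \<le> (1 - Phi x) * 1"
      by (rule mult_mono; use p m in linarith)+
    then show ?thesis using e p by auto
  next
    case False
    then have m: "Phi z \<le> Phi x" by (intro Phi_mono) simp
    have e: "?Q = Phi z * (1 - Phi x)" using False by (simp add: min_def algebra_simps)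
    have "Phi z * (1 - Phi x) \<le> Phi x * 1" "Phi z * (1 - Phi x) \<le> 1 * (1 - Phi x)"
      by (rule mult_mono; use p m in linarith)+
    then show ?thesis using e p by auto
  qed
  have "\<bar>x\<bar> * ?Q \<le> gdens x"
  proof -
    consider "x > 0" | "x = 0" | "x < 0" by linarith
    then show ?thesis
    proof cases
      case 1
      then have "\<bar>x\<bar> * ?Q \<le> x * (1 - Phi x)" using Q by (intro mult_mono) auto
      then show ?thesis using mills_ratio[OF 1] by simp
    next
      case 2
      then show ?thesis using gdens_pos[of 0] by simp
    next
      case 3
      have "\<bar>x\<bar> * ?Q \<le> \<bar>x\<bar> * Phi x" using Q by (intro mult_left_mono) auto
      also have "\<dots> = - x * (1 - Phi (- x))" using 3 by (simp add: Phi_minus)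
      also have "\<dots> \<le> gdens x" using mills_ratio[of "- x"] 3 by (simp add: gdens_minus)
      finally show ?thesis .
    qed
  qed
  moreover have "\<bar>x * stein_sol z x\<bar> = \<bar>x\<bar> * ?Q / gdens x"
    using Q gdens_pos[of x] by (simp add: stein_sol_def abs_mult)
  ultimately show ?thesis using gdens_pos[of x] by (simp only: pos_divide_le_eq mult_1)
qed

lemma stein_deriv_bound: "\<bar>stein_deriv z x\<bar> \<le> 2"
  using stein_sol_bound[of x z] Phi_bounds[of z] unfolding stein_deriv_def by (auto simp: abs_le_iff)

lemma stein_deriv_measurable [measurable]: "stein_deriv z \<in> borel_measurable borel"
proof -
  have [measurable]: "stein_sol z \<in> borel_measurable borel"
    by (rule borel_measurable_continuous_onI[OF continuous_stein_sol])
  show ?thesis unfolding stein_deriv_def[abs_def] by measurable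
qed

lemma cube_Phi_tail: "((\<lambda>x. x ^ 3 * (1 - Phi x)) \<longlongrightarrow> 0) at_top"
proof (rule tendsto_sandwich[OF _ _ tendsto_const square_gdens_at_top])
  show "\<forall>\<^sub>F x in at_top. 0 \<le> x ^ 3 * (1 - Phi x)"
    using eventually_ge_at_top[of 0] by eventually_elim (use Phi_bounds in auto)
  show "\<forall>\<^sub>F x in at_top. x ^ 3 * (1 - Phi x) \<le> x\<^sup>2 * gdens x"
    using eventually_gt_at_top[of 0]
  proof eventually_elim
    case (elim x)
    have "x\<^sup>2 * (x * (1 - Phi x)) \<le> x\<^sup>2 * gdens x" by (intro mult_left_mono mills_ratio elim) simp
    then show ?case by (simp add: power3_eq_cube power2_eq_square mult.assoc)
  qed
qed

text \<open>On each side of \<open>z\<close> the integrand has an elementary antiderivative.\<close>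

lemma integral_stein_deriv:
  "(\<integral>x. x * stein_deriv z x \<partial>std_normal_distribution) = (z\<^sup>2 - 1) * gdens z / 3"
proof -
  \<comment> \<open>Antiderivatives from integrating \<open>x\<^sup>2\<close> times a tail by parts;
    the remaining cubic Gaussian term is integrated by means of
    \<open>(x\<^sup>2 - 1) * gdens x\<close>. The constants are chosen so that \<open>L\<close>
    vanishes at minus infinity and \<open>R\<close> at plus infinity.\<close>
  define L where "L = (\<lambda>x. (1 - Phi z) * (x ^ 3 * Phi x / 3 + (x\<^sup>2 - 1) * gdens x / 3))"
  define R where "R = (\<lambda>x. Phi z * (x ^ 3 * (1 - Phi x) / 3 - (x\<^sup>2 - 1) * gdens x / 3))"
  define l where "l = (\<lambda>x. (1 - Phi z) * (x\<^sup>2 * Phi x + x * gdens x))"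
  define r where "r = (\<lambda>x. Phi z * (x\<^sup>2 * (1 - Phi x) - x * gdens x))"
  have dL: "(L has_real_derivative l x) (at x)" for x
    unfolding L_def l_def
    by (auto intro!: derivative_eq_intros DERIV_gdens DERIV_Phi simp: field_simps power3_eq_cube power2_eq_square)
  have dR: "(R has_real_derivative r x) (at x)" for x
    unfolding R_def r_def
    by (auto intro!: derivative_eq_intros DERIV_gdens DERIV_Phi simp: field_simps power3_eq_cube power2_eq_square)
  have cont: "continuous_on UNIV l" "continuous_on UNIV r"
    unfolding l_def r_def by (intro continuous_intros continuous_Phi continuous_gdens)+
  have Rlim: "(R \<longlongrightarrow> 0) at_top"
  proof -
    have "((\<lambda>x. Phi z * (x ^ 3 * (1 - Phi x) / 3 - (x\<^sup>2 * gdens x - gdens x) / 3)) \<longlongrightarrow> Phi z * (0 / 3 - (0 - 0) / 3)) at_top"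
      by (intro tendsto_intros cube_Phi_tail square_gdens_at_top gdens_at_top) auto
    then show ?thesis by (simp add: R_def algebra_simps)
  qed
  have Llim: "((\<lambda>x. L (- x)) \<longlongrightarrow> 0) at_top"
  proof -
    have "((\<lambda>x. (1 - Phi z) * (- (x ^ 3 * (1 - Phi x)) / 3 + (x\<^sup>2 * gdens x - gdens x) / 3)) \<longlongrightarrow> (1 - Phi z) * (- 0 / 3 + (0 - 0) / 3)) at_top"
      by (intro tendsto_intros cube_Phi_tail square_gdens_at_top gdens_at_top) auto
    then show ?thesis by (simp add: L_def Phi_minus gdens_minus algebra_simps)
  qed
  note [measurable] = borel_measurable_continuous_onI[OF cont(1)] borel_measurable_continuous_onI[OF cont(2)]
  define h where "h = (\<lambda>x. gdens x * (x * stein_deriv z x))"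
  have hl: "h x = l x" if "x \<le> z" for x
    using that gdens_pos[of x] unfolding h_def l_def stein_deriv_def stein_sol_le[OF that]
    by (simp add: field_simps power2_eq_square)
  have hr: "h x = r x" if "z < x" for x
    using that gdens_pos[of x] unfolding h_def r_def stein_deriv_def stein_sol_ge[OF less_imp_le[OF that]]
    by (simp add: field_simps power2_eq_square)
  have hm [measurable]: "h \<in> borel_measurable borel" unfolding h_def by simp
  have w: "integrable lborel (\<lambda>x. 2 * (gdens x * \<bar>x\<bar>))"
    using integrable_std_normal_moment_abs[of 1] by simp
  have hb: "\<bar>h x\<bar> \<le> 2 * (gdens x * \<bar>x\<bar>)" for x
  proof -
    have "(gdens x * \<bar>x\<bar>) * \<bar>stein_deriv z x\<bar> \<le> (gdens x * \<bar>x\<bar>) * 2"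
      using stein_deriv_bound[of z x] gdens_pos[of x] by (intro mult_left_mono) auto
    then show ?thesis using gdens_pos[of x] by (simp add: h_def abs_mult mult_ac)
  qed
  have "((\<lambda>b. \<integral>x. h x * indicator {-b..b} x \<partial>lborel) \<longlongrightarrow> (\<integral>x. h x \<partial>lborel)) at_top"
  proof (rule integral_dominated_convergence_at_top[OF _ _ w])
    show "AE x in lborel. ((\<lambda>b. h x * indicator {-b..b} x) \<longlongrightarrow> h x) at_top"
    proof (rule AE_I2)
      fix x
      have "\<forall>\<^sub>F b in at_top. h x * indicator {-b..b} x = h x"
        using eventually_ge_at_top[of "\<bar>x\<bar>"] by eventually_elim (auto simp: indicator_def)
      then show "((\<lambda>b. h x * indicator {-b..b} x) \<longlongrightarrow> h x) at_top" by (rule tendsto_eventually)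
    qed
    have "norm (h x * indicator {-b..b} x) \<le> 2 * (gdens x * \<bar>x\<bar>)" for b x
      using hb[of x] by (auto simp: indicator_def)
    then show "\<forall>\<^sub>F b in at_top. AE x in lborel. norm (h x * indicator {-b..b} x) \<le> 2 * (gdens x * \<bar>x\<bar>)"
      by simp
  qed simp_all
  moreover have "\<forall>\<^sub>F b in at_top. (\<integral>x. h x * indicator {-b..b} x \<partial>lborel) = (L z - L (- b)) + (R b - R z)"
    using eventually_gt_at_top[of "\<bar>z\<bar>"]
  proof eventually_elim
    case (elim b)
    have bL: "has_bochner_integral lborel (\<lambda>x. l x * indicator {-b..z} x) (L z - L (- b))"
      by (rule has_bochner_integral_FTC_Icc_real) (use elim dL cont in \<open>auto simp: continuous_on_eq_continuous_at\<close>)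
    have bR: "has_bochner_integral lborel (\<lambda>x. r x * indicator {z..b} x) (R b - R z)"
      by (rule has_bochner_integral_FTC_Icc_real) (use elim dR cont in \<open>auto simp: continuous_on_eq_continuous_at\<close>)
    have "(\<integral>x. h x * indicator {-b..b} x \<partial>lborel) = (\<integral>x. l x * indicator {-b..z} x + r x * indicator {z..b} x \<partial>lborel)"
    proof (rule integral_cong_AE)
      show "AE x in lborel. h x * indicator {-b..b} x = l x * indicator {-b..z} x + r x * indicator {z..b} x"
        using AE_lborel_singleton[of z]
      proof eventually_elim
        case (elim x)
        show ?case using \<open>\<bar>z\<bar> < b\<close> elim by (cases "x \<le> z") (auto simp: hl hr indicator_def)
      qed
    qed simp_all
    also have "\<dots> = (L z - L (- b)) + (R b - R z)"
      using has_bochner_integral_add[OF bL bR] by (rule has_bochner_integral_integral_eq)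
    finally show ?case .
  qed
  ultimately have "((\<lambda>b. (L z - L (- b)) + (R b - R z)) \<longlongrightarrow> (\<integral>x. h x \<partial>lborel)) at_top"
    by (rule Lim_transform_eventually)
  moreover have "((\<lambda>b. (L z - L (- b)) + (R b - R z)) \<longlongrightarrow> (L z - 0) + (0 - R z)) at_top"
    by (intro tendsto_intros Llim Rlim)
  ultimately have "(\<integral>x. h x \<partial>lborel) = L z - R z"
    by (auto dest: tendsto_unique[OF trivial_limit_at_top_linorder])
  \<comment> \<open>The cubic terms of \<open>L z\<close> and \<open>R z\<close> coincide and
    cancel; the weights \<open>1 - Phi z\<close> and \<open>Phi z\<close> of the Gaussian terms add
    up to 1.\<close>
  also have "\<dots> = (z\<^sup>2 - 1) * gdens z / 3" by (simp add: L_def R_def field_simps)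
  finally show ?thesis
    by (subst integral_density) (auto simp: h_def normal_density_nonneg)
qed

lemma antiderivative_exists:
  fixes u :: "real \<Rightarrow> real"
  assumes "continuous_on UNIV u"
  obtains g where "\<And>x. (g has_real_derivative u x) (at x)" "g 0 = c"
proof -
  have "\<exists>F. \<forall>x::real. -\<infinity> < ereal x \<longrightarrow> ereal x < \<infinity> \<longrightarrow> (F has_vector_derivative u x) (at x)"
    by (rule einterval_antiderivative) (use assms in \<open>auto simp: continuous_on_eq_continuous_at\<close>)
  then obtain F where F: "\<And>x. (F has_real_derivative u x) (at x)"
    by (auto simp: has_real_derivative_iff_has_vector_derivative)
  show ?thesis
    by (rule that[of "\<lambda>x. F x - F 0 + c"]) (auto intro!: derivative_eq_intros F)
qed

text \<open>A continuous approximation of the indicator from above. It equals 1 at \<open>z\<close>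
  itself, so the limit holds at every point and agrees with the convention in
  \<open>stein_deriv\<close>.\<close>

definition ramp :: "real \<Rightarrow> nat \<Rightarrow> real \<Rightarrow> real" where
  "ramp z k x = max 0 (min 1 (1 - real (Suc k) * (x - z)))"

lemma ramp_bounds: "0 \<le> ramp z k x" "ramp z k x \<le> 1"
  by (auto simp: ramp_def)

lemma continuous_ramp: "continuous_on A (ramp z k)"
  unfolding ramp_def[abs_def] by (intro continuous_intros)

lemma ramp_tendsto: "(\<lambda>k. ramp z k x) \<longlonglongrightarrow> (if x \<le> z then 1 else 0)"
proof (cases "x \<le> z")
  case True
  have "ramp z k x = 1" for k using True mult_nonneg_nonpos[of "real (Suc k)" "x - z"] by (simp add: ramp_def)
  then show ?thesis using True by simp
next
  case False
  then obtain K where "1 / (x - z) < real K" using reals_Archimedean2 by blast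
  then have K: "1 < real K * (x - z)" using False by (simp add: field_simps)
  have "ramp z k x = 0" if "k \<ge> K" for k
  proof -
    have "real K * (x - z) \<le> real (Suc k) * (x - z)" using that False by (intro mult_right_mono) auto
    then show ?thesis using K by (simp add: ramp_def)
  qed
  then have "\<forall>\<^sub>F k in sequentially. ramp z k x = 0" by (auto simp: eventually_sequentially)
  then show ?thesis using False by (simp add: tendsto_eventually)
qed

text \<open>The derivative of the Stein solution jumps at \<open>z\<close>.\<close>

lemma stein_sol_approx:
  obtains g u where "\<And>k x. (g k has_real_derivative u k x) (at x)" "\<And>k. continuous_on UNIV (u k)"
    "\<And>k x. \<bar>u k x\<bar> \<le> 3" "\<And>x. (\<lambda>k::nat. u k x) \<longlonglongrightarrow> stein_deriv z x" "\<And>x. (\<lambda>k. g k x) \<longlonglongrightarrow> stein_sol z x"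
    "\<And>k. g k 0 = stein_sol z 0"
proof -
  define u where "u = (\<lambda>k x. x * stein_sol z x + ramp z k x - Phi z)"
  have cu: "continuous_on UNIV (u k)" for k
    unfolding u_def by (intro continuous_intros continuous_ramp continuous_stein_sol)
  have ub: "\<bar>u k x\<bar> \<le> 3" for k x
    using stein_sol_bound[of x z] Phi_bounds[of z] ramp_bounds[of z k x] unfolding u_def by (auto simp: abs_le_iff)
  have ul: "(\<lambda>k. u k x) \<longlonglongrightarrow> stein_deriv z x" for x
    unfolding u_def stein_deriv_def by (intro tendsto_intros ramp_tendsto)
  have "\<forall>k. \<exists>g. (\<forall>x. (g has_real_derivative u k x) (at x)) \<and> g 0 = stein_sol z 0"
    using antiderivative_exists[OF cu, of _ "stein_sol z 0"] by metis
  from choice[OF this] obtain g where g: "\<And>k x. (g k has_real_derivative u k x) (at x)" "\<And>k. g k 0 = stein_sol z 0"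
    by blast
  have ftc: "(u k has_integral g k b - g k a) {a..b}" if "a \<le> b" for a b k
    by (rule fundamental_theorem_of_calculus[OF that])
      (use g(1) in \<open>auto simp: has_real_derivative_iff_has_vector_derivative intro: has_vector_derivative_at_within\<close>)
  \<comment> \<open>The fundamental theorem tolerates the exceptional point \<open>z\<close>, since
    the solution is continuous across it.\<close>
  have ftcs: "(stein_deriv z has_integral stein_sol z b - stein_sol z a) {a..b}" if "a \<le> b" for a b
    by (rule fundamental_theorem_of_calculus_interior_strong[of "{z}"])
      (use that DERIV_stein_sol in \<open>auto simp: has_real_derivative_iff_has_vector_derivative
        intro: continuous_on_subset[OF continuous_stein_sol]\<close>)
  \<comment> \<open>Bounded convergence of the derivatives on a compact interval. Convergence of the
    functions follows because all of them are anchored at 0 to the value of the solution.\<close>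
  have diff: "(\<lambda>k. g k b - g k a) \<longlonglongrightarrow> stein_sol z b - stein_sol z a" if "a \<le> b" for a b
  proof -
    have "(\<lambda>k. integral {a..b} (u k)) \<longlonglongrightarrow> integral {a..b} (stein_deriv z)"
      by (rule dominated_convergence[where h="\<lambda>_. 3"])
        (use ftc[OF that] ub ul in \<open>auto intro: has_integral_integrable\<close>)
    moreover have "integral {a..b} (u k) = g k b - g k a" for k by (rule integral_unique[OF ftc[OF that]])
    moreover have "integral {a..b} (stein_deriv z) = stein_sol z b - stein_sol z a" by (rule integral_unique[OF ftcs[OF that]])
    ultimately show ?thesis by simp
  qed
  have gl: "(\<lambda>k. g k x) \<longlonglongrightarrow> stein_sol z x" for x
  proof (cases "0 \<le> x")
    case True
    from tendsto_add[OF diff[OF True] tendsto_const[of "stein_sol z 0"]] show ?thesis by (simp add: g(2))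
  next
    case False
    then have "x \<le> 0" by simp
    from tendsto_diff[OF tendsto_const[of "stein_sol z 0"] diff[OF this]] show ?thesis by (simp add: g(2))
  qed
  show ?thesis using that[OF g(1) cu ub ul gl g(2)] .
qed

section \<open>Integration by parts for the Stein solution and for the square\<close>

context isonormal_process
begin

text \<open>Each \<open>u k\<close> needs a bound of its own for the identity to apply, and these
  bounds may grow with \<open>k\<close>. Only the majorants \<open>G\<close> and \<open>H\<close>
  are uniform, and they are required to be integrable just at \<open>F\<close>.\<close>

lemma malliavin_integration_by_parts_limit:
  assumes F: "F \<in> L2_functionals M X" "expectation F = 0" "F \<in> malliavin_D12 M X"
    and g: "\<And>k x. (g k has_real_derivative u k x) (at x)" "\<And>k. continuous_on UNIV (u k)" "\<And>k x. \<bar>u k x\<bar> \<le> C k"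
    and lim: "\<And>x. (\<lambda>k::nat. g k x) \<longlonglongrightarrow> g' x" "\<And>x. (\<lambda>k. u k x) \<longlonglongrightarrow> u' x"
    and dom: "\<And>k x. \<bar>g k x\<bar> \<le> G x" "\<And>k x. \<bar>u k x\<bar> \<le> H x"
    and int: "integrable M (\<lambda>\<omega>. G (F \<omega>) * \<bar>F \<omega>\<bar>)" "integrable M (\<lambda>\<omega>. H (F \<omega>) * \<bar>malliavin_inner M X F \<omega>\<bar>)"
  shows "expectation (\<lambda>\<omega>. g' (F \<omega>) * F \<omega>) = expectation (\<lambda>\<omega>. u' (F \<omega>) * malliavin_inner M X F \<omega>)"
proof -
  have [measurable]: "F \<in> borel_measurable M" using F(1) by (simp add: L2_functionals_iff sq_int_measurable)
  have [measurable]: "malliavin_inner M X F \<in> borel_measurable M"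
    using malliavin_integration_by_parts(2)[OF F g] by auto
  have cg: "continuous_on UNIV (g k)" for k
    using g(1) by (blast intro: continuous_at_imp_continuous_on DERIV_isCont)
  have [measurable]: "g k \<in> borel_measurable borel" "u k \<in> borel_measurable borel" for k
    by (rule borel_measurable_continuous_onI[OF cg] borel_measurable_continuous_onI[OF g(2)])+
  have [measurable]: "g' \<in> borel_measurable borel" "u' \<in> borel_measurable borel"
    by (rule borel_measurable_LIMSEQ_real[OF lim(1)] borel_measurable_LIMSEQ_real[OF lim(2)]; simp)+
  have "(\<lambda>k. expectation (\<lambda>\<omega>. g k (F \<omega>) * F \<omega>)) \<longlonglongrightarrow> expectation (\<lambda>\<omega>. g' (F \<omega>) * F \<omega>)"
    by (rule integral_dominated_convergence[OF _ _ int(1)])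
      (use lim dom in \<open>auto intro!: tendsto_intros mult_right_mono simp: abs_mult\<close>)
  moreover have "(\<lambda>k. expectation (\<lambda>\<omega>. u k (F \<omega>) * malliavin_inner M X F \<omega>)) \<longlonglongrightarrow> expectation (\<lambda>\<omega>. u' (F \<omega>) * malliavin_inner M X F \<omega>)"
    by (rule integral_dominated_convergence[OF _ _ int(2)])
      (use lim dom in \<open>auto intro!: tendsto_intros mult_right_mono simp: abs_mult\<close>)
  ultimately show ?thesis
    unfolding malliavin_integration_by_parts(1)[OF F g] by (rule LIMSEQ_unique)
qed

text \<open>The derivatives of the approximations are bounded by 3, so the approximations grow at
  most linearly from a common value at 0; a second moment of \<open>F\<close> and integrability of
  the Malliavin inner product are enough for the limit.\<close>

lemma malliavin_stein:
  assumes F: "F \<in> L2_functionals M X" "expectation F = 0" "F \<in> malliavin_D12 M X"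
  shows "prob {\<omega>\<in>space M. F \<omega> \<le> z} - Phi z = expectation (\<lambda>\<omega>. stein_deriv z (F \<omega>) * (1 - malliavin_inner M X F \<omega>))"
proof -
  have F2: "sq_int M F" using F(1) by (simp add: L2_functionals_iff)
  note [measurable] = sq_int_measurable[OF F2]
  have iT: "integrable M (malliavin_inner M X F)"
    by (rule malliavin_integration_by_parts(2)[OF F, of "\<lambda>_. 0" "\<lambda>_. 0" 0]) auto
  then have [measurable]: "malliavin_inner M X F \<in> borel_measurable M" by auto
  obtain g u where g: "\<And>k x. (g k has_real_derivative u k x) (at x)" "\<And>k. continuous_on UNIV (u k)"
    "\<And>k x. \<bar>u k x\<bar> \<le> 3" "\<And>x. (\<lambda>k::nat. u k x) \<longlonglongrightarrow> stein_deriv z x" "\<And>x. (\<lambda>k. g k x) \<longlonglongrightarrow> stein_sol z x"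
    "\<And>k. g k 0 = stein_sol z 0"
    by (rule stein_sol_approx[of z], rule that)
  have gb: "\<bar>g k x\<bar> \<le> \<bar>stein_sol z 0\<bar> + 3 * \<bar>x\<bar>" for k x
    using field_differentiable_bound[of UNIV "g k" "u k" 3 x 0] g(1,3) g(6)[of k] by simp
  have "integrable M (\<lambda>\<omega>. \<bar>stein_sol z 0\<bar> * \<bar>F \<omega>\<bar> + 3 * (F \<omega>)\<^sup>2)"
    using sq_int_integrable[OF F2] F2 by (simp add: sq_int_real)
  then have i1: "integrable M (\<lambda>\<omega>. (\<bar>stein_sol z 0\<bar> + 3 * \<bar>F \<omega>\<bar>) * \<bar>F \<omega>\<bar>)"
    by (simp add: distrib_right power2_eq_square mult.assoc)
  have main: "expectation (\<lambda>\<omega>. stein_sol z (F \<omega>) * F \<omega>) = expectation (\<lambda>\<omega>. stein_deriv z (F \<omega>) * malliavin_inner M X F \<omega>)"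
    by (rule malliavin_integration_by_parts_limit[OF F g(1,2,3,5,4) gb g(3) i1]) (use iT in simp)
  have iu: "integrable M (\<lambda>\<omega>. stein_deriv z (F \<omega>))"
    by (rule integrable_bounded[where C=2]) (use stein_deriv_bound in auto)
  have iuT: "integrable M (\<lambda>\<omega>. stein_deriv z (F \<omega>) * malliavin_inner M X F \<omega>)"
    by (rule Bochner_Integration.integrable_bound[where f="\<lambda>\<omega>. 2 * \<bar>malliavin_inner M X F \<omega>\<bar>"])
      (use iT stein_deriv_bound in \<open>auto simp: abs_mult intro!: mult_right_mono\<close>)
  have [measurable]: "stein_sol z \<in> borel_measurable borel"
    by (rule borel_measurable_continuous_onI[OF continuous_stein_sol])
  have if': "integrable M (\<lambda>\<omega>. stein_sol z (F \<omega>) * F \<omega>)"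
    by (rule integrable_bounded[where C=1]) (use stein_sol_bound in \<open>auto simp: mult.commute\<close>)
  have "stein_deriv z (F \<omega>) - stein_sol z (F \<omega>) * F \<omega> = indicator {\<omega>\<in>space M. F \<omega> \<le> z} \<omega> - Phi z" if "\<omega> \<in> space M" for \<omega>
    using that by (simp add: stein_deriv_def mult.commute)
  then have "expectation (\<lambda>\<omega>. stein_deriv z (F \<omega>) - stein_sol z (F \<omega>) * F \<omega>) = expectation (\<lambda>\<omega>. indicator {\<omega>\<in>space M. F \<omega> \<le> z} \<omega> - Phi z)"
    by (intro Bochner_Integration.integral_cong) auto
  also have "\<dots> = prob {\<omega>\<in>space M. F \<omega> \<le> z} - Phi z"
    proof -
    have "integrable M (indicator {\<omega>\<in>space M. F \<omega> \<le> z} :: 'w \<Rightarrow> real)"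
      by (intro integrable_real_indicator) (auto simp: emeasure_eq_measure)
    then show ?thesis by (simp add: prob_space)
  qed
  finally show ?thesis using iu iuT if' main by (simp add: right_diff_distrib)
qed

text \<open>The square is approximated by K ln(1 + x^2 / K) with K = k + 1. These functions stay
  below x^2, their derivatives are bounded for each K and dominated by 2|x|, so the third moment and
  the integrable product with the Malliavin inner product provide the majorants.\<close>

lemma malliavin_third_moment:
  assumes F: "F \<in> L2_functionals M X" "expectation F = 0" "F \<in> malliavin_D12 M X"
    and i3: "integrable M (\<lambda>\<omega>. \<bar>F \<omega>\<bar> ^ 3)" and iFT: "integrable M (\<lambda>\<omega>. F \<omega> * malliavin_inner M X F \<omega>)"
  shows "expectation (\<lambda>\<omega>. F \<omega> ^ 3) = 2 * expectation (\<lambda>\<omega>. F \<omega> * malliavin_inner M X F \<omega>)"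
proof -
  define g where "g = (\<lambda>(k::nat) x. real (Suc k) * ln (1 + x\<^sup>2 / real (Suc k)))"
  define u where "u = (\<lambda>(k::nat) x. 2 * x / (1 + x\<^sup>2 / real (Suc k)))"
  have p: "0 < 1 + x\<^sup>2 / real (Suc k)" for x :: real and k by (intro add_pos_nonneg) auto
  have n1: "1 \<le> 1 + x\<^sup>2 / real (Suc k)" for x :: real and k by simp
  have d: "(g k has_real_derivative u k x) (at x)" for k x
    proof -
    have "((\<lambda>x. K * ln (1 + x\<^sup>2 / K)) has_real_derivative 2 * x / (1 + x\<^sup>2 / K)) (at x)" if "0 < K" "0 < 1 + x\<^sup>2 / K" for K :: real
      using that by (auto intro!: derivative_eq_intros)
    then show ?thesis unfolding g_def u_def using p[of x k] by simp
  qed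
  have c: "continuous_on UNIV (u k)" for k
    unfolding u_def using p[of _ k] by (intro continuous_intros) (auto simp: less_imp_neq[symmetric])
  have ub: "\<bar>u k x\<bar> \<le> 1 + real (Suc k)" for k x
  proof -
    \<comment> \<open>A crude bound: all that matters is that it is independent of
      \<open>x\<close>.\<close>
    have "2 * \<bar>x\<bar> \<le> 1 + x\<^sup>2" using zero_le_power2[of "\<bar>x\<bar> - 1"] by (simp add: power2_diff)
    also have "\<dots> \<le> (1 + real (Suc k)) * (1 + x\<^sup>2 / real (Suc k))"
      by (simp add: field_simps)
    finally have "2 * \<bar>x\<bar> / (1 + x\<^sup>2 / real (Suc k)) \<le> 1 + real (Suc k)"
      using p[of x k] by (simp only: pos_divide_le_eq)
    then show ?thesis by (simp only: u_def abs_divide abs_of_pos[OF p] abs_mult abs_numeral)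
  qed
  have ub2: "\<bar>u k x\<bar> \<le> 2 * \<bar>x\<bar>" for k x
  proof -
    have "2 * \<bar>x\<bar> * 1 \<le> 2 * \<bar>x\<bar> * (1 + x\<^sup>2 / real (Suc k))" by (intro mult_left_mono n1) auto
    then show ?thesis using p[of x k] by (simp add: u_def abs_mult pos_divide_le_eq)
  qed
  have gb: "\<bar>g k x\<bar> \<le> x\<^sup>2" for k x
  proof -
    have "0 \<le> ln (1 + x\<^sup>2 / real (Suc k))" "ln (1 + x\<^sup>2 / real (Suc k)) \<le> x\<^sup>2 / real (Suc k)"
      using n1[of x k] by (auto intro!: ln_add_one_self_le_self)
    then have "0 \<le> g k x" "g k x \<le> real (Suc k) * (x\<^sup>2 / real (Suc k))"
      unfolding g_def by (auto intro!: mult_left_mono mult_nonneg_nonneg simp del: times_divide_eq_right)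
    then show ?thesis by simp
  qed
  have o: "(\<lambda>k. x\<^sup>2 / real (Suc k)) \<longlonglongrightarrow> 0" for x :: real
    using LIMSEQ_Suc[OF lim_const_over_n[of "x\<^sup>2"]] .
  have ul: "(\<lambda>k. u k x) \<longlonglongrightarrow> 2 * x" for x
  proof -
    have "(\<lambda>k. 2 * x / (1 + x\<^sup>2 / real (Suc k))) \<longlonglongrightarrow> 2 * x / (1 + 0)"
      by (intro tendsto_intros o) auto
    then show ?thesis by (simp add: u_def)
  qed
  have gl: "(\<lambda>k. g k x) \<longlonglongrightarrow> x\<^sup>2" for x
  proof (rule tendsto_sandwich[OF _ _ _ tendsto_const])
    let ?l = "\<lambda>k. x\<^sup>2 / (1 + x\<^sup>2 / real (Suc k))"
    have "?l \<longlonglongrightarrow> x\<^sup>2 / (1 + 0)" by (intro tendsto_intros o) auto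
    then show "?l \<longlonglongrightarrow> x\<^sup>2" by simp
    \<comment> \<open>The elementary bound y / (1 + y) \<le> ln(1 + y), obtained from the logarithm
      inequality at the inverse of 1 + y.\<close>
    have "?l k \<le> g k x" for k
    proof -
      let ?y = "x\<^sup>2 / real (Suc k)"
      have "1 - inverse (1 + ?y) \<le> ln (1 + ?y)"
        using ln_le_minus_one[of "inverse (1 + ?y)"] p[of x k] by (simp add: ln_inverse)
      moreover have "1 - inverse (1 + y) = y / (1 + y)" if "0 < 1 + y" for y :: real
        using that by (simp add: field_simps)
      note this[OF p[of x k]]
      ultimately have "real (Suc k) * (?y / (1 + ?y)) \<le> g k x" unfolding g_def by (intro mult_left_mono) auto
      moreover have "K * (a / K / b) = a / b" if "K > 0" for K a b :: real using that by simp
      ultimately show ?thesis by (metis of_nat_0_less_iff zero_less_Suc)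
    qed
    then show "\<forall>\<^sub>F k in sequentially. ?l k \<le> g k x" by simp
    show "\<forall>\<^sub>F k in sequentially. g k x \<le> x\<^sup>2" using gb[of _ x] by (simp add: abs_le_iff)
  qed
  have "expectation (\<lambda>\<omega>. (F \<omega>)\<^sup>2 * F \<omega>) = expectation (\<lambda>\<omega>. 2 * F \<omega> * malliavin_inner M X F \<omega>)"
  proof (rule malliavin_integration_by_parts_limit[OF F d c ub gl ul gb ub2])
    have "(F \<omega>)\<^sup>2 * \<bar>F \<omega>\<bar> = \<bar>F \<omega>\<bar> ^ 3" for \<omega>
      by (simp add: power2_eq_square power3_eq_cube abs_mult_self_eq)
    then show "integrable M (\<lambda>\<omega>. (F \<omega>)\<^sup>2 * \<bar>F \<omega>\<bar>)" using i3 by simp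
    have "integrable M (\<lambda>\<omega>. 2 * \<bar>F \<omega> * malliavin_inner M X F \<omega>\<bar>)" using iFT by simp
    then show "integrable M (\<lambda>\<omega>. 2 * \<bar>F \<omega>\<bar> * \<bar>malliavin_inner M X F \<omega>\<bar>)" by (simp add: abs_mult mult.assoc)
  qed
  then show ?thesis by (simp add: power2_eq_square power3_eq_cube mult.assoc)
qed

end

section \<open>Limits along pairs converging in distribution\<close>

text \<open>An interchange of limits. The error may depend on \<open>n\<close>, as long as its limit
  in \<open>n\<close> becomes small with \<open>k\<close>; this allows the error itself to be
  controlled through convergence in distribution.\<close>

lemma tendsto_approximation:
  fixes a :: "nat \<Rightarrow> real" and b e :: "nat \<Rightarrow> nat \<Rightarrow> real"
  assumes b: "\<And>k. b k \<longlonglongrightarrow> b' k" and ab: "\<And>k. \<forall>\<^sub>F n in sequentially. \<bar>a n - b k n\<bar> \<le> e k n"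
    and e: "\<And>k. e k \<longlonglongrightarrow> s k" and ab': "\<And>k. \<bar>a' - b' k\<bar> \<le> s k" and s: "s \<longlonglongrightarrow> 0"
  shows "a \<longlonglongrightarrow> a'"
proof (rule tendstoI)
  fix r :: real assume r: "0 < r"
  then have "0 < r / 4" by simp
  from order_tendstoD(2)[OF s this] obtain k where k: "s k < r / 4"
    using eventually_happens'[OF sequentially_bot] by blast
  have "\<forall>\<^sub>F n in sequentially. dist (b k n) (b' k) < r / 4" by (rule tendstoD[OF b]) (use r in simp)
  moreover have "\<forall>\<^sub>F n in sequentially. e k n < r / 2" by (rule order_tendstoD(2)[OF e]) (use r k in simp)
  ultimately show "\<forall>\<^sub>F n in sequentially. dist (a n) a' < r"
    using ab[of k]
  proof eventually_elim
    case (elim n)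
    then show ?case using ab'[of k] k unfolding dist_real_def by linarith
  qed
qed

definition clip :: "real \<Rightarrow> real \<Rightarrow> real" where
  "clip K y = max (- K) (min K y)"

lemma continuous_clip: "continuous_on A (clip K)"
  unfolding clip_def[abs_def] by (intro continuous_intros)

lemma clip_measurable [measurable]: "clip K \<in> borel_measurable borel"
  by (rule borel_measurable_continuous_onI[OF continuous_clip])

lemma clip_bound: "0 \<le> K \<Longrightarrow> \<bar>clip K y\<bar> \<le> K"
  by (auto simp: clip_def)

lemma clip_error:
  assumes "0 < K"
  shows "\<bar>y - clip K y\<bar> \<le> y\<^sup>2 / K" "\<bar>y - clip K y\<bar> \<le> \<bar>y\<bar>" "\<bar>y\<bar> \<le> K \<Longrightarrow> clip K y = y"
proof -
  show c: "\<bar>y\<bar> \<le> K \<Longrightarrow> clip K y = y" by (auto simp: clip_def)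
  show l: "\<bar>y - clip K y\<bar> \<le> \<bar>y\<bar>" using assms by (auto simp: clip_def max_def min_def)
  show "\<bar>y - clip K y\<bar> \<le> y\<^sup>2 / K"
  proof (cases "\<bar>y\<bar> \<le> K")
    case True
    then show ?thesis using c assms by simp
  next
    case False
    then have "\<bar>y\<bar> * K \<le> \<bar>y\<bar> * \<bar>y\<bar>" by (intro mult_left_mono) auto
    then have "\<bar>y\<bar> \<le> y\<^sup>2 / K" using assms by (simp add: field_simps power2_eq_square)
    then show ?thesis using l by linarith
  qed
qed

text \<open>The truncation error is at most \<open>y\<^sup>2 / K\<close> pointwise, so a second
  moment of at most 1 yields a bound uniform over all such \<open>Y\<close>.\<close>

lemma (in prob_space) clip_error_expectation:
  assumes Y: "sq_int M Y" "l2norm M Y \<le> 1" and K: "0 < K"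
    and A: "A \<in> borel_measurable M" "\<And>\<omega>. \<bar>A \<omega>\<bar> \<le> C"
  shows "\<bar>expectation (\<lambda>\<omega>. A \<omega> * Y \<omega>) - expectation (\<lambda>\<omega>. A \<omega> * clip K (Y \<omega>))\<bar> \<le> C / K"
proof -
  note [measurable] = sq_int_measurable[OF Y(1)] A(1)
  have C0: "0 \<le> C" using A(2)[of undefined] by linarith
  have i1: "integrable M (\<lambda>\<omega>. A \<omega> * Y \<omega>)"
    using sq_int_integrable[OF sq_int_bounded_mult[OF Y(1) A]] by simp
  have i2: "integrable M (\<lambda>\<omega>. A \<omega> * clip K (Y \<omega>))"
    by (rule integrable_const_bound[where B="C * K"])
      (use A(2) clip_bound[of K] K in \<open>auto simp: abs_mult intro!: mult_mono order_trans[OF abs_ge_zero]\<close>)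
  have iY: "integrable M (\<lambda>\<omega>. C * ((Y \<omega>)\<^sup>2 / K))" using Y(1) by (simp add: sq_int_real)
  have "expectation (\<lambda>\<omega>. A \<omega> * Y \<omega>) - expectation (\<lambda>\<omega>. A \<omega> * clip K (Y \<omega>)) = expectation (\<lambda>\<omega>. A \<omega> * (Y \<omega> - clip K (Y \<omega>)))"
    using i1 i2 by (simp add: right_diff_distrib)
  also have "\<bar>\<dots>\<bar> \<le> expectation (\<lambda>\<omega>. C * ((Y \<omega>)\<^sup>2 / K))"
  proof (rule integral_abs_bound[THEN order_trans], rule integral_mono[OF _ iY])
    show "integrable M (\<lambda>\<omega>. \<bar>A \<omega> * (Y \<omega> - clip K (Y \<omega>))\<bar>)"
      using Bochner_Integration.integrable_diff[OF i1 i2] by (simp add: right_diff_distrib)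
    show "\<bar>A \<omega> * (Y \<omega> - clip K (Y \<omega>))\<bar> \<le> C * ((Y \<omega>)\<^sup>2 / K)" for \<omega>
      unfolding abs_mult by (intro mult_mono A clip_error K C0) simp
  qed
  also have "\<dots> = C / K * (l2norm M Y)\<^sup>2" by (simp add: l2norm_sq)
  also have "\<dots> \<le> C / K * 1" using Y(2) C0 K by (intro mult_left_mono) (auto simp: power_le_one)
  finally show ?thesis by simp
qed

text \<open>The conditions on \<open>F n\<close> and \<open>Y n\<close> start at \<open>m\<close>,
  from where the normalising factor is positive. Of the second component the locale records only an
  L2 norm of at most 1, which makes every truncation estimate uniform in \<open>n\<close>.\<close>

locale pair_limit = M: prob_space M + N: prob_space M'
  for M :: "'w measure" and M' :: "'v measure" +
  fixes F Y :: "nat \<Rightarrow> 'w \<Rightarrow> real" and N1 N2 :: "'v \<Rightarrow> real" and m :: nat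
  assumes F_measurable: "n \<ge> m \<Longrightarrow> F n \<in> borel_measurable M"
    and Y_sq_int: "n \<ge> m \<Longrightarrow> sq_int M (Y n)" and Y_norm: "n \<ge> m \<Longrightarrow> l2norm M (Y n) \<le> 1"
    and N1_measurable [measurable]: "N1 \<in> borel_measurable M'"
    and N2_sq_int: "sq_int M' N2" and N2_norm: "l2norm M' N2 \<le> 1"
    and conv: "converges_in_distribution M (\<lambda>n \<omega>. (F n \<omega>, Y n \<omega>)) M' (\<lambda>\<omega>. (N1 \<omega>, N2 \<omega>))"
begin



lemma N2_measurable [measurable]: "N2 \<in> borel_measurable M'"
  using sq_int_measurable[OF N2_sq_int] .

lemma eventually_ge_m: "(\<And>n. n \<ge> m \<Longrightarrow> P n) \<Longrightarrow> eventually P sequentially"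
  unfolding eventually_sequentially by blast

lemma convD:
  fixes f :: "real \<times> real \<Rightarrow> real"
  assumes "continuous_on UNIV f" "\<And>p. \<bar>f p\<bar> \<le> C"
  shows "(\<lambda>n. \<integral>\<omega>. f (F n \<omega>, Y n \<omega>) \<partial>M) \<longlonglongrightarrow> (\<integral>\<omega>. f (N1 \<omega>, N2 \<omega>) \<partial>M')"
  proof -
  have "bounded (range f)" using assms(2) by (intro boundedI[where B=C]) auto
  then show ?thesis using conv assms(1) unfolding converges_in_distribution_def by blast
qed

text \<open>The function \<open>A x * y\<close> is unbounded and hence no test function for
  convergence in distribution. Truncating \<open>y\<close> makes it one, with an error uniform in
  \<open>n\<close>.\<close>

lemma tendsto_continuous:
  assumes A: "continuous_on UNIV A" "\<And>x. \<bar>A x\<bar> \<le> C"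
  shows "(\<lambda>n. \<integral>\<omega>. A (F n \<omega>) * Y n \<omega> \<partial>M) \<longlonglongrightarrow> (\<integral>\<omega>. A (N1 \<omega>) * N2 \<omega> \<partial>M')"
proof (rule tendsto_approximation)
  let ?K = "\<lambda>k. real (Suc k)"
  have [measurable]: "A \<in> borel_measurable borel" by (rule borel_measurable_continuous_onI[OF A(1)])
  show "(\<lambda>n. \<integral>\<omega>. A (F n \<omega>) * clip (?K k) (Y n \<omega>) \<partial>M) \<longlonglongrightarrow> (\<integral>\<omega>. A (N1 \<omega>) * clip (?K k) (N2 \<omega>) \<partial>M')" for k
  proof -
    have "continuous_on UNIV (\<lambda>p. A (fst p) * clip (?K k) (snd p))"
      by (intro continuous_intros continuous_on_compose2[OF A(1)] continuous_on_compose2[OF continuous_clip[of UNIV]]) auto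
    moreover have "\<bar>A (fst p) * clip (?K k) (snd p)\<bar> \<le> C * ?K k" for p
      unfolding abs_mult by (intro mult_mono A clip_bound) (auto intro: order_trans[OF abs_ge_zero A(2)])
    ultimately have "(\<lambda>n. \<integral>\<omega>. (\<lambda>p. A (fst p) * clip (?K k) (snd p)) (F n \<omega>, Y n \<omega>) \<partial>M)
        \<longlonglongrightarrow> (\<integral>\<omega>. (\<lambda>p. A (fst p) * clip (?K k) (snd p)) (N1 \<omega>, N2 \<omega>) \<partial>M')"
      by (rule convD)
    then show ?thesis by simp
  qed
  show "\<forall>\<^sub>F n in sequentially. \<bar>(\<integral>\<omega>. A (F n \<omega>) * Y n \<omega> \<partial>M) - (\<integral>\<omega>. A (F n \<omega>) * clip (?K k) (Y n \<omega>) \<partial>M)\<bar> \<le> C / ?K k" for k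
    by (rule eventually_ge_m, rule M.clip_error_expectation) (use Y_sq_int Y_norm F_measurable A in auto)
  show "(\<lambda>n. C / ?K k) \<longlonglongrightarrow> C / ?K k" for k by simp
  show "\<bar>(\<integral>\<omega>. A (N1 \<omega>) * N2 \<omega> \<partial>M') - (\<integral>\<omega>. A (N1 \<omega>) * clip (?K k) (N2 \<omega>) \<partial>M')\<bar> \<le> C / ?K k" for k
    by (rule N.clip_error_expectation) (use N2_sq_int N2_norm A in auto)
  show "(\<lambda>k. C / ?K k) \<longlonglongrightarrow> 0" by (rule LIMSEQ_Suc[OF lim_const_over_n])
qed

text \<open>A continuous majorant of the distance between indicator and ramp, concentrated near
  \<open>z\<close>. Continuity lets convergence in distribution control it along the
  sequence.\<close>

definition tent :: "real \<Rightarrow> nat \<Rightarrow> real \<Rightarrow> real" where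
  "tent z k x = max 0 (1 - real (Suc k) * \<bar>x - z\<bar>)"

lemma tent_bounds: "0 \<le> tent z k x" "tent z k x \<le> 1"
  by (auto simp: tent_def)

lemma continuous_tent: "continuous_on A (tent z k)"
  unfolding tent_def[abs_def] by (intro continuous_intros)

lemma ramp_error: "\<bar>(if x \<le> z then 1 else 0) - ramp z k x\<bar> \<le> tent z k x"
proof (cases "x \<le> z")
  case True
  then have "ramp z k x = 1" using mult_nonneg_nonpos[of "real (Suc k)" "x - z"] by (simp add: ramp_def)
  then show ?thesis using True tent_bounds by simp
next
  case False
  then have "0 \<le> real (Suc k) * (x - z)" by (intro mult_nonneg_nonneg) auto
  then show ?thesis using False by (auto simp: ramp_def tent_def)
qed

text \<open>By Cauchy-Schwarz, replacing the indicator by a ramp costs at most the L2 norm of the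
  tent at \<open>F n\<close>. This converges to its value at \<open>N1\<close>, which tends to 0 as
  the tent narrows because \<open>N1\<close> has no atom at \<open>z\<close>.\<close>

lemma tendsto_indicator:
  assumes z: "AE \<omega> in M'. N1 \<omega> \<noteq> z"
  shows "(\<lambda>n. \<integral>\<omega>. (if F n \<omega> \<le> z then 1 else 0) * Y n \<omega> \<partial>M) \<longlonglongrightarrow> (\<integral>\<omega>. (if N1 \<omega> \<le> z then 1 else 0) * N2 \<omega> \<partial>M')"
proof (rule tendsto_approximation)
  have [measurable]: "tent z k \<in> borel_measurable borel" "ramp z k \<in> borel_measurable borel" for k
    by (rule borel_measurable_continuous_onI[OF continuous_tent] borel_measurable_continuous_onI[OF continuous_ramp])+
  show "(\<lambda>n. \<integral>\<omega>. ramp z k (F n \<omega>) * Y n \<omega> \<partial>M) \<longlonglongrightarrow> (\<integral>\<omega>. ramp z k (N1 \<omega>) * N2 \<omega> \<partial>M')" for k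
    by (rule tendsto_continuous[OF continuous_ramp, of _ _ 1]) (use ramp_bounds in auto)
  have err: "\<bar>(\<integral>\<omega>. (if f \<omega> \<le> z then 1 else 0) * y \<omega> \<partial>Q) - (\<integral>\<omega>. ramp z k (f \<omega>) * y \<omega> \<partial>Q)\<bar> \<le> sqrt (\<integral>\<omega>. (tent z k (f \<omega>))\<^sup>2 \<partial>Q)"
    if Q: "prob_space Q" and f [measurable]: "f \<in> borel_measurable Q" and y: "sq_int Q y" "l2norm Q y \<le> 1"
    for Q :: "'q measure" and f y k
  proof -
    interpret Q: prob_space Q by (rule Q)
    note [measurable] = sq_int_measurable[OF y(1)]
    have i1: "integrable Q (\<lambda>\<omega>. (if f \<omega> \<le> z then 1 else 0) * y \<omega>)"
      using Q.sq_int_integrable[OF sq_int_bounded_mult[OF y(1), of "\<lambda>\<omega>. if f \<omega> \<le> z then 1 else 0" 1]] by simp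
    have i2: "integrable Q (\<lambda>\<omega>. ramp z k (f \<omega>) * y \<omega>)"
      using Q.sq_int_integrable[OF sq_int_bounded_mult[OF y(1), of "\<lambda>\<omega>. ramp z k (f \<omega>)" 1]] ramp_bounds by simp
    have t: "sq_int Q (\<lambda>\<omega>. tent z k (f \<omega>))"
      by (rule Q.sq_int_bounded[where C=1]) (use tent_bounds in auto)
    have "(\<integral>\<omega>. (if f \<omega> \<le> z then 1 else 0) * y \<omega> \<partial>Q) - (\<integral>\<omega>. ramp z k (f \<omega>) * y \<omega> \<partial>Q)
      = (\<integral>\<omega>. ((if f \<omega> \<le> z then 1 else 0) - ramp z k (f \<omega>)) * y \<omega> \<partial>Q)"
      using i1 i2 by (simp add: left_diff_distrib)
    also have "\<bar>\<dots>\<bar> \<le> (\<integral>\<omega>. norm (tent z k (f \<omega>)) * norm (y \<omega>) \<partial>Q)"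
    proof (rule integral_abs_bound[THEN order_trans], rule integral_mono[OF _ sq_int_norm_mult[OF t y(1)]])
      show "integrable Q (\<lambda>\<omega>. \<bar>((if f \<omega> \<le> z then 1 else 0) - ramp z k (f \<omega>)) * y \<omega>\<bar>)"
        using Bochner_Integration.integrable_diff[OF i1 i2] by (simp add: left_diff_distrib)
      show "\<bar>((if f \<omega> \<le> z then 1 else 0) - ramp z k (f \<omega>)) * y \<omega>\<bar> \<le> norm (tent z k (f \<omega>)) * norm (y \<omega>)" for \<omega>
        unfolding abs_mult real_norm_def using ramp_error[where x="f \<omega>" and z=z and k=k] tent_bounds by (intro mult_right_mono) auto
    qed
    also have "\<dots> \<le> l2norm Q (\<lambda>\<omega>. tent z k (f \<omega>)) * l2norm Q y" by (rule l2_cauchy_schwarz[OF t y(1)])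
    also have "\<dots> \<le> l2norm Q (\<lambda>\<omega>. tent z k (f \<omega>)) * 1" by (intro mult_left_mono y) simp
    finally show ?thesis by (simp add: l2norm_def)
  qed
  show "\<forall>\<^sub>F n in sequentially. \<bar>(\<integral>\<omega>. (if F n \<omega> \<le> z then 1 else 0) * Y n \<omega> \<partial>M) - (\<integral>\<omega>. ramp z k (F n \<omega>) * Y n \<omega> \<partial>M)\<bar>
      \<le> sqrt (\<integral>\<omega>. (tent z k (F n \<omega>))\<^sup>2 \<partial>M)" for k
    by (rule eventually_ge_m, rule err) (use Y_sq_int Y_norm F_measurable M.prob_space_axioms in auto)
  show "\<bar>(\<integral>\<omega>. (if N1 \<omega> \<le> z then 1 else 0) * N2 \<omega> \<partial>M') - (\<integral>\<omega>. ramp z k (N1 \<omega>) * N2 \<omega> \<partial>M')\<bar>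
      \<le> sqrt (\<integral>\<omega>. (tent z k (N1 \<omega>))\<^sup>2 \<partial>M')" for k
    by (rule err) (use N2_sq_int N2_norm N.prob_space_axioms in auto)
  show "(\<lambda>n. sqrt (\<integral>\<omega>. (tent z k (F n \<omega>))\<^sup>2 \<partial>M)) \<longlonglongrightarrow> sqrt (\<integral>\<omega>. (tent z k (N1 \<omega>))\<^sup>2 \<partial>M')" for k
  proof -
    have "continuous_on UNIV (\<lambda>p. (tent z k (fst p))\<^sup>2)"
      by (intro continuous_intros continuous_on_compose2[OF continuous_tent[of UNIV]]) auto
    moreover have "\<bar>(tent z k (fst p))\<^sup>2\<bar> \<le> 1" for p :: "real \<times> real"
      using tent_bounds[of z k "fst p"] by (simp add: power_le_one)
    ultimately have "(\<lambda>n. \<integral>\<omega>. (tent z k (F n \<omega>))\<^sup>2 \<partial>M) \<longlonglongrightarrow> (\<integral>\<omega>. (tent z k (N1 \<omega>))\<^sup>2 \<partial>M')"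
      using convD[of "\<lambda>p. (tent z k (fst p))\<^sup>2" 1] by simp
    then show ?thesis by (intro tendsto_intros)
  qed
  have "(\<lambda>k. \<integral>\<omega>. (tent z k (N1 \<omega>))\<^sup>2 \<partial>M') \<longlonglongrightarrow> (\<integral>\<omega>. 0 \<partial>M')"
  proof (rule integral_dominated_convergence[where w="\<lambda>_. 1"])
    show "AE \<omega> in M'. (\<lambda>k. (tent z k (N1 \<omega>))\<^sup>2) \<longlonglongrightarrow> 0"
      using z
    proof eventually_elim
      case (elim \<omega>)
      then have p: "0 < \<bar>N1 \<omega> - z\<bar>" by simp
      obtain K where "1 / \<bar>N1 \<omega> - z\<bar> < real K" using reals_Archimedean2 by blast
      then have K: "1 < real K * \<bar>N1 \<omega> - z\<bar>" using p by (simp add: field_simps)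
      have "tent z k (N1 \<omega>) = 0" if "k \<ge> K" for k
      proof -
        have "real K * \<bar>N1 \<omega> - z\<bar> \<le> real (Suc k) * \<bar>N1 \<omega> - z\<bar>" using that by (intro mult_right_mono) auto
        then show ?thesis using K by (simp add: tent_def)
      qed
      then have "\<forall>\<^sub>F k in sequentially. (tent z k (N1 \<omega>))\<^sup>2 = 0" unfolding eventually_sequentially by (intro exI[of _ K]) simp
      then show ?case by (rule tendsto_eventually)
    qed
    show "AE \<omega> in M'. norm ((tent z k (N1 \<omega>))\<^sup>2) \<le> 1" for k
      using tent_bounds by (simp add: power_le_one)
  qed auto
  from tendsto_real_sqrt[OF this] show "(\<lambda>k. sqrt (\<integral>\<omega>. (tent z k (N1 \<omega>))\<^sup>2 \<partial>M')) \<longlonglongrightarrow> 0" by simp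
qed

text \<open>Now the first factor is unbounded too. Its truncation error in L2 is uniformly small by
  the moment of order \<open>2 + \<epsilon>\<close>, and Cauchy-Schwarz against \<open>Y n\<close>
  carries this over to the product.\<close>

lemma tendsto_product:
  assumes \<epsilon>: "\<epsilon> > 0" and S: "\<And>n. n \<ge> m \<Longrightarrow> (\<integral>\<^sup>+\<omega>. ennreal (\<bar>F n \<omega>\<bar> powr (2 + \<epsilon>)) \<partial>M) \<le> ennreal S" "0 \<le> S"
    and F2: "\<And>n. n \<ge> m \<Longrightarrow> sq_int M (F n)" and N12: "sq_int M' N1"
  shows "(\<lambda>n. \<integral>\<omega>. F n \<omega> * Y n \<omega> \<partial>M) \<longlonglongrightarrow> (\<integral>\<omega>. N1 \<omega> * N2 \<omega> \<partial>M')"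
proof -
  let ?K = "\<lambda>k. real (Suc k)"
  \<comment> \<open>One summand bounds the truncation error along the sequence, the other that of
    the limit, so that the same \<open>s\<close> serves both comparisons.\<close>
  define s where "s = (\<lambda>k. sqrt (S * ?K k powr (- \<epsilon>)) + sqrt (\<integral>\<omega>. (N1 \<omega> - clip (?K k) (N1 \<omega>))\<^sup>2 \<partial>M'))"
  have err: "\<bar>(\<integral>\<omega>. f \<omega> * y \<omega> \<partial>Q) - (\<integral>\<omega>. clip K (f \<omega>) * y \<omega> \<partial>Q)\<bar> \<le> sqrt (\<integral>\<omega>. (f \<omega> - clip K (f \<omega>))\<^sup>2 \<partial>Q)"
    if Q: "prob_space Q" and f: "sq_int Q f" and y: "sq_int Q y" "l2norm Q y \<le> 1" and K: "0 < K"
    for Q :: "'q measure" and f y K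
  proof -
    interpret Q: prob_space Q by (rule Q)
    note [measurable] = sq_int_measurable[OF y(1)] sq_int_measurable[OF f]
    have c: "sq_int Q (\<lambda>\<omega>. clip K (f \<omega>))"
      by (rule Q.sq_int_bounded[where C=K]) (use clip_bound[of K] K in auto)
    have d: "sq_int Q (\<lambda>\<omega>. f \<omega> - clip K (f \<omega>))" by (rule sq_int_diff[OF f c])
    have "(\<integral>\<omega>. f \<omega> * y \<omega> \<partial>Q) - (\<integral>\<omega>. clip K (f \<omega>) * y \<omega> \<partial>Q) = (\<integral>\<omega>. inner (f \<omega> - clip K (f \<omega>)) (y \<omega>) \<partial>Q)"
      using sq_int_mult[OF f y(1)] sq_int_mult[OF c y(1)] by (simp add: left_diff_distrib)
    also have "\<bar>\<dots>\<bar> \<le> l2norm Q (\<lambda>\<omega>. f \<omega> - clip K (f \<omega>)) * l2norm Q y"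
      by (rule l2_cauchy_schwarz_inner[OF d y(1)])
    also have "\<dots> \<le> l2norm Q (\<lambda>\<omega>. f \<omega> - clip K (f \<omega>)) * 1" by (intro mult_left_mono y) simp
    finally show ?thesis by (simp add: l2norm_def)
  qed
  show ?thesis
  proof (rule tendsto_approximation)
    show "(\<lambda>n. \<integral>\<omega>. clip (?K k) (F n \<omega>) * Y n \<omega> \<partial>M) \<longlonglongrightarrow> (\<integral>\<omega>. clip (?K k) (N1 \<omega>) * N2 \<omega> \<partial>M')" for k
      by (rule tendsto_continuous[OF continuous_clip clip_bound]) simp
    show "(\<lambda>n. s k) \<longlonglongrightarrow> s k" for k by simp
    show "\<forall>\<^sub>F n in sequentially. \<bar>(\<integral>\<omega>. F n \<omega> * Y n \<omega> \<partial>M) - (\<integral>\<omega>. clip (?K k) (F n \<omega>) * Y n \<omega> \<partial>M)\<bar> \<le> s k" for k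
    proof (rule eventually_ge_m)
      fix n assume n: "n \<ge> m"
      note [measurable] = F_measurable[OF n]
      have c: "sq_int M (\<lambda>\<omega>. F n \<omega> - clip (?K k) (F n \<omega>))"
        by (rule sq_int_bound[OF _ F2[OF n]]) (use clip_error(2) in auto)
      \<comment> \<open>Truncation acts only where \<open>\<bar>x\<bar>\<close> exceeds
        \<open>?K k\<close>; there the ratio of the two, raised to the power
        \<open>\<epsilon>\<close>, is at least 1 and may be inserted as a factor.\<close>
      have pt: "(x - clip (?K k) x)\<^sup>2 \<le> ?K k powr (- \<epsilon>) * \<bar>x\<bar> powr (2 + \<epsilon>)" for x
      proof (cases "\<bar>x\<bar> \<le> ?K k")
        case True
        then show ?thesis using clip_error(3)[of "?K k" x] by simp
      next
        case False
        then have x: "0 < \<bar>x\<bar>" "?K k \<le> \<bar>x\<bar>" by auto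
        have "(x - clip (?K k) x)\<^sup>2 \<le> \<bar>x\<bar>\<^sup>2"
          using clip_error(2)[of "?K k" x] by (simp add: abs_le_square_iff[symmetric])
        also have "\<dots> = 1 * \<bar>x\<bar> powr 2" using x by (simp add: powr_numeral)
        also have "\<dots> \<le> (?K k powr (- \<epsilon>) * \<bar>x\<bar> powr \<epsilon>) * \<bar>x\<bar> powr 2"
        proof (rule mult_right_mono)
          have "?K k powr \<epsilon> \<le> \<bar>x\<bar> powr \<epsilon>" using x \<epsilon> by (intro powr_mono2) auto
          then have "?K k powr (- \<epsilon>) * ?K k powr \<epsilon> \<le> ?K k powr (- \<epsilon>) * \<bar>x\<bar> powr \<epsilon>" by (intro mult_left_mono) auto
          then show "1 \<le> ?K k powr (- \<epsilon>) * \<bar>x\<bar> powr \<epsilon>" by (simp add: powr_add[symmetric])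
        qed simp
        finally show ?thesis by (simp add: powr_add mult_ac)
      qed
      have "ennreal (\<integral>\<omega>. (F n \<omega> - clip (?K k) (F n \<omega>))\<^sup>2 \<partial>M) = (\<integral>\<^sup>+\<omega>. ennreal ((F n \<omega> - clip (?K k) (F n \<omega>))\<^sup>2) \<partial>M)"
        using c by (intro nn_integral_eq_integral[symmetric]) (auto simp: sq_int_real)
      also have "\<dots> \<le> (\<integral>\<^sup>+\<omega>. ennreal (?K k powr (- \<epsilon>)) * ennreal (\<bar>F n \<omega>\<bar> powr (2 + \<epsilon>)) \<partial>M)"
        by (intro nn_integral_mono) (simp add: ennreal_mult[symmetric] ennreal_leI pt del: of_nat_Suc)
      also have "\<dots> = ennreal (?K k powr (- \<epsilon>)) * (\<integral>\<^sup>+\<omega>. ennreal (\<bar>F n \<omega>\<bar> powr (2 + \<epsilon>)) \<partial>M)"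
        by (rule nn_integral_cmult) measurable
      also have "\<dots> \<le> ennreal (?K k powr (- \<epsilon>)) * ennreal S" by (intro mult_left_mono S n) simp
      also have "\<dots> = ennreal (S * ?K k powr (- \<epsilon>))" using S(2) by (simp add: ennreal_mult[symmetric] mult.commute)
      finally have "(\<integral>\<omega>. (F n \<omega> - clip (?K k) (F n \<omega>))\<^sup>2 \<partial>M) \<le> S * ?K k powr (- \<epsilon>)"
        using S(2) by (simp add: ennreal_le_iff)
      then have "sqrt (\<integral>\<omega>. (F n \<omega> - clip (?K k) (F n \<omega>))\<^sup>2 \<partial>M) \<le> sqrt (S * ?K k powr (- \<epsilon>))" by (rule real_sqrt_le_mono)
      moreover have "\<bar>(\<integral>\<omega>. F n \<omega> * Y n \<omega> \<partial>M) - (\<integral>\<omega>. clip (?K k) (F n \<omega>) * Y n \<omega> \<partial>M)\<bar> \<le> sqrt (\<integral>\<omega>. (F n \<omega> - clip (?K k) (F n \<omega>))\<^sup>2 \<partial>M)"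
        by (rule err[OF M.prob_space_axioms F2[OF n] Y_sq_int[OF n] Y_norm[OF n]]) simp
      moreover have "0 \<le> sqrt (\<integral>\<omega>. (N1 \<omega> - clip (?K k) (N1 \<omega>))\<^sup>2 \<partial>M')" by simp
      ultimately show "\<bar>(\<integral>\<omega>. F n \<omega> * Y n \<omega> \<partial>M) - (\<integral>\<omega>. clip (?K k) (F n \<omega>) * Y n \<omega> \<partial>M)\<bar> \<le> s k"
        unfolding s_def by linarith
    qed
    show "\<bar>(\<integral>\<omega>. N1 \<omega> * N2 \<omega> \<partial>M') - (\<integral>\<omega>. clip (?K k) (N1 \<omega>) * N2 \<omega> \<partial>M')\<bar> \<le> s k" for k
    proof -
      have "0 \<le> sqrt (S * ?K k powr (- \<epsilon>))" using S(2) by simp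
      then show ?thesis
        using err[OF N.prob_space_axioms N12 N2_sq_int N2_norm, of "?K k"] unfolding s_def by linarith
    qed
    have "(\<lambda>k. ?K k powr (- \<epsilon>)) \<longlonglongrightarrow> 0"
      by (rule tendsto_neg_powr) (use \<epsilon> filterlim_compose[OF filterlim_real_sequentially filterlim_Suc] in auto)
    then have t1: "(\<lambda>k. sqrt (S * ?K k powr (- \<epsilon>))) \<longlonglongrightarrow> sqrt (S * 0)" by (intro tendsto_intros)
    have "(\<lambda>k. \<integral>\<omega>. (N1 \<omega> - clip (?K k) (N1 \<omega>))\<^sup>2 \<partial>M') \<longlonglongrightarrow> (\<integral>\<omega>. 0 \<partial>M')"
    proof (rule integral_dominated_convergence[where w="\<lambda>\<omega>. (N1 \<omega>)\<^sup>2"])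
      show "integrable M' (\<lambda>\<omega>. (N1 \<omega>)\<^sup>2)" using N12 by (simp add: sq_int_real)
      show "AE \<omega> in M'. (\<lambda>k. (N1 \<omega> - clip (?K k) (N1 \<omega>))\<^sup>2) \<longlonglongrightarrow> 0"
      proof (rule AE_I2)
        fix \<omega>
        obtain K where "\<bar>N1 \<omega>\<bar> < real K" using reals_Archimedean2 by blast
        then have "(N1 \<omega> - clip (?K k) (N1 \<omega>))\<^sup>2 = 0" if "k \<ge> K" for k
          using clip_error(3)[of "?K k" "N1 \<omega>"] that by simp
        then have "\<forall>\<^sub>F k in sequentially. (N1 \<omega> - clip (?K k) (N1 \<omega>))\<^sup>2 = 0" unfolding eventually_sequentially by blast
        then show "(\<lambda>k. (N1 \<omega> - clip (?K k) (N1 \<omega>))\<^sup>2) \<longlonglongrightarrow> 0" by (rule tendsto_eventually)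
      qed
      show "AE \<omega> in M'. norm ((N1 \<omega> - clip (?K k) (N1 \<omega>))\<^sup>2) \<le> (N1 \<omega>)\<^sup>2" for k
        using clip_error(2)[of "?K k"] by (simp add: abs_le_square_iff[symmetric] del: of_nat_Suc)
    qed auto
    from tendsto_add[OF t1 tendsto_real_sqrt[OF this]] show "s \<longlonglongrightarrow> 0" by (simp add: s_def[abs_def])
  qed
qed

end

text \<open>Multiples of a standard Gaussian variable form an isonormal process over the real line.
  In this way its law is inherited from \<open>distr_X_unit\<close>.\<close>

lemma standard_gaussian_isonormal:
  assumes "prob_space M" "gaussian_pair M Y Z" "integral\<^sup>L M Y = 0" "integral\<^sup>L M (\<lambda>\<omega>. (Y \<omega>)\<^sup>2) = 1"
  shows "isonormal_process M (\<lambda>(h::real) \<omega>. h * Y \<omega>)"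
proof -
  interpret prob_space M by fact
  show ?thesis
  proof
    show "gaussian_family M (\<lambda>h \<omega>. h * Y \<omega>)"
      unfolding gaussian_family_def
    proof (intro allI impI)
      fix I and c :: "real \<Rightarrow> real"
      have "(\<lambda>\<omega>. \<Sum>i\<in>I. c i * (i * Y \<omega>)) = (\<lambda>\<omega>. (\<Sum>i\<in>I. c i * i) * Y \<omega> + 0 * Z \<omega>)"
        by (simp add: sum_distrib_right mult.assoc)
      then show "gaussian_rv M (\<lambda>\<omega>. \<Sum>i\<in>I. c i * (i * Y \<omega>))"
        using assms(2)[unfolded gaussian_pair_def, rule_format, of "\<Sum>i\<in>I. c i * i" 0] by (simp only:)
    qed
    show "expectation (\<lambda>\<omega>. h * Y \<omega>) = 0" for h using assms(3) by simp
    have "expectation (\<lambda>\<omega>. h * Y \<omega> * (g * Y \<omega>)) = expectation (\<lambda>\<omega>. (h * g) * (Y \<omega>)\<^sup>2)" for h g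
      by (simp add: power2_eq_square mult_ac)
    then show "expectation (\<lambda>\<omega>. h * Y \<omega> * (g * Y \<omega>)) = inner h g" for h g using assms(4) by simp
  qed
qed

text \<open>The residual \<open>W\<close> of the regression of \<open>Z\<close> on \<open>Y\<close>
  is uncorrelated with \<open>Y\<close>. After normalisation the two span an isonormal process over
  the plane, and integration by parts in the direction of \<open>W\<close>, along which
  \<open>u (Y \<omega>)\<close> is constant, gives \<open>E[u(Y) W] = 0\<close>.\<close>

lemma gaussian_pair_regression:
  assumes M: "prob_space M" and G: "gaussian_pair M Y Z"
    and mean: "integral\<^sup>L M Y = 0" "integral\<^sup>L M Z = 0"
    and var: "integral\<^sup>L M (\<lambda>\<omega>. (Y \<omega>)\<^sup>2) = 1" "sq_int M Y" "sq_int M Z"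
    and cov: "integral\<^sup>L M (\<lambda>\<omega>. Y \<omega> * Z \<omega>) = \<rho>"
    and u [measurable]: "u \<in> borel_measurable borel" "\<And>x. \<bar>u x\<bar> \<le> C"
  shows "integral\<^sup>L M (\<lambda>\<omega>. u (Y \<omega>) * Z \<omega>) = \<rho> * integral\<^sup>L M (\<lambda>\<omega>. Y \<omega> * u (Y \<omega>))"
proof -
  interpret prob_space M by fact
  note [measurable] = sq_int_measurable[OF var(2)] sq_int_measurable[OF var(3)]
  define W where "W = (\<lambda>\<omega>. Z \<omega> - \<rho> * Y \<omega>)"
  have W2: "sq_int M W" unfolding W_def by (intro sq_int_diff sq_int_cmult var)
  note [measurable] = sq_int_measurable[OF W2]
  have iY: "integrable M Y" and iZ: "integrable M Z" using sq_int_integrable var by auto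
  have W0: "expectation W = 0" unfolding W_def using iY iZ mean by simp
  have YW: "expectation (\<lambda>\<omega>. Y \<omega> * W \<omega>) = 0"
  proof -
    have "expectation (\<lambda>\<omega>. Y \<omega> * W \<omega>) = expectation (\<lambda>\<omega>. Y \<omega> * Z \<omega> - \<rho> * (Y \<omega>)\<^sup>2)"
      by (simp add: W_def right_diff_distrib power2_eq_square mult_ac)
    then show ?thesis using sq_int_mult[OF var(2,3)] var(2) cov var(1) by (simp add: sq_int_real)
  qed
  define v where "v = expectation (\<lambda>\<omega>. (W \<omega>)\<^sup>2)"
  have uW: "expectation (\<lambda>\<omega>. u (Y \<omega>) * W \<omega>) = 0"
  proof (cases "v = 0")
    \<comment> \<open>A residual without variance cannot be normalised, but it vanishes almost
      surely.\<close>
    case True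
    then have "AE \<omega> in M. W \<omega> = 0"
      using W2 integral_nonneg_eq_0_iff_AE[of M "\<lambda>\<omega>. (W \<omega>)\<^sup>2"] by (auto simp: v_def sq_int_real)
    then show ?thesis by (intro integral_eq_zero_AE) auto
  next
    case False
    define \<sigma> where "\<sigma> = sqrt v"
    have v: "0 < v" using False unfolding v_def by (simp add: less_le)
    then have \<sigma>: "0 < \<sigma>" "\<sigma>\<^sup>2 = v" by (auto simp: \<sigma>_def)
    define X where "X = (\<lambda>(h::real \<times> real) \<omega>. fst h * Y \<omega> + snd h * (W \<omega> / \<sigma>))"
    interpret I: isonormal_process M X
    proof
      show "gaussian_family M X"
        unfolding gaussian_family_def
      proof (intro allI impI)
        fix I and c :: "real \<times> real \<Rightarrow> real"
        have "(\<lambda>\<omega>. \<Sum>i\<in>I. c i * X i \<omega>) = (\<lambda>\<omega>. (\<Sum>i\<in>I. c i * fst i - c i * snd i / \<sigma> * \<rho>) * Y \<omega> + (\<Sum>i\<in>I. c i * snd i / \<sigma>) * Z \<omega>)"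
          unfolding sum_distrib_right sum.distrib[symmetric]
          by (intro ext sum.cong refl) (use \<sigma> in \<open>simp add: X_def W_def field_simps\<close>)
        then show "gaussian_rv M (\<lambda>\<omega>. \<Sum>i\<in>I. c i * X i \<omega>)"
          using G[unfolded gaussian_pair_def, rule_format,
              of "\<Sum>i\<in>I. c i * fst i - c i * snd i / \<sigma> * \<rho>" "\<Sum>i\<in>I. c i * snd i / \<sigma>"]
          by (simp only:)
      qed
      show "expectation (X h) = 0" for h
        unfolding X_def using iY sq_int_integrable[OF W2] mean W0 by simp
      fix h g
      have "expectation (\<lambda>\<omega>. X h \<omega> * X g \<omega>) = expectation (\<lambda>\<omega>. (fst h * fst g) * (Y \<omega>)\<^sup>2
         + ((fst h * snd g + snd h * fst g) / \<sigma>) * (Y \<omega> * W \<omega>) + (snd h * snd g / v) * (W \<omega>)\<^sup>2)"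
        by (rule Bochner_Integration.integral_cong) (use \<sigma> in \<open>auto simp: X_def \<sigma>(2)[symmetric] power2_eq_square field_simps\<close>)
      also have "\<dots> = fst h * fst g + snd h * snd g"
        using sq_int_mult[OF var(2) W2] W2 var(1,2) YW v by (simp add: sq_int_real v_def[symmetric])
      finally show "expectation (\<lambda>\<omega>. X h \<omega> * X g \<omega>) = inner h g" by (simp add: inner_prod_def)
    qed
    have X1: "X (1, 0) = Y" and X2: "X (0, 1) = (\<lambda>\<omega>. W \<omega> / \<sigma>)" by (auto simp: X_def)
    have D: "I.dir_deriv (0, 1) (\<lambda>\<omega>. u (X (1, 0) \<omega>)) (\<lambda>_. 0)"
      by (rule I.dir_deriv_orthogonal) (auto simp: inner_prod_def)
    have "sq_int M (\<lambda>\<omega>. u (Y \<omega>))" by (rule sq_int_bounded[where C=C]) (use u in auto)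
    then have i: "integrable M (\<lambda>\<omega>. u (Y \<omega>))" "integrable M (\<lambda>\<omega>. u (Y \<omega>) * W \<omega>)"
      using sq_int_integrable sq_int_mult W2 by auto
    have "expectation (\<lambda>_. 0) = expectation (\<lambda>\<omega>. u (X (1, 0) \<omega>) * X (0, 1) \<omega>)"
      by (rule I.gaussian_integration_by_parts[OF _ D]) (use i in \<open>simp_all add: X1 X2 norm_Pair\<close>)
    then show ?thesis using \<sigma> by (simp add: X1 X2)
  qed
  have su: "sq_int M (\<lambda>\<omega>. u (Y \<omega>))" by (rule sq_int_bounded[where C=C]) (use u in auto)
  have "expectation (\<lambda>\<omega>. u (Y \<omega>) * Z \<omega>) = expectation (\<lambda>\<omega>. u (Y \<omega>) * W \<omega> + \<rho> * (Y \<omega> * u (Y \<omega>)))"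
    by (rule Bochner_Integration.integral_cong) (auto simp: W_def algebra_simps)
  also have "\<dots> = \<rho> * expectation (\<lambda>\<omega>. Y \<omega> * u (Y \<omega>))"
    using sq_int_mult[OF su W2] sq_int_mult[OF var(2) su] uW by simp
  finally show ?thesis .
qed

theorem proposition3p3:
  fixes M :: "'w measure"
    and X :: "'h :: {real_inner, banach, second_countable_topology} \<Rightarrow> 'w \<Rightarrow> real"
    and F :: "nat \<Rightarrow> 'w \<Rightarrow> real"
    and \<phi> :: "nat \<Rightarrow> real"
    and M' :: "'v measure"
    and N1 N2 :: "'v \<Rightarrow> real"
    and \<rho> :: real
  assumes "isonormal_process M X"
    and "\<forall>n\<ge>1. F n \<in> L2_functionals M X"
    and "\<forall>n\<ge>1. integral\<^sup>L M (F n) = 0"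
    and "\<forall>n\<ge>1. integral\<^sup>L M (\<lambda>\<omega>. (F n \<omega>)\<^sup>2) = 1"
    and "\<forall>n\<ge>1. F n \<in> malliavin_D12 M X"
    and "\<forall>n\<ge>1. absolutely_continuous lborel (distr M borel (F n))"
    and "\<forall>n. \<phi> n = sqrt (integral\<^sup>L M (\<lambda>\<omega>. (1 - malliavin_inner M X (F n) \<omega>)\<^sup>2))"
    and "\<forall>n\<ge>1. integrable M (\<lambda>\<omega>. (1 - malliavin_inner M X (F n) \<omega>)\<^sup>2)"
    and "\<phi> \<longlonglongrightarrow> 0"
    and "\<exists>m\<ge>1. \<forall>n\<ge>m. \<phi> n > 0"
    and "prob_space M'"
    and "gaussian_pair M' N1 N2"
    and "integral\<^sup>L M' N1 = 0" and "integral\<^sup>L M' N2 = 0"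
    and "integral\<^sup>L M' (\<lambda>\<omega>. (N1 \<omega>)\<^sup>2) = 1" and "integral\<^sup>L M' (\<lambda>\<omega>. (N2 \<omega>)\<^sup>2) = 1"
    and "integral\<^sup>L M' (\<lambda>\<omega>. N1 \<omega> * N2 \<omega>) = \<rho>"
    and "converges_in_distribution M
           (\<lambda>n \<omega>. (F n \<omega>, (1 - malliavin_inner M X (F n) \<omega>) / \<phi> n)) M' (\<lambda>\<omega>. (N1 \<omega>, N2 \<omega>))"
    and "\<forall>n\<ge>1. integrable M (\<lambda>\<omega>. \<bar>F n \<omega>\<bar> ^ 3)"
    and "\<exists>\<epsilon>>0. (SUP n\<in>{1..}. \<integral>\<^sup>+ \<omega>. ennreal (\<bar>F n \<omega>\<bar> powr (2 + \<epsilon>)) \<partial>M) < \<infinity>"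
  shows "(\<lambda>n. 1 / (2 * \<phi> n) * integral\<^sup>L M (\<lambda>\<omega>. F n \<omega> ^ 3)) \<longlonglongrightarrow> - \<rho> \<and>
    (\<forall>z. (\<lambda>n. (measure M {\<omega> \<in> space M. F n \<omega> \<le> z} - Phi z
              + 1 / fact 3 * integral\<^sup>L M (\<lambda>\<omega>. F n \<omega> ^ 3) * (deriv ^^ 3) Phi z) / \<phi> n)
           \<longlonglongrightarrow> 0)"
proof -
  interpret I: isonormal_process M X by fact
  interpret N: prob_space M' by fact
  define \<Theta> where "\<Theta> = (\<lambda>n. malliavin_inner M X (F n))"
  define Y where "Y = (\<lambda>n \<omega>. (1 - \<Theta> n \<omega>) / \<phi> n)"
  obtain m where m: "m \<ge> 1" "\<And>n. n \<ge> m \<Longrightarrow> \<phi> n > 0" using assms(10) by blast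
  have F: "F n \<in> L2_functionals M X" "integral\<^sup>L M (F n) = 0" "F n \<in> malliavin_D12 M X" if "n \<ge> m" for n
    using assms(2,3,5) m(1) that by auto
  have F2: "sq_int M (F n)" if "n \<ge> m" for n using F(1)[OF that] by (simp add: I.L2_functionals_iff)
  \<comment> \<open>Integrability does not depend on the test function, so the zero function is
    inserted.\<close>
  have \<Theta>i: "integrable M (\<Theta> n)" if "n \<ge> m" for n
    unfolding \<Theta>_def by (rule I.malliavin_integration_by_parts(2)[OF F[OF that], of "\<lambda>_. 0" "\<lambda>_. 0" 0]) auto
  have D2: "sq_int M (\<lambda>\<omega>. 1 - \<Theta> n \<omega>)" if "n \<ge> m" for n
    using assms(8) m(1) that borel_measurable_integrable[OF \<Theta>i[OF that]] unfolding sq_int_real \<Theta>_def by auto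
  have \<Theta>2: "sq_int M (\<Theta> n)" if "n \<ge> m" for n
    using sq_int_diff[OF I.sq_int_const[of 1] D2[OF that]] by simp
  have Y2: "sq_int M (Y n)" if "n \<ge> m" for n
    using sq_int_cmult[OF D2[OF that], of "1 / \<phi> n"] by (simp add: Y_def)
  have \<phi>: "\<phi> n = l2norm M (\<lambda>\<omega>. 1 - \<Theta> n \<omega>)" for n using assms(7) by (simp add: l2norm_def \<Theta>_def)
  have Ynorm: "l2norm M (Y n) = 1" if "n \<ge> m" for n
    using l2norm_scaleR[of M "1 / \<phi> n" "\<lambda>\<omega>. 1 - \<Theta> n \<omega>"] m(2)[OF that] by (simp add: Y_def \<phi>[symmetric])
  have N1m: "N1 \<in> borel_measurable M'" and N2m: "N2 \<in> borel_measurable M'"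
    using assms(12)[unfolded gaussian_pair_def, rule_format, of 1 0] assms(12)[unfolded gaussian_pair_def, rule_format, of 0 1]
    by (auto simp: gaussian_rv_def)
  note [measurable] = N1m N2m
  \<comment> \<open>A second moment equal to 1 is not the default value 0 of a non-integrable
    function, hence the squares are integrable.\<close>
  have N12: "sq_int M' N1" and N22: "sq_int M' N2"
    using assms(15,16) N1m N2m not_integrable_integral_eq unfolding sq_int_real by fastforce+
  interpret P: pair_limit M M' F Y N1 N2 m
  proof
    show "converges_in_distribution M (\<lambda>n \<omega>. (F n \<omega>, Y n \<omega>)) M' (\<lambda>\<omega>. (N1 \<omega>, N2 \<omega>))"
      using assms(18) by (simp add: Y_def \<Theta>_def)
    show "l2norm M' N2 \<le> 1" using assms(16) by (simp add: l2norm_def)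
  qed (use sq_int_measurable[OF F2] Y2 Ynorm N12 N22 in auto)
  have law: "distr M' borel N1 = std_normal_distribution"
    using isonormal_process.distr_X_unit[OF standard_gaussian_isonormal[OF assms(11,12,13,15)], of 1] by simp
  obtain \<epsilon> S where \<epsilon>: "\<epsilon> > 0" and S: "0 \<le> S" "\<And>n. n \<ge> m \<Longrightarrow> (\<integral>\<^sup>+\<omega>. ennreal (\<bar>F n \<omega>\<bar> powr (2 + \<epsilon>)) \<partial>M) \<le> ennreal S"
  proof -
    obtain \<epsilon> where e: "\<epsilon> > 0" "(SUP n\<in>{1..}. \<integral>\<^sup>+ \<omega>. ennreal (\<bar>F n \<omega>\<bar> powr (2 + \<epsilon>)) \<partial>M) < \<infinity>"
      using assms(20) by blast
    let ?S = "SUP n\<in>{1..}. \<integral>\<^sup>+ \<omega>. ennreal (\<bar>F n \<omega>\<bar> powr (2 + \<epsilon>)) \<partial>M"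
    have "(\<integral>\<^sup>+\<omega>. ennreal (\<bar>F n \<omega>\<bar> powr (2 + \<epsilon>)) \<partial>M) \<le> ennreal (enn2real ?S)" if "n \<ge> m" for n
    proof -
      have "(\<integral>\<^sup>+\<omega>. ennreal (\<bar>F n \<omega>\<bar> powr (2 + \<epsilon>)) \<partial>M) \<le> ?S" using m(1) that by (intro SUP_upper) auto
      also have "?S = ennreal (enn2real ?S)" using e(2) by simp
      finally show ?thesis .
    qed
    then show ?thesis using that[OF e(1), of "enn2real ?S"] by simp
  qed
  have FY: "(\<lambda>n. \<integral>\<omega>. F n \<omega> * Y n \<omega> \<partial>M) \<longlonglongrightarrow> \<rho>"
    using P.tendsto_product[OF \<epsilon> S(2,1) F2 N12] assms(17) by simp
  \<comment> \<open>Since \<open>F n\<close> is centered, replacing 1 - \<Theta> by - \<Theta>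
    changes nothing in the product expectation; this accounts for the minus sign.\<close>
  have third: "1 / (2 * \<phi> n) * integral\<^sup>L M (\<lambda>\<omega>. F n \<omega> ^ 3) = - (\<integral>\<omega>. F n \<omega> * Y n \<omega> \<partial>M)" if n: "n \<ge> m" for n
  proof -
    have iFT: "integrable M (\<lambda>\<omega>. F n \<omega> * \<Theta> n \<omega>)" by (rule sq_int_mult[OF F2[OF n] \<Theta>2[OF n]])
    have "integral\<^sup>L M (\<lambda>\<omega>. F n \<omega> ^ 3) = 2 * (\<integral>\<omega>. F n \<omega> * \<Theta> n \<omega> \<partial>M)"
      unfolding \<Theta>_def by (rule I.malliavin_third_moment[OF F[OF n]]) (use assms(19) m(1) n iFT in \<open>auto simp: \<Theta>_def\<close>)
    moreover have "(\<integral>\<omega>. F n \<omega> * Y n \<omega> \<partial>M) = (\<integral>\<omega>. (F n \<omega> - F n \<omega> * \<Theta> n \<omega>) / \<phi> n \<partial>M)"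
      by (simp add: Y_def right_diff_distrib)
    moreover have "\<dots> = - (\<integral>\<omega>. F n \<omega> * \<Theta> n \<omega> \<partial>M) / \<phi> n"
      using iFT I.sq_int_integrable[OF F2[OF n]] F(2)[OF n] by simp
    ultimately show ?thesis using m(2)[OF n] by simp
  qed
  have lim1: "(\<lambda>n. 1 / (2 * \<phi> n) * integral\<^sup>L M (\<lambda>\<omega>. F n \<omega> ^ 3)) \<longlonglongrightarrow> - \<rho>"
    by (rule Lim_transform_eventually[OF tendsto_minus[OF FY]])
      (rule P.eventually_ge_m, rule third[symmetric])
  have "(\<lambda>n. (measure M {\<omega> \<in> space M. F n \<omega> \<le> z} - Phi z
              + 1 / fact 3 * integral\<^sup>L M (\<lambda>\<omega>. F n \<omega> ^ 3) * (deriv ^^ 3) Phi z) / \<phi> n) \<longlonglongrightarrow> 0" for z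
  proof -
    \<comment> \<open>The Stein derivative is a bounded continuous function plus the indicator of
      the half-line up to \<open>z\<close>, and each part has its own limit lemma.\<close>
    define A where "A = (\<lambda>x. x * stein_sol z x - Phi z)"
    have A: "continuous_on UNIV A" "\<bar>A x\<bar> \<le> 2" for x
      unfolding A_def using stein_sol_bound[of x z] Phi_bounds[of z]
      by (auto intro!: continuous_intros continuous_stein_sol simp: abs_le_iff)
    have sd: "stein_deriv z x = A x + (if x \<le> z then 1 else 0)" for x by (simp add: stein_deriv_def A_def)
    have [measurable]: "A \<in> borel_measurable borel" by (rule borel_measurable_continuous_onI[OF A(1)])
    have split: "(\<integral>\<omega>. stein_deriv z (f \<omega>) * y \<omega> \<partial>Q) = (\<integral>\<omega>. A (f \<omega>) * y \<omega> \<partial>Q) + (\<integral>\<omega>. (if f \<omega> \<le> z then 1 else 0) * y \<omega> \<partial>Q)"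
      if Q: "prob_space Q" and f [measurable]: "f \<in> borel_measurable Q" and y: "sq_int Q y" for Q :: "'q measure" and f y
    proof -
      interpret Q: prob_space Q by (rule Q)
      have "integrable Q (\<lambda>\<omega>. A (f \<omega>) * y \<omega>)" "integrable Q (\<lambda>\<omega>. (if f \<omega> \<le> z then 1 else 0) * y \<omega>)"
        using Q.sq_int_integrable[OF sq_int_bounded_mult[OF y, of "\<lambda>\<omega>. A (f \<omega>)" 2]] A(2)
          Q.sq_int_integrable[OF sq_int_bounded_mult[OF y, of "\<lambda>\<omega>. if f \<omega> \<le> z then 1 else 0" 1]] by auto
      then show ?thesis unfolding sd distrib_right by (rule Bochner_Integration.integral_add)
    qed
    \<comment> \<open>The limit law has a density, so the discontinuity of the indicator at
      \<open>z\<close> is not charged.\<close>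
    have "AE x in lborel. x \<noteq> z" by (rule AE_lborel_singleton)
    then have "AE x in std_normal_distribution. x \<noteq> z" by (subst AE_density) auto
    then have z: "AE \<omega> in M'. N1 \<omega> \<noteq> z" unfolding law[symmetric] by (subst (asm) AE_distr_iff) auto
    have "(\<lambda>n. (\<integral>\<omega>. A (F n \<omega>) * Y n \<omega> \<partial>M) + (\<integral>\<omega>. (if F n \<omega> \<le> z then 1 else 0) * Y n \<omega> \<partial>M)) \<longlonglongrightarrow> (\<integral>\<omega>. stein_deriv z (N1 \<omega>) * N2 \<omega> \<partial>M')"
      unfolding split[OF assms(11) N1m N22] by (intro tendsto_add P.tendsto_continuous[OF A] P.tendsto_indicator z)
    then have "(\<lambda>n. \<integral>\<omega>. stein_deriv z (F n \<omega>) * Y n \<omega> \<partial>M) \<longlonglongrightarrow> (\<integral>\<omega>. stein_deriv z (N1 \<omega>) * N2 \<omega> \<partial>M')"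
      by (rule Lim_transform_eventually)
        (rule P.eventually_ge_m, simp add: split[OF I.prob_space_axioms P.F_measurable Y2])
    also have "(\<integral>\<omega>. stein_deriv z (N1 \<omega>) * N2 \<omega> \<partial>M') = \<rho> * (\<integral>\<omega>. N1 \<omega> * stein_deriv z (N1 \<omega>) \<partial>M')"
      by (rule gaussian_pair_regression[OF assms(11,12,13,14,15) N12 N22 assms(17) _ stein_deriv_bound]) simp
    also have "(\<integral>\<omega>. N1 \<omega> * stein_deriv z (N1 \<omega>) \<partial>M') = (\<integral>x. x * stein_deriv z x \<partial>std_normal_distribution)"
      unfolding law[symmetric] by (subst integral_distr) auto
    also have "\<dots> = (deriv ^^ 3) Phi z / 3"
      unfolding integral_stein_deriv Phi_third_deriv by (simp add: std_normal_density_def)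
    \<comment> \<open>The factor 1/3! in front of the third moment is split as 1/2 times 1/3: the
      half belongs to the normalised third moment, the third to the Stein integral. The two limits
      are opposite.\<close>
    finally have "(\<lambda>n. (\<integral>\<omega>. stein_deriv z (F n \<omega>) * Y n \<omega> \<partial>M) + (1 / (2 * \<phi> n) * integral\<^sup>L M (\<lambda>\<omega>. F n \<omega> ^ 3)) * ((deriv ^^ 3) Phi z / 3))
      \<longlonglongrightarrow> \<rho> * ((deriv ^^ 3) Phi z / 3) + - \<rho> * ((deriv ^^ 3) Phi z / 3)"
      by (intro tendsto_add tendsto_mult lim1 tendsto_const)
    then have "(\<lambda>n. (\<integral>\<omega>. stein_deriv z (F n \<omega>) * Y n \<omega> \<partial>M) + (1 / (2 * \<phi> n) * integral\<^sup>L M (\<lambda>\<omega>. F n \<omega> ^ 3)) * ((deriv ^^ 3) Phi z / 3)) \<longlonglongrightarrow> 0"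
      by simp
    then show ?thesis
    proof (rule Lim_transform_eventually, intro P.eventually_ge_m)
      fix n assume n: "n \<ge> m"
      have "measure M {\<omega> \<in> space M. F n \<omega> \<le> z} - Phi z = (\<integral>\<omega>. stein_deriv z (F n \<omega>) * (1 - \<Theta> n \<omega>) \<partial>M)"
        unfolding \<Theta>_def by (rule I.malliavin_stein[OF F[OF n]])
      moreover have "(\<integral>\<omega>. stein_deriv z (F n \<omega>) * Y n \<omega> \<partial>M) = (\<integral>\<omega>. stein_deriv z (F n \<omega>) * (1 - \<Theta> n \<omega>) \<partial>M) / \<phi> n"
        by (simp add: Y_def)
      ultimately show "(\<integral>\<omega>. stein_deriv z (F n \<omega>) * Y n \<omega> \<partial>M) + (1 / (2 * \<phi> n) * integral\<^sup>L M (\<lambda>\<omega>. F n \<omega> ^ 3)) * ((deriv ^^ 3) Phi z / 3) =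
        (measure M {\<omega> \<in> space M. F n \<omega> \<le> z} - Phi z + 1 / fact 3 * integral\<^sup>L M (\<lambda>\<omega>. F n \<omega> ^ 3) * (deriv ^^ 3) Phi z) / \<phi> n"
        using m(2)[OF n] by (simp add: field_simps fact_numeral)
    qed
  qed
  then show ?thesis using lim1 by blast
qed

end
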